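(* Let $M\in\mathbb N$ and let $\varepsilon_M>0$ be such that $P^\varepsilon_N(\eta)\ge\frac\lambda2|\eta|^2$ for all $\eta\in K$, all $0<\varepsilon<\varepsilon_M$ and all $N\in\mathbb N$ with $N\le M$. Then there exists a constant $C>0$, independent of $\varepsilon$, such that for every $0<\varepsilon<\varepsilon_M$ with $K\subset Z/\varepsilon$ the unique optimal control $u^*_M$ of $(\mathrm P^*_M)$ satisfies $$\|\tilde u^*_\varepsilon-u^*_M\|_{L^2(\mathbb R^n)}\le C\varepsilon^{2M},$$ where $\tilde u^*_\varepsilon(x)=\int_K\hat u^*_{\varepsilon,0}(\eta)e^{2\pi i\eta\cdot x}\,d\eta$ and $\hat u^*_{\varepsilon,0}$ is the Bloch coefficient of order $m=0$ of the optimal control $u^*_\varepsilon$ of $(\mathrm P_\varepsilon)$.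
   Context: **Bloch waves.** Let $n\in\mathbb N$, $Y=[0,1]^n$, $Z=[-\tfrac12,\tfrac12)^n$. $A\in L^\infty(\mathbb R^n;\mathbb R^{n\times n})$ is symmetric, uniformly elliptic and $Y$-periodic; $A^\varepsilon(x)=A(x/\varepsilon)$ for $\varepsilon>0$. For $\eta\in Z$ let $0\le\lambda_0(\eta)\le\lambda_1(\eta)\le\dots$ be the eigenvalues of $-(\nabla+2\pi i\eta)\cdot(A(\nabla+2\pi i\eta))$ on $Y$-periodic functions, with eigenfunctions $\Phi_m(\cdot;\eta)\in H^1_\sharp(Y;\mathbb C)$, $m\in\mathbb N_0$, forming an orthonormal basis of $L^2_\sharp(Y;\mathbb C)$ ($\sharp$: periodic functions), chosen measurable in $\eta$ and with $\Phi_m(\cdot;-\eta)=\overline{\Phi_m(\cdot;\eta)}$ for a.e. $\eta$. For $\eta\in Z/\varepsilon$ put $\lambda^\varepsilon_m(\eta)=\varepsilon^{-2}\lambda_m(\varepsilon\eta)$ and $\omega^\varepsilon_m(x;\eta)=\Phi_m(x/\varepsilon;\varepsilon\eta)e^{2\pi i\eta\cdot x}$. The Bloch coefficients of $u\in L^2(\mathbb R^n;\mathbb C)$ are $\hat u^\varepsilon_m(\eta)=\int_{\mathbb R^n}u\,\overline{\omega^\varepsilon_m(\cdot;\eta)}\,dx$ ($L^2$ sense), so $u=\int_{Z/\varepsilon}\sum_m\hat u^\varepsilon_m(\eta)\omega^\varepsilon_m(\cdot;\eta)\,d\eta$. The Fourier transform is $\hat u(\eta)=\int u(x)e^{-2\pi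 ix\cdot\eta}dx$. $L^2(\mathbb R^n)$, $H^k(\mathbb R^n)$ denote real-valued functions. The adaption of $f\in L^2(\mathbb R^n;\mathbb C)$ is $\mathcal A^\varepsilon(f)=\int_{Z/\varepsilon}\hat f(\eta)\omega^\varepsilon_0(\cdot;\eta)\,d\eta$. **Original problem.** Fix $\mu_1,\mu_2\ge0$, $\kappa>0$. Let $E^\varepsilon(y)=\int_{\mathbb R^n}\nabla y\cdot A^\varepsilon\nabla y+|y|^2\,dx$ and $J^\varepsilon(u,y)=\frac{\mu_1}2E^\varepsilon(y-y^\varepsilon_{d,1})+\frac{\mu_2}2\int|y-y^\varepsilon_{d,2}|^2dx+\frac\kappa2\int|u|^2dx$, where $y^\varepsilon_{d,1}\in H^1(\mathbb R^n)$, $y^\varepsilon_{d,2}\in L^2(\mathbb R^n)$. Problem $(\mathrm P_\varepsilon)$: minimize $J^\varepsilon(u,y)$ over $(u,y)\in U^\varepsilon_{ad}\times H^1(\mathbb R^n)$ subject to $-\nabla\cdot(A^\varepsilon\nabla y)+y=f^\varepsilon+u$ weakly on $\mathbb R^n$, with $f^\varepsilon\in L^2(\mathbb R^n)$ and $\emptyset\ne U^\varepsilon_{ad}\subset L^2(\mathbb R^n)$. Its unique solution is $(u^*_\varepsilon,y^*_\varepsilon)$. **Assumption on data.** There are $f,y_{d,1},y_{d,2}\in L^2(\mathbb R^n)$ and a compact $K\subset\mathbb R^n$ with $-K=K$ such that $f^\varepsilon=\mathcal A^\varepsilon(f)$, $y^\varepsilon_{d,j}=\mathcal A^\varepsilon(y_{d,j})$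 ($j=1,2$), and the supports of $\hat f,\hat y_{d,1},\hat y_{d,2}$ lie in $K$. **Assumption on admissible sets.** (i) $U^\varepsilon_{ad}$ is convex and closed. (ii) There is $u_0\in L^2(\mathbb R^n)$ with $\mathcal A^\varepsilon(u_0)\in U^\varepsilon_{ad}$ for every $\varepsilon>0$. (iii) For $u\in U^\varepsilon_{ad}$ the projection $u_K=\int_K\hat u^\varepsilon_0(\eta)\omega^\varepsilon_0(\cdot;\eta)\,d\eta$ lies in $U^\varepsilon_{ad}$. **Effective problem.** $\mathbb A^*_{2k}$ ($k\ge1$) are real tensors of order $2k$ with $\lambda_0(\eta)=\sum_{k=1}^M(2\pi)^{2k}\mathbb A^*_{2k}\cdot\eta^{\otimes2k}+O(|\eta|^{2M+2})$ as $\eta\to0$ for each $M$ (Taylor expansion of the even function $\lambda_0$, analytic near $0$), where $\mathbb A^*_{2k}\cdot\eta^{\otimes2k}=\sum_{i_1,\dots,i_{2k}}(\mathbb A^*_{2k})_{i_1\dots i_{2k}}\eta_{i_1}\cdots\eta_{i_{2k}}$; $\mathbb A_2^*$ is symmetric positive definite and $\lambda>0$ satisfies $\mathbb A^*_2\cdot\eta^{\otimes2}\ge\lambda|\eta|^2$ for all $\eta$. $P^\varepsilon_N(\eta)=\sum_{k=1}^N\varepsilon^{2k-2}(2\pi)^{2k}\mathbb A^*_{2k}\cdot\eta^{\otimes2k}$. Let $\langle D^ky,D^ky\rangle_{\mathbb A^*_{2k}}=\sum(\mathbb A^*_{2k})_{i_1\dots i_{2k}}\,\partial^k_{x_{i_1}\dots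 x_{i_k}}y\;\partial^k_{x_{i_{k+1}}\dots x_{i_{2k}}}y$, $\mathbb A^*_{2k}D^{2k}=\sum(\mathbb A^*_{2k})_{i_1\dots i_{2k}}\partial^{2k}_{x_{i_1}\dots x_{i_{2k}}}$, $E^*_M(y)=\int_{\mathbb R^n}\sum_{k=1}^M\varepsilon^{2k-2}\langle D^ky,D^ky\rangle_{\mathbb A^*_{2k}}+|y|^2\,dx$, and $J^*_M(u,y)=\frac{\mu_1}2E^*_M(y-y_{d,1})+\frac{\mu_2}2\int|y-y_{d,2}|^2dx+\frac\kappa2\int|u|^2dx$. Problem $(\mathrm P^*_M)$: minimize $J^*_M(u,y)$ over $(u,y)\in U^*_{ad}\times H^{2M}(\mathbb R^n)$ subject to $\sum_{k=1}^M\varepsilon^{2k-2}(-1)^k\mathbb A^*_{2k}D^{2k}y+y=f+u$, where $U^*_{ad}=\{u=\int_K\hat u(\eta)e^{2\pi i\eta\cdot x}d\eta\;:\;\mathcal A^\varepsilon(u)\in U^\varepsilon_{ad}\}$. *)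

theory Defs
  imports "HOL-Analysis.Analysis" "HOL-Library.Landau_Symbols"
begin

text \<open>Elements of Lebesgue and Sobolev spaces are represented by Borel functions; every class has a
  Borel representative, and identities between elements are stated almost everywhere.\<close>

definition L2 :: "(real^'n) set \<Rightarrow> (real^'n \<Rightarrow> 'b::{banach, second_countable_topology}) set" where
  "L2 S = {u. set_borel_measurable lborel S u \<and> set_integrable lborel S (\<lambda>x. (norm (u x))\<^sup>2)}"

definition L2_norm :: "(real^'n) set \<Rightarrow> (real^'n \<Rightarrow> 'b::{banach, second_countable_topology}) \<Rightarrow> real" where
  "L2_norm S u = sqrt (LINT x:S|lborel. (norm (u x))\<^sup>2)"

definition partial_d :: "'n \<Rightarrow> (real^'n \<Rightarrow> real) \<Rightarrow> real^'n \<Rightarrow> real" where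
  "partial_d i f x = frechet_derivative f (at x) (axis i 1)"

primrec iter_partial :: "'n list \<Rightarrow> (real^'n \<Rightarrow> real) \<Rightarrow> real^'n \<Rightarrow> real" where
  "iter_partial [] f = f"
| "iter_partial (i # js) f = partial_d i (iter_partial js f)"

definition test_function :: "(real^'n \<Rightarrow> real) \<Rightarrow> bool" where
  "test_function \<phi> \<longleftrightarrow>
     (\<forall>js x. iter_partial js \<phi> differentiable (at x)) \<and> compact (closure {x. \<phi> x \<noteq> 0})"

definition locally_integrable :: "(real^'n \<Rightarrow> 'b::{banach, second_countable_topology}) \<Rightarrow> bool" where
  "locally_integrable u \<longleftrightarrow> (\<forall>R. set_integrable lborel (cball 0 R) u)"

definition has_weak_deriv ::
  "'n list \<Rightarrow> (real^'n \<Rightarrow> 'b::{banach, second_countable_topology}) \<Rightarrow> (real^'n \<Rightarrow> 'b) \<Rightarrow> bool" where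
  "has_weak_deriv js u v \<longleftrightarrow> locally_integrable u \<and> locally_integrable v \<and>
     (\<forall>\<phi>. test_function \<phi> \<longrightarrow>
        (LINT x|lborel. iter_partial js \<phi> x *\<^sub>R u x)
          = (-1::real) ^ length js *\<^sub>R (LINT x|lborel. \<phi> x *\<^sub>R v x))"

definition weak_deriv ::
  "'n list \<Rightarrow> (real^'n \<Rightarrow> 'b::{banach, second_countable_topology}) \<Rightarrow> real^'n \<Rightarrow> 'b" where
  "weak_deriv js u = (SOME v. has_weak_deriv js u v)"

definition weak_grad ::
  "(real^'n \<Rightarrow> 'b::{banach, second_countable_topology}) \<Rightarrow> real^'n \<Rightarrow> 'b^'n" where
  "weak_grad u x = (\<chi> i. weak_deriv [i] u x)"

definition Sobolev :: "nat \<Rightarrow> (real^'n \<Rightarrow> real) set" where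
  "Sobolev k = {u \<in> L2 UNIV. \<forall>js. length js \<le> k \<longrightarrow> (\<exists>v \<in> L2 UNIV. has_weak_deriv js u v)}"

definition Ycell :: "(real^'n) set" where
  "Ycell = {x. \<forall>i. 0 \<le> x $ i \<and> x $ i \<le> 1}"

definition Zcell :: "(real^'n) set" where
  "Zcell = {\<eta>. \<forall>i. - (1/2) \<le> \<eta> $ i \<and> \<eta> $ i < 1/2}"

definition scaled_Zcell :: "real \<Rightarrow> (real^'n) set" where
  "scaled_Zcell \<epsilon> = (\<lambda>\<eta>. (1/\<epsilon>) *\<^sub>R \<eta>) ` Zcell"

definition periodic :: "(real^'n \<Rightarrow> 'b) \<Rightarrow> bool" where
  "periodic u \<longleftrightarrow> (\<forall>i. AE x in lborel. u (x + axis i 1) = u x)"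

definition L2_per :: "(real^'n \<Rightarrow> complex) set" where
  "L2_per = {u \<in> borel_measurable borel. periodic u \<and> u \<in> L2 Ycell}"

definition H1_per :: "(real^'n \<Rightarrow> complex) set" where
  "H1_per = {u \<in> L2_per. \<forall>i. \<exists>v \<in> L2_per. has_weak_deriv [i] u v}"

definition coefficient_field :: "(real^'n \<Rightarrow> real^'n^'n) \<Rightarrow> bool" where
  "coefficient_field A \<longleftrightarrow>
     A \<in> borel_measurable borel \<and> periodic A \<and>
     (\<exists>\<beta>. AE x in lborel. norm (A x) \<le> \<beta>) \<and>
     (AE x in lborel. transpose (A x) = A x) \<and>
     (\<exists>\<alpha>>0. AE x in lborel. \<forall>\<xi>. \<alpha> * (norm \<xi>)\<^sup>2 \<le> \<xi> \<bullet> (A x *v \<xi>))"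

definition shifted_grad :: "real^'n \<Rightarrow> (real^'n \<Rightarrow> complex) \<Rightarrow> real^'n \<Rightarrow> complex^'n" where
  "shifted_grad \<eta> u x = (\<chi> i. weak_deriv [i] u x + 2 * of_real pi * \<i> * of_real (\<eta> $ i) * u x)"

text \<open>Weak form on periodic functions of
  \<open>- (\<nabla> + 2\<pi>i\<eta>) \<cdot> (A (\<nabla> + 2\<pi>i\<eta>) u) = \<lambda> u\<close>.\<close>

definition shifted_eigen :: "(real^'n \<Rightarrow> real^'n^'n) \<Rightarrow> real^'n \<Rightarrow> real \<Rightarrow> (real^'n \<Rightarrow> complex) \<Rightarrow> bool" where
  "shifted_eigen A \<eta> lam u \<longleftrightarrow> u \<in> H1_per \<and>
     (\<forall>\<psi> \<in> H1_per.
        (LINT x:Ycell|lborel. \<Sum>i\<in>UNIV. \<Sum>j\<in>UNIV.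
            of_real (A x $ i $ j) * shifted_grad \<eta> u x $ j * cnj (shifted_grad \<eta> \<psi> x $ i))
        = of_real lam * (LINT x:Ycell|lborel. u x * cnj (\<psi> x)))"

definition orthonormal_basis_per :: "(nat \<Rightarrow> real^'n \<Rightarrow> complex) \<Rightarrow> bool" where
  "orthonormal_basis_per e \<longleftrightarrow>
     (\<forall>m. e m \<in> L2_per) \<and>
     (\<forall>m k. (LINT x:Ycell|lborel. e m x * cnj (e k x)) = (if m = k then 1 else 0)) \<and>
     (\<forall>g \<in> L2_per.
        (\<lambda>N. L2_norm Ycell (\<lambda>x. g x - (\<Sum>m<N. (LINT z:Ycell|lborel. g z * cnj (e m z)) * e m x)))
          \<longlonglongrightarrow> 0)"

text \<open>\<open>Phi m \<eta> x\<close> is $\Phi_m(x;\eta)$. Measurability in \<open>\<eta>\<close> is joint measurability in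
  \<open>(x, \<eta>)\<close>, so that integrals over \<open>\<eta>\<close> make sense for almost every fixed \<open>x\<close>.\<close>

definition bloch_system ::
  "(real^'n \<Rightarrow> real^'n^'n) \<Rightarrow> (nat \<Rightarrow> real^'n \<Rightarrow> real) \<Rightarrow> (nat \<Rightarrow> real^'n \<Rightarrow> real^'n \<Rightarrow> complex) \<Rightarrow> bool" where
  "bloch_system A lam Phi \<longleftrightarrow>
     (\<forall>\<eta>\<in>Zcell. \<forall>m. 0 \<le> lam m \<eta> \<and> lam m \<eta> \<le> lam (Suc m) \<eta> \<and> shifted_eigen A \<eta> (lam m \<eta>) (Phi m \<eta>)) \<and>
     (\<forall>\<eta>\<in>Zcell. orthonormal_basis_per (\<lambda>m. Phi m \<eta>)) \<and>
     (\<forall>m. (\<lambda>(x, \<eta>). Phi m \<eta> x) \<in> borel_measurable (borel \<Otimes>\<^sub>M restrict_space borel Zcell)) \<and>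
     (\<forall>m. AE \<eta> in lborel. \<eta> \<in> Zcell \<and> - \<eta> \<in> Zcell \<longrightarrow>
        (AE x in lborel. Phi m (- \<eta>) x = cnj (Phi m \<eta> x)))"

definition plane_wave :: "real^'n \<Rightarrow> real^'n \<Rightarrow> complex" where
  "plane_wave x \<eta> = exp (2 * of_real pi * \<i> * of_real (\<eta> \<bullet> x))"

definition bloch_wave ::
  "(nat \<Rightarrow> real^'n \<Rightarrow> real^'n \<Rightarrow> complex) \<Rightarrow> real \<Rightarrow> nat \<Rightarrow> real^'n \<Rightarrow> real^'n \<Rightarrow> complex" where
  "bloch_wave Phi \<epsilon> m x \<eta> = Phi m (\<epsilon> *\<^sub>R \<eta>) ((1/\<epsilon>) *\<^sub>R x) * plane_wave x \<eta>"

text \<open>The transform \<open>\<eta> \<mapsto> \<integral> u(x) cnj (k(x,\<eta>)) dx\<close> of \<open>u \<in> L\<^sup>2\<close> for a kernel \<open>k\<close>, with the integral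
  understood as the limit in \<open>L\<^sup>2(S)\<close> of the integrals over the balls of radius \<open>R \<rightarrow> \<infinity>\<close>.\<close>

definition L2_transform ::
  "(real^'n) set \<Rightarrow> (real^'n \<Rightarrow> real^'n \<Rightarrow> complex) \<Rightarrow> (real^'n \<Rightarrow> complex) \<Rightarrow> real^'n \<Rightarrow> complex" where
  "L2_transform S k u = (SOME c. c \<in> L2 S \<and>
     ((\<lambda>R. \<integral>\<^sup>+\<eta>\<in>S. ennreal ((norm (c \<eta> - (LINT x:cball 0 R|lborel. u x * cnj (k x \<eta>))))\<^sup>2) \<partial>lborel)
        \<longlongrightarrow> 0) at_top)"

definition fourier :: "(real^'n \<Rightarrow> complex) \<Rightarrow> real^'n \<Rightarrow> complex" where
  "fourier u = L2_transform UNIV plane_wave u"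

definition bloch_coeff ::
  "(nat \<Rightarrow> real^'n \<Rightarrow> real^'n \<Rightarrow> complex) \<Rightarrow> real \<Rightarrow> nat \<Rightarrow> (real^'n \<Rightarrow> complex) \<Rightarrow> real^'n \<Rightarrow> complex" where
  "bloch_coeff Phi \<epsilon> m u = L2_transform (scaled_Zcell \<epsilon>) (bloch_wave Phi \<epsilon> m) u"

definition synthesis ::
  "(real^'n) set \<Rightarrow> (real^'n \<Rightarrow> real^'n \<Rightarrow> complex) \<Rightarrow> (real^'n \<Rightarrow> complex) \<Rightarrow> real^'n \<Rightarrow> complex" where
  "synthesis S k c x = (LINT \<eta>:S|lborel. c \<eta> * k x \<eta>)"

definition adaption ::
  "(nat \<Rightarrow> real^'n \<Rightarrow> real^'n \<Rightarrow> complex) \<Rightarrow> real \<Rightarrow> (real^'n \<Rightarrow> complex) \<Rightarrow> real^'n \<Rightarrow> complex" where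
  "adaption Phi \<epsilon> f = synthesis (scaled_Zcell \<epsilon>) (bloch_wave Phi \<epsilon> 0) (fourier f)"

abbreviation cplx :: "('a \<Rightarrow> real) \<Rightarrow> 'a \<Rightarrow> complex" where
  "cplx u \<equiv> (\<lambda>x. complex_of_real (u x))"

text \<open>A complex-valued function, taken modulo null sets, is equal to the real-valued function \<open>v\<close>,
  respectively belongs to the set \<open>U\<close> of real-valued functions.\<close>

definition ae_real :: "(real^'n \<Rightarrow> complex) \<Rightarrow> (real^'n \<Rightarrow> real) \<Rightarrow> bool" where
  "ae_real g v \<longleftrightarrow> (AE x in lborel. g x = complex_of_real (v x))"

definition ae_mem :: "(real^'n \<Rightarrow> complex) \<Rightarrow> (real^'n \<Rightarrow> real) set \<Rightarrow> bool" where
  "ae_mem g U \<longleftrightarrow> (\<exists>v\<in>U. ae_real g v)"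

definition fourier_supported :: "(real^'n) set \<Rightarrow> (real^'n \<Rightarrow> real) \<Rightarrow> bool" where
  "fourier_supported K u \<longleftrightarrow> (AE \<eta> in lborel. \<eta> \<notin> K \<longrightarrow> fourier (cplx u) \<eta> = 0)"

definition tracking_cost ::
  "((real^'n \<Rightarrow> real) \<Rightarrow> real) \<Rightarrow> real \<Rightarrow> real \<Rightarrow> real \<Rightarrow> (real^'n \<Rightarrow> real) \<Rightarrow> (real^'n \<Rightarrow> real)
     \<Rightarrow> (real^'n \<Rightarrow> real) \<times> (real^'n \<Rightarrow> real) \<Rightarrow> real" where
  "tracking_cost E \<mu>1 \<mu>2 \<kappa> yd1 yd2 = (\<lambda>(u, y).
     \<mu>1 / 2 * E (\<lambda>x. y x - yd1 x)
     + \<mu>2 / 2 * (LINT x|lborel. (y x - yd2 x)\<^sup>2)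
     + \<kappa> / 2 * (LINT x|lborel. (u x)\<^sup>2))"

definition energy_eps :: "(real^'n \<Rightarrow> real^'n^'n) \<Rightarrow> real \<Rightarrow> (real^'n \<Rightarrow> real) \<Rightarrow> real" where
  "energy_eps A \<epsilon> y =
     (LINT x|lborel. weak_grad y x \<bullet> (A ((1/\<epsilon>) *\<^sub>R x) *v weak_grad y x) + (y x)\<^sup>2)"

definition feasible_eps ::
  "(real^'n \<Rightarrow> real^'n^'n) \<Rightarrow> real \<Rightarrow> (real^'n \<Rightarrow> real) \<Rightarrow> (real^'n \<Rightarrow> real) set
     \<Rightarrow> (real^'n \<Rightarrow> real) \<times> (real^'n \<Rightarrow> real) \<Rightarrow> bool" where
  "feasible_eps A \<epsilon> f U = (\<lambda>(u, y). u \<in> U \<and> y \<in> Sobolev 1 \<and>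
     (\<forall>\<phi> \<in> Sobolev 1.
        (LINT x|lborel. weak_grad \<phi> x \<bullet> (A ((1/\<epsilon>) *\<^sub>R x) *v weak_grad y x) + y x * \<phi> x)
          = (LINT x|lborel. (f x + u x) * \<phi> x)))"

definition L2_convex :: "(real^'n \<Rightarrow> real) set \<Rightarrow> bool" where
  "L2_convex U \<longleftrightarrow> (\<forall>u\<in>U. \<forall>v\<in>U. \<forall>t. 0 \<le> t \<and> t \<le> 1 \<longrightarrow> (\<lambda>x. (1 - t) * u x + t * v x) \<in> U)"

text \<open>Sequential closedness in \<open>L\<^sup>2\<close>; applied to constant sequences it also makes \<open>U\<close> invariant
  under changes on null sets.\<close>

definition L2_closed :: "(real^'n \<Rightarrow> real) set \<Rightarrow> bool" where
  "L2_closed U \<longleftrightarrow>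
     (\<forall>u v. (\<forall>k. u k \<in> U) \<and> v \<in> L2 UNIV \<and> (\<lambda>k::nat. L2_norm UNIV (\<lambda>x. u k x - v x)) \<longlonglongrightarrow> 0
        \<longrightarrow> v \<in> U)"

text \<open>A real tensor of order \<open>j\<close> is a function on index lists of length \<open>j\<close>; \<open>AA j\<close> is the
  effective tensor of (even) order \<open>j\<close>.\<close>

definition indices :: "nat \<Rightarrow> 'n list set" where
  "indices j = {js. length js = j}"

definition tensor_power :: "('n list \<Rightarrow> real) \<Rightarrow> nat \<Rightarrow> real^'n \<Rightarrow> real" where
  "tensor_power T j \<eta> = (\<Sum>js\<in>indices j. T js * (\<Prod>i\<leftarrow>js. \<eta> $ i))"

definition effective_symbol :: "(nat \<Rightarrow> 'n list \<Rightarrow> real) \<Rightarrow> real \<Rightarrow> nat \<Rightarrow> real^'n \<Rightarrow> real" where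
  "effective_symbol AA \<epsilon> N \<eta> =
     (\<Sum>k=1..N. \<epsilon> ^ (2*k - 2) * (2 * pi) ^ (2*k) * tensor_power (AA (2*k)) (2*k) \<eta>)"

definition effective_tensors :: "(real^'n \<Rightarrow> real) \<Rightarrow> (nat \<Rightarrow> 'n list \<Rightarrow> real) \<Rightarrow> bool" where
  "effective_tensors lam0 AA \<longleftrightarrow>
     (\<forall>N\<ge>1. (\<lambda>\<eta>. lam0 \<eta> - (\<Sum>k=1..N. (2 * pi) ^ (2*k) * tensor_power (AA (2*k)) (2*k) \<eta>))
        \<in> O[at 0](\<lambda>\<eta>. norm \<eta> ^ (2*N + 2))) \<and>
     (\<forall>i j. AA 2 [i, j] = AA 2 [j, i])"

definition deriv_form :: "('n list \<Rightarrow> real) \<Rightarrow> nat \<Rightarrow> (real^'n \<Rightarrow> real) \<Rightarrow> real^'n \<Rightarrow> real" where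
  "deriv_form T k y x =
     (\<Sum>js\<in>indices (2*k). T js * weak_deriv (take k js) y x * weak_deriv (drop k js) y x)"

definition tensor_deriv :: "('n list \<Rightarrow> real) \<Rightarrow> nat \<Rightarrow> (real^'n \<Rightarrow> real) \<Rightarrow> real^'n \<Rightarrow> real" where
  "tensor_deriv T j y x = (\<Sum>js\<in>indices j. T js * weak_deriv js y x)"

definition energy_eff :: "(nat \<Rightarrow> 'n list \<Rightarrow> real) \<Rightarrow> real \<Rightarrow> nat \<Rightarrow> (real^'n \<Rightarrow> real) \<Rightarrow> real" where
  "energy_eff AA \<epsilon> M y =
     (LINT x|lborel. (\<Sum>k=1..M. \<epsilon> ^ (2*k - 2) * deriv_form (AA (2*k)) k y x) + (y x)\<^sup>2)"

definition admissible_eff ::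
  "(nat \<Rightarrow> real^'n \<Rightarrow> real^'n \<Rightarrow> complex) \<Rightarrow> real \<Rightarrow> (real^'n) set \<Rightarrow> (real^'n \<Rightarrow> real) set
     \<Rightarrow> (real^'n \<Rightarrow> real) set" where
  "admissible_eff Phi \<epsilon> K U = {u \<in> L2 UNIV.
     ae_real (synthesis K plane_wave (fourier (cplx u))) u \<and> ae_mem (adaption Phi \<epsilon> (cplx u)) U}"

definition feasible_eff ::
  "(nat \<Rightarrow> 'n list \<Rightarrow> real) \<Rightarrow> real \<Rightarrow> nat \<Rightarrow> (real^'n \<Rightarrow> real) \<Rightarrow> (real^'n \<Rightarrow> real) set
     \<Rightarrow> (real^'n \<Rightarrow> real) \<times> (real^'n \<Rightarrow> real) \<Rightarrow> bool" where
  "feasible_eff AA \<epsilon> M f U = (\<lambda>(u, y). u \<in> U \<and> y \<in> Sobolev (2*M) \<and>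
     (AE x in lborel.
        (\<Sum>k=1..M. \<epsilon> ^ (2*k - 2) * (-1) ^ k * tensor_deriv (AA (2*k)) (2*k) y x) + y x = f x + u x))"

definition optimal_control ::
  "((real^'n \<Rightarrow> real) \<times> (real^'n \<Rightarrow> real) \<Rightarrow> real) \<Rightarrow> ((real^'n \<Rightarrow> real) \<times> (real^'n \<Rightarrow> real) \<Rightarrow> bool)
     \<Rightarrow> (real^'n \<Rightarrow> real) \<Rightarrow> bool" where
  "optimal_control J feasible u \<longleftrightarrow> (\<exists>y. is_arg_min J feasible (u, y))"

end

theory Submission
 imports Defs "HOL-Computational_Algebra.Polynomial"
begin

text \<open>The Bloch coefficients of order zero diagonalise the oscillating problem. Let \<open>S e\<close> be the synthesis of a
 coefficient function \<open>e\<close> on the scaled cell with the lowest Bloch waves. Over each fibre \<open>eta + \<int>\<^sup>n/eps\<close> the Fourier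
 transform of \<open>S e\<close> is \<open>e eta\<close> times the Fourier coefficients of the eigenfunction. Hence \<open>S\<close> is an isometry, and the
 eigenvalue equation shows that the elliptic operator acts on \<open>e\<close> as multiplication by \<open>1 / res\<close>, where
 \<open>res eta = 1 / (1 + lam 0 (eps *R eta) / eps^2)\<close> (\<open>resolvent_equation\<close>). All data are syntheses of functions on \<open>K\<close>.
 So the part of a control orthogonal to the syntheses from \<open>K\<close> only adds to the cost, and it can be removed since
 admissible sets are invariant under the projection (\<open>cost_projection\<close>). The optimal control is therefore \<open>S c\<close>, where
 \<open>c\<close> minimises a quadratic functional with multiplier \<open>res\<close> over a set \<open>Cset\<close> of coefficients (\<open>optimal_eps\<close>).

 The effective problem has the same form with the Fourier transform instead of the Bloch transform. Its operator is
 multiplication by \<open>1 + P\<close> with the effective symbol \<open>P\<close>, its energy is given by Parseval's identity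
 (\<open>effective_equation\<close>, \<open>effective_energy\<close>), and the adaption of a control with transform \<open>c\<close> on \<open>K\<close> is \<open>S c\<close>. So the
 transforms of its admissible controls are exactly the elements of \<open>Cset\<close> (\<open>admissible_coefficients\<close>, \<open>admissible_exists\<close>), where reality
 is preserved because the eigenfunctions at \<open>eta\<close> and \<open>- eta\<close> are conjugate (\<open>real_coefficients_symmetric\<close>).

 Thus both optimal controls are minimisers over one convex closed set of two functionals that differ only in their
 multipliers \<open>res\<close> and \<open>es = 1 / (1 + P)\<close>. Both functionals are convex with constant \<open>\<kappa>\<close>, so the minimisers differ by
 a constant times the supremum of \<open>\<bar>res - es\<bar>\<close> over \<open>K\<close> (\<open>minimiser_stability\<close>); the constant involves the norm of a
 minimiser, which is bounded by comparison with the projection of the adaption of \<open>u0\<close>. The Taylor expansion of the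
 lowest eigenvalue bounds the supremum by a multiple of \<open>eps ^ (2*M)\<close> (\<open>resolvent_difference\<close>), and Plancherel's
 identity returns to the controls.\<close>

text \<open>Lebesgue measure and the whole space are implicit in the following notation.\<close>

abbreviation (input) LL :: "(real^'n => 'b::{banach, second_countable_topology}) set" where "LL \<equiv> L2 UNIV"
abbreviation (input) bmeas :: "('a::topological_space => 'b::topological_space) set" where "bmeas \<equiv> borel_measurable borel"
abbreviation (input) cspace :: "'a measure" where "cspace \<equiv> count_space UNIV"

abbreviation (input) almost_every :: "('a::euclidean_space => bool) => bool" (binder "ae " 10) where
 "almost_every P \<equiv> (AE x in lborel. P x)"

abbreviation (input) lebesgue_int :: "('a::euclidean_space => 'b::{banach, second_countable_topology}) => 'b" (binder "LI " 60) where
 "lebesgue_int f \<equiv> (LINT x|lborel. f x)"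

abbreviation (input) nn_int :: "('a::euclidean_space => ennreal) => ennreal" (binder "NI " 60) where
 "nn_int f \<equiv> (\<integral>\<^sup>+x. f x \<partial>lborel)"

abbreviation (input) sequence_limit :: "(nat => 'a::topological_space) => 'a => bool" (infix "---->" 60) where
 "X ----> l \<equiv> X \<longlonglongrightarrow> l"

abbreviation (input) scale :: "real => 'a::real_vector => 'a" (infixr "*R" 75) where
 "c *R x \<equiv> c *\<^sub>R x"

text \<open>Most of the unqualified names belong to the gauge integral.\<close>

lemmas B_integrable_add = Bochner_Integration.integrable_add
lemmas B_integrable_bound = Bochner_Integration.integrable_bound
lemmas B_integrable_diff = Bochner_Integration.integrable_diff
lemmas B_integrable_sum = Bochner_Integration.integrable_sum
lemmas B_integral_add = Bochner_Integration.integral_add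
lemmas B_integral_cnj = Bochner_Integration.integral_cnj
lemmas B_integral_cong = Bochner_Integration.integral_cong
lemmas B_integral_diff = Bochner_Integration.integral_diff
lemmas B_integral_mult_right_zero = Bochner_Integration.integral_mult_right_zero
lemmas B_integral_nonneg = Bochner_Integration.integral_nonneg
lemmas B_integral_scaleR_left = Bochner_Integration.integral_scaleR_left
lemmas B_integral_sum = Bochner_Integration.integral_sum

section \<open>The space of square integrable functions\<close>

abbreviation (input) nrm :: "(real^'n => 'b::{banach, second_countable_topology}) => real" where
 "nrm \<equiv> L2_norm UNIV"

definition ip :: "(real^'n => complex) => (real^'n => complex) => complex" where
 "ip f g = (LI x. f x * cnj (g x))"

lemma borel_measurable_cnj [measurable (raw)]:
 "f \<in> borel_measurable M ==> (\<lambda>x. cnj (f x)) \<in> borel_measurable M"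
 by (rule measurable_compose[of f M borel cnj borel])
   (auto intro!: borel_measurable_continuous_onI continuous_intros)

lemma L2_UNIV_iff:
 "u \<in> LL \<longleftrightarrow> u \<in> bmeas \<and> integrable lborel (\<lambda>x. (norm (u x))^2)"
 by (simp add: L2_def set_borel_measurable_def set_integrable_def)

lemma L2_measurable [measurable_dest]: "u \<in> LL ==> u \<in> bmeas"
 and L2_integrable: "u \<in> LL ==> integrable lborel (\<lambda>x. (norm (u x))^2)"
 by (auto simp: L2_UNIV_iff)

lemma nrm_eq: "nrm u = sqrt (LI x. (norm (u x))^2)"
 by (simp add: L2_norm_def set_lebesgue_integral_def)

lemma nrm_nonneg [simp]: "nrm u \<ge> 0"
 by (simp add: nrm_eq)

lemma nrm_sq: "(nrm u)^2 = (LI x. (norm (u x))^2)"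
 by (simp add: nrm_eq)

lemma nn_integral_L2:
 assumes "u \<in> LL" shows "(NI x. ennreal ((norm (u x))^2)) = ennreal ((nrm u)^2)"
 unfolding nrm_sq by (rule nn_integral_eq_integral) (use L2_integrable[OF assms] in auto)

lemma L2_nn_integralI:
 assumes "u \<in> bmeas" "(NI x. ennreal ((norm (u x))^2)) \<le> ennreal B" "B \<ge> 0"
 shows "u \<in> LL" "(nrm u)^2 \<le> B"
proof -
 have "integrable lborel (\<lambda>x. (norm (u x))^2)"
  using assms by (intro integrableI_bounded) (auto simp: le_less_trans[OF _ ennreal_less_top])
 with assms(1) show u: "u \<in> LL" by (simp add: L2_UNIV_iff)
 show "(nrm u)^2 \<le> B" using assms(2,3) unfolding nn_integral_L2[OF u] by simp
qed

lemma L2_bound: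
 fixes u :: "real^'n => 'b::{banach, second_countable_topology}"
  and v :: "real^'n => 'c::{banach, second_countable_topology}"
 assumes "v \<in> LL" "u \<in> bmeas" "ae x. norm (u x) \<le> norm (v x)"
 shows "u \<in> LL" and "nrm u \<le> nrm v"
proof -
 have *: "ae x. (norm (u x))^2 \<le> (norm (v x))^2"
  using assms(3) by eventually_elim (simp add: power_mono)
 have "integrable lborel (\<lambda>x. (norm (u x))^2)"
  by (rule B_integrable_bound[OF L2_integrable[OF assms(1)]])
    (use assms(2) * in auto)
 then show u: "u \<in> LL" using assms(2) by (simp add: L2_UNIV_iff)
 show "nrm u \<le> nrm v" unfolding nrm_eq
  by (intro real_sqrt_le_mono integral_mono_AE L2_integrable u assms *)
qed

lemma L2_AE_cong:
 assumes "v \<in> LL" "u \<in> bmeas" "ae x. u x = v x"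
 shows "u \<in> LL" "nrm u = nrm v"
proof -
 show u: "u \<in> LL"
  by (rule L2_bound(1)[OF assms(1,2)]) (use assms(3) in auto)
 show "nrm u = nrm v" unfolding nrm_eq
  using assms by (intro arg_cong[where f=sqrt] integral_cong_AE) (auto dest: L2_measurable)
qed

lemma norm_add_sq_le: "(norm (a + b))^2 \<le> 2 * (norm a)^2 + 2 * (norm (b::'a::real_normed_vector))^2"
proof -
 have "(norm (a + b))^2 \<le> (norm a + norm b)^2" by (intro power_mono norm_triangle_ineq) auto
 also have "... \<le> 2 * (norm a)^2 + 2 * (norm b)^2"
  using sum_squares_bound[of "norm a" "norm b"] by (simp add: power2_sum)
 finally show ?thesis .
qed

lemma L2_add [intro]:
 fixes u v :: "real^'n => 'b::{banach, second_countable_topology}"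
 assumes "u \<in> LL" "v \<in> LL" shows "(\<lambda>x. u x + v x) \<in> LL"
proof -
 have "integrable lborel (\<lambda>x. (norm (u x + v x))^2)"
  by (rule B_integrable_bound[of _ "\<lambda>x. 2 * (norm (u x))^2 + 2 * (norm (v x))^2"])
    (use assms in \<open>auto simp: norm_add_sq_le intro!: L2_integrable dest: L2_measurable\<close>)
 with assms show ?thesis by (auto simp: L2_UNIV_iff)
qed

lemma L2_mult_bounded:
 fixes a u :: "real^'n => complex"
 assumes "u \<in> LL" "a \<in> bmeas" "\<And>x. norm (a x) \<le> B"
 shows "(\<lambda>x. a x * u x) \<in> LL" "nrm (\<lambda>x. a x * u x) \<le> B * nrm u"
proof -
 have B: "B \<ge> 0" using norm_ge_zero assms(3) order_trans by blast
 have v: "(\<lambda>x. complex_of_real B * u x) \<in> LL"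
  using assms(1) by (auto simp: L2_UNIV_iff norm_mult power_mult_distrib)
 have le: "ae x. norm (a x * u x) \<le> norm (complex_of_real B * u x)"
  using assms(3) B by (auto simp: norm_mult intro!: mult_right_mono)
 have m: "(\<lambda>x. a x * u x) \<in> bmeas" using assms(1,2) by (auto dest: L2_measurable)
 show "(\<lambda>x. a x * u x) \<in> LL" by (rule L2_bound(1)[OF v m le])
 have "nrm (\<lambda>x. a x * u x) \<le> nrm (\<lambda>x. complex_of_real B * u x)" by (rule L2_bound(2)[OF v m le])
 also have "... = B * nrm u" using B
  by (simp add: nrm_eq norm_mult power_mult_distrib real_sqrt_mult)
 finally show "nrm (\<lambda>x. a x * u x) \<le> B * nrm u" .
qed

lemma L2_cmult [intro]: "u \<in> LL ==> (\<lambda>x. (a::complex) * u x) \<in> LL"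
 by (rule L2_mult_bounded(1)[of u "\<lambda>_. a" "norm a"]) auto

lemma nrm_cmult: "nrm (\<lambda>x. (a::complex) * u x) = norm a * nrm u"
 by (simp add: nrm_eq norm_mult power_mult_distrib real_sqrt_mult)

lemma L2_uminus [intro]: "u \<in> LL ==> (\<lambda>x. - u x) \<in> LL"
 by (simp add: L2_UNIV_iff)

lemma L2_diff [intro]:
 "u \<in> LL ==> v \<in> LL ==> (\<lambda>x. u x - v x) \<in> LL"
 using L2_add[of u "\<lambda>x. - v x"] L2_uminus[of v] by simp

lemma L2_zero [simp, intro]: "(\<lambda>x. 0) \<in> LL"
 by (simp add: L2_UNIV_iff)

lemma L2_sum [intro]:
 "(\<And>i. i \<in> I ==> u i \<in> LL) ==> (\<lambda>x. \<Sum>i\<in>I. u i x) \<in> LL"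
 by (induction I rule: infinite_finite_induct) auto

lemma L2_indicator [intro]:
 "u \<in> LL ==> A \<in> sets borel ==> (\<lambda>x. indicator A x * u x :: complex) \<in> LL"
 by (rule L2_mult_bounded(1)[of u "indicator A" 1]) (auto simp: indicator_def)

lemma L2_cnj [intro]: "u \<in> LL ==> (\<lambda>x. cnj (u x)) \<in> LL"
 by (simp add: L2_UNIV_iff borel_measurable_cnj)

lemma L2_cplx [simp]:
 fixes u :: "real^'n => real"
 shows "cplx u \<in> LL \<longleftrightarrow> u \<in> LL"
proof
 assume u: "cplx u \<in> LL"
 have "u \<in> bmeas"
  using L2_measurable[OF u] by (simp add: borel_measurable_complex_iff)
 then show "u \<in> LL" by (intro L2_bound(1)[OF u]) auto
next
 assume "u \<in> LL"
 then show "cplx u \<in> LL"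
  by (intro L2_bound(1)[of u "cplx u"]) (auto dest: L2_measurable)
qed

lemma nrm_cplx [simp]: "nrm (cplx u) = nrm u"
 by (simp add: nrm_eq)

lemma L2_Re [intro]: "u \<in> LL ==> (\<lambda>x. Re (u x)) \<in> LL"
 by (rule L2_bound(1)[of u]) (auto simp: abs_Re_le_cmod dest: L2_measurable)

lemma L2_Im [intro]: "u \<in> LL ==> (\<lambda>x. Im (u x)) \<in> LL"
 by (rule L2_bound(1)[of u]) (auto simp: abs_Im_le_cmod dest: L2_measurable)

lemma integrable_L2_mult [intro]:
 fixes u v :: "real^'n => 'b::{banach, second_countable_topology, real_normed_field}"
 assumes "u \<in> LL" "v \<in> LL" shows "integrable lborel (\<lambda>x. u x * v x)"
proof (rule B_integrable_bound[of _ "\<lambda>x. (norm (u x))^2 + (norm (v x))^2"])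
 have "norm (u x) * norm (v x) \<le> (norm (u x))^2 + (norm (v x))^2" for x
  using sum_squares_bound[of "norm (u x)" "norm (v x)"] mult_nonneg_nonneg[OF norm_ge_zero[of "u x"] norm_ge_zero[of "v x"]]
  by linarith
 then show "ae x. norm (u x * v x) \<le> norm ((norm (u x))^2 + (norm (v x))^2)"
  by (simp add: norm_mult)
qed (use assms in \<open>auto intro!: L2_integrable dest: L2_measurable\<close>)

lemma integrable_ip [intro]: "u \<in> LL ==> v \<in> LL ==> integrable lborel (\<lambda>x. u x * cnj (v x))"
 by (intro integrable_L2_mult L2_cnj)

lemma ip_self: "ip u u = complex_of_real ((nrm u)^2)"
 unfolding ip_def nrm_sq complex_norm_square[symmetric] by (rule integral_complex_of_real)

lemma ip_add_left: "u \<in> LL ==> v \<in> LL ==> w \<in> LL ==> ip (\<lambda>x. u x + v x) w = ip u w + ip v w"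
 unfolding ip_def by (subst B_integral_add[symmetric]) (auto simp: algebra_simps)

lemma ip_diff_left: "u \<in> LL ==> v \<in> LL ==> w \<in> LL ==> ip (\<lambda>x. u x - v x) w = ip u w - ip v w"
 unfolding ip_def by (subst B_integral_diff[symmetric]) (auto simp: algebra_simps)

lemma ip_cmult_left: "ip (\<lambda>x. a * u x) w = a * ip u w"
 unfolding ip_def by (simp add: mult.assoc)

lemma ip_commute: "ip u v = cnj (ip v u)"
 unfolding ip_def by (subst B_integral_cnj[symmetric]) (simp add: mult.commute)

lemma ip_add_right: "u \<in> LL ==> v \<in> LL ==> w \<in> LL ==> ip w (\<lambda>x. u x + v x) = ip w u + ip w v"
 by (simp add: ip_commute[of w] ip_add_left)

lemma ip_diff_right: "u \<in> LL ==> v \<in> LL ==> w \<in> LL ==> ip w (\<lambda>x. u x - v x) = ip w u - ip w v"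
 by (simp add: ip_commute[of w] ip_diff_left)

lemma ip_cmult_right: "ip w (\<lambda>x. a * u x) = cnj a * ip w u"
 by (simp add: ip_commute[of w] ip_cmult_left)

lemma ip_AE_cong:
 assumes "u \<in> bmeas" "u' \<in> bmeas" "v \<in> bmeas" "v' \<in> bmeas"
  "ae x. u x = u' x" "ae x. v x = v' x"
 shows "ip u v = ip u' v'"
 unfolding ip_def using assms(5,6) by (intro integral_cong_AE borel_measurable_times borel_measurable_cnj) (use assms(1-4) in auto)

lemma nrm_add_sq:
 assumes "u \<in> LL" "v \<in> LL"
 shows "(nrm (\<lambda>x. u x + v x))^2 = (nrm u)^2 + 2 * Re (ip u v) + (nrm v)^2"
proof -
 have "ip (\<lambda>x. u x + v x) (\<lambda>x. u x + v x) = ip u u + ip u v + cnj (ip u v) + ip v v"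
  using assms by (simp add: ip_add_left ip_add_right L2_add ip_commute[of v u])
 then have "Re (ip (\<lambda>x. u x + v x) (\<lambda>x. u x + v x)) = (nrm u)^2 + 2 * Re (ip u v) + (nrm v)^2"
  by (simp add: ip_self)
 then show ?thesis by (simp add: ip_self)
qed

lemma nrm_diff_sq:
 assumes "u \<in> LL" "v \<in> LL"
 shows "(nrm (\<lambda>x. u x - v x))^2 = (nrm u)^2 - 2 * Re (ip u v) + (nrm v)^2"
proof -
 have "ip (\<lambda>x. u x - v x) (\<lambda>x. u x - v x) = ip u u - ip u v - cnj (ip u v) + ip v v"
  using assms by (simp add: ip_diff_left ip_diff_right L2_diff ip_commute[of v u])
 then have "Re (ip (\<lambda>x. u x - v x) (\<lambda>x. u x - v x)) = (nrm u)^2 - 2 * Re (ip u v) + (nrm v)^2"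
  by (simp add: ip_self)
 then show ?thesis by (simp add: ip_self)
qed

lemma nrm_zero_iff:
 assumes "u \<in> LL" shows "nrm u = 0 \<longleftrightarrow> (ae x. u x = 0)"
 using integral_nonneg_eq_0_iff_AE[OF L2_integrable[OF assms]] by (simp add: nrm_eq)

lemma Re_ip_le:
 assumes "u \<in> LL" "v \<in> LL" shows "Re (ip u v) \<le> nrm u * nrm v"
proof -
 let ?a = "nrm u" and ?b = "nrm v"
 have "0 \<le> (nrm (\<lambda>x. complex_of_real ?b * u x - complex_of_real ?a * v x))^2" by simp
 also have "... = (?b * ?a)^2 - 2 * (?b * (?a * Re (ip u v))) + (?a * ?b)^2"
  using assms by (subst nrm_diff_sq) (auto simp: nrm_cmult ip_cmult_left ip_cmult_right)
 finally have *: "0 \<le> (?a * ?b) * (?a * ?b - Re (ip u v))" by (simp add: power2_eq_square algebra_simps)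
 show ?thesis
 proof (cases "?a * ?b = 0")
  case False
  then have "?a * ?b > 0" by (simp add: less_le)
  with * show ?thesis by (simp add: zero_le_mult_iff)
 next
  case True
  then have "(ae x. u x = 0) \<or> (ae x. v x = 0)" using assms by (auto simp: nrm_zero_iff)
  then have "ae x. u x * cnj (v x) = 0" by (auto elim: eventually_mono)
  then have "ip u v = 0" unfolding ip_def by (rule integral_eq_zero_AE)
  with True show ?thesis by simp
 qed
qed

lemma norm_ip_le:
 assumes "u \<in> LL" "v \<in> LL" shows "norm (ip u v) \<le> nrm u * nrm v"
proof -
 obtain a where a: "norm a = 1" "complex_of_real (norm (ip u v)) = a * ip u v"
 proof (cases "ip u v = 0")
  case True then show ?thesis using that[of 1] by simp
 next
  case False
  then show ?thesis
   using that[of "cnj (ip u v) / complex_of_real (norm (ip u v))"] complex_norm_square[of "ip u v"]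
   by (simp add: norm_divide power2_eq_square nonzero_eq_divide_eq mult.commute)
 qed
 have "norm (ip u v) = Re (ip (\<lambda>x. a * u x) v)" using a(2) by (metis Re_complex_of_real ip_cmult_left)
 also have "... \<le> nrm (\<lambda>x. a * u x) * nrm v" using assms by (intro Re_ip_le) auto
 finally show ?thesis by (simp add: nrm_cmult a)
qed

lemma nrm_triangle:
 fixes u v :: "real^'n => complex"
 assumes "u \<in> LL" "v \<in> LL" shows "nrm (\<lambda>x. u x + v x) \<le> nrm u + nrm v"
proof (rule power2_le_imp_le)
 show "(nrm (\<lambda>x. u x + v x))^2 \<le> (nrm u + nrm v)^2"
  using Re_ip_le[OF assms] by (simp add: nrm_add_sq[OF assms] power2_sum)
qed simp

lemma nrm_minus_commute: "nrm (\<lambda>x. u x - v x) = nrm (\<lambda>x. v x - u x)"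
 by (simp add: nrm_eq norm_minus_commute)

lemma nrm_diff_triangle:
 fixes u v :: "real^'n => complex"
 assumes "u \<in> LL" "v \<in> LL" "w \<in> LL"
 shows "nrm (\<lambda>x. u x - w x) \<le> nrm (\<lambda>x. u x - v x) + nrm (\<lambda>x. v x - w x)"
 using nrm_triangle[of "\<lambda>x. u x - v x" "\<lambda>x. v x - w x"] assms by auto

lemma nrm_diff_le:
 fixes u v :: "real^'n => complex"
 assumes "u \<in> LL" "v \<in> LL"
 shows "\<bar>nrm u - nrm v\<bar> \<le> nrm (\<lambda>x. u x - v x)"
 using nrm_triangle[of "\<lambda>x. u x - v x" v] nrm_triangle[of "\<lambda>x. v x - u x" u] assms
  nrm_minus_commute[of u v] L2_diff[OF assms] L2_diff[OF assms(2,1)]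
 by (simp add: abs_le_iff)

text \<open>Fast Cauchy subsequences converge almost everywhere, because
 \<open>\<Sum>k. 2 ^ k * (norm (\<Delta> k x))^2\<close> has finite integral; Fatou's lemma then identifies the limit.\<close>

lemma L2_fast_Cauchy_AE:
 fixes g :: "nat => real^'n => complex"
 assumes g: "\<And>k. g k \<in> LL" and fast: "\<And>k. nrm (\<lambda>x. g (Suc k) x - g k x) \<le> (1/2) ^ k"
 shows "ae x. convergent (\<lambda>k. g k x)"
proof -
 have [measurable]: "g k \<in> bmeas" for k using g by (rule L2_measurable)
 define D where "D k x = norm (g (Suc k) x - g k x)" for k x
 have [measurable]: "D k \<in> bmeas" for k unfolding D_def by measurable
 have "(NI x. (\<Sum>k. ennreal (2 ^ k * (D k x)^2))) = (\<Sum>k. \<integral>\<^sup>+x. ennreal (2 ^ k * (D k x)^2) \<partial>lborel)"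
  by (intro nn_integral_suminf) measurable
 also have "... \<le> (\<Sum>k. ennreal ((1/2) ^ k))"
 proof (intro suminf_le summableI)
  fix k
  have "(NI x. ennreal (2 ^ k * (D k x)^2)) = ennreal (2 ^ k) * (NI x. ennreal ((D k x)^2))"
   by (subst nn_integral_cmult[symmetric]) (auto simp: ennreal_mult)
  also have "... = ennreal (2 ^ k * (nrm (\<lambda>x. g (Suc k) x - g k x))^2)"
   unfolding D_def using nn_integral_L2[of "\<lambda>x. g (Suc k) x - g k x"] g
   by (simp add: L2_diff ennreal_mult)
  also have "... \<le> ennreal (2 ^ k * ((1/2) ^ k)^2)"
   by (intro ennreal_leI mult_left_mono power_mono fast) auto
  also have "2 ^ k * ((1/2) ^ k)^2 = ((1/2) ^ k :: real)"
   by (simp add: power2_eq_square field_simps power_mult_distrib[symmetric])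
  finally show "(NI x. ennreal (2 ^ k * (D k x)^2)) \<le> ennreal ((1/2) ^ k)" .
 qed
 also have "... = ennreal (\<Sum>k. (1/2) ^ k)"
  by (intro suminf_ennreal2) (auto intro: summable_geometric)
 also have "... < \<infinity>" by simp
 finally have "(NI x. (\<Sum>k. ennreal (2 ^ k * (D k x)^2))) \<noteq> \<infinity>" by simp
 then have "ae x. (\<Sum>k. ennreal (2 ^ k * (D k x)^2)) \<noteq> \<infinity>"
  by (intro nn_integral_noteq_infinite) measurable
 then show ?thesis
 proof eventually_elim
  case (elim x)
  then have s: "summable (\<lambda>k. 2 ^ k * (D k x)^2)"
   by (intro summable_suminf_not_top) (auto simp: top_unique)
  then have "(\<lambda>k. 2 ^ k * (D k x)^2) ----> 0" by (rule summable_LIMSEQ_zero)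
  then have "Bseq (\<lambda>k. 2 ^ k * (D k x)^2)" by (intro convergent_imp_Bseq convergentI)
  then obtain C where C: "C > 0" "\<And>k. 2 ^ k * (D k x)^2 \<le> C" by (auto simp: Bseq_def)
  have le: "D k x \<le> sqrt C * (sqrt (1/2)) ^ k" for k
  proof (rule power2_le_imp_le)
   have "((sqrt (1/2)) ^ k)^2 = (1/2 :: real) ^ k"
    by (subst power_mult[symmetric], subst mult.commute, subst power_mult) simp
   then have "(sqrt C * (sqrt (1/2)) ^ k)^2 = C / 2 ^ k"
    using C(1) by (simp add: power_mult_distrib power_divide)
   then show "(D k x)^2 \<le> (sqrt C * (sqrt (1/2)) ^ k)^2"
    using C(2)[of k] by (simp add: pos_le_divide_eq mult.commute)
  qed (use C in auto)
  have "sqrt (1/2) < (1::real)" using real_sqrt_lt_1_iff by simp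
  then have "summable (\<lambda>k. sqrt C * (sqrt (1/2)) ^ k)"
   by (intro summable_mult summable_geometric) auto
  then have "summable (\<lambda>k. g (Suc k) x - g k x)"
   by (rule summable_comparison_test'[of _ 0]) (use le in \<open>auto simp: D_def\<close>)
  then have "convergent (\<lambda>n. \<Sum>k<n. g (Suc k) x - g k x)" by (simp add: summable_iff_convergent)
  then have "convergent (\<lambda>n. (\<Sum>k<n. g (Suc k) x - g k x) + g 0 x)"
   by (intro convergent_add convergent_const)
  moreover have "(\<Sum>k<n. g (Suc k) x - g k x) + g 0 x = g n x" for n
   using sum_lessThan_telescope[of "\<lambda>k. g k x" n] by simp
  ultimately show ?case by simp
 qed
qed

lemma L2_complete:
 fixes f :: "nat => real^'n => complex"
 assumes f: "\<And>n. f n \<in> LL"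
  and Cauchy: "\<And>e. e > 0 ==> \<exists>N. \<forall>m\<ge>N. \<forall>n\<ge>N. nrm (\<lambda>x. f m x - f n x) < e"
 obtains l where "l \<in> LL" "(\<lambda>n. nrm (\<lambda>x. f n x - l x)) ----> 0"
proof -
 have "\<exists>N. \<forall>m\<ge>N. \<forall>n\<ge>N. nrm (\<lambda>x. f m x - f n x) < (1/2) ^ k" for k
  by (rule Cauchy) simp
 then obtain N where N: "\<And>k m n. m \<ge> N k ==> n \<ge> N k ==> nrm (\<lambda>x. f m x - f n x) < (1/2) ^ k"
  by metis
 define r where "r k = (\<Sum>i\<le>k. N i) + k" for k
 have rN: "r k \<ge> N k" "r (Suc k) \<ge> r k" "r k \<ge> k" for k
  using member_le_sum[of k "{..k}" N] by (auto simp: r_def)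
 define g where "g k = f (r k)" for k
 have g: "g k \<in> LL" for k by (simp add: g_def f)
 have [measurable]: "f k \<in> bmeas" "g k \<in> bmeas" for k
  using f g by (auto intro: L2_measurable)
 have conv: "ae x. convergent (\<lambda>k. g k x)"
 proof (rule L2_fast_Cauchy_AE[OF g])
  show "nrm (\<lambda>x. g (Suc k) x - g k x) \<le> (1/2) ^ k" for k
   unfolding g_def by (rule less_imp_le[OF N]) (use rN(1)[of k] rN(2)[of k] in linarith)+
 qed
 define l where "l x = lim (\<lambda>k. g k x)" for x
 have [measurable]: "l \<in> bmeas"
  unfolding l_def by measurable
 have lim: "ae x. (\<lambda>k. g k x) ----> l x"
  using conv by eventually_elim (simp add: l_def convergent_LIMSEQ_iff)
 have fatou: "(NI x. ennreal ((norm (f n x - l x))^2)) \<le> ennreal (e^2)"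
  if e: "e > 0" and n: "\<And>m. m \<ge> N0 ==> nrm (\<lambda>x. f n x - f m x) < e" for n e N0
 proof -
  have "(NI x. ennreal ((norm (f n x - l x))^2))
    = (NI x. liminf (\<lambda>k. ennreal ((norm (f n x - g k x))^2)))"
  proof (rule nn_integral_cong_AE, use lim in eventually_elim)
   case (elim x)
   have "(\<lambda>k. ennreal ((norm (f n x - g k x))^2)) ----> ennreal ((norm (f n x - l x))^2)"
    by (intro tendsto_ennrealI tendsto_intros elim)
   then show ?case using lim_imp_Liminf[OF sequentially_bot] by metis
  qed
  also have "... \<le> liminf (\<lambda>k. \<integral>\<^sup>+x. ennreal ((norm (f n x - g k x))^2) \<partial>lborel)"
   by (rule nn_integral_liminf) measurable
  also have "... \<le> ennreal (e^2)"
  proof (rule Liminf_le)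
   show "\<forall>\<^sub>F k in sequentially. (NI x. ennreal ((norm (f n x - g k x))^2)) \<le> ennreal (e^2)"
   proof (rule eventually_sequentiallyI[of N0])
    fix k assume "N0 \<le> k"
    then have "nrm (\<lambda>x. f n x - f (r k) x) < e" using rN(3)[of k] by (intro n) linarith
    then have "(nrm (\<lambda>x. f n x - g k x))^2 \<le> e^2" by (intro power_mono) (auto simp: g_def)
    then show "(NI x. ennreal ((norm (f n x - g k x))^2)) \<le> ennreal (e^2)"
     using nn_integral_L2[of "\<lambda>x. f n x - g k x"] f g by (auto simp: L2_diff ennreal_leI)
   qed
  qed auto
  finally show ?thesis .
 qed
 have l: "l \<in> LL"
 proof -
  obtain N0 where "\<And>m n. m \<ge> N0 ==> n \<ge> N0 ==> nrm (\<lambda>x. f m x - f n x) < 1" using Cauchy[of 1] by auto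
  then have "(\<lambda>x. f N0 x - l x) \<in> LL"
   by (intro L2_nn_integralI(1)[OF _ fatou[of 1 N0 N0]]) auto
  from L2_diff[OF f[of N0] this] show ?thesis by simp
 qed
 moreover have "(\<lambda>n. nrm (\<lambda>x. f n x - l x)) ----> 0"
 proof (rule LIMSEQ_I)
  fix e :: real assume "e > 0"
  then obtain N0 where N0: "\<And>m n. m \<ge> N0 ==> n \<ge> N0 ==> nrm (\<lambda>x. f m x - f n x) < e/2" using Cauchy[of "e/2"] by auto
  have "nrm (\<lambda>x. f n x - l x) < e" if "n \<ge> N0" for n
  proof -
   have "(nrm (\<lambda>x. f n x - l x))^2 \<le> (e/2)^2"
    by (rule L2_nn_integralI(2)[OF _ fatou[of "e/2" N0 n]]) (use N0 that \<open>e > 0\<close> in auto)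
   then have "nrm (\<lambda>x. f n x - l x) \<le> e/2" by (rule power2_le_imp_le) (use \<open>e > 0\<close> in simp)
   with \<open>e > 0\<close> show ?thesis by simp
  qed
  then show "\<exists>no. \<forall>n\<ge>no. norm (nrm (\<lambda>x. f n x - l x) - 0) < e" by auto
 qed
 ultimately show ?thesis using that by blast
qed

lemma L2_tendsto_AE_subseq:
 fixes f :: "nat => real^'n => complex"
 assumes "\<And>n. f n \<in> LL" "l \<in> LL" "(\<lambda>n. nrm (\<lambda>x. f n x - l x)) ----> 0"
 obtains r :: "nat => nat" where "strict_mono r" "ae x. (\<lambda>k. f (r k) x) ----> l x"
proof -
 have "(\<lambda>n. (nrm (\<lambda>x. f n x - l x))^2) ----> 0" using tendsto_power[OF assms(3), of 2] by simp
 then have "(\<lambda>n. \<integral>x. norm ((norm (f n x - l x))^2) \<partial>lborel) ----> 0" by (simp add: nrm_sq)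
 then obtain r where r: "strict_mono (r::nat=>nat)" "ae x. (\<lambda>k. (norm (f (r k) x - l x))^2) ----> 0"
  using tendsto_L1_AE_subseq[of lborel "\<lambda>n x. (norm (f n x - l x))^2", OF L2_integrable[OF L2_diff[OF assms(1,2)]]]
  by blast
 have "ae x. (\<lambda>k. f (r k) x) ----> l x"
  using r(2)
 proof eventually_elim
  case (elim x)
  then have "(\<lambda>k. sqrt ((norm (f (r k) x - l x))^2)) ----> sqrt 0" by (intro tendsto_real_sqrt)
  then have "(\<lambda>k. f (r k) x - l x) ----> 0" by (simp add: tendsto_norm_zero_iff)
  then show ?case by (simp add: LIM_zero_iff)
 qed
 with r(1) that show ?thesis by blast
qed

lemma L2_dominated_convergence:
 fixes f :: "nat => real^'n => complex"
 assumes f: "\<And>n. f n \<in> bmeas" and l: "l \<in> bmeas" and g: "g \<in> LL"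
  and le: "\<And>n. ae x. norm (f n x) \<le> norm (g x :: complex)"
  and lim: "ae x. (\<lambda>n. f n x) ----> l x"
 shows "\<And>n. f n \<in> LL" "l \<in> LL" "(\<lambda>n. nrm (\<lambda>x. f n x - l x)) ----> 0"
proof -
 show fn: "f n \<in> LL" for n by (rule L2_bound(1)[OF g f le])
 have "ae x. \<forall>n. norm (f n x) \<le> norm (g x)" using le by (simp add: AE_all_countable)
 with lim have lg: "ae x. norm (l x) \<le> norm (g x)"
 proof eventually_elim
  case (elim x)
  show ?case by (rule LIMSEQ_le_const2[OF tendsto_norm[OF elim(1)]]) (use elim(2) in auto)
 qed
 show ll: "l \<in> LL" by (rule L2_bound(1)[OF g l lg])
 have "(\<lambda>n. LI x. (norm (f n x - l x))^2) ----> (LINT x::real^'n|lborel. 0)"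
 proof (rule integral_dominated_convergence[where w="\<lambda>x. 4 * (norm (g x))^2"])
  show "ae x. (\<lambda>n. (norm (f n x - l x))^2) ----> 0"
   using lim
  proof eventually_elim
   case (elim x)
   have "(\<lambda>n. (norm (f n x - l x))^2) ----> (norm (l x - l x))^2"
    by (intro tendsto_intros elim)
   then show ?case by simp
  qed
  show "ae x. norm ((norm (f n x - l x))^2) \<le> 4 * (norm (g x))^2" for n
   using le[of n] lg
  proof eventually_elim
   case (elim x)
   have "norm (f n x - l x) \<le> 2 * norm (g x)" using norm_triangle_ineq4[of "f n x" "l x"] elim by linarith
   then have "(norm (f n x - l x))^2 \<le> (2 * norm (g x))^2" by (intro power_mono) auto
   then show ?case by (simp add: power_mult_distrib)
  qed
 qed (use f l g in \<open>auto intro: L2_integrable\<close>)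
 then have "(\<lambda>n. sqrt (LI x. (norm (f n x - l x))^2)) ----> sqrt 0"
  by (intro tendsto_real_sqrt) simp
 then show "(\<lambda>n. nrm (\<lambda>x. f n x - l x)) ----> 0" by (simp add: nrm_eq)
qed

lemma ip_tendsto:
 assumes u: "\<And>n. u n \<in> LL" "l \<in> LL" "(\<lambda>n. nrm (\<lambda>x. u n x - l x)) ----> 0" and v: "v \<in> LL"
 shows "(\<lambda>n. ip (u n) v) ----> ip l v"
proof -
 have "(\<lambda>n. ip (u n) v - ip l v) ----> 0"
 proof (rule Lim_null_comparison)
  show "\<forall>\<^sub>F n in sequentially. norm (ip (u n) v - ip l v) \<le> nrm (\<lambda>x. u n x - l x) * nrm v"
   using u v by (intro always_eventually allI)
    (subst ip_diff_left[symmetric], auto intro!: norm_ip_le)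
  show "(\<lambda>n. nrm (\<lambda>x. u n x - l x) * nrm v) ----> 0"
   using tendsto_mult_right[OF u(3), of "nrm v"] by simp
 qed
 then show ?thesis by (simp add: LIM_zero_iff)
qed

lemma nrm_tendsto:
 fixes l :: "real^'n => complex"
 assumes u: "\<And>n. u n \<in> LL" "l \<in> LL" "(\<lambda>n. nrm (\<lambda>x. u n x - l x)) ----> 0"
 shows "(\<lambda>n. nrm (u n)) ----> nrm l"
proof -
 have "(\<lambda>n. nrm (u n) - nrm l) ----> 0"
  by (rule Lim_null_comparison[OF _ u(3)]) (use nrm_diff_le[OF u(1,2)] in auto)
 then show ?thesis by (simp add: LIM_zero_iff)
qed

text \<open>Square integrable functions of bounded support suffice as test functions: test with the
 restrictions of the function itself to balls.\<close>

definition bdd_supp :: "(real^'n => complex) => bool" where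
 "bdd_supp g \<longleftrightarrow> g \<in> LL \<and> (\<exists>R. \<forall>x. g x \<noteq> 0 --> norm x \<le> R)"

definition trunc :: "real => (real^'n => complex) => real^'n => complex" where
 "trunc R u x = indicator (cball 0 R) x * u x"

lemma trunc_L2 [intro, simp]: "u \<in> LL ==> trunc R u \<in> LL"
 unfolding trunc_def[abs_def] by (rule L2_indicator) auto

lemma bdd_supp_trunc [intro]: "u \<in> LL ==> bdd_supp (trunc R u)"
 unfolding bdd_supp_def by (auto simp: trunc_def indicator_def split: if_splits)

lemma bdd_suppD: "bdd_supp g ==> g \<in> LL"
 by (simp add: bdd_supp_def)

lemma bdd_supp_obtain:
 assumes "bdd_supp g" obtains R where "R > 0" "\<And>x. g x \<noteq> 0 ==> norm x \<le> R"
proof -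
 obtain R where "\<And>x. g x \<noteq> 0 ==> norm x \<le> R" using assms by (auto simp: bdd_supp_def)
 then show ?thesis using that[of "max R 1"] by force
qed

lemma bdd_supp_integrable:
 assumes "bdd_supp g" shows "integrable lborel g"
proof -
 obtain R where R: "\<And>x. g x \<noteq> 0 ==> norm x \<le> R" using bdd_supp_obtain[OF assms] by auto
 have g: "g \<in> LL" using assms by (rule bdd_suppD)
 have b: "bounded (cball (0::real^'a) R)" "cball (0::real^'a) R \<in> sets lborel" by auto
 have "integrable lborel (\<lambda>x. indicator (cball (0::real^'a) R) x :: real)"
  using emeasure_bounded_finite[OF b(1)] by (simp add: integrable_indicator_iff)
 then have "integrable lborel (\<lambda>x. indicator (cball 0 R) x + (norm (g x))^2)"
  by (intro B_integrable_add L2_integrable g)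
 then show ?thesis
 proof (rule B_integrable_bound)
  have "norm (g x) \<le> indicator (cball 0 R) x + (norm (g x))^2" for x
  proof (cases "g x = 0")
   case False
   have "2 * norm (g x) \<le> 1 + (norm (g x))^2" using sum_squares_bound[of 1 "norm (g x)"] by simp
   then have "norm (g x) \<le> 1 + (norm (g x))^2" using norm_ge_zero[of "g x"] by linarith
   then show ?thesis using R[OF False] by simp
  qed simp
  then show "ae x. norm (g x) \<le> norm (indicator (cball 0 R) x + (norm (g x))^2)"
   by (auto intro!: AE_I2 simp: order_trans[OF _ abs_ge_self])
 qed (use g in measurable)
qed

lemma trunc_tendsto:
 fixes u :: "real^'n => complex"
 assumes "u \<in> LL" shows "((\<lambda>R. nrm (\<lambda>x. u x - trunc R u x)) \<longlongrightarrow> 0) at_top"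
proof (rule tendsto_at_topI_sequentially)
 fix X :: "nat => real" assume X: "filterlim X at_top sequentially"
 have "(\<lambda>n. nrm (\<lambda>x. trunc (X n) u x - u x)) ----> 0"
 proof (rule L2_dominated_convergence(3)[OF _ _ assms])
  show "ae x. (\<lambda>n. trunc (X n) u x) ----> u x"
  proof (intro AE_I2 tendsto_eventually)
   fix x :: "real^'n"
   have "\<forall>\<^sub>F n in sequentially. norm x \<le> X n" using X by (simp add: filterlim_at_top)
   then show "\<forall>\<^sub>F n in sequentially. trunc (X n) u x = u x"
    by eventually_elim (simp add: trunc_def)
  qed
 qed (use assms in \<open>auto simp: trunc_def indicator_def dest: L2_measurable\<close>)
 then show "(\<lambda>n. nrm (\<lambda>x. u x - trunc (X n) u x)) ----> 0" by (simp add: nrm_minus_commute[of u])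
qed

lemma L2_zero_by_testing:
 assumes u: "u \<in> LL" and t: "\<And>g. bdd_supp g ==> ip u g = 0"
 shows "ae x. u x = 0"
proof -
 have "ip u (trunc (real n) u) = 0" for n by (intro t bdd_supp_trunc u)
 moreover have "ip u (trunc (real n) u) = ip (trunc (real n) u) (trunc (real n) u)" for n
  unfolding ip_def by (intro B_integral_cong) (auto simp: trunc_def indicator_def)
 ultimately have "nrm (trunc (real n) u) = 0" for n by (simp add: ip_self)
 then have "ae x. trunc (real n) u x = 0" for n by (simp add: nrm_zero_iff u)
 then have "ae x. \<forall>n::nat. trunc (real n) u x = 0" by (simp add: AE_all_countable)
 then show ?thesis
 proof eventually_elim
  case (elim x)
  have "trunc (real (nat \<lceil>norm x\<rceil>)) u x = u x" by (simp add: trunc_def real_nat_ceiling_ge)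
  with elim show ?case by metis
 qed
qed

lemma L2_eq_by_testing:
 assumes "u \<in> LL" "v \<in> LL" "\<And>g. bdd_supp g ==> ip u g = ip v g"
 shows "ae x. u x = v x"
proof -
 have "ae x. u x - v x = 0"
  by (rule L2_zero_by_testing) (use assms in \<open>auto simp: ip_diff_left bdd_suppD\<close>)
 then show ?thesis by simp
qed

section \<open>Tilings and Fourier series on the unit cell\<close>

lemma nn_integral_affine:
 fixes f :: "real^'n => ennreal"
 assumes [measurable]: "f \<in> bmeas" and "c \<noteq> 0"
 shows "(NI x. f x) = ennreal (\<bar>c\<bar> ^ CARD('n)) * (NI x. f (t + c *R x))"
 by (subst lborel_affine[OF \<open>c \<noteq> 0\<close>, of t])
   (simp add: nn_integral_density nn_integral_distr nn_integral_cmult)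

lemma integral_affine:
 fixes f :: "real^'n => 'b::{banach, second_countable_topology}"
 assumes [measurable]: "f \<in> bmeas" and "c \<noteq> 0"
 shows "(LI x. f x) = \<bar>c\<bar> ^ CARD('n) *R (LI x. f (t + c *R x))"
 by (subst lborel_affine[OF \<open>c \<noteq> 0\<close>, of t])
   (simp add: integral_density integral_distr)

lemma integrable_affine:
 fixes f :: "real^'n => 'b::{banach, second_countable_topology}"
 assumes [measurable]: "f \<in> bmeas" and "c \<noteq> 0"
 shows "integrable lborel (\<lambda>x. f (t + c *R x)) \<longleftrightarrow> integrable lborel f"
 unfolding integrable_iff_bounded
 by (subst nn_integral_affine[of "\<lambda>x. ennreal (norm (f x))", OF _ \<open>c \<noteq> 0\<close>, of t])
   (use \<open>c \<noteq> 0\<close> in \<open>auto simp: ennreal_mult_less_top\<close>)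

lemma AE_affine:
 fixes P :: "real^'n => bool"
 assumes "ae x. P x" "c \<noteq> 0"
 shows "ae x. P (t + c *R x)"
proof -
 obtain N where N0: "{x \<in> space lborel. \<not> P x} \<subseteq> N" "emeasure lborel N = 0" "N \<in> sets lborel"
  using assms(1) by (rule AE_E)
 then have N: "{x. \<not> P x} \<subseteq> N" "N \<in> sets borel" "emeasure lborel N = 0"
  by simp_all
 have "ennreal (\<bar>c\<bar> ^ CARD('n)) * (NI x. indicator N (t + c *R x)) = 0"
  using nn_integral_affine[of "indicator N" c t] N assms(2) by simp
 then have "(NI x. indicator N (t + c *R x)) = 0"
  using assms(2) by simp
 then have "ae x. indicator N (t + c *R x) = (0::ennreal)"
  by (subst (asm) nn_integral_0_iff_AE) (use N in auto)
 then show ?thesis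
  by eventually_elim (use N(1) in \<open>auto simp: indicator_def split: if_splits\<close>)
qed

lemma AE_translate:
 fixes P :: "real^'n => bool"
 assumes "ae x. P x" shows "ae x. P (x + t)"
 using AE_affine[OF assms, of 1 t] by (simp add: add.commute)

lemma integral_translate:
 fixes f :: "real^'n => 'b::{banach, second_countable_topology}"
 assumes "f \<in> bmeas"
 shows "(LI x. f (x + t)) = (LI x. f x)"
 using integral_affine[OF assms, of 1 t] by (simp add: add.commute)

lemma integrable_translate:
 fixes f :: "real^'n => 'b::{banach, second_countable_topology}"
 assumes "f \<in> bmeas"
 shows "integrable lborel (\<lambda>x. f (x + t)) \<longleftrightarrow> integrable lborel f"
 using integrable_affine[OF assms, of 1 t] by (simp add: add.commute)

lemma nn_integral_translate:
 fixes f :: "real^'n => ennreal"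
 assumes "f \<in> bmeas"
 shows "(NI x. f (x + t)) = (NI x. f x)"
 using nn_integral_affine[OF assms, of 1 t] by (simp add: add.commute)

lemma integral_reflect:
 fixes f :: "real^'n => 'b::{banach, second_countable_topology}"
 assumes "f \<in> bmeas"
 shows "(LI x. f (- x)) = (LI x. f x)"
 using integral_affine[OF assms, of "-1" 0] by simp

lemma L2_translate:
 fixes u :: "real^'n => 'b::{banach, second_countable_topology}"
 assumes "u \<in> LL" shows "(\<lambda>x. u (x + t)) \<in> LL" "nrm (\<lambda>x. u (x + t)) = nrm u"
proof -
 note [measurable] = L2_measurable[OF assms]
 show "(\<lambda>x. u (x + t)) \<in> LL"
  using L2_integrable[OF assms] integrable_translate[of "\<lambda>x. (norm (u x))^2" t]
  by (simp add: L2_UNIV_iff)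
 show "nrm (\<lambda>x. u (x + t)) = nrm u"
  unfolding nrm_eq using integral_translate[of "\<lambda>x. (norm (u x))^2" t] by simp
qed

lemma L2_reflect:
 fixes u :: "real^'n => 'b::{banach, second_countable_topology}"
 assumes "u \<in> LL" shows "(\<lambda>x. u (- x)) \<in> LL"
proof -
 note [measurable] = L2_measurable[OF assms]
 show ?thesis
  using L2_integrable[OF assms] integrable_affine[of "\<lambda>x. (norm (u x))^2" "-1" 0]
  by (simp add: L2_UNIV_iff)
qed

subsection \<open>Plane waves\<close>

lemma continuous_on_plane_wave [continuous_intros]:
 "continuous_on S f ==> continuous_on S g ==> continuous_on S (\<lambda>z. plane_wave (f z) (g z))"
 unfolding plane_wave_def by (intro continuous_intros)

lemma borel_measurable_plane_wave [measurable (raw)]: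
 "f \<in> borel_measurable M ==> g \<in> borel_measurable M ==> (\<lambda>z. plane_wave (f z) (g z)) \<in> borel_measurable M"
 unfolding plane_wave_def by measurable

lemma norm_plane_wave [simp]: "norm (plane_wave x eta) = 1"
 by (simp add: plane_wave_def mult.assoc mult.left_commute)

lemma plane_wave_commute: "plane_wave x eta = plane_wave eta x"
 by (simp add: plane_wave_def inner_commute)

lemma plane_wave_add_right: "plane_wave x (eta + xi) = plane_wave x eta * plane_wave x xi"
 by (simp add: plane_wave_def inner_add_left distrib_left exp_add)

lemma plane_wave_add_left: "plane_wave (x + y) eta = plane_wave x eta * plane_wave y eta"
 by (simp add: plane_wave_def inner_add_right distrib_left exp_add)

lemma plane_wave_0 [simp]: "plane_wave x 0 = 1" "plane_wave 0 eta = 1"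
 by (simp_all add: plane_wave_def)

lemma cnj_plane_wave: "cnj (plane_wave x eta) = plane_wave x (- eta)"
 by (simp add: plane_wave_def exp_cnj)

lemma plane_wave_minus: "plane_wave (- x) eta = plane_wave x (- eta)"
 by (simp add: plane_wave_def)

lemma plane_wave_mult_cnj [simp]: "plane_wave x eta * cnj (plane_wave x eta) = 1"
 unfolding cnj_plane_wave plane_wave_add_right[symmetric] by simp

lemma plane_wave_scale: "plane_wave (c *R x) eta = plane_wave x (c *R eta)"
 by (simp add: plane_wave_def)

definition rv :: "int^'n => real^'n" where
 "rv k = (\<chi> i. of_int (k $ i))"

lemma rv_nth [simp]: "rv k $ i = of_int (k $ i)" by (simp add: rv_def)
lemma rv_0 [simp]: "rv 0 = 0" by (simp add: rv_def vec_eq_iff)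
lemma rv_add: "rv (k + l) = rv k + rv l" by (simp add: vec_eq_iff)
lemma rv_diff: "rv (k - l) = rv k - rv l" by (simp add: vec_eq_iff)
lemma rv_minus: "rv (- k) = - rv k" by (simp add: vec_eq_iff)
lemma plane_wave_int [simp]: "plane_wave (rv k) (rv l) = 1"
proof -
 have "rv l \<bullet> rv k = of_int (\<Sum>i\<in>UNIV. l $ i * k $ i)" by (simp add: inner_vec_def)
 then show ?thesis unfolding plane_wave_def
  by (auto simp: exp_eq_1 intro: exI[of _ "\<Sum>i\<in>UNIV. l $ i * k $ i"])
qed

subsection \<open>Tilings\<close>

lemma countable_int_vec: "countable (UNIV :: (int^'n) set)" by simp

interpretation lattice: pair_sigma_finite "count_space (UNIV :: (int^'n) set)" "lborel :: (real^'n) measure"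
 by (intro pair_sigma_finite.intro sigma_finite_measure_count_space_countable countable_int_vec
   sigma_finite_lborel)

lemma borel_measurable_lattice:
 assumes "\<And>k. f k \<in> bmeas"
 shows "(\<lambda>(k, x). f k x) \<in> borel_measurable (count_space (UNIV :: (int^'n) set) \<Otimes>\<^sub>M (lborel :: (real^'n) measure))"
 by (rule measurable_pair_measure_countable1) (use assms in auto)

lemma AE_lattice:
 "(ae x. \<forall>k::int^'n. P k x) \<longleftrightarrow> (\<forall>k. ae x. P k x)"
 by (rule AE_all_countable)

definition tiles :: "(real^'n) set => real => bool" where
 "tiles Q s \<longleftrightarrow> Q \<in> sets borel \<and> (ae x. \<exists>!k. x + s *R rv k \<in> Q)"

lemma nn_integral_tiling:
 fixes h :: "real^'n => ennreal"
 assumes Q: "tiles Q s" and [measurable]: "h \<in> bmeas"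
 shows "(NI x. h x) = (NI x. (\<integral>\<^sup>+k. indicator Q x * h (x + s *R rv k) \<partial>cspace))"
proof -
 have [measurable]: "Q \<in> sets borel" and ex: "ae x. \<exists>!k. x + s *R rv k \<in> Q"
  using Q by (auto simp: tiles_def)
 have "(NI x. h x) = (NI x. (\<integral>\<^sup>+k. indicator Q (x + s *R rv k) * h x \<partial>cspace))"
 proof (rule nn_integral_cong_AE, use ex in eventually_elim)
  case (elim x)
  then obtain k where k: "\<And>l. x + s *R rv l \<in> Q \<longleftrightarrow> l = k" by blast
  have "(\<integral>\<^sup>+l. indicator Q (x + s *R rv l) * h x \<partial>cspace)
    = (\<integral>\<^sup>+l. h x * indicator {k} l \<partial>cspace)"
   by (intro nn_integral_cong) (auto simp: indicator_def k)
  also have "... = h x" by (subst nn_integral_cmult_indicator) auto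
  finally show ?case by simp
 qed
 also have "... = (\<integral>\<^sup>+k. (NI x. indicator Q (x + s *R rv k) * h x) \<partial>cspace)"
  by (rule lattice.Fubini'[OF borel_measurable_lattice]) measurable
 also have "... = (\<integral>\<^sup>+k. (NI x. indicator Q x * h (x + s *R rv (- k))) \<partial>cspace)"
 proof (rule nn_integral_cong)
  fix k :: "int^'n"
  show "(NI x. indicator Q (x + s *R rv k) * h x) = (NI x. indicator Q x * h (x + s *R rv (- k)))"
   using nn_integral_translate[of "\<lambda>x. indicator Q x * h (x + s *R rv (- k))" "s *R rv k"]
   by (simp add: rv_minus)
 qed
 also have "... = (\<integral>\<^sup>+k. (NI x. indicator Q x * h (x + s *R rv k)) \<partial>cspace)"
  by (rule nn_integral_bij_count_space[where g=uminus]) (auto intro: bij_uminus)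
 also have "... = (NI x. (\<integral>\<^sup>+k. indicator Q x * h (x + s *R rv k) \<partial>cspace))"
  by (rule lattice.Fubini'[OF borel_measurable_lattice, symmetric]) measurable
 finally show ?thesis .
qed

text \<open>Fubini's theorem for counting measure and Lebesgue measure: every point of the space lies in exactly one
 translate of the tile, and the substitution \<open>k \<mapsto> - k\<close> exchanges translating the tile with translating the function.\<close>

lemma integrable_tiling:
 fixes h :: "real^'n => complex"
 assumes Q: "tiles Q s" and h: "integrable lborel h"
 shows "integrable (cspace \<Otimes>\<^sub>M lborel) (\<lambda>(k, x). indicator Q x * h (x + s *R rv k))"
  and "ae x. x \<in> Q --> integrable (cspace) (\<lambda>k. h (x + s *R rv k))"
  and "integrable lborel (\<lambda>x. indicator Q x * (LINT k|cspace. h (x + s *R rv k)))"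
  and "(LI x. h x) = (LI x. indicator Q x * (LINT k|cspace. h (x + s *R rv k)))"
proof -
 have [measurable]: "Q \<in> sets borel" and ex: "ae x. \<exists>!k. x + s *R rv k \<in> Q"
  using Q by (auto simp: tiles_def)
 have [measurable]: "h \<in> bmeas" using h by auto
 let ?F = "\<lambda>k x. indicator Q x * h (x + s *R rv k)"
 let ?G = "\<lambda>k x. indicator Q (x + s *R rv k) * h x"
 have mF: "(\<lambda>(k, x). ?F k x) \<in> borel_measurable (cspace \<Otimes>\<^sub>M lborel)"
  by (rule borel_measurable_lattice) measurable
 have mG: "(\<lambda>(k, x). ?G k x) \<in> borel_measurable (cspace \<Otimes>\<^sub>M lborel)"
  by (rule borel_measurable_lattice) measurable
 have fin: "(NI x. ennreal (norm (h x))) < \<infinity>"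
  using h by (simp add: integrable_iff_bounded)
 have nF: "(NI x. (\<integral>\<^sup>+k. ennreal (norm (?F k x)) \<partial>cspace)) = (NI x. ennreal (norm (h x)))"
  by (subst nn_integral_tiling[OF Q]) (auto simp: norm_mult ennreal_mult indicator_def intro!: nn_integral_cong)
 show intF: "integrable (cspace \<Otimes>\<^sub>M lborel) (\<lambda>(k, x). ?F k x)"
  unfolding integrable_iff_bounded
 proof
  have "(\<integral>\<^sup>+z. ennreal (norm (case z of (k, x) => ?F k x)) \<partial>(cspace \<Otimes>\<^sub>M lborel))
    = (NI x. (\<integral>\<^sup>+k. ennreal (norm (?F k x)) \<partial>cspace))"
   using lattice.nn_integral_snd[of "\<lambda>z. ennreal (norm (case z of (k, x) => ?F k x))"] mF by simp
  with nF fin show "(\<integral>\<^sup>+z. ennreal (norm (case z of (k, x) => ?F k x)) \<partial>(cspace \<Otimes>\<^sub>M lborel)) < \<infinity>"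
   by simp
 qed (rule mF)
 have sumG: "ae x. (\<integral>\<^sup>+k. ennreal (norm (?G k x)) \<partial>cspace) = ennreal (norm (h x))
   \<and> (LINT k|cspace. ?G k x) = h x"
  using ex
 proof eventually_elim
  case (elim x)
  then obtain k where k: "\<And>l. x + s *R rv l \<in> Q \<longleftrightarrow> l = k" by blast
  have *: "?G l x = indicator {k} l *R h x" for l by (auto simp: indicator_def k)
  have "(\<integral>\<^sup>+l. ennreal (norm (?G l x)) \<partial>cspace) = (\<integral>\<^sup>+l. ennreal (norm (h x)) * indicator {k} l \<partial>cspace)"
   unfolding * by (intro nn_integral_cong) (auto simp: indicator_def)
  also have "... = ennreal (norm (h x))" by (subst nn_integral_cmult_indicator) auto
  finally have 1: "(\<integral>\<^sup>+l. ennreal (norm (?G l x)) \<partial>cspace) = ennreal (norm (h x))" .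
  have "(LINT l|cspace. ?G l x) = h x"
   unfolding * by (subst B_integral_scaleR_left) (auto simp: measure_def)
  with 1 show ?case by simp
 qed
 have intG: "integrable (cspace \<Otimes>\<^sub>M lborel) (\<lambda>(k, x). ?G k x)"
  unfolding integrable_iff_bounded
 proof
  have "(\<integral>\<^sup>+z. ennreal (norm (case z of (k, x) => ?G k x)) \<partial>(cspace \<Otimes>\<^sub>M lborel))
    = (NI x. (\<integral>\<^sup>+k. ennreal (norm (?G k x)) \<partial>cspace))"
   using lattice.nn_integral_snd[of "\<lambda>z. ennreal (norm (case z of (k, x) => ?G k x))"] mG by simp
  also have "... = (NI x. ennreal (norm (h x)))"
   by (rule nn_integral_cong_AE) (use sumG in auto)
  finally show "(\<integral>\<^sup>+z. ennreal (norm (case z of (k, x) => ?G k x)) \<partial>(cspace \<Otimes>\<^sub>M lborel)) < \<infinity>"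
   using fin by simp
 qed (rule mG)
 have "ae x. integrable (cspace) (\<lambda>k. ?F k x)"
  using lattice.AE_integrable_snd[OF intF] by simp
 then show "ae x. x \<in> Q --> integrable (cspace) (\<lambda>k. h (x + s *R rv k))"
  by eventually_elim (auto simp: indicator_def)
 show "integrable lborel (\<lambda>x. indicator Q x * (LINT k|cspace. h (x + s *R rv k)))"
  using lattice.integrable_snd[OF intF] by simp
 have "(LI x. h x) = (LI x. LINT k|cspace. ?G k x)"
  by (rule integral_cong_AE) (use sumG lattice.integrable_snd[OF intG] in auto)
 also have "... = (LINT k|cspace. LI x. ?G k x)"
  by (rule lattice.Fubini_integral[OF intG])
 also have "... = (LINT k|cspace. LI x. ?F (- k) x)"
 proof (rule B_integral_cong[OF refl])
  fix k :: "int^'n"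
  show "(LI x. ?G k x) = (LI x. ?F (- k) x)"
   using integral_translate[of "\<lambda>x. indicator Q x * h (x + s *R rv (- k))" "s *R rv k"]
   by (simp add: rv_minus)
 qed
 also have "... = (LINT k|cspace. LI x. ?F k x)"
  by (rule integral_bij_count_space[where g=uminus]) (auto intro: bij_uminus)
 also have "... = (LI x. LINT k|cspace. ?F k x)"
  by (rule lattice.Fubini_integral[OF intF, symmetric])
 finally show "(LI x. h x) = (LI x. indicator Q x * (LINT k|cspace. h (x + s *R rv k)))"
  by simp
qed

lemma AE_tiling:
 fixes P :: "real^'n => bool"
 assumes "ae x. P x" shows "ae x. \<forall>k. P (x + s *R rv k)"
 unfolding AE_lattice by (intro allI AE_translate assms)

lemma Ycell_eq_cbox: "(Ycell :: (real^'n) set) = cbox 0 1"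
 by (auto simp: Ycell_def mem_box_cart)

lemma Ycell_sets [measurable, simp]: "(Ycell :: (real^'n) set) \<in> sets borel"
 by (simp add: Ycell_eq_cbox)

lemma Zcell_sets [measurable, simp]: "(Zcell :: (real^'n) set) \<in> sets borel"
proof -
 have "(Zcell :: (real^'n) set) = (\<Inter>i. {eta. - (1/2) \<le> eta $ i} \<inter> {eta. eta $ i < 1/2})" by (auto simp: Zcell_def)
 also have "... \<in> sets borel"
  by (intro sets.countable_INT'' sets.Int borel_closed borel_open closed_Collect_le open_Collect_less continuous_intros) auto
 finally show ?thesis .
qed

lemma AE_not_int: "AE x::real^'n in lborel. \<forall>i. x $ i \<notin> \<int>"
proof -
 have "AE x::real^'n in lborel. x $ i \<noteq> of_int m" for i and m :: int
 proof -
  have "negligible {x::real^'n. x $ i = of_int m}"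
   using negligible_hyperplane[of "axis i (1::real)" "of_int m"] by (simp add: inner_axis' axis_eq_0_iff)
  then show ?thesis
   by (subst AE_iff_null) (auto simp: negligible_iff_null_sets null_sets_completion_iff
     intro!: borel_closed closed_Collect_eq continuous_intros)
 qed
 then have "AE x::real^'n in lborel. \<forall>i. \<forall>m::int. x $ i \<noteq> of_int m" by (simp add: AE_all_countable)
 then show ?thesis by eventually_elim (auto simp: Ints_def)
qed

lemma tiles_Ycell: "tiles (Ycell :: (real^'n) set) 1"
 unfolding tiles_def
proof (intro conjI)
 show "AE x::real^'n in lborel. \<exists>!k. x + 1 *R rv k \<in> Ycell"
  using AE_not_int
 proof eventually_elim
  case (elim x)
  have eq: "k $ i = - \<lfloor>x $ i\<rfloor>" if "x + rv k \<in> Ycell" for k i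
  proof -
   have "0 \<le> x $ i + of_int (k $ i)" "x $ i + of_int (k $ i) \<le> 1" using that by (auto simp: Ycell_def)
   moreover have "x $ i + of_int (k $ i) \<noteq> 1" using elim by (metis Ints_1 Ints_diff Ints_of_int add_diff_cancel_right')
   ultimately have "of_int (- (k $ i)) \<le> x $ i" "x $ i < of_int (- (k $ i)) + 1" by auto
   then have "\<lfloor>x $ i\<rfloor> = - (k $ i)" by (rule floor_unique)
   then show ?thesis by simp
  qed
  show ?case
  proof (rule ex1I[of _ "\<chi> i. - \<lfloor>x $ i\<rfloor>"])
   show "x + 1 *R rv (\<chi> i. - \<lfloor>x $ i\<rfloor>) \<in> Ycell"
    unfolding Ycell_def using floor_correct by (auto simp: algebra_simps intro: less_imp_le)
  qed (use eq in \<open>auto simp: vec_eq_iff\<close>)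
 qed
qed simp

definition lat :: "real^'n => int^'n" where
 "lat x = (\<chi> i. \<lfloor>x $ i + 1/2\<rfloor>)"

lemma Zcell_lat: "x - rv k \<in> Zcell \<longleftrightarrow> k = lat x"
proof -
 have "x - rv k \<in> Zcell \<longleftrightarrow> (\<forall>i. of_int (k $ i) \<le> x $ i + 1/2 \<and> x $ i + 1/2 < of_int (k $ i) + 1)"
  unfolding Zcell_def mem_Collect_eq by (intro all_cong1) auto
 also have "... \<longleftrightarrow> (\<forall>i. \<lfloor>x $ i + 1/2\<rfloor> = k $ i)" by (simp add: floor_eq_iff)
 finally show ?thesis by (auto simp: lat_def vec_eq_iff)
qed

lemma scaled_Zcell_iff: "eps > 0 ==> eta \<in> scaled_Zcell eps \<longleftrightarrow> eps *R eta \<in> Zcell"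
 unfolding scaled_Zcell_def by (auto intro!: image_eqI[of _ _ "eps *R eta"])

lemma scaled_Zcell_sets [measurable, simp]: "eps > 0 ==> (scaled_Zcell eps :: (real^'n) set) \<in> sets borel"
proof -
 assume "eps > 0"
 have "(\<lambda>eta::real^'n. eps *R eta) -` Zcell \<inter> space borel \<in> sets borel"
  by (rule measurable_sets[of _ borel borel]) auto
 moreover have "(\<lambda>eta::real^'n. eps *R eta) -` Zcell \<inter> space borel = scaled_Zcell eps"
  using scaled_Zcell_iff[OF \<open>eps > 0\<close>] by auto
 ultimately show ?thesis by simp
qed

lemma scaled_Zcell_lat:
 assumes "eps > 0" shows "xi - (1/eps) *R rv k \<in> scaled_Zcell eps \<longleftrightarrow> k = lat (eps *R xi)"
proof -
 have "eps *R (xi - (1/eps) *R rv k) = eps *R xi - rv k" using assms by (simp add: scaleR_diff_right)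
 then show ?thesis by (simp add: scaled_Zcell_iff[OF assms] Zcell_lat)
qed

lemma tiles_scaled_Zcell:
 assumes "eps > 0" shows "tiles (scaled_Zcell eps :: (real^'n) set) (1/eps)"
 unfolding tiles_def
proof (intro conjI AE_I2)
 fix x :: "real^'n"
 have "x + (1/eps) *R rv k \<in> scaled_Zcell eps \<longleftrightarrow> - k = lat (eps *R x)" for k
  using scaled_Zcell_lat[OF assms, of x "- k"] by (simp add: rv_minus)
 then show "\<exists>!k. x + (1/eps) *R rv k \<in> scaled_Zcell eps"
  by (metis minus_minus)
qed (use assms in simp)

subsection \<open>Trigonometric polynomials\<close>

inductive trig :: "(real^'n => complex) => bool" where
 mono: "trig (\<lambda>x. c * plane_wave x (rv k))"
| add: "trig p ==> trig q ==> trig (\<lambda>x. p x + q x)"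

lemma trig_const: "trig (\<lambda>x. c)"
 using trig.mono[of c 0] by simp

lemma trig_mult: assumes "trig p" "trig q" shows "trig (\<lambda>x. p x * q x)"
 using assms(1)
proof induction
 case (mono c k)
 from assms(2) show ?case
 proof induction
  case (mono d l)
  have "(\<lambda>x. (c * plane_wave x (rv k)) * (d * plane_wave x (rv l))) = (\<lambda>x. (c * d) * plane_wave x (rv (k + l)))"
   by (simp add: rv_add plane_wave_add_right algebra_simps)
  then show ?case by (metis trig.mono)
 next
  case (add p q) then show ?case by (simp add: distrib_left trig.add)
 qed
next
 case (add p q) then show ?case by (simp add: distrib_right trig.add)
qed

lemma trig_sum: "(\<And>i. i \<in> I ==> trig (p i)) ==> trig (\<lambda>x. \<Sum>i\<in>I. p i x)"
 by (induction I rule: infinite_finite_induct) (auto simp: trig_const intro: trig.add)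

lemma trig_coefficients:
 assumes "trig p" obtains F a where "finite F" "\<And>x. p x = (\<Sum>k\<in>F. a k * plane_wave x (rv k))"
proof -
 have "\<exists>F a. finite F \<and> (\<forall>x. p x = (\<Sum>k\<in>F. a k * plane_wave x (rv k)))"
  using assms
 proof induction
  case (mono c k)
  show ?case by (rule exI[of _ "{k}"], rule exI[of _ "\<lambda>_. c"]) simp
 next
  case (add p q)
  then obtain F a G b where F: "finite F" "\<And>x. p x = (\<Sum>k\<in>F. a k * plane_wave x (rv k))"
   and G: "finite G" "\<And>x. q x = (\<Sum>k\<in>G. b k * plane_wave x (rv k))" by blast
  let ?a = "\<lambda>k. if k \<in> F then a k else 0" and ?b = "\<lambda>k. if k \<in> G then b k else 0"
  have "p x = (\<Sum>k\<in>F \<union> G. ?a k * plane_wave x (rv k))" for x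
   unfolding F(2) by (rule sum.mono_neutral_cong_left) (use F G in auto)
  moreover have "q x = (\<Sum>k\<in>F \<union> G. ?b k * plane_wave x (rv k))" for x
   unfolding G(2) by (rule sum.mono_neutral_cong_left) (use F G in auto)
  ultimately have "p x + q x = (\<Sum>k\<in>F \<union> G. (?a k + ?b k) * plane_wave x (rv k))" for x
   by (simp add: distrib_right sum.distrib)
  with F(1) G(1) show ?case
   by (intro exI[of _ "F \<union> G"] exI[of _ "\<lambda>k. ?a k + ?b k"]) simp
 qed
 then show ?thesis using that by blast
qed

lemma trig_measurable [measurable_dest]: "trig p ==> p \<in> bmeas"
 by (induction rule: trig.induct) auto

definition torus :: "real^'n => complex^'n" where
 "torus x = (\<chi> j. plane_wave x (axis j 1))"

lemma torus_nth: "torus x $ j = exp (2 * of_real pi * \<i> * of_real (x $ j))"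
 by (simp add: torus_def plane_wave_def inner_axis')

lemma continuous_on_torus: "continuous_on S torus"
 unfolding torus_def by (intro continuous_intros)

lemma torus_eq_iff: "torus x = torus y \<longleftrightarrow> (\<forall>j. x $ j - y $ j \<in> \<int>)"
proof -
 have "torus x $ j = torus y $ j \<longleftrightarrow> x $ j - y $ j \<in> \<int>" for j
 proof -
  have "torus x $ j = torus y $ j \<longleftrightarrow> (\<exists>n::int. 2 * pi * x $ j = 2 * pi * y $ j + of_int (2 * n) * pi)"
   unfolding torus_nth exp_eq by (simp add: complex_eq_iff)
  also have "... \<longleftrightarrow> (\<exists>n::int. x $ j - y $ j = of_int n)"
  proof (rule ex_cong1)
   fix n :: int
   have "2 * pi * x $ j = 2 * pi * y $ j + of_int (2 * n) * pi \<longleftrightarrow> (2 * pi) * (x $ j - y $ j) = (2 * pi) * of_int n"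
    by (auto simp: algebra_simps)
   then show "2 * pi * x $ j = 2 * pi * y $ j + of_int (2 * n) * pi \<longleftrightarrow> x $ j - y $ j = of_int n"
    by (metis mult_cancel_left pi_neq_zero mult_eq_0_iff zero_neq_numeral)
  qed
  finally show ?thesis by (auto simp: Ints_def)
 qed
 then show ?thesis by (auto simp: vec_eq_iff)
qed

lemma torus_Ycell: "torus x \<in> torus ` Ycell"
proof (rule image_eqI)
 show "torus x = torus (\<chi> j. frac (x $ j))"
  by (simp add: torus_eq_iff frac_def)
 show "(\<chi> j. frac (x $ j)) \<in> Ycell"
  by (simp add: Ycell_def frac_ge_0 less_imp_le[OF frac_lt_1])
qed

lemma trig_real_polynomial_torus:
 assumes "real_polynomial_function q" shows "trig (\<lambda>x. complex_of_real (q (torus x)))"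
 using assms
proof induction
 case (linear f)
 interpret bounded_linear f by fact
 have z: "z = (\<Sum>j\<in>UNIV. Re (z $ j) *R axis j 1 + Im (z $ j) *R axis j \<i>)" for z :: "complex^'a"
 proof -
  have "(\<Sum>j\<in>UNIV. Re (z $ j) *R axis j 1 + Im (z $ j) *R axis j \<i>) $ i = z $ i" for i
  proof -
   have "(\<Sum>j\<in>UNIV. Re (z $ j) *R axis j 1 + Im (z $ j) *R axis j \<i>) $ i
    = (\<Sum>j\<in>UNIV. if j = i then z $ j else 0)"
    unfolding sum_component by (intro sum.cong) (auto simp: axis_def complex_eq_iff)
   then show ?thesis by simp
  qed
  then show ?thesis by (simp add: vec_eq_iff)
 qed
 have fz: "f z = (\<Sum>j\<in>UNIV. Re (z $ j) * f (axis j 1) + Im (z $ j) * f (axis j \<i>))" for z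
  by (subst z) (simp add: sum add scaleR)
 have ax: "rv (axis j 1) = axis j (1::real)" for j :: 'a
  by (simp add: vec_eq_iff axis_def)
 have "complex_of_real (f (torus x)) = (\<Sum>j\<in>UNIV.
   (of_real (f (axis j 1)) / 2 + of_real (f (axis j \<i>)) / (2 * \<i>)) * plane_wave x (rv (axis j 1))
   + (of_real (f (axis j 1)) / 2 - of_real (f (axis j \<i>)) / (2 * \<i>)) * plane_wave x (rv (- axis j 1)))" for x
  unfolding fz[of "torus x"] of_real_sum
  by (intro sum.cong)
    (auto simp: torus_def ax rv_minus cnj_plane_wave[symmetric] complex_eq_iff field_simps)
 then show ?case by (simp only:) (intro trig_sum trig.add trig.mono)
next
 case (mult f g) then show ?case by (simp add: trig_mult)
qed (auto intro: trig_const trig.add)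

text \<open>The torus is a quotient of the compact cell. Two distinct points of the cell with the same image lie on its
 boundary, where the function vanishes.\<close>

lemma continuous_lift_torus:
 fixes G :: "real^'n => real"
 assumes G: "continuous_on Ycell G" and z: "\<And>x. x \<notin> box 0 1 ==> G x = 0"
 obtains H where "continuous_on (torus ` Ycell) H" "\<And>x. x \<in> Ycell ==> H (torus x) = G x"
proof -
 have inj: "x = y" if "x \<in> box 0 1" "y \<in> Ycell" "torus x = torus y" for x y :: "real^'n"
 proof -
  note xy = that
  have "x $ j = y $ j" for j
  proof -
   obtain n :: int where n: "x $ j - y $ j = of_int n" using xy(3) by (auto simp: torus_eq_iff Ints_def)
   have "0 < x $ j" "x $ j < 1" "0 \<le> y $ j" "y $ j \<le> 1" using xy by (auto simp: mem_box_cart Ycell_def)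
   with n have "of_int n < (1::real)" "of_int n > (-1::real)" by linarith+
   then have "n = 0" by linarith
   with n show ?thesis by simp
  qed
  then show ?thesis by (simp add: vec_eq_iff)
 qed
 have fib: "G x = G y" if "x \<in> Ycell" "y \<in> Ycell" "torus x = torus y" for x y
  using inj[of x y] inj[of y x] that z by metis
 define H where "H w = G (SOME x. x \<in> Ycell \<and> torus x = w)" for w
 have H: "H (torus x) = G x" if "x \<in> Ycell" for x
 proof -
  have "(SOME y. y \<in> Ycell \<and> torus y = torus x) \<in> Ycell \<and> torus (SOME y. y \<in> Ycell \<and> torus y = torus x) = torus x"
   by (rule someI[of _ x]) (use that in simp)
  then show ?thesis unfolding H_def using fib that by blast
 qed
 have cY: "compact (Ycell :: (real^'n) set)" by (simp add: Ycell_eq_cbox)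
 have "closed (H -` C \<inter> torus ` Ycell)" if C: "closed C" for C
 proof -
  have "H -` C \<inter> torus ` Ycell = torus ` (G -` C \<inter> Ycell)" using H by auto
  moreover have "compact (G -` C \<inter> Ycell)"
   using continuous_on_closed_vimage[of Ycell G] G C cY compact_Int_closed[of Ycell "G -` C \<inter> Ycell"]
   by (simp add: compact_imp_closed Int_commute Int_left_commute)
  ultimately show ?thesis by (simp add: compact_imp_closed compact_continuous_image continuous_on_torus)
 qed
 moreover have "closed (torus ` (Ycell :: (real^'n) set))"
  by (intro compact_imp_closed compact_continuous_image continuous_on_torus cY)
 ultimately have "continuous_on (torus ` Ycell) H" by (simp add: continuous_on_closed_vimage)
 with H that show ?thesis by blast
qed

lemma trig_approx_real:
 fixes f :: "real^'n => real"
 assumes f: "f \<in> bmeas" and B: "\<And>x. \<bar>f x\<bar> \<le> B"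
 obtains p where "\<And>n. trig (\<lambda>x. complex_of_real (p n x))" "\<And>n x. \<bar>p n x\<bar> \<le> B + 1"
  "ae x. x \<in> Ycell --> (\<lambda>n. p n x) ----> f x"
proof -
 have B0: "B \<ge> 0" using B[of 0] by linarith
 have "f measurable_on UNIV" using f
  by (intro lebesgue_measurable_imp_measurable_on) (auto intro: measurable_completion)
 then obtain N g where N: "negligible N" and g: "\<And>n. continuous_on UNIV (g n)"
  and lim: "\<And>x. x \<notin> N ==> (\<lambda>n. g n x) ----> f x" for n::nat
  unfolding measurable_on_def by auto
 define D where "D = (box 0 1 :: (real^'n) set)"
 define cut where "cut n x = min 1 (real n * infdist x (- D))" for n x
 define G where "G n x = cut n x * max (- B) (min B (g n x))" for n x
 have neD: "- D \<noteq> {}" unfolding D_def using bounded_box not_bounded_UNIV by (metis Compl_empty_eq double_compl)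
 have contG: "continuous_on Ycell (G n)" for n
  unfolding G_def cut_def using g[of n]
  by (intro continuous_intros continuous_on_infdist) (auto intro: continuous_on_subset)
 have cutb: "0 \<le> cut n x" "cut n x \<le> 1" for n x by (auto simp: cut_def infdist_nonneg)
 have Gb: "\<bar>G n x\<bar> \<le> B" for n x
 proof -
  have "\<bar>max (- B) (min B (g n x))\<bar> \<le> B" using B0 by (auto simp: abs_le_iff min_def max_def)
  then have "cut n x * \<bar>max (- B) (min B (g n x))\<bar> \<le> 1 * B" by (intro mult_mono cutb) auto
  then show ?thesis using cutb[of n x] by (simp add: G_def abs_mult)
 qed
 have G0: "G n x = 0" if "x \<notin> box 0 1" for n x
  using that neD by (simp add: G_def cut_def D_def)
 have limG: "(\<lambda>n. G n x) ----> f x" if "x \<in> D" "x \<notin> N" for x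
 proof -
  have "closed (- D)" by (auto simp: D_def)
  then have pos: "infdist x (- D) > 0" using that(1) neD in_closed_iff_infdist_zero[of "- D" x] infdist_nonneg[of x "- D"]
   by auto
  have "\<forall>\<^sub>F n in sequentially. cut n x = 1"
  proof (rule eventually_sequentiallyI[of "nat \<lceil>1 / infdist x (- D)\<rceil>"])
   fix n assume "nat \<lceil>1 / infdist x (- D)\<rceil> \<le> n"
   then have "1 / infdist x (- D) \<le> real n" by (simp add: nat_le_iff ceiling_le_iff)
   then show "cut n x = 1" using pos by (simp add: cut_def field_simps)
  qed
  then have "(\<lambda>n. cut n x) ----> 1" by (rule tendsto_eventually)
  moreover have "(\<lambda>n. max (- B) (min B (g n x))) ----> max (- B) (min B (f x))"
   by (intro tendsto_intros lim that)
  ultimately have "(\<lambda>n. G n x) ----> 1 * max (- B) (min B (f x))" unfolding G_def by (rule tendsto_mult)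
  moreover have "max (- B) (min B (f x)) = f x" using B[of x] by (auto simp: abs_le_iff)
  ultimately show ?thesis by simp
 qed
 have "\<exists>q. real_polynomial_function q \<and> (\<forall>x\<in>Ycell. \<bar>q (torus x) - G n x\<bar> < 1 / (real n + 1))" for n
 proof -
  obtain H where H: "continuous_on (torus ` Ycell) H" "\<And>x. x \<in> Ycell ==> H (torus x) = G n x"
   using continuous_lift_torus[OF contG G0] by blast
  have "compact (torus ` (Ycell :: (real^'n) set))"
   by (intro compact_continuous_image continuous_on_torus) (simp add: Ycell_eq_cbox)
  then obtain q where q: "real_polynomial_function q" "\<And>w. w \<in> torus ` Ycell ==> \<bar>H w - q w\<bar> < 1 / (real n + 1)"
   using Stone_Weierstrass_real_polynomial_function[of "torus ` Ycell" H "1 / (real n + 1)"] H(1) by auto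
  have "\<bar>q (torus x) - G n x\<bar> < 1 / (real n + 1)" if "x \<in> Ycell" for x
   using q(2)[of "torus x"] H(2)[OF that] that by (simp add: abs_minus_commute)
  with q(1) show ?thesis by blast
 qed
 then obtain q where q: "\<And>n. real_polynomial_function (q n)"
  and qG: "\<And>n x. x \<in> Ycell ==> \<bar>q n (torus x) - G n x\<bar> < 1 / (real n + 1)" by metis
 show ?thesis
 proof (rule that[of "\<lambda>n x. q n (torus x)"])
  show "trig (\<lambda>x. complex_of_real (q n (torus x)))" for n by (rule trig_real_polynomial_torus[OF q])
  show "\<bar>q n (torus x)\<bar> \<le> B + 1" for n x
  proof -
   obtain y where y: "y \<in> Ycell" "torus x = torus y" using torus_Ycell[of x] by auto
   have "1 / (real n + 1) \<le> 1" by simp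
   then show ?thesis unfolding y(2) using qG[OF y(1), of n] Gb[of n y] by linarith
  qed
  have "negligible (N \<union> (cbox 0 1 - box 0 (1::real^'n)))"
   using N negligible_frontier_interval by (intro negligible_Un) auto
  then obtain N' where N': "N \<union> (cbox 0 1 - box 0 (1::real^'n)) \<subseteq> N'" "N' \<in> null_sets lborel"
   using completion_ex_simple_function by (auto simp: negligible_iff_null_sets null_sets_completion_iff2)
  have "ae x. x \<notin> N'" using N'(2) by (rule AE_not_in)
  then show "ae x. x \<in> Ycell --> (\<lambda>n. q n (torus x)) ----> f x"
  proof eventually_elim
   case (elim x)
   show ?case
   proof
    assume Y: "x \<in> Ycell"
    then have x: "x \<in> D" "x \<notin> N" using elim N'(1) by (auto simp: Ycell_eq_cbox D_def)
    have "(\<lambda>n. q n (torus x) - G n x) ----> 0"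
    proof (rule Lim_null_comparison)
     show "\<forall>\<^sub>F n in sequentially. norm (q n (torus x) - G n x) \<le> 1 / (real n + 1)"
      by (intro always_eventually allI) (use less_imp_le[OF qG[OF Y]] in simp)
     show "(\<lambda>n. 1 / (real n + 1)) ----> 0" using lim_inverse_n' LIMSEQ_inverse_real_of_nat
      by (simp add: inverse_eq_divide add.commute)
    qed
    from tendsto_add[OF this limG[OF x]] show "(\<lambda>n. q n (torus x)) ----> f x" by simp
   qed
  qed
 qed
qed

text \<open>Every bounded Borel function on the cell is a bounded almost everywhere limit of trigonometric
 polynomials: approximate it by continuous functions that vanish on the boundary of the cell, which
 live on the torus, where the Stone--Weierstrass theorem applies.\<close>

lemma trig_approx:
 fixes f :: "real^'n => complex"
 assumes [measurable]: "f \<in> bmeas" and B: "\<And>x. norm (f x) \<le> B"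
 obtains p where "\<And>n. trig (p n)" "\<And>n x. norm (p n x) \<le> 2 * B + 2"
  "ae x. x \<in> Ycell --> (\<lambda>n. p n x) ----> f x"
proof -
 obtain p where p: "\<And>n. trig (\<lambda>x. complex_of_real (p n x))" "\<And>n x. \<bar>p n x\<bar> \<le> B + 1"
  "ae x. x \<in> Ycell --> (\<lambda>n. p n x) ----> Re (f x)"
  by (rule trig_approx_real[of "\<lambda>x. Re (f x)" B]) (use B abs_Re_le_cmod order_trans in \<open>auto, blast\<close>)
 obtain q where q: "\<And>n. trig (\<lambda>x. complex_of_real (q n x))" "\<And>n x. \<bar>q n x\<bar> \<le> B + 1"
  "ae x. x \<in> Ycell --> (\<lambda>n. q n x) ----> Im (f x)"
  by (rule trig_approx_real[of "\<lambda>x. Im (f x)" B]) (use B abs_Im_le_cmod order_trans in \<open>auto, blast\<close>)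
 show ?thesis
 proof (rule that[of "\<lambda>n x. complex_of_real (p n x) + \<i> * complex_of_real (q n x)"])
  show "trig (\<lambda>x. complex_of_real (p n x) + \<i> * complex_of_real (q n x))" for n
   by (intro trig.add p(1) trig_mult trig_const q(1))
  show "norm (complex_of_real (p n x) + \<i> * complex_of_real (q n x)) \<le> 2 * B + 2" for n x
   using norm_triangle_ineq[of "complex_of_real (p n x)" "\<i> * complex_of_real (q n x)"] p(2)[of n x] q(2)[of n x]
   by (simp add: norm_mult)
  show "ae x. x \<in> Ycell --> (\<lambda>n. complex_of_real (p n x) + \<i> * complex_of_real (q n x)) ----> f x"
   using p(3) q(3)
  proof eventually_elim
   case (elim x)
   show ?case
   proof
    assume "x \<in> Ycell"
    with elim have "(\<lambda>n. complex_of_real (p n x) + \<i> * complex_of_real (q n x))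
      ----> complex_of_real (Re (f x)) + \<i> * complex_of_real (Im (f x))" by (intro tendsto_intros) auto
    then show "(\<lambda>n. complex_of_real (p n x) + \<i> * complex_of_real (q n x)) ----> f x"
     by (simp add: complex_eq[symmetric])
   qed
  qed
 qed
qed

subsection \<open>Parseval's identity for Fourier series\<close>

text \<open>The Fourier integral. At an integer frequency and for a function supported in the cell it is also the Fourier coefficient.\<close>

definition cf :: "(real^'n => complex) => real^'n => complex" where
 "cf u xi = (LI x. u x * cnj (plane_wave x xi))"

definition tp :: "(int^'n) set => (int^'n => complex) => real^'n => complex" where
 "tp F a x = indicator Ycell x * (\<Sum>k\<in>F. a k * plane_wave x (rv k))"

lemma periodic_lattice:
 fixes u :: "real^'n => 'b"
 assumes "periodic u" shows "ae x. \<forall>k. u (x + rv k) = u x"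
proof -
 let ?P = "\<lambda>k. ae x. u (x + rv k) = u x"
 have add: "?P (k + l)" if "?P k" "?P l" for k l
  using AE_translate[OF that(2), of "rv k"] that(1)
  by eventually_elim (simp add: rv_add add.assoc)
 have neg: "?P (- k)" if "?P k" for k
  using AE_translate[OF that, of "- rv k"] by (simp add: rv_minus eq_commute)
 have ax: "?P (axis i 1)" for i
 proof -
  have "rv (axis i 1) = axis i 1" by (simp add: vec_eq_iff axis_def)
  then show ?thesis using assms by (simp add: periodic_def)
 qed
 have nat: "?P (axis i (int m))" for i m
 proof (induction m)
  case 0
  have "axis i (int 0) = (0 :: int^'n)" by (simp add: vec_eq_iff axis_def)
  then show ?case by (simp only:) simp
 next
  case (Suc m)
  have "axis i (int (Suc m)) = axis i (int m) + axis i 1" by (simp add: vec_eq_iff axis_def)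
  then show ?case using add[OF Suc ax] by simp
 qed
 have int: "?P (axis i m)" for i and m :: int
 proof (cases "m \<ge> 0")
  case True then show ?thesis using nat[of i "nat m"] by simp
 next
  case False
  have "axis i m = - axis i (int (nat (- m)))" using False by (simp add: vec_eq_iff axis_def)
  then show ?thesis using neg[OF nat, of i "nat (- m)"] by (simp only:)
 qed
 have "?P (\<Sum>i\<in>I. axis i (k $ i))" if "finite I" for I :: "'n set" and k :: "int^'n"
  using that
 proof induction
  case empty then show ?case by simp
 next
  case (insert i I)
  then show ?case using add[OF int[of i "k $ i"] insert.IH] by (simp only: sum.insert[OF insert.hyps(1,2)])
 qed
 moreover have "(\<Sum>i\<in>UNIV. axis i (k $ i)) = k" for k :: "int^'n"
  by (simp add: vec_eq_iff axis_def)
 ultimately have "?P k" for k by (metis finite)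
 then show ?thesis by (simp add: AE_lattice)
qed

lemma integral_Ycell_translate:
 fixes g :: "real^'n => complex"
 assumes [measurable]: "g \<in> bmeas" and per: "ae x. \<forall>k. g (x + rv k) = g x"
  and int: "integrable lborel (\<lambda>x. indicator Ycell x * g x)"
 shows "integrable lborel (\<lambda>x. indicator Ycell x * g (x + t))"
  and "(LI x. indicator Ycell x * g (x + t)) = (LI x. indicator Ycell x * g x)"
proof -
 define h where "h x = indicator Ycell (x - t) * g x" for x
 have [measurable]: "h \<in> bmeas" unfolding h_def by measurable
 have ex: "ae x. \<exists>!k. (x - t) + 1 *R rv k \<in> (Ycell :: (real^'n) set)"
  using AE_translate[of "\<lambda>x. \<exists>!k. x + 1 *R rv k \<in> (Ycell :: (real^'n) set)" "- t"] tiles_Ycell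
  by (simp add: tiles_def)
 have sums: "ae x. (\<integral>\<^sup>+k. ennreal (norm (h (x + 1 *R rv k))) \<partial>cspace) = ennreal (norm (g x))
   \<and> (LINT k|cspace. h (x + 1 *R rv k)) = g x"
  using ex per
 proof eventually_elim
  case (elim x)
  then obtain k where k: "\<And>l. (x - t) + rv l \<in> Ycell \<longleftrightarrow> l = k" by auto
  have *: "h (x + 1 *R rv l) = indicator {k} l *R g x" for l
   using k[of l] elim(2) by (simp add: h_def indicator_def algebra_simps)
  have "(\<integral>\<^sup>+l. ennreal (norm (h (x + 1 *R rv l))) \<partial>cspace) = (\<integral>\<^sup>+l. ennreal (norm (g x)) * indicator {k} l \<partial>cspace)"
   unfolding * by (intro nn_integral_cong) (auto simp: indicator_def)
  also have "... = ennreal (norm (g x))" by (subst nn_integral_cmult_indicator) auto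
  finally have 1: "(\<integral>\<^sup>+l. ennreal (norm (h (x + 1 *R rv l))) \<partial>cspace) = ennreal (norm (g x))" .
  have "(LINT l|cspace. h (x + 1 *R rv l)) = g x"
   unfolding * by (subst B_integral_scaleR_left) (auto simp: measure_def)
  with 1 show ?case by simp
 qed
 have "(NI x. ennreal (norm (h x)))
   = (NI x. (\<integral>\<^sup>+k. indicator Ycell x * ennreal (norm (h (x + 1 *R rv k))) \<partial>cspace))"
  by (rule nn_integral_tiling[OF tiles_Ycell]) measurable
 also have "... = (NI x. ennreal (norm (indicator Ycell x * g x)))"
 proof (rule nn_integral_cong_AE, use sums in eventually_elim)
  case (elim x)
  then show ?case by (simp add: nn_integral_cmult indicator_def)
 qed
 also have "... < \<infinity>" using int by (simp add: integrable_iff_bounded)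
 finally have hi: "integrable lborel h" by (simp add: integrable_iff_bounded)
 have eq: "(\<lambda>x. indicator Ycell x * g (x + t)) = (\<lambda>x. h (x + t))" by (simp add: h_def)
 show "integrable lborel (\<lambda>x. indicator Ycell x * g (x + t))"
  unfolding eq using hi by (simp add: integrable_translate)
 have "(LI x. indicator Ycell x * g (x + t)) = (LI x. h x)"
  unfolding eq by (simp add: integral_translate)
 also have "... = (LI x. indicator Ycell x * (LINT k|cspace. h (x + 1 *R rv k)))"
  by (rule integrable_tiling(4)[OF tiles_Ycell hi])
 also have "... = (LI x. indicator Ycell x * g x)"
  by (rule integral_cong_AE)
    (use sums borel_measurable_integrable[OF integrable_tiling(3)[OF tiles_Ycell hi]] in auto)
 finally show "(LI x. indicator Ycell x * g (x + t)) = (LI x. indicator Ycell x * g x)" .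
qed

lemma emeasure_Ycell: "emeasure lborel (Ycell :: (real^'n) set) = 1"
proof -
 have "measure lborel (cbox 0 (1::real^'n)) = 1"
  by (subst content_cbox_cart) (auto simp: interval_eq_empty_cart)
 moreover have "emeasure lborel (cbox 0 (1::real^'n)) \<noteq> \<infinity>"
  using emeasure_lborel_cbox_finite[of 0 "1::real^'n"] by simp
 ultimately show ?thesis unfolding Ycell_eq_cbox by (metis emeasure_eq_ennreal_measure ennreal_1 infinity_ennreal_def)
qed

lemma integrable_Ycell_bounded:
 fixes g :: "real^'n => complex"
 assumes "g \<in> bmeas" "\<And>x. norm (g x) \<le> B"
 shows "integrable lborel (\<lambda>x. indicator Ycell x * g x)"
proof (rule B_integrable_bound[of _ "\<lambda>x. B * indicator Ycell x"])
 show "integrable lborel (\<lambda>x::real^'n. B * indicator Ycell x)"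
  by (intro integrable_mult_right) (simp add: integrable_indicator_iff emeasure_Ycell)
 have "0 \<le> B" using assms(2)[of 0] norm_ge_zero order_trans by blast
 with assms(2) show "ae x. norm (indicator Ycell x * g x) \<le> norm (B * indicator Ycell x)"
  by (auto simp: indicator_def)
qed (use assms in auto)

lemma Ycell_bounded: "x \<in> (Ycell :: (real^'n) set) ==> norm x \<le> CARD('n)"
proof -
 assume "x \<in> Ycell"
 then have "\<bar>x $ i\<bar> \<le> 1" for i by (auto simp: Ycell_def)
 then have "(\<Sum>i\<in>UNIV. \<bar>x $ i\<bar>) \<le> (\<Sum>i\<in>(UNIV::'n set). 1)" by (intro sum_mono)
 then show "norm x \<le> CARD('n)" using norm_le_l1_cart[of x] by simp
qed

lemma L2_Ycell_bounded:
 assumes "g \<in> bmeas" "\<And>x. norm (g x) \<le> B"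
 shows "(\<lambda>x. indicator Ycell x * g x :: complex) \<in> LL"
proof -
 have "(norm (indicator Ycell x * g x))^2 = norm (indicator Ycell x * (g x)^2)" for x
  by (simp add: norm_mult power_mult_distrib norm_power indicator_def)
 moreover have "integrable lborel (\<lambda>x. indicator Ycell x * (g x)^2)"
  using assms by (intro integrable_Ycell_bounded[where B="B^2"]) (auto simp: norm_power intro: power_mono)
 ultimately show ?thesis using assms by (simp add: L2_UNIV_iff)
qed

lemma integral_Ycell_plane_wave:
 "(LI x. indicator Ycell x * plane_wave x (rv k)) = (if k = 0 then 1 else 0)"
proof (cases "k = 0")
 case True
 have "(LINT x::real^'a|lborel. indicator Ycell x * (1::complex)) = (LI x. indicator (Ycell :: (real^'a) set) x *R (1::complex))"
  by (intro B_integral_cong) (auto simp: indicator_def)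
 also have "... = 1"
  by (subst B_integral_scaleR_left)
    (auto simp: measure_def integrable_indicator_iff emeasure_Ycell)
 finally show ?thesis using True by simp
next
 case False
 then obtain i where i: "k $ i \<noteq> 0" by (auto simp: vec_eq_iff)
 define t :: "real^'a" where "t = axis i (1 / (2 * of_int (k $ i)))"
 have t: "plane_wave t (rv k) = -1"
 proof -
  have "rv k \<bullet> t = 1/2" using i by (simp add: t_def inner_axis)
  then show ?thesis by (simp only: plane_wave_def) (simp add: exp_eq_polar mult.commute)
 qed
 let ?I = "LI x. indicator Ycell x * plane_wave x (rv k)"
 have "(LI x. indicator Ycell x * plane_wave (x + t) (rv k)) = ?I"
  by (rule integral_Ycell_translate(2)) (auto simp: plane_wave_add_left intro!: integrable_Ycell_bounded[where B=1])
 moreover have "(LI x. indicator Ycell x * plane_wave (x + t) (rv k)) = - ?I"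
  by (simp add: plane_wave_add_left t)
 ultimately show ?thesis using False by (simp add: eq_neg_iff_add_eq_0)
qed

lemma tp_L2: "tp F a \<in> LL"
 unfolding tp_def[abs_def] sum_distrib_left
proof (rule L2_sum)
 fix k
 have "(\<lambda>x. a k * (indicator Ycell x * plane_wave x (rv k))) \<in> LL"
  by (intro L2_cmult L2_Ycell_bounded[where B=1]) auto
 then show "(\<lambda>x. indicator Ycell x * (a k * plane_wave x (rv k))) \<in> LL" by (simp add: ac_simps)
qed

lemma ip_tp:
 assumes h: "h \<in> LL" "\<And>x. x \<notin> Ycell ==> h x = 0"
 shows "ip h (tp F a) = (\<Sum>k\<in>F. cnj (a k) * cf h (rv k))"
proof -
 have b: "bdd_supp h" unfolding bdd_supp_def using h Ycell_bounded by blast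
 have "ip h (tp F a) = (LI x. (\<Sum>k\<in>F. cnj (a k) * (h x * cnj (plane_wave x (rv k)))))"
  unfolding ip_def tp_def by (intro B_integral_cong)
   (use h(2) in \<open>auto simp: sum_distrib_left indicator_def ac_simps\<close>)
 also have "... = (\<Sum>k\<in>F. cnj (a k) * cf h (rv k))"
  unfolding cf_def
 proof (subst B_integral_sum)
  fix k
  have "integrable lborel (\<lambda>x. h x * cnj (plane_wave x (rv k)))"
   by (rule B_integrable_bound[OF bdd_supp_integrable[OF b]])
     (use h(1) in \<open>auto simp: norm_mult dest: L2_measurable\<close>)
  then show "integrable lborel (\<lambda>x. cnj (a k) * (h x * cnj (plane_wave x (rv k))))" by simp
 qed simp
 finally show ?thesis .
qed

lemma cf_tp: assumes "finite F" shows "cf (tp F a) (rv k) = (if k \<in> F then a k else 0)"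
proof -
 have pw: "plane_wave x (rv (l - k)) = plane_wave x (rv l) * cnj (plane_wave x (rv k))" for l x
  by (simp add: rv_diff cnj_plane_wave flip: plane_wave_add_right)
 have "cf (tp F a) (rv k) = (LI x. (\<Sum>l\<in>F. a l * (indicator Ycell x * plane_wave x (rv (l - k)))))"
  unfolding cf_def tp_def pw by (simp add: sum_distrib_left sum_distrib_right ac_simps)
 also have "... = (\<Sum>l\<in>F. a l * (LI x. indicator Ycell x * plane_wave x (rv (l - k))))"
  by (subst B_integral_sum) (auto intro!: integrable_mult_right integrable_Ycell_bounded[where B=1])
 also have "... = (\<Sum>l\<in>F. if l = k then a l else 0)"
  by (intro sum.cong) (auto simp: integral_Ycell_plane_wave)
 finally show ?thesis using assms by simp
qed

text \<open>The Fourier coefficients give the best approximation among all trigonometric polynomials with frequencies in \<open>F\<close>,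
 since the last sum is the only term that depends on \<open>a\<close>.\<close>

lemma nrm_diff_tp:
 assumes h: "h \<in> LL" "\<And>x. x \<notin> Ycell ==> h x = 0" and F: "finite F"
 shows "(nrm (\<lambda>x. h x - tp F a x))^2
  = (nrm h)^2 - (\<Sum>k\<in>F. (norm (cf h (rv k)))^2) + (\<Sum>k\<in>F. (norm (a k - cf h (rv k)))^2)"
proof -
 have "ip (tp F a) (tp F a) = (\<Sum>k\<in>F. cnj (a k) * a k)"
  by (subst ip_tp[OF tp_L2]) (auto simp: tp_def[of _ _ "_ :: real^'a"] indicator_def cf_tp[OF F])
 then have P: "(nrm (tp F a))^2 = (\<Sum>k\<in>F. (norm (a k))^2)"
 proof -
  assume "ip (tp F a) (tp F a) = (\<Sum>k\<in>F. cnj (a k) * a k)"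
  also have "... = complex_of_real (\<Sum>k\<in>F. (norm (a k))^2)"
   unfolding of_real_sum by (intro sum.cong refl) (metis complex_norm_square mult.commute)
  finally show ?thesis unfolding ip_self by (simp only: of_real_eq_iff)
 qed
 have ipP: "ip h (tp F a) = (\<Sum>k\<in>F. cnj (a k) * cf h (rv k))" by (rule ip_tp) (use h in auto)
 have "(norm (a k - cf h (rv k)))^2 = (norm (a k))^2 - 2 * Re (cnj (a k) * cf h (rv k)) + (norm (cf h (rv k)))^2" for k
  unfolding cmod_power2 by (simp add: power2_eq_square algebra_simps)
 then show ?thesis
  unfolding nrm_diff_sq[OF h(1) tp_L2] P ipP
  by (simp only: sum.distrib sum_subtractf sum_distrib_left[symmetric] Re_sum)
qed

lemma trig_dense:
 assumes h: "h \<in> LL" "\<And>x. x \<notin> Ycell ==> h x = 0" and e: "e > 0"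
 obtains F a where "finite F" "nrm (\<lambda>x. h x - tp F a x) < e"
proof -
 note [measurable] = L2_measurable[OF h(1)]
 define H where "H n x = (if norm (h x) \<le> real n then h x else 0)" for n :: nat and x
 have [measurable]: "H n \<in> bmeas" for n unfolding H_def by measurable
 have "(\<lambda>n. nrm (\<lambda>x. H n x - h x)) ----> 0"
 proof (rule L2_dominated_convergence(3)[OF _ _ h(1)])
  show "ae x. (\<lambda>n. H n x) ----> h x"
  proof (intro AE_I2 tendsto_eventually eventually_sequentiallyI)
   fix x n assume "nat \<lceil>norm (h x)\<rceil> \<le> n"
   then show "H n x = h x" by (simp add: H_def nat_le_iff ceiling_le_iff)
  qed
 qed (auto simp: H_def)
 then obtain n where n: "nrm (\<lambda>x. H n x - h x) < e/2"
  using e by (metis (no_types, lifting) half_gt_zero eventually_sequentially order_refl order_tendstoD(2))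
 have HL: "H n \<in> LL" by (rule L2_bound(1)[OF h(1)]) (auto simp: H_def)
 obtain p where p: "\<And>m. trig (p m)" "\<And>m x. norm (p m x) \<le> 2 * real n + 2"
  "ae x. x \<in> Ycell --> (\<lambda>m. p m x) ----> H n x"
  by (rule trig_approx[of "H n" "real n"]) (auto simp: H_def)
 have pL: "(\<lambda>x. indicator Ycell x * p m x) \<in> LL" for m
  by (rule L2_Ycell_bounded[OF trig_measurable[OF p(1)] p(2)])
 have "(\<lambda>m. nrm (\<lambda>x. indicator Ycell x * p m x - H n x)) ----> 0"
 proof (rule L2_dominated_convergence(3))
  show "(\<lambda>x. indicator Ycell x * complex_of_real (2 * real n + 2)) \<in> LL"
   by (rule L2_Ycell_bounded[where B="2 * real n + 2"]) (simp, unfold norm_of_real, simp)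
  show "ae x. (\<lambda>m. indicator Ycell x * p m x) ----> H n x"
   using p(3) by eventually_elim (use h(2) in \<open>auto simp: indicator_def H_def\<close>)
  show "ae x. norm (indicator Ycell x * p m x) \<le> norm (indicator Ycell x * complex_of_real (2 * real n + 2))" for m
  proof (rule AE_I2)
   fix x
   have "norm (complex_of_real (2 * real n + 2)) = 2 * real n + 2" unfolding norm_of_real by simp
   then show "norm (indicator Ycell x * p m x) \<le> norm (indicator Ycell x * complex_of_real (2 * real n + 2))"
    using p(2)[of m x] by (simp add: norm_mult indicator_def)
  qed
 qed (use trig_measurable[OF p(1)] in auto)
 then obtain m where m: "nrm (\<lambda>x. indicator Ycell x * p m x - H n x) < e/2"
  using e by (metis (no_types, lifting) half_gt_zero eventually_sequentially order_refl order_tendstoD(2))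
 obtain F a where F: "finite F" "\<And>x. p m x = (\<Sum>k\<in>F. a k * plane_wave x (rv k))"
  using trig_coefficients[OF p(1)] by blast
 have "tp F a = (\<lambda>x. indicator Ycell x * p m x)" unfolding tp_def F(2) ..
 then have "nrm (\<lambda>x. h x - tp F a x) \<le> nrm (\<lambda>x. h x - H n x) + nrm (\<lambda>x. H n x - indicator Ycell x * p m x)"
  using nrm_diff_triangle[OF h(1) HL pL] by simp
 also have "... < e/2 + e/2"
  by (intro add_strict_mono) (subst nrm_minus_commute, fact n, subst nrm_minus_commute, fact m)
 also have "... = e" by simp
 finally show ?thesis using F(1) that by blast
qed

lemma fourier_series_converges:
 assumes h: "h \<in> LL" "\<And>x. x \<notin> Ycell ==> h x = 0"
 shows "((\<lambda>F. nrm (\<lambda>x. h x - tp F (\<lambda>k. cf h (rv k)) x)) \<longlongrightarrow> 0) (finite_subsets_at_top UNIV)"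
proof (rule tendstoI)
 fix e :: real assume "e > 0"
 then obtain F0 a where F0: "finite F0" "nrm (\<lambda>x. h x - tp F0 a x) < e" using trig_dense[OF h] by blast
 have "nrm (\<lambda>x. h x - tp F (\<lambda>k. cf h (rv k)) x) < e" if F: "finite F" "F0 \<subseteq> F" for F
 proof -
  let ?a = "\<lambda>k. if k \<in> F0 then a k else 0"
  have "tp F ?a = tp F0 a"
   unfolding tp_def fun_eq_iff using F
   by (auto intro!: sum.mono_neutral_cong_right)
  then have "(nrm (\<lambda>x. h x - tp F (\<lambda>k. cf h (rv k)) x))^2 \<le> (nrm (\<lambda>x. h x - tp F0 a x))^2"
   using nrm_diff_tp[OF h F(1), of ?a] nrm_diff_tp[OF h F(1), of "\<lambda>k. cf h (rv k)"]
   by (simp add: sum_nonneg)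
  then have "nrm (\<lambda>x. h x - tp F (\<lambda>k. cf h (rv k)) x) \<le> nrm (\<lambda>x. h x - tp F0 a x)"
   by (rule power2_le_imp_le) simp
  with F0(2) show ?thesis by simp
 qed
 then show "\<forall>\<^sub>F F in finite_subsets_at_top UNIV. dist (nrm (\<lambda>x. h x - tp F (\<lambda>k. cf h (rv k)) x)) 0 < e"
  unfolding eventually_finite_subsets_at_top using F0(1) by (intro exI[of _ F0]) auto
qed

lemma parseval_torus:
 assumes h: "h \<in> LL" "\<And>x. x \<notin> Ycell ==> h x = 0"
 shows "(\<integral>\<^sup>+k. ennreal ((norm (cf h (rv k)))^2) \<partial>cspace) = ennreal ((nrm h)^2)"
  and "integrable (cspace) (\<lambda>k. (norm (cf h (rv k)))^2)"
  and "(LINT k|cspace. (norm (cf h (rv k)))^2) = (nrm h)^2"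
proof -
 let ?c = "\<lambda>k. (norm (cf h (rv k)))^2"
 have "((\<lambda>F. (nrm h)^2 - (nrm (\<lambda>x. h x - tp F (\<lambda>k. cf h (rv k)) x))^2) \<longlongrightarrow> (nrm h)^2 - 0^2) (finite_subsets_at_top UNIV)"
  by (intro tendsto_intros fourier_series_converges h)
 then have "((\<lambda>F. sum ?c F) \<longlongrightarrow> (nrm h)^2 - 0^2) (finite_subsets_at_top UNIV)"
  by (rule Lim_transform_eventually)
    (auto intro!: eventually_finite_subsets_at_top_weakI simp: nrm_diff_tp[OF h])
 then have hs: "(?c has_sum (nrm h)^2) UNIV" by (simp add: has_sum_def)
 then have "?c summable_on UNIV" by (auto simp: summable_on_def)
 then have "(\<lambda>k. norm (?c k)) summable_on UNIV" by simp
 then have i: "Infinite_Set_Sum.abs_summable_on ?c UNIV" by (simp only: abs_summable_equivalent)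
 then show int: "integrable (cspace) ?c" by (simp add: Infinite_Set_Sum.abs_summable_on_def)
 have "infsetsum ?c UNIV = infsum ?c UNIV" by (rule infsetsum_infsum[OF i])
 then show eq: "(LINT k|cspace. ?c k) = (nrm h)^2"
  using hs by (simp add: infsetsum_def infsumI)
 show "(\<integral>\<^sup>+k. ennreal (?c k) \<partial>cspace) = ennreal ((nrm h)^2)"
  unfolding eq[symmetric] by (rule nn_integral_eq_integral[OF int]) auto
qed

section \<open>The Fourier transform on square integrable functions\<close>

lemma cf_measurable [measurable]:
 assumes [measurable]: "u \<in> bmeas" shows "cf u \<in> bmeas"
 unfolding cf_def[abs_def] by measurable

lemma cf_translate_arg: "cf u (xi + zeta) = cf (\<lambda>x. u x * cnj (plane_wave x zeta)) xi"
 unfolding cf_def plane_wave_add_right by (simp add: ac_simps)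

text \<open>A function supported in the unit cell has, for every shift \<open>xi\<close>, the Fourier coefficients
 \<open>cf u (xi + k)\<close>, up to a phase factor on \<open>u\<close>; integrating Parseval's identity over \<open>xi\<close>
 in the cell gives Plancherel's identity. A general bounded support is rescaled into the cell.\<close>

lemma plancherel_cell:
 assumes u: "u \<in> LL" "\<And>x. x \<notin> Ycell ==> u x = 0"
 shows "(NI xi. ennreal ((norm (cf u xi))^2)) = ennreal ((nrm u)^2)"
proof -
 note [measurable] = L2_measurable[OF u(1)]
 have "(\<integral>\<^sup>+k. ennreal ((norm (cf u (xi + 1 *R rv k)))^2) \<partial>cspace) = ennreal ((nrm u)^2)" for xi
 proof -
  let ?v = "\<lambda>x. u x * cnj (plane_wave x xi)"
  have v: "?v \<in> LL" by (rule L2_bound(1)[OF u(1)]) (auto simp: norm_mult)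
  have "nrm ?v = nrm u" by (simp add: nrm_eq norm_mult)
  then show ?thesis using parseval_torus(1)[OF v] u(2)
   by (simp add: add.commute[of xi] cf_translate_arg)
 qed
 then have "(NI xi. ennreal ((norm (cf u xi))^2)) = (\<integral>\<^sup>+xi. ennreal ((nrm u)^2) * indicator Ycell xi \<partial>(lborel :: (real^'a) measure))"
  by (subst nn_integral_tiling[OF tiles_Ycell]) (auto simp: nn_integral_cmult mult.commute)
 also have "... = ennreal ((nrm u)^2)"
  by (subst nn_integral_cmult_indicator) (auto simp: emeasure_Ycell)
 finally show ?thesis .
qed

lemma plancherel_bdd_supp:
 assumes u: "bdd_supp u" shows "cf u \<in> LL" "nrm (cf u) = nrm u"
proof -
 have uL: "u \<in> LL" using u by (rule bdd_suppD)
 note [measurable] = L2_measurable[OF uL]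
 obtain R where R: "R > 0" "\<And>x. u x \<noteq> 0 ==> norm x \<le> R" using bdd_supp_obtain[OF u] by blast
 define L where "L = 2 * R"
 have L: "L > 0" using R by (simp add: L_def)
 define t :: "real^'a" where "t = (\<chi> i. - L / 2)"
 define v where "v x = u (t + L *R x)" for x
 have [measurable]: "v \<in> bmeas" unfolding v_def by measurable
 have v: "v \<in> LL"
  using L2_integrable[OF uL] integrable_affine[of "\<lambda>x. (norm (u x))^2" L t] L
  by (simp add: L2_UNIV_iff v_def)
 have v0: "v x = 0" if "x \<notin> Ycell" for x
 proof (rule ccontr)
  assume "v x \<noteq> 0"
  then have "norm (t + L *R x) \<le> R" by (intro R(2)) (simp add: v_def)
  then have "\<bar>(t + L *R x) $ i\<bar> \<le> R" for i using component_le_norm_cart order_trans by blast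
  then have *: "\<bar>L * x $ i - R\<bar> \<le> R" for i by (simp add: t_def L_def)
  have "0 \<le> x $ i \<and> x $ i \<le> 1" for i
   using *[of i] R(1) by (simp add: abs_le_iff L_def field_simps zero_le_mult_iff)
  then show False using that by (simp add: Ycell_def)
 qed
 have nv: "(nrm u)^2 = L ^ CARD('a) * (nrm v)^2"
  unfolding nrm_sq v_def using integral_affine[of "\<lambda>x. (norm (u x))^2" L t] L by simp
 have c: "norm (cf u xi) = L ^ CARD('a) * norm (cf v (L *R xi))" for xi
 proof -
  have "cf u xi = L ^ CARD('a) *R (LI x. cnj (plane_wave t xi) * (v x * cnj (plane_wave x (L *R xi))))"
   unfolding cf_def v_def using integral_affine[of "\<lambda>x. u x * cnj (plane_wave x xi)" L t] L
   by (simp add: plane_wave_add_left plane_wave_scale ac_simps)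
  then show ?thesis using L unfolding integral_mult_right_zero cf_def by (simp add: norm_mult)
 qed
 have "(NI xi. ennreal ((norm (cf u xi))^2))
   = ennreal ((L ^ CARD('a))^2) * (NI xi. ennreal ((norm (cf v (0 + L *R xi)))^2))"
  unfolding c using L
  by (subst nn_integral_cmult[symmetric]) (auto simp: power_mult_distrib ennreal_mult)
 also have "... = ennreal (L ^ CARD('a)) * (ennreal (L ^ CARD('a)) * (NI xi. ennreal ((norm (cf v (0 + L *R xi)))^2)))"
  using L by (simp add: power2_eq_square ennreal_mult mult.assoc)
 also have "ennreal (L ^ CARD('a)) * (NI xi. ennreal ((norm (cf v (0 + L *R xi)))^2))
   = (NI xi. ennreal ((norm (cf v xi))^2))"
  using nn_integral_affine[of "\<lambda>xi. ennreal ((norm (cf v xi))^2)" L 0] L by simp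
 also have "ennreal (L ^ CARD('a)) * (NI xi. ennreal ((norm (cf v xi))^2)) = ennreal ((nrm u)^2)"
  using L by (subst plancherel_cell[OF v v0]) (simp_all add: nv ennreal_mult)
 finally have P: "(NI xi. ennreal ((norm (cf u xi))^2)) = ennreal ((nrm u)^2)" .
 show cL: "cf u \<in> LL" by (rule L2_nn_integralI(1)[of _ "(nrm u)^2"]) (use P in auto)
 have "(nrm (cf u))^2 = (nrm u)^2" using P unfolding nn_integral_L2[OF cL] by simp
 then show "nrm (cf u) = nrm u" by simp
qed

definition icf :: "(real^'n => complex) => real^'n => complex" where
 "icf g x = cf g (- x)"

lemma icf_eq: "icf g x = (LI xi. g xi * plane_wave x xi)"
 unfolding icf_def cf_def by (simp add: cnj_plane_wave plane_wave_commute[of x])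

lemma icf_L2: assumes "bdd_supp g" shows "icf g \<in> LL" "nrm (icf g) = nrm g"
proof -
 show "icf g \<in> LL" unfolding icf_def[abs_def] by (rule L2_reflect[OF plancherel_bdd_supp(1)[OF assms]])
 have "nrm (icf g) = nrm (cf g)"
  unfolding nrm_eq icf_def
  using integral_reflect[of "\<lambda>x. (norm (cf g x))^2"] L2_measurable[OF plancherel_bdd_supp(1)[OF assms]] by simp
 then show "nrm (icf g) = nrm g" by (simp add: plancherel_bdd_supp(2)[OF assms])
qed

lemma Fubini_plane_wave:
 fixes a b :: "real^'n => complex"
 assumes a: "integrable lborel a" and b: "integrable lborel b"
 shows "(LI xi. a xi * (LI x. b x * plane_wave x xi))
  = (LI x. b x * (LI xi. a xi * plane_wave x xi))"
proof -
 have [measurable]: "a \<in> bmeas" "b \<in> bmeas" using a b by auto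
 have "integrable (lborel \<Otimes>\<^sub>M lborel) (\<lambda>(xi, x). a xi * (b x * plane_wave x xi))"
 proof (rule lborel_pair.Fubini_integrable)
  have "(\<lambda>xi. LI x. norm (case (xi, x) of (xi, x) => a xi * (b x * plane_wave x xi)))
    = (\<lambda>xi. norm (a xi) * (LI x. norm (b x)))"
   by (simp add: norm_mult)
  then show "integrable lborel (\<lambda>xi. LI x. norm (case (xi, x) of (xi, x) => a xi * (b x * plane_wave x xi)))"
   using a by simp
  have "integrable lborel (\<lambda>x. b x * plane_wave x xi)" for xi
   by (rule B_integrable_bound[OF b]) (auto simp: norm_mult)
  then show "ae xi. integrable lborel (\<lambda>x. case (xi, x) of (xi, x) => a xi * (b x * plane_wave x xi))"
   by (intro AE_I2) simp
 qed measurable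
 then have "(LI x. LI xi. a xi * (b x * plane_wave x xi)) = (LI xi. LI x. a xi * (b x * plane_wave x xi))"
  by (rule lborel_pair.Fubini_integral)
 then show ?thesis
  by (simp only: mult.left_commute[of "a _" "b _"] integral_mult_right_zero) (simp add: mult.left_commute)
qed

lemma ip_cf:
 assumes u: "integrable lborel u" and g: "integrable lborel g" shows "ip (cf u) g = ip u (icf g)"
proof -
 have "integrable lborel (\<lambda>x. cnj (g x))" using g by simp
 from Fubini_plane_wave[OF this integrable_affine[THEN iffD2, of u "-1" 0]] u
 have *: "(LI xi. cnj (g xi) * (LI x. u (- x) * plane_wave x xi))
  = (LI x. u (- x) * (LI xi. cnj (g xi) * plane_wave x xi))" by auto
 have [measurable]: "u \<in> bmeas" "g \<in> bmeas" using u g by auto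
 have "cf u xi = (LI x. u (- x) * plane_wave x xi)" for xi
  using integral_reflect[of "\<lambda>x. u x * plane_wave (- x) xi"] unfolding cf_def
  by (simp add: cnj_plane_wave plane_wave_minus)
 then have "ip (cf u) g = (LI xi. cnj (g xi) * (LI x. u (- x) * plane_wave x xi))"
  unfolding ip_def by (simp add: mult.commute)
 also have "... = (LI x. u (- x) * (LI xi. cnj (g xi) * plane_wave x xi))" by (rule *)
 also have "... = (LI x. u x * (LI xi. cnj (g xi) * plane_wave (- x) xi))"
  using integral_reflect[of "\<lambda>x. u x * (LI xi. cnj (g xi) * plane_wave (- x) xi)"] by simp
 also have "... = ip u (icf g)"
  unfolding ip_def icf_eq by (simp add: cnj_plane_wave plane_wave_minus flip: B_integral_cnj)
 finally show ?thesis .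
qed

text \<open>The relation \<open>FT u c\<close> says, by duality, that \<open>c\<close> is the Fourier transform of \<open>u\<close>. In this form
 the algebraic rules and the passage to limits are immediate, and almost everywhere uniqueness is
 built in; \<open>fourier_FT\<close> connects it with the truncated integrals.\<close>

definition FT :: "(real^'n => complex) => (real^'n => complex) => bool" where
 "FT u c \<longleftrightarrow> u \<in> LL \<and> c \<in> LL \<and> (\<forall>g. bdd_supp g --> ip c g = ip u (icf g))"

lemma FT_L2: "FT u c ==> u \<in> LL" "FT u c ==> c \<in> LL"
 by (auto simp: FT_def)

lemma FT_cf: "bdd_supp u ==> FT u (cf u)"
 unfolding FT_def by (auto simp: bdd_suppD plancherel_bdd_supp(1) ip_cf bdd_supp_integrable)

lemma FT_unique: "FT u c ==> FT u c' ==> ae xi. c xi = c' xi"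
 by (rule L2_eq_by_testing) (auto simp: FT_def)

lemma FT_add: "FT u c ==> FT v d ==> FT (\<lambda>x. u x + v x) (\<lambda>x. c x + d x)"
 unfolding FT_def by (auto simp: ip_add_left bdd_suppD icf_L2)

lemma FT_diff: "FT u c ==> FT v d ==> FT (\<lambda>x. u x - v x) (\<lambda>x. c x - d x)"
 unfolding FT_def by (auto simp: ip_diff_left bdd_suppD icf_L2)

lemma FT_cmult: "FT u c ==> FT (\<lambda>x. a * u x) (\<lambda>x. a * c x)"
 unfolding FT_def by (auto simp: ip_cmult_left)

lemma FT_zero: "FT (\<lambda>x. 0) (\<lambda>x. 0)"
 unfolding FT_def by (auto simp: ip_def)

lemma FT_sum: "(\<And>i. i \<in> I ==> FT (u i) (c i)) ==> FT (\<lambda>x. \<Sum>i\<in>I. u i x) (\<lambda>x. \<Sum>i\<in>I. c i x)"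
 by (induction I rule: infinite_finite_induct) (auto simp: FT_zero intro: FT_add)

lemma FT_cong:
 assumes "FT u c" "u' \<in> bmeas" "ae x. u' x = u x"
  "c' \<in> bmeas" "ae x. c' x = c x"
 shows "FT u' c'"
proof -
 note u = FT_L2(1)[OF assms(1)] and c = FT_L2(2)[OF assms(1)]
 have L: "u' \<in> LL" "c' \<in> LL"
  by (rule L2_AE_cong(1)[OF u assms(2,3)], rule L2_AE_cong(1)[OF c assms(4,5)])
 have "ip c' g = ip u' (icf g)" if "bdd_supp g" for g
 proof -
  note g = L2_measurable[OF bdd_suppD[OF that]]
  have "ip c' g = ip c g"
   by (rule ip_AE_cong[OF assms(4) L2_measurable[OF c] g g assms(5)]) simp
  also have "... = ip u (icf g)" using assms(1) that by (simp add: FT_def)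
  also have "... = ip u' (icf g)"
   using ip_AE_cong[OF assms(2) L2_measurable[OF u] _ _ assms(3), of "icf g" "icf g"] L2_measurable[OF icf_L2(1)[OF that]]
   by simp
  finally show ?thesis .
 qed
 with L show ?thesis by (auto simp: FT_def)
qed

lemma FT_limit:
 assumes "\<And>n. FT (u n) (c n)" and "v \<in> LL" "(\<lambda>n. nrm (\<lambda>x. u n x - v x)) ----> 0"
  and "d \<in> LL" "(\<lambda>n. nrm (\<lambda>x. c n x - d x)) ----> 0"
 shows "FT v d"
 unfolding FT_def
proof (intro conjI allI impI assms)
 fix g :: "real^'a => complex" assume g: "bdd_supp g"
 have "(\<lambda>n. ip (c n) g) ----> ip d g"
  using assms g by (intro ip_tendsto) (auto intro: FT_L2 bdd_suppD)
 moreover have "(\<lambda>n. ip (u n) (icf g)) ----> ip v (icf g)"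
  using assms g by (intro ip_tendsto) (auto intro: FT_L2 icf_L2)
 moreover have "ip (c n) g = ip (u n) (icf g)" for n using assms(1) g by (simp add: FT_def)
 ultimately show "ip d g = ip v (icf g)" using LIMSEQ_unique by simp
qed

lemma bdd_supp_diff: assumes "bdd_supp f" "bdd_supp g" shows "bdd_supp (\<lambda>x. f x - g x)"
proof -
 obtain R S where R: "\<And>x. f x \<noteq> 0 ==> norm x \<le> R" and S: "\<And>x. g x \<noteq> 0 ==> norm x \<le> S"
  using assms by (auto simp: bdd_supp_def)
 have "f x - g x \<noteq> 0 ==> norm x \<le> max R S" for x using R[of x] S[of x] by fastforce
 then show ?thesis using assms unfolding bdd_supp_def by blast
qed

lemma cf_diff:
 assumes "bdd_supp f" "bdd_supp g" shows "cf (\<lambda>x. f x - g x) xi = cf f xi - cf g xi"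
proof -
 have "integrable lborel (\<lambda>x. h x * cnj (plane_wave x xi))" if h: "bdd_supp h" for h :: "real^'a => complex"
  by (rule B_integrable_bound[OF bdd_supp_integrable[OF h]])
    (use bdd_suppD[OF h] in \<open>auto simp: norm_mult dest: L2_measurable\<close>)
 with assms show ?thesis unfolding cf_def left_diff_distrib
  by (intro B_integral_diff) auto
qed

text \<open>Plancherel's identity makes the transforms of the truncations a Cauchy family.\<close>

lemma fourier_limit_exists:
 assumes u: "u \<in> LL"
 obtains c where "c \<in> LL" "((\<lambda>R. nrm (\<lambda>xi. c xi - cf (trunc R u) xi)) \<longlongrightarrow> 0) at_top"
proof -
 have tL: "cf (trunc R u) \<in> LL" for R by (rule plancherel_bdd_supp(1)[OF bdd_supp_trunc[OF u]])
 have diff: "nrm (\<lambda>xi. cf (trunc R u) xi - cf (trunc S u) xi) = nrm (\<lambda>x. trunc R u x - trunc S u x)" for R S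
  using plancherel_bdd_supp(2)[OF bdd_supp_diff[OF bdd_supp_trunc[OF u] bdd_supp_trunc[OF u]]]
  by (simp add: cf_diff[OF bdd_supp_trunc[OF u] bdd_supp_trunc[OF u], abs_def])
 have lim: "((\<lambda>R. nrm (\<lambda>x. u x - trunc R u x)) \<longlongrightarrow> 0) at_top" by (rule trunc_tendsto[OF u])
 have le: "nrm (\<lambda>xi. cf (trunc R u) xi - cf (trunc S u) xi) \<le> nrm (\<lambda>x. u x - trunc R u x) + nrm (\<lambda>x. u x - trunc S u x)" for R S
  unfolding diff using nrm_diff_triangle[of "trunc R u" u "trunc S u"] u
  by (simp add: nrm_minus_commute[of "trunc R u"])
 have small: "\<exists>N. \<forall>R\<ge>N. nrm (\<lambda>x. u x - trunc R u x) < e" if "e > 0" for e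
  using order_tendstoD(2)[OF lim that] by (simp add: eventually_at_top_linorder)
 have "\<exists>N. \<forall>m\<ge>N. \<forall>n\<ge>N. nrm (\<lambda>xi. cf (trunc (real m) u) xi - cf (trunc (real n) u) xi) < e" if "e > 0" for e
 proof -
  have "e/2 > 0" using that by simp
  from small[OF this] obtain N where N: "\<And>R. R \<ge> N ==> nrm (\<lambda>x. u x - trunc R u x) < e/2" by blast
  show ?thesis
  proof (intro exI[of _ "nat \<lceil>N\<rceil>"] allI impI)
   fix m n assume "m \<ge> nat \<lceil>N\<rceil>" "n \<ge> nat \<lceil>N\<rceil>"
   then have "real m \<ge> N" "real n \<ge> N" by (auto simp: nat_le_iff ceiling_le_iff)
   then show "nrm (\<lambda>xi. cf (trunc (real m) u) xi - cf (trunc (real n) u) xi) < e"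
    using N[of "real m"] N[of "real n"] le[of "real m" "real n"] by linarith
  qed
 qed
 then obtain c where c: "c \<in> LL" "(\<lambda>n. nrm (\<lambda>xi. cf (trunc (real n) u) xi - c xi)) ----> 0"
  using L2_complete[of "\<lambda>n. cf (trunc (real n) u)"] tL by blast
 have "((\<lambda>R. nrm (\<lambda>xi. c xi - cf (trunc R u) xi)) \<longlongrightarrow> 0) at_top"
 proof (rule tendstoI)
  fix e :: real assume e: "e > 0"
  have "e/3 > 0" using e by simp
  from small[OF this] obtain N where N: "\<And>R. R \<ge> N ==> nrm (\<lambda>x. u x - trunc R u x) < e/3" by blast
  obtain m where m: "real m \<ge> N" "nrm (\<lambda>xi. cf (trunc (real m) u) xi - c xi) < e/3"
  proof -
   obtain M where M: "\<And>m. m \<ge> M ==> nrm (\<lambda>xi. cf (trunc (real m) u) xi - c xi) < e/3"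
    using order_tendstoD(2)[OF c(2) \<open>e/3 > 0\<close>] unfolding eventually_sequentially by blast
   have "real (max M (nat \<lceil>N\<rceil>)) \<ge> N" using real_nat_ceiling_ge[of N] by linarith
   then show ?thesis using that[of "max M (nat \<lceil>N\<rceil>)"] M by simp
  qed
  have "nrm (\<lambda>xi. c xi - cf (trunc R u) xi) < e" if "R \<ge> N" for R
  proof -
   have "nrm (\<lambda>xi. c xi - cf (trunc R u) xi)
     \<le> nrm (\<lambda>xi. c xi - cf (trunc (real m) u) xi) + nrm (\<lambda>xi. cf (trunc (real m) u) xi - cf (trunc R u) xi)"
    by (rule nrm_diff_triangle[OF c(1) tL tL])
   then show ?thesis
    using m N[of R] N[of "real m"] le[of "real m" R] that by (simp add: nrm_minus_commute[of c])
  qed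
  then show "\<forall>\<^sub>F R in at_top. dist (nrm (\<lambda>xi. c xi - cf (trunc R u) xi)) 0 < e"
   unfolding eventually_at_top_linorder by (intro exI[of _ N]) simp
 qed
 with c(1) that show ?thesis by blast
qed

lemma FT_of_limit:
 assumes u: "u \<in> LL" and c: "c \<in> LL" "((\<lambda>R. nrm (\<lambda>xi. c xi - cf (trunc R u) xi)) \<longlongrightarrow> 0) at_top"
 shows "FT u c" "nrm c = nrm u"
proof -
 have r: "filterlim real at_top sequentially" by (rule filterlim_real_sequentially)
 have l1: "(\<lambda>n. nrm (\<lambda>x. trunc (real n) u x - u x)) ----> 0"
  using filterlim_compose[OF trunc_tendsto[OF u] r] by (simp add: nrm_minus_commute[of u])
 have l2: "(\<lambda>n. nrm (\<lambda>x. cf (trunc (real n) u) x - c x)) ----> 0"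
  using filterlim_compose[OF c(2) r] by (simp add: nrm_minus_commute[of c])
 have b: "bdd_supp (trunc R u)" for R by (rule bdd_supp_trunc[OF u])
 show "FT u c" by (rule FT_limit[OF FT_cf[OF b] u l1 c(1) l2])
 have "(\<lambda>n. nrm (cf (trunc (real n) u))) ----> nrm c"
  by (rule nrm_tendsto[OF plancherel_bdd_supp(1)[OF b] c(1) l2])
 moreover have "(\<lambda>n. nrm (trunc (real n) u)) ----> nrm u"
  by (rule nrm_tendsto[OF bdd_suppD[OF b] u l1])
 ultimately show "nrm c = nrm u" using LIMSEQ_unique plancherel_bdd_supp(2)[OF b] by simp
qed

lemma tendsto_ennreal_sq_iff:
 assumes "\<And>R. (0::real) \<le> f R"
 shows "((\<lambda>R. ennreal ((f R)^2)) \<longlongrightarrow> 0) F \<longleftrightarrow> (f \<longlongrightarrow> 0) F"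
proof
 assume "((\<lambda>R. ennreal ((f R)^2)) \<longlongrightarrow> 0) F"
 then have "((\<lambda>R. (f R)^2) \<longlongrightarrow> 0) F"
  using tendsto_ennreal_iff[of "\<lambda>R. (f R)^2" F 0] by simp
 then have "((\<lambda>R. sqrt ((f R)^2)) \<longlongrightarrow> sqrt 0) F" by (rule tendsto_real_sqrt)
 then show "(f \<longlongrightarrow> 0) F" using assms by simp
next
 assume "(f \<longlongrightarrow> 0) F"
 then have "((\<lambda>R. (f R)^2) \<longlongrightarrow> 0^2) F" by (intro tendsto_intros)
 then show "((\<lambda>R. ennreal ((f R)^2)) \<longlongrightarrow> 0) F"
  using tendsto_ennrealI[of "\<lambda>R. (f R)^2" 0 F] by simp
qed

lemma fourier_FT: assumes u: "u \<in> LL" shows "FT u (fourier u)" "nrm (fourier u) = nrm u"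
proof -
 let ?L = "\<lambda>c. ((\<lambda>R. \<integral>\<^sup>+eta\<in>UNIV. ennreal ((norm (c eta - (LINT x:cball 0 R|lborel. u x * cnj (plane_wave x eta))))^2) \<partial>lborel) \<longlongrightarrow> 0) at_top"
 have tL: "cf (trunc R u) \<in> LL" for R by (rule plancherel_bdd_supp(1)[OF bdd_supp_trunc[OF u]])
 have "(LINT x:cball 0 R|lborel. u x * cnj (plane_wave x eta)) = cf (trunc R u) eta" for R eta
  unfolding cf_def trunc_def set_lebesgue_integral_def
  by (intro B_integral_cong) (auto simp: indicator_def)
 then have "(\<integral>\<^sup>+eta\<in>UNIV. ennreal ((norm (c eta - (LINT x:cball 0 R|lborel. u x * cnj (plane_wave x eta))))^2) \<partial>lborel)
   = ennreal ((nrm (\<lambda>xi. c xi - cf (trunc R u) xi))^2)" if "c \<in> LL" for c R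
  using nn_integral_L2[OF L2_diff[OF that tL, of R]] by simp
 then have iff: "?L c \<longleftrightarrow> ((\<lambda>R. nrm (\<lambda>xi. c xi - cf (trunc R u) xi)) \<longlongrightarrow> 0) at_top" if "c \<in> LL" for c
  using tendsto_ennreal_sq_iff[of "\<lambda>R. nrm (\<lambda>xi. c xi - cf (trunc R u) xi)" at_top] that by simp
 obtain c where "c \<in> LL" "((\<lambda>R. nrm (\<lambda>xi. c xi - cf (trunc R u) xi)) \<longlongrightarrow> 0) at_top"
  using fourier_limit_exists[OF u] by blast
 then have "c \<in> LL \<and> ?L c" using iff by blast
 then have "fourier u \<in> LL \<and> ?L (fourier u)"
  unfolding fourier_def L2_transform_def
  by (rule someI[of "\<lambda>c. c \<in> LL \<and> ?L c"])
 then have "fourier u \<in> LL" "((\<lambda>R. nrm (\<lambda>xi. fourier u xi - cf (trunc R u) xi)) \<longlongrightarrow> 0) at_top"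
  using iff by blast+
 from FT_of_limit[OF u this] show "FT u (fourier u)" "nrm (fourier u) = nrm u" .
qed

lemma FT_nrm: assumes "FT u c" shows "nrm c = nrm u"
proof -
 have u: "u \<in> LL" using assms by (rule FT_L2)
 have "ae x. c x = fourier u x" by (rule FT_unique[OF assms fourier_FT(1)[OF u]])
 then have "nrm c = nrm (fourier u)"
  by (intro L2_AE_cong(2)) (use assms fourier_FT[OF u] in \<open>auto dest: FT_L2 intro: L2_measurable\<close>)
 then show ?thesis by (simp add: fourier_FT(2)[OF u])
qed

lemma FT_ip: assumes "FT u c" "FT v d" shows "ip u v = ip c d"
proof -
 have Re: "Re (ip u' v) = Re (ip c' d)" if "FT u' c'" for u' c'
  using FT_nrm[OF FT_add[OF that assms(2)]] FT_nrm[OF that] FT_nrm[OF assms(2)]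
   nrm_add_sq[OF FT_L2(1)[OF that] FT_L2(1)[OF assms(2)]] nrm_add_sq[OF FT_L2(2)[OF that] FT_L2(2)[OF assms(2)]]
  by simp
 have "Re (\<i> * ip u v) = Re (\<i> * ip c d)"
  using Re[OF FT_cmult[OF assms(1), of \<i>]] by (simp only: ip_cmult_left)
 with Re[OF assms(1)] show ?thesis by (simp add: complex_eq_iff)
qed

text \<open>The duality that defines \<open>FT\<close>, tested with \<open>g\<close>, gives equality in the Cauchy--Schwarz inequality for \<open>g\<close> and the
 transform of \<open>icf g\<close>.\<close>

lemma FT_icf: assumes g: "bdd_supp g" shows "FT (icf g) g"
proof -
 have gL: "g \<in> LL" using g by (rule bdd_suppD)
 have iL: "icf g \<in> LL" by (rule icf_L2(1)[OF g])
 let ?c = "fourier (icf g)"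
 have c: "FT (icf g) ?c" by (rule fourier_FT[OF iL])
 have "ip ?c g = ip (icf g) (icf g)" using c g by (simp add: FT_def)
 then have "Re (ip ?c g) = (nrm g)^2" by (simp add: ip_self icf_L2(2)[OF g])
 then have "(nrm (\<lambda>x. ?c x - g x))^2 = 0"
  using nrm_diff_sq[OF FT_L2(2)[OF c] gL] FT_nrm[OF c] icf_L2(2)[OF g] by simp
 then have "ae x. ?c x - g x = 0"
  using nrm_zero_iff[OF L2_diff[OF FT_L2(2)[OF c] gL]] by simp
 then have "ae x. g x = ?c x" by eventually_elim simp
 with c gL iL show ?thesis by (intro FT_cong[OF c]) (auto dest: L2_measurable)
qed

lemma FT_surj: assumes c: "c \<in> LL" obtains u where "FT u c"
proof -
 define w where "w x = cnj (c x)" for x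
 have w: "w \<in> LL" unfolding w_def by (rule L2_cnj[OF c])
 obtain v where v: "v \<in> LL" "((\<lambda>R. nrm (\<lambda>xi. v xi - cf (trunc R w) xi)) \<longlongrightarrow> 0) at_top"
  using fourier_limit_exists[OF w] by blast
 have cj: "cnj (cf (trunc R w) x) = icf (trunc R c) x" for R x
  unfolding cf_def icf_eq B_integral_cnj[symmetric]
  by (intro B_integral_cong)
    (auto simp: trunc_def w_def indicator_def plane_wave_commute[of x])
 have r: "filterlim real at_top sequentially" by (rule filterlim_real_sequentially)
 have "nrm (\<lambda>x. icf (trunc R c) x - cnj (v x)) = nrm (\<lambda>xi. v xi - cf (trunc R w) xi)" for R
 proof -
  have "norm (icf (trunc R c) x - cnj (v x)) = norm (v x - cf (trunc R w) x)" for x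
   unfolding cj[symmetric] complex_cnj_diff[symmetric] complex_mod_cnj by (rule norm_minus_commute)
  then show ?thesis by (simp add: nrm_eq)
 qed
 then have l1: "(\<lambda>n. nrm (\<lambda>x. icf (trunc (real n) c) x - cnj (v x))) ----> 0"
  using filterlim_compose[OF v(2) r] by simp
 have l2: "(\<lambda>n. nrm (\<lambda>x. trunc (real n) c x - c x)) ----> 0"
  using filterlim_compose[OF trunc_tendsto[OF c] r] by (simp add: nrm_minus_commute[of c])
 have "FT (\<lambda>x. cnj (v x)) c"
  by (rule FT_limit[OF FT_icf[OF bdd_supp_trunc[OF c]] L2_cnj[OF v(1)] l1 c l2])
 with that show ?thesis by blast
qed

lemma FT_inj: "FT u c ==> FT u' c ==> ae x. u x = u' x"
proof -
 assume "FT u c" "FT u' c"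
 from FT_diff[OF this] have F: "FT (\<lambda>x. u x - u' x) (\<lambda>x. 0)" by simp
 have "nrm (\<lambda>x. u x - u' x) = 0" using FT_nrm[OF F] by (simp add: nrm_eq)
 then show ?thesis using nrm_zero_iff[OF FT_L2(1)[OF F]] by simp
qed

lemma FT_cnj_reflect: assumes "FT u c" shows "FT (\<lambda>x. cnj (u x)) (\<lambda>xi. cnj (c (- xi)))"
 unfolding FT_def
proof (intro conjI allI impI)
 have u: "u \<in> LL" and c: "c \<in> LL" using assms by (auto dest: FT_L2)
 note [measurable] = L2_measurable[OF u] L2_measurable[OF c]
 show "(\<lambda>x. cnj (u x)) \<in> LL" "(\<lambda>xi. cnj (c (- xi))) \<in> LL"
  using u c by (auto intro: L2_cnj L2_reflect)
 fix g :: "real^'a => complex" assume g: "bdd_supp g"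
 note [measurable] = L2_measurable[OF bdd_suppD[OF g]]
 let ?g = "\<lambda>xi. cnj (g (- xi))"
 have g': "bdd_supp ?g"
  using g by (auto simp: bdd_supp_def intro!: L2_cnj L2_reflect) (metis minus_minus norm_minus_cancel)
 have i: "icf ?g x = cnj (icf g x)" for x
  unfolding icf_eq using integral_reflect[of "\<lambda>xi. cnj (g xi) * plane_wave x (- xi)"]
  by (simp add: cnj_plane_wave flip: B_integral_cnj)
 have "ip (\<lambda>xi. cnj (c (- xi))) g = cnj (ip c ?g)"
  unfolding ip_def using integral_reflect[of "\<lambda>x. cnj (c (- x)) * cnj (g x)"]
  by (simp flip: B_integral_cnj)
 also have "... = cnj (ip u (icf ?g))" using assms g' by (simp add: FT_def)
 also have "... = ip (\<lambda>x. cnj (u x)) (icf g)"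
  unfolding ip_def i by (simp flip: B_integral_cnj)
 finally show "ip (\<lambda>xi. cnj (c (- xi))) g = ip (\<lambda>x. cnj (u x)) (icf g)" .
qed

lemma FT_modulate: assumes "FT u c" shows "FT (\<lambda>x. plane_wave x a * u x) (\<lambda>xi. c (xi - a))"
 unfolding FT_def
proof (intro conjI allI impI)
 have u: "u \<in> LL" and c: "c \<in> LL" using assms by (auto dest: FT_L2)
 note [measurable] = L2_measurable[OF u] L2_measurable[OF c]
 show "(\<lambda>x. plane_wave x a * u x) \<in> LL" by (rule L2_mult_bounded(1)[OF u, of _ 1]) auto
 show "(\<lambda>xi. c (xi - a)) \<in> LL" using L2_translate(1)[OF c, of "- a"] by simp
 fix g :: "real^'a => complex" assume g: "bdd_supp g"
 note [measurable] = L2_measurable[OF bdd_suppD[OF g]]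
 let ?g = "\<lambda>xi. g (xi + a)"
 have g': "bdd_supp ?g"
 proof -
  obtain R where R: "\<And>x. g x \<noteq> 0 ==> norm x \<le> R" using g by (auto simp: bdd_supp_def)
  have "norm x \<le> R + norm a" if "g (x + a) \<noteq> 0" for x
   using R[OF that] norm_triangle_ineq4[of "x + a" a] by simp
  then show ?thesis using L2_translate(1)[OF bdd_suppD[OF g], of a] unfolding bdd_supp_def by blast
 qed
 have i: "icf ?g x = cnj (plane_wave x a) * icf g x" for x
 proof -
  have "icf ?g x = (LI xi. g xi * plane_wave x (xi - a))"
   unfolding icf_eq using integral_translate[of "\<lambda>xi. g xi * plane_wave x (xi - a)" a] by simp
  also have "... = (LI xi. cnj (plane_wave x a) * (g xi * plane_wave x xi))"
   using plane_wave_add_right[of x _ "- a"]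
   by (intro B_integral_cong) (auto simp: cnj_plane_wave ac_simps)
  finally show ?thesis by (simp add: icf_eq)
 qed
 have "ip (\<lambda>xi. c (xi - a)) g = ip c ?g"
  unfolding ip_def using integral_translate[of "\<lambda>xi. c (xi - a) * cnj (g xi)" a] by simp
 also have "... = ip u (icf ?g)" using assms g' by (simp add: FT_def)
 also have "... = ip (\<lambda>x. plane_wave x a * u x) (icf g)"
  unfolding ip_def i by (intro B_integral_cong) auto
 finally show "ip (\<lambda>xi. c (xi - a)) g = ip (\<lambda>x. plane_wave x a * u x) (icf g)" .
qed

lemma FT_real_iff:
 assumes "FT u c"
 shows "(ae x. cnj (u x) = u x) \<longleftrightarrow> (ae xi. cnj (c (- xi)) = c xi)"
proof
 have L: "u \<in> LL" "c \<in> LL" using assms FT_L2 by auto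
 assume "ae x. cnj (u x) = u x"
 then have "FT u (\<lambda>xi. cnj (c (- xi)))"
  using L L2_reflect[OF L(2)] by (intro FT_cong[OF FT_cnj_reflect[OF assms]]) (auto dest: L2_measurable simp: eq_commute)
 from FT_unique[OF this assms] show "ae xi. cnj (c (- xi)) = c xi" .
next
 have L: "u \<in> LL" "c \<in> LL" using assms FT_L2 by auto
 assume "ae xi. cnj (c (- xi)) = c xi"
 then have "FT (\<lambda>x. cnj (u x)) c"
  using L by (intro FT_cong[OF FT_cnj_reflect[OF assms]]) (auto dest: L2_measurable simp: eq_commute)
 from FT_inj[OF this assms] show "ae x. cnj (u x) = u x" .
qed

text \<open>Both \<open>h\<close> and the test functions are integrable, so Fubini moves the transform onto \<open>h\<close>, where it vanishes.\<close>

lemma L1_fourier_inj: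
 assumes h: "h \<in> LL" "integrable lborel h" and z: "\<And>x. (LI xi. h xi * plane_wave x xi) = 0"
 shows "ae xi. h xi = 0"
proof -
 obtain u where u: "FT u h" using FT_surj[OF h(1)] by blast
 have "ip u v = 0" if v: "bdd_supp v" for v
 proof -
  have vi: "integrable lborel (\<lambda>x. cnj (v x))" using bdd_supp_integrable[OF v] by simp
  have "ip u v = ip h (cf v)" by (rule FT_ip[OF u FT_cf[OF v]])
  also have "... = (LI xi. h xi * (LI x. cnj (v x) * plane_wave x xi))"
   unfolding ip_def cf_def by (simp flip: B_integral_cnj)
  also have "... = 0" unfolding Fubini_plane_wave[OF h(2) vi] z by simp
  finally show ?thesis .
 qed
 then have "ae x. u x = 0" by (rule L2_zero_by_testing[OF FT_L2(1)[OF u]])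
 then have "nrm h = 0" using FT_nrm[OF u] nrm_zero_iff[OF FT_L2(1)[OF u]] by simp
 then show ?thesis using nrm_zero_iff[OF h(1)] by simp
qed

lemma synthesis_plane_wave: "synthesis K plane_wave c = icf (\<lambda>eta. indicator K eta * c eta)"
 unfolding synthesis_def icf_eq set_lebesgue_integral_def fun_eq_iff
 by (auto intro!: B_integral_cong simp: indicator_def)

section \<open>Test functions and weak derivatives\<close>

definition flat :: "real poly => real => real" where
 "flat p t = (if t > 0 then poly p (1/t) * exp (- (1/t)) else 0)"

lemma poly_exp_tendsto_0: "((\<lambda>s. poly p s * exp (- s)) \<longlongrightarrow> (0::real)) at_top"
proof -
 have "((\<lambda>s. \<Sum>i\<le>degree p. coeff p i * (s ^ i / exp s)) \<longlongrightarrow> (\<Sum>i\<le>degree p. coeff p i * 0)) at_top"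
  by (intro tendsto_sum tendsto_mult_left tendsto_power_div_exp_0)
 then show ?thesis
  by (simp add: poly_altdef exp_minus divide_inverse sum_distrib_right mult.assoc)
qed

lemma flat_tendsto_0: "((\<lambda>h. flat p h / h) \<longlongrightarrow> 0) (at 0)"
proof -
 have "((\<lambda>s. poly (pCons 0 p) s * exp (- s)) \<longlongrightarrow> 0) at_top" by (rule poly_exp_tendsto_0)
 moreover have "filterlim (\<lambda>h::real. inverse h) at_top (at_right 0)" by (rule filterlim_inverse_at_top_right)
 ultimately have "((\<lambda>h. poly (pCons 0 p) (inverse h) * exp (- inverse h)) \<longlongrightarrow> 0) (at_right 0)"
  by (rule filterlim_compose)
 moreover have "\<forall>\<^sub>F h in at_right 0. poly (pCons 0 p) (inverse h) * exp (- inverse h) = flat p h / h"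
  by (simp add: eventually_at_right_less flat_def divide_inverse mult.commute eventually_at_filter)
 ultimately have "((\<lambda>h. flat p h / h) \<longlongrightarrow> 0) (at_right 0)" by (rule Lim_transform_eventually)
 moreover have "((\<lambda>h. flat p h / h) \<longlongrightarrow> 0) (at_left 0)"
  by (rule tendsto_eventually) (simp add: flat_def eventually_at_filter)
 ultimately show ?thesis by (simp add: filterlim_at_split)
qed

lemma flat_deriv: "(flat p has_real_derivative flat ([:0, 0, 1:] * (p - pderiv p)) t) (at t)"
proof -
 let ?q = "[:0, 0, 1:] * (p - pderiv p)"
 consider "t > 0" | "t < 0" | "t = 0" by linarith
 then show ?thesis
 proof cases
  case 1
  have i: "((\<lambda>t. 1/t) has_real_derivative - (1/t * (1/t))) (at t)"
   using DERIV_inverse[of t] 1 by (simp add: inverse_eq_divide power2_eq_square)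
  have "((\<lambda>t. poly p (1/t) * exp (- (1/t))) has_real_derivative
    (poly (pderiv p) (1/t) * - (1/t * (1/t))) * exp (- (1/t)) + (exp (- (1/t)) * - (- (1/t * (1/t)))) * poly p (1/t)) (at t)"
   by (intro DERIV_mult DERIV_chain2[OF poly_DERIV i] DERIV_chain2[OF DERIV_exp] DERIV_minus i)
  moreover have "flat ?q t = (poly (pderiv p) (1/t) * - (1/t * (1/t))) * exp (- (1/t)) + (exp (- (1/t)) * - (- (1/t * (1/t)))) * poly p (1/t)"
  proof -
   have *: "poly ?q s * E = (poly (pderiv p) s * - (s * s)) * E + (E * - (- (s * s))) * poly p s" for s E :: real
    by (simp add: algebra_simps)
   show ?thesis unfolding flat_def if_P[OF 1] by (rule *)
  qed
  ultimately have "((\<lambda>t. poly p (1/t) * exp (- (1/t))) has_real_derivative flat ?q t) (at t)" by simp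
  then show ?thesis
   by (rule has_field_derivative_transform_within_open[of _ _ _ "{0<..}"]) (use 1 in \<open>auto simp: flat_def\<close>)
 next
  case 2
  have "((\<lambda>t. 0) has_real_derivative flat ?q t) (at t)" using 2 by (simp add: flat_def)
  then show ?thesis
   by (rule has_field_derivative_transform_within_open[of _ _ _ "{..<0}"]) (use 2 in \<open>auto simp: flat_def\<close>)
 next
  case 3
  have z: "flat ?q 0 = 0" "flat p 0 = 0" by (simp_all add: flat_def)
  show ?thesis unfolding 3 has_field_derivative_iff z using flat_tendsto_0[of p] by simp
 qed
qed

text \<open>An algebra of functions that is closed under partial derivatives consists of smooth functions.
 This one is generated by rescaled copies of \<open>poly p (1/t) * exp (- 1/t)\<close> in the coordinates.\<close>

inductive flat_algebra :: "(real^'n => real) => bool" where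
 const: "flat_algebra (\<lambda>x. c)"
| flat: "flat_algebra (\<lambda>x. flat p (c * x $ i + d))"
| add: "flat_algebra f ==> flat_algebra g ==> flat_algebra (\<lambda>x. f x + g x)"
| mult: "flat_algebra f ==> flat_algebra g ==> flat_algebra (\<lambda>x. f x * g x)"

lemma flat_algebra_partial_derivatives:
 assumes "flat_algebra f"
 shows "\<exists>D. (\<forall>x. (f has_derivative (\<lambda>h. \<Sum>j\<in>UNIV. h $ j * D j x)) (at x)) \<and> (\<forall>j. flat_algebra (D j))"
 using assms
proof induction
 case (const c)
 show ?case by (rule exI[of _ "\<lambda>j x. 0"]) (auto intro: flat_algebra.const)
next
 case (flat p c i d)
 let ?q = "[:0, 0, 1:] * (p - pderiv p)"
 let ?D = "\<lambda>j x. if j = i then c * flat ?q (c * x $ i + d) else 0"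
 have "((\<lambda>x. flat p (c * x $ i + d)) has_derivative (\<lambda>h. \<Sum>j\<in>UNIV. h $ j * ?D j x)) (at x)" for x
 proof -
  have "((\<lambda>x. c * x $ i + d) has_derivative (\<lambda>h. c * h $ i)) (at x)"
   by (auto intro!: derivative_eq_intros bounded_linear_imp_has_derivative bounded_linear_vec_nth)
  from has_derivative_compose[OF this flat_deriv[of p "c * x $ i + d", unfolded has_field_derivative_def]]
  have "((\<lambda>x. flat p (c * x $ i + d)) has_derivative (\<lambda>h. flat ?q (c * x $ i + d) * (c * h $ i))) (at x)" .
  moreover have "(\<Sum>j\<in>UNIV. h $ j * ?D j x) = flat ?q (c * x $ i + d) * (c * h $ i)" for h
   by (simp add: if_distrib cong: if_cong)
  ultimately show ?thesis by simp
 qed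
 moreover have "flat_algebra (?D j)" for j
  by (cases "j = i") (auto intro: flat_algebra.intros)
 ultimately show ?case by (intro exI[of _ ?D]) blast
next
 case (add f g)
 then obtain D E where D: "\<And>x. (f has_derivative (\<lambda>h. \<Sum>j\<in>UNIV. h $ j * D j x)) (at x)" "\<And>j. flat_algebra (D j)"
  and E: "\<And>x. (g has_derivative (\<lambda>h. \<Sum>j\<in>UNIV. h $ j * E j x)) (at x)" "\<And>j. flat_algebra (E j)" by blast
 show ?case
  by (intro exI[of _ "\<lambda>j x. D j x + E j x"] conjI allI)
    (use has_derivative_add[OF D(1) E(1)] in \<open>auto simp: distrib_left sum.distrib intro: flat_algebra.add D E\<close>)
next
 case (mult f g)
 then obtain D E where D: "\<And>x. (f has_derivative (\<lambda>h. \<Sum>j\<in>UNIV. h $ j * D j x)) (at x)" "\<And>j. flat_algebra (D j)"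
  and E: "\<And>x. (g has_derivative (\<lambda>h. \<Sum>j\<in>UNIV. h $ j * E j x)) (at x)" "\<And>j. flat_algebra (E j)" by blast
 have "((\<lambda>x. f x * g x) has_derivative (\<lambda>h. \<Sum>j\<in>UNIV. h $ j * (f x * E j x + D j x * g x))) (at x)" for x
  using has_derivative_mult[OF D(1) E(1), of x]
  by (simp add: distrib_left sum.distrib sum_distrib_left sum_distrib_right ac_simps)
 moreover have "flat_algebra (\<lambda>x. f x * E j x + D j x * g x)" for j
  by (rule flat_algebra.add[OF flat_algebra.mult[OF mult.hyps(1) E(2)] flat_algebra.mult[OF D(2) mult.hyps(2)]])
 ultimately show ?case by (intro exI[of _ "\<lambda>j x. f x * E j x + D j x * g x"]) blast
qed

lemma partial_d_eq:
 assumes "(f has_derivative (\<lambda>h. \<Sum>j\<in>UNIV. h $ j * D j)) (at x)" shows "partial_d i f x = D i"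
proof -
 have "partial_d i f x = (\<Sum>j\<in>UNIV. axis i 1 $ j * D j)"
  unfolding partial_d_def using frechet_derivative_at[OF assms] by metis
 also have "... = (\<Sum>j\<in>UNIV. if j = i then D j else 0)" by (intro sum.cong) (auto simp: axis_def)
 finally show ?thesis by simp
qed

lemma flat_algebra_smooth:
 assumes "flat_algebra f"
 shows "iter_partial js f differentiable (at x)"
proof -
 have p: "flat_algebra (partial_d i f) \<and> (\<forall>x. f differentiable (at x))" if f: "flat_algebra f" for f :: "real^'a => real" and i
 proof -
  obtain D where D: "\<And>x. (f has_derivative (\<lambda>h. \<Sum>j\<in>UNIV. h $ j * D j x)) (at x)" "\<And>j. flat_algebra (D j)"
   using flat_algebra_partial_derivatives[OF f] by blast
  have "partial_d i f = D i" using partial_d_eq[OF D(1)] by (intro ext)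
  with D show ?thesis unfolding differentiable_def by auto
 qed
 have "flat_algebra (iter_partial js f)" by (induction js) (use assms p in auto)
 then show ?thesis using p by blast
qed

lemma flat_algebra_prod: "finite I ==> (\<And>i. i \<in> I ==> flat_algebra (f i)) ==> flat_algebra (\<lambda>x. \<Prod>i\<in>I. f i x)"
 by (induction I rule: finite_induct) (auto intro: flat_algebra.intros)

definition bump :: "real => real^'n => real^'n => real^'n => real" where
 "bump m a b x = (\<Prod>i\<in>UNIV. flat 1 (m * x $ i + - m * a $ i) * flat 1 (- m * x $ i + m * b $ i))"

lemma flat_1: "flat 1 t = (if t > 0 then exp (- (1/t)) else 0)"
 by (simp add: flat_def)

lemma bump_bounds: "0 \<le> bump m a b x" "bump m a b x \<le> 1"
proof -
 have "0 \<le> flat 1 t" "flat 1 t \<le> 1" for t by (auto simp: flat_1)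
 then show "0 \<le> bump m a b x" "bump m a b x \<le> 1"
  unfolding bump_def by (auto intro!: prod_nonneg prod_le_1 mult_le_one)
qed

lemma bump_pos_iff: assumes "m > 0" shows "bump m a b x \<noteq> 0 \<longleftrightarrow> x \<in> box a b"
proof -
 have "flat 1 (m * x $ i + - m * a $ i) * flat 1 (- m * x $ i + m * b $ i) \<noteq> 0 \<longleftrightarrow> a $ i < x $ i \<and> x $ i < b $ i" for i
  using assms by (auto simp: flat_1 zero_less_mult_iff simp flip: right_diff_distrib)
 then show ?thesis by (simp add: bump_def mem_box_cart)
qed

lemma test_function_bump: assumes "m > 0" shows "test_function (bump m a b)"
 unfolding test_function_def
proof (intro conjI allI)
 show "iter_partial js (bump m a b) differentiable (at x)" for js x
  unfolding bump_def[abs_def]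
  by (intro flat_algebra_smooth flat_algebra_prod flat_algebra.mult flat_algebra.flat) auto
 have "{x. bump m a b x \<noteq> 0} \<subseteq> cbox a b"
  using bump_pos_iff[OF assms, of a b] by (auto dest: subsetD[OF box_subset_cbox])
 then show "compact (closure {x. bump m a b x \<noteq> 0})"
  by (meson bounded_cbox bounded_subset compact_closure)
qed

lemma bump_translate: "bump m a b (x - z) = bump m (a + z) (b + z) x"
 unfolding bump_def by (intro prod.cong refl) (simp add: algebra_simps)

lemma bump_tendsto: "(\<lambda>n. bump (real (Suc n)) a b x) ----> indicator (box a b) x"
proof (cases "x \<in> box a b")
 case True
 have "(\<lambda>n. flat 1 (real (Suc n) * s)) ----> 1" if "s > 0" for s
 proof -
  have "(\<lambda>n. exp (- (1 / real (Suc n) * (1/s)))) ----> exp (- (0 * (1/s)))"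
   using LIMSEQ_inverse_real_of_nat by (intro tendsto_intros) (simp add: inverse_eq_divide)
  then show ?thesis using that by (simp add: flat_1 del: of_nat_Suc)
 qed
 then have l: "(\<lambda>n. flat 1 (real (Suc n) * (x $ i - a $ i)) * flat 1 (real (Suc n) * (b $ i - x $ i))) ----> 1 * 1" for i
  using True by (intro tendsto_mult) (auto simp: mem_box_cart)
 have e: "bump (real (Suc n)) a b x = (\<Prod>i\<in>UNIV. flat 1 (real (Suc n) * (x $ i - a $ i)) * flat 1 (real (Suc n) * (b $ i - x $ i)))" for n
  unfolding bump_def by (intro prod.cong refl) (simp add: algebra_simps)
 have "(\<lambda>n. bump (real (Suc n)) a b x) ----> (\<Prod>i\<in>(UNIV::'a set). 1 * 1)"
  unfolding e by (intro tendsto_prod l)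
 then show ?thesis using True by simp
next
 case False
 then have "bump (real (Suc n)) a b x = 0" for n using bump_pos_iff[of "real (Suc n)" a b x] by auto
 then show ?thesis using False by simp
qed

subsection \<open>Test functions and their Fourier transforms\<close>

lemma partial_d_support: "{x. partial_d i f x \<noteq> 0} \<subseteq> closure {x. f x \<noteq> 0}"
proof
 fix x assume x: "x \<in> {x. partial_d i f x \<noteq> 0}"
 show "x \<in> closure {x. f x \<noteq> 0}"
 proof (rule ccontr)
  assume n: "x \<notin> closure {x. f x \<noteq> 0}"
  have "((\<lambda>x. 0) has_derivative (\<lambda>h. 0)) (at x)" by simp
  then have "(f has_derivative (\<lambda>h. 0)) (at x)"
  proof (rule has_derivative_transform_within_open[where s="- closure {x. f x \<noteq> 0}"])
   show "0 = f y" if "y \<in> - closure {x. f x \<noteq> 0}" for y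
    using that closure_subset[of "{x. f x \<noteq> 0}"] by auto
  qed (use n in auto)
  then have "partial_d i f x = 0" unfolding partial_d_def using frechet_derivative_at by metis
  with x show False by simp
 qed
qed

lemma test_function_iter: assumes "test_function \<phi>" shows "test_function (iter_partial js \<phi>)"
proof -
 have app: "iter_partial ks (iter_partial js \<phi>) = iter_partial (ks @ js) \<phi>" for ks
  by (induction ks) auto
 have "{x. iter_partial js \<phi> x \<noteq> 0} \<subseteq> closure {x. \<phi> x \<noteq> 0}"
 proof (induction js)
  case (Cons i js)
  have "closure {x. iter_partial js \<phi> x \<noteq> 0} \<subseteq> closure {x. \<phi> x \<noteq> 0}"
   using Cons closure_minimal by blast
  with partial_d_support[of i "iter_partial js \<phi>"] show ?case by auto
 qed (simp add: closure_subset)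
 then have "closure {x. iter_partial js \<phi> x \<noteq> 0} \<subseteq> closure {x. \<phi> x \<noteq> 0}"
  by (simp add: closure_minimal)
 with assms show ?thesis
  unfolding test_function_def app using compact_Int_closed[of "closure {x. \<phi> x \<noteq> 0}" "closure {x. iter_partial js \<phi> x \<noteq> 0}"]
  by (auto simp: Int_absorb1)
qed

lemma test_function_facts:
 assumes "test_function \<phi>"
 shows "continuous_on UNIV \<phi>" "\<phi> \<in> bmeas"
  and "\<exists>B. \<forall>x. \<bar>\<phi> x\<bar> \<le> B" "\<exists>R>0. \<forall>x. \<phi> x \<noteq> 0 --> norm x \<le> R"
  and "bdd_supp (cplx \<phi>)"
proof -
 have "\<phi> differentiable (at x)" for x
  using assms iter_partial.simps(1)[of \<phi>] unfolding test_function_def by metis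
 then show cont: "continuous_on UNIV \<phi>"
  by (simp add: continuous_at_imp_continuous_on differentiable_imp_continuous_within)
 then show meas: "\<phi> \<in> bmeas" by (rule borel_measurable_continuous_onI)
 let ?S = "closure {x. \<phi> x \<noteq> 0}"
 have S: "compact ?S" using assms by (simp add: test_function_def)
 have sub: "\<phi> x \<noteq> 0 ==> x \<in> ?S" for x using closure_subset[of "{x. \<phi> x \<noteq> 0}"] by auto
 have "compact (\<phi> ` ?S)" using S cont by (intro compact_continuous_image) (auto intro: continuous_on_subset)
 then obtain B where B: "\<And>x. x \<in> ?S ==> norm (\<phi> x) \<le> B" using compact_imp_bounded by (force simp: bounded_iff)
 have Bb: "\<bar>\<phi> x\<bar> \<le> max B 0" for x using B[of x] sub[of x] by (cases "\<phi> x = 0") auto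
 then show "\<exists>B. \<forall>x. \<bar>\<phi> x\<bar> \<le> B" by blast
 obtain R where R: "\<And>x. x \<in> ?S ==> norm x \<le> R" using compact_imp_bounded[OF S] by (auto simp: bounded_iff)
 have Rb: "\<phi> x \<noteq> 0 ==> norm x \<le> max R 1" for x using R[of x] sub[of x] by auto
 then show "\<exists>R>0. \<forall>x. \<phi> x \<noteq> 0 --> norm x \<le> R" by (intro exI[of _ "max R 1"]) auto
 have "(\<lambda>x. complex_of_real (max B 0) * indicator (cball 0 (max R 1)) x) \<in> L2 (UNIV :: (real^'a) set)"
 proof (rule L2_cmult)
  have "integrable lborel (\<lambda>x. indicator (cball (0::real^'a) (max R 1)) x :: real)"
   using emeasure_bounded_finite[of "cball (0::real^'a) (max R 1)"] by (simp add: integrable_indicator_iff)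
  moreover have "(norm (indicator (cball (0::real^'a) (max R 1)) x :: complex))^2 = indicator (cball 0 (max R 1)) x" for x
   by (simp add: indicator_def)
  ultimately show "(indicator (cball (0::real^'a) (max R 1)) :: _ => complex) \<in> LL"
   by (simp add: L2_UNIV_iff borel_measurable_indicator)
 qed
 then have "cplx \<phi> \<in> LL"
 proof (rule L2_bound(1))
  show "ae x. norm (complex_of_real (\<phi> x)) \<le> norm (complex_of_real (max B 0) * indicator (cball 0 (max R 1)) x)"
  proof (rule AE_I2)
   fix x
   show "norm (complex_of_real (\<phi> x)) \<le> norm (complex_of_real (max B 0) * indicator (cball 0 (max R 1)) x)"
    using Bb[of x] Rb[of x] by (cases "\<phi> x = 0") (simp_all add: norm_mult)
  qed
 qed (use meas in measurable)
 then show "bdd_supp (cplx \<phi>)" unfolding bdd_supp_def using Rb by auto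
qed

lemma integrable_test_function:
 assumes "test_function \<phi>" shows "integrable lborel \<phi>"
proof -
 have "integrable lborel (cplx \<phi>)" by (rule bdd_supp_integrable[OF test_function_facts(5)[OF assms]])
 from integrable_Re[OF this] show ?thesis by simp
qed

lemma cf_shift:
 fixes u :: "real^'n => complex"
 assumes [measurable]: "u \<in> bmeas"
 shows "cf (\<lambda>x. u (x + t)) xi = plane_wave t xi * cf u xi"
proof -
 have "cf (\<lambda>x. u (x + t)) xi = (LI x. u x * cnj (plane_wave (x - t) xi))"
  unfolding cf_def using integral_translate[of "\<lambda>x. u x * cnj (plane_wave (x - t) xi)" t] by simp
 also have "... = (LI x. plane_wave t xi * (u x * cnj (plane_wave x xi)))"
  using plane_wave_add_left[of _ "- t" xi]
  by (intro B_integral_cong) (auto simp: plane_wave_minus cnj_plane_wave ac_simps)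
 finally show ?thesis by (simp add: cf_def)
qed

text \<open>A difference quotient is a combination of translates, on which the transform acts by phase factors;
 it is bounded by the supremum of the derivative, so dominated convergence applies.\<close>

lemma cf_partial_d:
 assumes \<psi>: "test_function \<psi>"
 shows "cf (cplx (partial_d i \<psi>)) xi = 2 * of_real pi * \<i> * of_real (xi $ i) * cf (cplx \<psi>) xi"
proof -
 have d: "test_function (partial_d i \<psi>)" using test_function_iter[OF \<psi>, of "[i]"] by simp
 obtain B where B: "\<And>x. \<bar>partial_d i \<psi> x\<bar> \<le> B" using test_function_facts(3)[OF d] by blast
 obtain R where R: "R > 0" "\<And>x. \<psi> x \<noteq> 0 ==> norm x \<le> R" using test_function_facts(4)[OF \<psi>] by blast
 note [measurable] = test_function_facts(2)[OF \<psi>] test_function_facts(2)[OF d]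
 define t where "t n = 1 / real (Suc n)" for n
 have t: "t n > 0" "t n \<le> 1" for n by (auto simp: t_def field_simps)
 have t0: "t ----> 0" unfolding t_def using LIMSEQ_inverse_real_of_nat by (simp add: inverse_eq_divide)
 define e where "e = (axis i 1 :: real^'a)"
 have ne: "norm e = 1" by (simp add: e_def norm_axis_1)
 have der: "((\<lambda>s. \<psi> (x + s *R e)) has_real_derivative partial_d i \<psi> (x + s *R e)) (at s)" for x s
 proof -
  have "\<psi> differentiable (at (x + s *R e))"
   using \<psi> iter_partial.simps(1)[of \<psi>] unfolding test_function_def by metis
  then have D: "(\<psi> has_derivative frechet_derivative \<psi> (at (x + s *R e))) (at (x + s *R e))"
   by (simp add: frechet_derivative_works)
  have "((\<lambda>s. x + s *R e) has_derivative (\<lambda>h. h *R e)) (at s)"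
   by (auto intro!: derivative_eq_intros)
  from has_derivative_compose[OF this D]
  have "((\<lambda>s. \<psi> (x + s *R e)) has_derivative (\<lambda>h. frechet_derivative \<psi> (at (x + s *R e)) (h *R e))) (at s)" .
  moreover have "frechet_derivative \<psi> (at (x + s *R e)) (h *R e) = partial_d i \<psi> (x + s *R e) * h" for h
   using linear_cmul[OF has_derivative_linear[OF D]] by (simp add: partial_d_def e_def mult.commute)
  ultimately show ?thesis by (simp add: has_field_derivative_def)
 qed
 define q where "q n x = (\<psi> (x + t n *R e) - \<psi> x) / t n" for n x
 have [measurable]: "q n \<in> bmeas" for n unfolding q_def by measurable
 have qB: "\<bar>q n x\<bar> \<le> B" for n x
 proof -
  have "\<exists>z>0. z < t n \<and> \<psi> (x + t n *R e) - \<psi> (x + 0 *R e) = (t n - 0) * partial_d i \<psi> (x + z *R e)"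
   using MVT2[of 0 "t n" "\<lambda>s. \<psi> (x + s *R e)" "\<lambda>s. partial_d i \<psi> (x + s *R e)"] t(1)[of n] der by auto
  then show ?thesis using B t(1)[of n] by (auto simp: q_def abs_mult)
 qed
 have q0: "q n x = 0" if "norm x > R + 1" for n x
 proof -
  have "norm (x + t n *R e) > R"
   using norm_triangle_ineq4[of "x + t n *R e" "t n *R e"] that t[of n] ne by simp
  then have "\<psi> (x + t n *R e) = 0" "\<psi> x = 0" using R(2) that by force+
  then show ?thesis by (simp add: q_def)
 qed
 have ql: "(\<lambda>n. q n x) ----> partial_d i \<psi> x" for x
 proof -
  have "((\<lambda>h. (\<psi> (x + (0 + h) *R e) - \<psi> (x + 0 *R e)) / h) \<longlongrightarrow> partial_d i \<psi> (x + 0 *R e)) (at 0)"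
   using der[of x 0] unfolding DERIV_def .
  moreover have "filterlim t (at 0) sequentially"
   using t0 t(1) by (auto simp: filterlim_at less_imp_neq[symmetric])
  ultimately have "(\<lambda>n. (\<psi> (x + (0 + t n) *R e) - \<psi> (x + 0 *R e)) / t n) ----> partial_d i \<psi> (x + 0 *R e)"
   by (rule filterlim_compose)
  then show ?thesis by (simp add: q_def)
 qed
 have "(\<lambda>n. cf (cplx (q n)) xi) ----> cf (cplx (partial_d i \<psi>)) xi"
  unfolding cf_def
 proof (rule integral_dominated_convergence[where w="\<lambda>x. B * indicator (cball 0 (R + 1)) x"])
  show "integrable lborel (\<lambda>x::real^'a. B * indicator (cball 0 (R + 1)) x)"
   using emeasure_bounded_finite[of "cball (0::real^'a) (R + 1)"]
   by (intro integrable_mult_right) (simp add: integrable_indicator_iff)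
  show "ae x. (\<lambda>n. complex_of_real (q n x) * cnj (plane_wave x xi)) ----> complex_of_real (partial_d i \<psi> x) * cnj (plane_wave x xi)"
   by (intro AE_I2 tendsto_intros ql)
  show "ae x. norm (complex_of_real (q n x) * cnj (plane_wave x xi)) \<le> B * indicator (cball 0 (R + 1)) x" for n
   using qB q0 by (auto simp: norm_mult indicator_def not_le)
 qed auto
 moreover have "cf (cplx (q n)) xi = (plane_wave (t n *R e) xi - 1) / of_real (t n) * cf (cplx \<psi>) xi" for n
 proof -
  have i: "integrable lborel (\<lambda>x. complex_of_real (\<psi> x) * cnj (plane_wave x xi))"
   by (rule B_integrable_bound[OF integrable_test_function[OF \<psi>]]) (auto simp: norm_mult)
  have i': "integrable lborel (\<lambda>x. complex_of_real (\<psi> (x + t n *R e)) * cnj (plane_wave x xi))"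
  proof (rule B_integrable_bound)
   show "integrable lborel (\<lambda>x. \<psi> (x + t n *R e))"
    using integrable_test_function[OF \<psi>] by (simp add: integrable_translate)
  qed (auto simp: norm_mult)
  have "cf (cplx (q n)) xi = (LI x. (complex_of_real (\<psi> (x + t n *R e)) * cnj (plane_wave x xi)
    - complex_of_real (\<psi> x) * cnj (plane_wave x xi)) / of_real (t n))"
   unfolding cf_def q_def by (intro B_integral_cong) (auto simp: diff_divide_distrib left_diff_distrib)
  also have "... = (cf (\<lambda>x. complex_of_real (\<psi> (x + t n *R e))) xi - cf (cplx \<psi>) xi) / of_real (t n)"
   unfolding cf_def using i i' by simp
  also have "cf (\<lambda>x. complex_of_real (\<psi> (x + t n *R e))) xi = plane_wave (t n *R e) xi * cf (cplx \<psi>) xi"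
   by (rule cf_shift[of "cplx \<psi>"]) measurable
  finally show ?thesis by (simp add: left_diff_distrib)
 qed
 moreover have "(\<lambda>n. (plane_wave (t n *R e) xi - 1) / of_real (t n)) ----> 2 * of_real pi * \<i> * of_real (xi $ i)"
 proof -
  let ?a = "2 * of_real pi * \<i> * of_real (xi $ i)"
  have "((\<lambda>z. exp (?a * z)) has_field_derivative ?a * exp (?a * 0)) (at 0)"
   by (auto intro!: derivative_eq_intros)
  then have "((\<lambda>h. (exp (?a * h) - 1) / h) \<longlongrightarrow> ?a) (at 0)"
   by (simp add: DERIV_def)
  moreover have "filterlim (\<lambda>n. complex_of_real (t n)) (at 0) sequentially"
   using tendsto_of_real[OF t0, where 'a=complex] t(1) by (auto simp: filterlim_at less_imp_neq[symmetric])
  ultimately have "(\<lambda>n. (exp (?a * of_real (t n)) - 1) / of_real (t n)) ----> ?a"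
   by (rule filterlim_compose)
  moreover have "plane_wave (t n *R e) xi = exp (?a * of_real (t n))" for n
   by (simp add: plane_wave_def e_def inner_axis ac_simps)
  ultimately show ?thesis by simp
 qed
 then have "(\<lambda>n. (plane_wave (t n *R e) xi - 1) / of_real (t n) * cf (cplx \<psi>) xi) ----> 2 * of_real pi * \<i> * of_real (xi $ i) * cf (cplx \<psi>) xi"
  by (rule tendsto_mult_right)
 ultimately show ?thesis using LIMSEQ_unique by simp
qed

definition symb :: "'n list => real^'n => complex" where
 "symb js xi = (\<Prod>i\<leftarrow>js. 2 * of_real pi * \<i> * of_real (xi $ i))"

lemma symb_simps [simp]:
 "symb [] xi = 1" "symb (i # js) xi = 2 * of_real pi * \<i> * of_real (xi $ i) * symb js xi"
 by (simp_all add: symb_def)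

lemma symb_measurable [measurable]: "symb js \<in> bmeas"
 by (induction js) (auto simp: symb_def[abs_def])

lemma cnj_symb: "cnj (symb js xi) = (-1) ^ length js * symb js xi"
 by (induction js) auto

lemma cf_iter_partial:
 assumes "test_function \<phi>" shows "cf (cplx (iter_partial js \<phi>)) xi = symb js xi * cf (cplx \<phi>) xi"
proof (induction js)
 case (Cons i js)
 then show ?case using cf_partial_d[OF test_function_iter[OF assms, of js], of i xi] by simp
qed simp

subsection \<open>The fundamental lemma of the calculus of variations\<close>

lemma locally_integrableD:
 assumes "locally_integrable u" shows "u \<in> bmeas"
  and "\<And>R. integrable lborel (\<lambda>x. indicator (cball 0 R) x *R u x)"
proof -
 show i: "\<And>R. integrable lborel (\<lambda>x. indicator (cball 0 R) x *R u x)"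
  using assms by (simp add: locally_integrable_def set_integrable_def)
 have "(\<lambda>n. indicator (cball 0 (real n)) x *R u x) ----> u x" for x
 proof (intro tendsto_eventually eventually_sequentiallyI)
  fix n assume "nat \<lceil>norm x\<rceil> \<le> n"
  then show "indicator (cball 0 (real n)) x *R u x = u x" by (simp add: nat_le_iff ceiling_le_iff)
 qed
 then show "u \<in> bmeas"
  by (rule borel_measurable_LIMSEQ_metric[rotated]) (use i borel_measurable_integrable in \<open>force simp: measurable_lborel1\<close>)
qed

lemma integrable_bounded_mult:
 fixes v :: "real^'n => 'b::{banach, second_countable_topology}"
 assumes v: "locally_integrable v" and \<phi>: "\<phi> \<in> bmeas"
  and B: "\<And>x. \<bar>\<phi> x\<bar> \<le> B" and R: "\<And>x. \<phi> x \<noteq> 0 ==> norm x \<le> R"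
 shows "integrable lborel (\<lambda>x. \<phi> x *R v x)"
proof (rule B_integrable_bound)
 show "integrable lborel (\<lambda>x. B *R (indicator (cball 0 R) x *R v x))"
  by (intro integrable_scaleR_right locally_integrableD(2)[OF v])
 have "B \<ge> 0" using B[of 0] by linarith
 show "ae x. norm (\<phi> x *R v x) \<le> norm (B *R (indicator (cball 0 R) x *R v x))"
 proof (rule AE_I2)
  fix x
  show "norm (\<phi> x *R v x) \<le> norm (B *R (indicator (cball 0 R) x *R v x))"
   using B[of x] R[of x] \<open>B \<ge> 0\<close> by (cases "\<phi> x = 0") (auto intro: mult_right_mono)
 qed
qed (use \<phi> locally_integrableD(1)[OF v] in measurable)

lemma integrable_test_mult:
 fixes v :: "real^'n => 'b::{banach, second_countable_topology}"
 assumes "locally_integrable v" "test_function \<phi>"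
 shows "integrable lborel (\<lambda>x. \<phi> x *R v x)"
proof -
 obtain B R where "\<And>x. \<bar>\<phi> x\<bar> \<le> B" "\<And>x. \<phi> x \<noteq> 0 ==> norm x \<le> R"
  using test_function_facts(3,4)[OF assms(2)] by blast
 then show ?thesis using integrable_bounded_mult[OF assms(1) test_function_facts(2)[OF assms(2)]] by blast
qed

lemma set_integrals_zero_AE:
 fixes v :: "real^'n => real"
 assumes i: "integrable lborel v" and z: "\<And>A. A \<in> sets borel ==> (LI x. indicator A x * v x) = 0"
 shows "ae x. v x = 0"
proof -
 have [measurable]: "v \<in> bmeas" using i by auto
 have "ae x. s * v x \<le> 0" if s: "s = 1 \<or> s = -1" for s
 proof -
  define A where "A = {x. s * v x > 0}"
  have A: "A \<in> sets borel" unfolding A_def by measurable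
  have "integrable lborel (\<lambda>x. s * (indicator A x * v x))"
   using integrable_mult_indicator[of A lborel v] A i by (intro integrable_mult_right) simp
  moreover have "ae x. 0 \<le> s * (indicator A x * v x)" by (auto simp: A_def indicator_def)
  moreover have "(LI x. s * (indicator A x * v x)) = 0" using z[OF A] by simp
  ultimately have "ae x. s * (indicator A x * v x) = 0"
   using integral_nonneg_eq_0_iff_AE[of lborel "\<lambda>x. s * (indicator A x * v x)"] by blast
  then show ?thesis by eventually_elim (auto simp: A_def indicator_def split: if_splits)
 qed
 from this[of 1] this[of "-1"] show ?thesis by (auto simp: AE_conj_iff[symmetric] elim!: AE_mp)
qed

text \<open>Bumps exhaust the indicators of open boxes, which form an intersection-stable generator of the Borel sets.\<close>

lemma fundamental_lemma_real:
 fixes v :: "real^'n => real"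
 assumes v: "locally_integrable v"
  and z: "\<And>\<phi>. test_function \<phi> ==> (LI x. \<phi> x * v x) = 0"
 shows "ae x. v x = 0"
proof -
 note [measurable] = locally_integrableD(1)[OF v]
 have box0: "(LI x. indicator (box a b) x * v x) = 0" for a b
 proof -
  obtain R where R: "\<And>x. x \<in> box a b ==> norm x \<le> R" using bounded_box[of a b] by (auto simp: bounded_iff)
  have "(\<lambda>n. LI x. bump (real (Suc n)) a b x * v x) ----> (LI x. indicator (box a b) x * v x)"
  proof (rule integral_dominated_convergence[where w="\<lambda>x. norm (indicator (cball 0 R) x *R v x)"])
   show "integrable lborel (\<lambda>x. norm (indicator (cball 0 R) x *R v x))"
    by (intro integrable_norm locally_integrableD(2)[OF v])
   show "(\<lambda>x. bump (real (Suc n)) a b x * v x) \<in> borel_measurable lborel" for n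
    using test_function_facts(2)[OF test_function_bump[of "real (Suc n)" a b]] by simp
   show "ae x. (\<lambda>n. bump (real (Suc n)) a b x * v x) ----> indicator (box a b) x * v x"
    by (intro AE_I2 tendsto_mult_right bump_tendsto)
   show "ae x. norm (bump (real (Suc n)) a b x * v x) \<le> norm (indicator (cball 0 R) x *R v x)" for n
   proof (rule AE_I2)
    fix x
    show "norm (bump (real (Suc n)) a b x * v x) \<le> norm (indicator (cball 0 R) x *R v x)"
    proof (cases "x \<in> box a b")
     case True
     then show ?thesis using R bump_bounds[of "real (Suc n)" a b x] by (simp add: abs_mult mult_left_le_one_le del: of_nat_Suc)
    next
     case False
     then have "bump (real (Suc n)) a b x = 0" using bump_pos_iff[of "real (Suc n)" a b x] by auto
     then show ?thesis by simp
    qed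
   qed
  qed measurable
  moreover have "(LI x. bump (real (Suc n)) a b x * v x) = 0" for n
   by (rule z[OF test_function_bump]) simp
  ultimately have "(\<lambda>n::nat. 0) ----> (LI x. indicator (box a b) x * v x)" by simp
  from LIMSEQ_unique[OF this tendsto_const] show ?thesis .
 qed
 have loc: "ae x. indicator (box a b) x * v x = 0" for a b
 proof (rule set_integrals_zero_AE)
  obtain R where R: "\<And>x. x \<in> box a b ==> norm x \<le> R" using bounded_box[of a b] by (auto simp: bounded_iff)
  have "integrable lborel (\<lambda>x. indicator (box a b) x *R v x)"
   by (rule integrable_bounded_mult[OF v, of _ 1 R]) (use R in \<open>auto simp: indicator_def split: if_splits\<close>)
  then show int: "integrable lborel (\<lambda>x. indicator (box a b) x * v x)" by simp
  let ?w = "\<lambda>x. indicator (box a b) x * v x"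
  have intA: "integrable lborel (\<lambda>x. indicator A x * ?w x)" if "A \<in> sets borel" for A
   using integrable_mult_indicator[of A lborel ?w] that int by simp
  fix A :: "(real^'n) set" assume "A \<in> sets borel"
  then have "A \<in> sigma_sets UNIV (range (\<lambda>(a, b). box a b))" by (simp add: borel_eq_box)
  have "Int_stable (range (\<lambda>(a, b). box a (b::real^'n)))"
   by (auto simp: Int_stable_def box_Int_box)
  moreover have "range (\<lambda>(a, b). box a (b::real^'n)) \<subseteq> Pow UNIV" by simp
  ultimately show "(LI x. indicator A x * ?w x) = 0"
   using \<open>A \<in> sigma_sets UNIV _\<close>
  proof (induction rule: sigma_sets_induct_disjoint)
   case (basic A)
   then obtain c d where A: "A = box c d" by auto
   obtain p q where pq: "box c d \<inter> box a b = box p q" using box_Int_box[of c d a b] by blast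
   have "(\<lambda>x. indicator A x * ?w x) = (\<lambda>x. indicator (box p q) x * v x)"
    unfolding A pq[symmetric] by (auto simp: indicator_def)
   then show ?case using box0 by simp
  next
   case (compl A)
   have [measurable]: "A \<in> sets borel" using compl(1) by (simp add: borel_eq_box)
   have "(\<lambda>x. indicator (UNIV - A) x * ?w x) = (\<lambda>x. ?w x - indicator A x * ?w x)" by (auto simp: indicator_def)
   then show ?case using compl(2) box0[of a b] int intA[of A] by simp
  next
   case (union A)
   have [measurable]: "A i \<in> sets borel" for i using union(2) by (auto simp: borel_eq_box)
   have "(LINT x:(\<Union>i. A i)|lborel. ?w x) = (\<Sum>i. (LINT x:(A i)|lborel. ?w x))"
    by (rule lebesgue_integral_countable_add)
      (use union(1) intA[of "\<Union>i. A i"] in \<open>auto simp: disjoint_family_on_def set_integrable_def\<close>)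
   then show ?case using union(3) by (simp add: set_lebesgue_integral_def)
  qed simp
 qed
 define k where "k n = ((\<chi> i. real n) :: real^'n)" for n :: nat
 have "ae x. \<forall>n. indicator (box (- k n) (k n)) x * v x = 0" by (subst AE_all_countable) (use loc in blast)
 then show ?thesis
 proof eventually_elim
  case (elim x)
  obtain n :: nat where n: "norm x < real n" using reals_Archimedean2 by blast
  have "\<bar>x $ i\<bar> < real n" for i using component_le_norm_cart[of x i] n by linarith
  then have "x \<in> box (- k n) (k n)" by (auto simp: mem_box_cart k_def abs_less_iff minus_less_iff)
  then show ?case using elim by (auto simp: indicator_def)
 qed
qed

lemma fundamental_lemma:
 fixes v :: "real^'n => complex"
 assumes v: "locally_integrable v"
  and z: "\<And>\<phi>. test_function \<phi> ==> (LI x. \<phi> x *R v x) = 0"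
 shows "ae x. v x = 0"
proof -
 have r: "ae x. f (v x) = 0" if f: "bounded_linear f" for f :: "complex => real"
 proof (rule fundamental_lemma_real)
  interpret bounded_linear f by fact
  have "integrable lborel (\<lambda>x. f (indicator (cball 0 R) x *R v x))" for R
   by (rule integrable_bounded_linear[OF f locally_integrableD(2)[OF v]])
  then show "locally_integrable (\<lambda>x. f (v x))"
   by (simp add: locally_integrable_def set_integrable_def scaleR)
  show "(LI x. \<phi> x * f (v x)) = 0" if "test_function \<phi>" for \<phi>
   using integral_bounded_linear[OF f integrable_test_mult[OF v that]] z[OF that] by (simp add: scaleR zero)
 qed
 from r[OF bounded_linear_Re] r[OF bounded_linear_Im] show ?thesis
  by eventually_elim (simp add: complex_eq_iff)
qed

lemma L2_locally_integrable:
 fixes u :: "real^'n => complex"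
 assumes "u \<in> LL" shows "locally_integrable u"
proof -
 have "integrable lborel (trunc R u)" for R by (rule bdd_supp_integrable[OF bdd_supp_trunc[OF assms]])
 moreover have "trunc R u = (\<lambda>x. indicator (cball 0 R) x *R u x)" for R
  by (auto simp: trunc_def indicator_def)
 ultimately show ?thesis by (simp add: locally_integrable_def set_integrable_def)
qed

lemma locally_integrable_diff:
 "locally_integrable u ==> locally_integrable v ==> locally_integrable (\<lambda>x. u x - v x)"
 unfolding locally_integrable_def set_integrable_def by (auto simp: scaleR_diff_right)

lemma weak_deriv_unique:
 fixes u v v' :: "real^'n => complex"
 assumes "has_weak_deriv js u v" "has_weak_deriv js u v'"
 shows "ae x. v x = v' x"
proof -
 have l: "locally_integrable v" "locally_integrable v'" using assms by (auto simp: has_weak_deriv_def)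
 have "ae x. v x - v' x = 0"
 proof (rule fundamental_lemma[OF locally_integrable_diff[OF l]])
  fix \<phi> :: "real^'n => real" assume \<phi>: "test_function \<phi>"
  have "(-1::real) ^ length js *R (LI x. \<phi> x *R v x) = (-1::real) ^ length js *R (LI x. \<phi> x *R v' x)"
   using assms \<phi> unfolding has_weak_deriv_def by metis
  then show "(LI x. \<phi> x *R (v x - v' x)) = 0"
   using integrable_test_mult[OF l(1) \<phi>] integrable_test_mult[OF l(2) \<phi>] by (simp add: scaleR_diff_right)
 qed
 then show ?thesis by simp
qed

lemma has_weak_deriv_of_real:
 fixes u v :: "real^'n => real"
 shows "has_weak_deriv js (cplx u) (cplx v) \<longleftrightarrow> has_weak_deriv js u v"
proof -
 have l: "locally_integrable (cplx w) \<longleftrightarrow> locally_integrable w" for w :: "real^'n => real"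
 proof -
  have "integrable lborel (\<lambda>x. indicator S x *R complex_of_real (w x)) \<longleftrightarrow> integrable lborel (\<lambda>x. indicator S x * w x)" for S
  proof
   assume "integrable lborel (\<lambda>x. indicator S x *R complex_of_real (w x))"
   from integrable_Re[OF this] show "integrable lborel (\<lambda>x. indicator S x * w x)" by simp
  next
   assume "integrable lborel (\<lambda>x. indicator S x * w x)"
   then have "integrable lborel (\<lambda>x. complex_of_real (indicator S x * w x))" by (rule integrable_of_real)
   then show "integrable lborel (\<lambda>x. indicator S x *R complex_of_real (w x))" by (simp add: scaleR_conv_of_real)
  qed
  then show ?thesis by (simp add: locally_integrable_def set_integrable_def)
 qed
 have i: "(LI x. \<phi> x *R complex_of_real (w x)) = complex_of_real (LI x. \<phi> x *R w x)" for \<phi> w :: "real^'n => real"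
  by (subst integral_complex_of_real[symmetric]) (simp add: scaleR_conv_of_real)
 have "(complex_of_real a = c *R complex_of_real b) \<longleftrightarrow> (a = c *R b)" for a b c :: real
  by (simp add: scaleR_conv_of_real flip: of_real_mult)
 then show ?thesis unfolding has_weak_deriv_def l i by simp
qed

lemma weak_deriv_unique_real:
 fixes u v v' :: "real^'n => real"
 assumes "has_weak_deriv js u v" "has_weak_deriv js u v'"
 shows "ae x. v x = v' x"
 using weak_deriv_unique[of js "cplx u" "cplx v" "cplx v'"] assms by (simp add: has_weak_deriv_of_real)

lemma weak_deriv_AE:
 fixes u v :: "real^'n => complex"
 assumes "has_weak_deriv js u v"
 shows "weak_deriv js u \<in> bmeas" "ae x. weak_deriv js u x = v x"
proof -
 have "has_weak_deriv js u (weak_deriv js u)" unfolding weak_deriv_def by (rule someI[of "has_weak_deriv js u" v, OF assms])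
 then show "weak_deriv js u \<in> bmeas" "ae x. weak_deriv js u x = v x"
  using weak_deriv_unique[OF _ assms] locally_integrableD(1) by (auto simp: has_weak_deriv_def)
qed

lemma weak_deriv_AE_real:
 fixes u v :: "real^'n => real"
 assumes "has_weak_deriv js u v"
 shows "weak_deriv js u \<in> bmeas" "ae x. weak_deriv js u x = v x"
proof -
 have "has_weak_deriv js u (weak_deriv js u)" unfolding weak_deriv_def by (rule someI[of "has_weak_deriv js u" v, OF assms])
 then show "weak_deriv js u \<in> bmeas" "ae x. weak_deriv js u x = v x"
  using weak_deriv_unique_real[OF _ assms] locally_integrableD(1) by (auto simp: has_weak_deriv_def)
qed

subsection \<open>Weak derivatives on the Fourier side\<close>

lemma ip_test:
 "ip u (cplx \<phi>) = (LI x. \<phi> x *R u x)"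
 unfolding ip_def by (simp add: scaleR_conv_of_real mult.commute)

text \<open>On the Fourier side a derivative of the test function becomes a conjugated symbol, which differs from the symbol by
 the sign of integration by parts.\<close>

lemma FT_has_weak_deriv:
 assumes "FT u c" "FT v (\<lambda>xi. symb js xi * c xi)" shows "has_weak_deriv js u v"
 unfolding has_weak_deriv_def
proof (intro conjI allI impI L2_locally_integrable FT_L2(1)[OF assms(1)] FT_L2(1)[OF assms(2)])
 fix \<phi> :: "real^'a => real" assume \<phi>: "test_function \<phi>"
 note b = test_function_facts(5)[OF \<phi>] test_function_facts(5)[OF test_function_iter[OF \<phi>, of js]]
 have "(LI x. iter_partial js \<phi> x *R u x) = ip c (cf (cplx (iter_partial js \<phi>)))"
  unfolding ip_test[symmetric] by (rule FT_ip[OF assms(1) FT_cf[OF b(2)]])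
 also have "... = (-1) ^ length js * ip (\<lambda>xi. symb js xi * c xi) (cf (cplx \<phi>))"
  unfolding ip_def integral_mult_right_zero[symmetric] cf_iter_partial[OF \<phi>]
  by (intro B_integral_cong) (auto simp: cnj_symb)
 also have "... = (-1) ^ length js * ip v (cplx \<phi>)"
  by (simp add: FT_ip[OF assms(2) FT_cf[OF b(1)]])
 finally show "(LI x. iter_partial js \<phi> x *R u x) = (-1::real) ^ length js *R (LI x. \<phi> x *R v x)"
  by (simp add: ip_test scaleR_conv_of_real)
qed

lemma norm_cf_le:
 assumes "integrable lborel u" shows "norm (cf u xi) \<le> (LI x. norm (u x))"
 unfolding cf_def using integral_norm_bound[of lborel "\<lambda>x. u x * cnj (plane_wave x xi)"] by (simp add: norm_mult)

text \<open>If the support is so small that the phase \<open>2 \<pi> xi \<bullet> x\<close> stays below \<open>\<pi>/2\<close> on it, then the real part of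
 the integrand is positive.\<close>

lemma bump_cf_nonzero:
 fixes xi :: "real^'n"
 shows "\<exists>n. cf (cplx (bump 1 (\<chi> i. - (1 / real (Suc n))) (\<chi> i. 1 / real (Suc n)))) xi \<noteq> 0"
proof -
 let ?S = "\<Sum>i\<in>UNIV. \<bar>xi $ i\<bar>"
 obtain n :: nat where n: "8 * ?S < real n" using reals_Archimedean2 by blast
 define s where "s = 1 / real (Suc n)"
 have s: "s > 0" "?S * s < 1/8" using n by (auto simp: s_def field_simps)
 define a b where "a = (\<chi> i. - s :: real^'n)" and "b = (\<chi> i. s :: real^'n)"
 let ?\<phi> = "bump 1 a b"
 have tf: "test_function ?\<phi>" by (rule test_function_bump) simp
 have int: "integrable lborel (\<lambda>x. complex_of_real (?\<phi> x) * cnj (plane_wave x xi))"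
  by (rule B_integrable_bound[OF integrable_test_function[OF tf]])
    (use test_function_facts(2)[OF tf] in \<open>auto simp: norm_mult\<close>)
 have Re: "Re (complex_of_real (?\<phi> x) * cnj (plane_wave x xi)) = ?\<phi> x * cos (2 * pi * (xi \<bullet> x))" for x
  by (simp add: plane_wave_def Re_exp)
 have cpos: "cos (2 * pi * (xi \<bullet> x)) > 0" if "x \<in> box a b" for x
 proof -
  have "\<bar>x $ i\<bar> \<le> s" for i using that by (auto simp: mem_box_cart a_def b_def abs_le_iff less_imp_le minus_le_iff)
  then have "\<bar>xi \<bullet> x\<bar> \<le> (\<Sum>i\<in>UNIV. \<bar>xi $ i\<bar> * s)"
   unfolding inner_vec_def by (intro order_trans[OF sum_abs] sum_mono) (auto simp: abs_mult intro: mult_left_mono)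
  also have "... < 1/8" using s(2) by (simp add: sum_distrib_right)
  finally have "\<bar>2 * pi * (xi \<bullet> x)\<bar> < 2 * pi * (1/8)" by (simp add: abs_mult)
  then have "\<bar>2 * pi * (xi \<bullet> x)\<bar> < pi / 2" using pi_gt_zero by linarith
  from abs_less_iff[THEN iffD1, OF this] show ?thesis by (intro cos_gt_zero_pi) linarith+
 qed
 have "cf (cplx ?\<phi>) xi \<noteq> 0"
 proof
  assume "cf (cplx ?\<phi>) xi = 0"
  then have "(LI x. Re (complex_of_real (?\<phi> x) * cnj (plane_wave x xi))) = 0"
   unfolding cf_def using integral_Re[OF int] by simp
  moreover have "ae x. 0 \<le> Re (complex_of_real (?\<phi> x) * cnj (plane_wave x xi))"
  proof (rule AE_I2)
   fix x
   show "0 \<le> Re (complex_of_real (?\<phi> x) * cnj (plane_wave x xi))"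
    unfolding Re using cpos[of x] bump_pos_iff[of 1 a b x] bump_bounds[of 1 a b x] by (cases "x \<in> box a b") auto
  qed
  ultimately have "ae x. Re (complex_of_real (?\<phi> x) * cnj (plane_wave x xi)) = 0"
   using integral_nonneg_eq_0_iff_AE[OF integrable_Re[OF int]] by simp
  then have "ae x. x \<notin> box a b"
  proof eventually_elim
   case (elim x)
   then show ?case unfolding Re using cpos[of x] bump_pos_iff[of 1 a b x] by auto
  qed
  then have "emeasure lborel (box a b) = 0" by (subst (asm) AE_iff_measurable[of "box a b"]) auto
  then have "negligible (box a b)"
   unfolding negligible_iff_null_sets by (intro null_sets_completionI) (simp add: null_sets_def)
  moreover have "box a b \<noteq> {}" using s(1) by (simp add: interval_ne_empty_cart a_def b_def)
  ultimately show False using open_not_negligible[OF open_box] by blast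
 qed
 then show ?thesis unfolding a_def b_def s_def by blast
qed

text \<open>Test with all translates of one bump. On the Fourier side the translates multiply by plane waves, so an integrable
 function has vanishing transform; the bumps have no common zero in frequency.\<close>

lemma weak_deriv_FT:
 assumes w: "has_weak_deriv js u v" and u: "FT u c" and v: "FT v d"
 shows "ae xi. d xi = symb js xi * c xi"
proof -
 have cL: "c \<in> LL" and dL: "d \<in> LL" using u v FT_L2 by auto
 note [measurable] = L2_measurable[OF cL] L2_measurable[OF dL]
 have zero: "ae xi. (symb js xi * c xi - d xi) * cnj (cf (cplx (bump 1 a b)) xi) = 0" for a b
 proof -
  define \<phi> where "\<phi> = bump 1 a b"
  have \<phi>: "test_function \<phi>" unfolding \<phi>_def by (rule test_function_bump) simp
  let ?C = "cf (cplx \<phi>)" and ?D = "cf (cplx (iter_partial js \<phi>))"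
  note t = \<phi> test_function_iter[OF \<phi>, of js]
  have meas [measurable]: "?C \<in> bmeas" "?D \<in> bmeas"
   using t by (auto intro!: cf_measurable dest: test_function_facts(2))
  define h where "h xi = (-1) ^ length js * (c xi * cnj (?D xi)) - d xi * cnj (?C xi)" for xi
  have h: "h xi = (symb js xi * c xi - d xi) * cnj (?C xi)" for xi
  proof -
   have s: "(-1::complex) ^ n * (-1) ^ n = 1" for n by (simp flip: power_mult_distrib)
   have "(-1) ^ length js * (c xi * cnj (?D xi)) = ((-1) ^ length js * (-1) ^ length js) * (symb js xi * c xi * cnj (?C xi))"
    unfolding cf_iter_partial[OF \<phi>] complex_cnj_mult cnj_symb by (simp only: ac_simps)
   then show ?thesis by (simp add: h_def s left_diff_distrib)
  qed
  have CL: "?C \<in> LL" "?D \<in> LL"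
   using t by (auto intro!: plancherel_bdd_supp(1) dest: test_function_facts(5))
  have bd: "norm (cf (cplx \<psi>) xi) \<le> (LI x. norm (complex_of_real (\<psi> x)))" if "test_function \<psi>" for \<psi> :: "real^'a => real" and xi
   using integrable_test_function[OF that] by (intro norm_cf_le) auto
  have hL: "h \<in> LL"
  proof -
   have "(\<lambda>xi. cnj (?D xi) * c xi) \<in> LL"
    by (rule L2_mult_bounded(1)[OF cL]) (use bd[OF t(2)] in auto)
   moreover have "(\<lambda>xi. cnj (?C xi) * d xi) \<in> LL"
    by (rule L2_mult_bounded(1)[OF dL]) (use bd[OF t(1)] in auto)
   ultimately show ?thesis unfolding h_def[abs_def] by (simp only: mult.commute[of "c _"] mult.commute[of "d _"]) (intro L2_diff L2_cmult)
  qed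
  have hi: "integrable lborel h" unfolding h_def[abs_def]
   by (intro B_integrable_diff integrable_mult_right integrable_ip cL dL CL)
  have "(LI xi. h xi * plane_wave z xi) = 0" for z
  proof -
   define \<psi> where "\<psi> = bump 1 (a + z) (b + z)"
   have \<psi>: "test_function \<psi>" unfolding \<psi>_def by (rule test_function_bump) simp
   have "\<psi> x = \<phi> (x + - z)" for x unfolding \<psi>_def \<phi>_def using bump_translate[of 1 a b x z] by simp
   then have sh: "cf (cplx \<psi>) xi = cnj (plane_wave z xi) * ?C xi" for xi
    using cf_shift[of "cplx \<phi>" "- z" xi] test_function_facts(2)[OF \<phi>] by (simp add: plane_wave_minus cnj_plane_wave)
   note b = test_function_facts(5)[OF \<psi>] test_function_facts(5)[OF test_function_iter[OF \<psi>, of js]]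
   have "ip c (cf (cplx (iter_partial js \<psi>))) = ip u (cplx (iter_partial js \<psi>))" by (rule FT_ip[OF u FT_cf[OF b(2)], symmetric])
   also have "... = (-1) ^ length js * ip v (cplx \<psi>)"
    using w \<psi> by (simp add: ip_test has_weak_deriv_def scaleR_conv_of_real)
   also have "ip v (cplx \<psi>) = ip d (cf (cplx \<psi>))" by (rule FT_ip[OF v FT_cf[OF b(1)]])
   finally have eq: "(-1) ^ length js * ip c (cf (cplx (iter_partial js \<psi>))) - ip d (cf (cplx \<psi>)) = 0"
    by (simp flip: mult.assoc power_add)
   have "(LI xi. h xi * plane_wave z xi)
    = (LI xi. (-1) ^ length js * (c xi * cnj (cf (cplx (iter_partial js \<psi>)) xi)) - d xi * cnj (cf (cplx \<psi>) xi))"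
    by (intro B_integral_cong) (auto simp: h_def sh cf_iter_partial[OF \<psi>] cf_iter_partial[OF \<phi>] algebra_simps)
   also have "... = (-1) ^ length js * ip c (cf (cplx (iter_partial js \<psi>))) - ip d (cf (cplx \<psi>))"
    unfolding ip_def using plancherel_bdd_supp(1)[OF b(1)] plancherel_bdd_supp(1)[OF b(2)]
    by (subst B_integral_diff) (auto intro!: integrable_mult_right integrable_ip cL dL)
   finally show ?thesis using eq by simp
  qed
  then have "ae xi. h xi = 0" by (rule L1_fourier_inj[OF hL hi])
  then show ?thesis by (simp add: h \<phi>_def)
 qed
 have "ae xi. \<forall>n. (symb js xi * c xi - d xi) * cnj (cf (cplx (bump 1 (\<chi> i. - (1 / real (Suc n))) (\<chi> i. 1 / real (Suc n)))) xi) = 0"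
  by (subst AE_all_countable) (use zero in blast)
 then show ?thesis
 proof eventually_elim
  case (elim xi)
  then show ?case using bump_cf_nonzero[of xi] by (metis complex_cnj_zero_iff eq_iff_diff_eq_0 mult_eq_0_iff)
 qed
qed

section \<open>Periodic functions\<close>

definition cell :: "(real^'n => complex) => real^'n => complex" where
 "cell u x = indicator Ycell x * u x"

lemma cell_outside: "x \<notin> Ycell ==> cell u x = 0"
 by (simp add: cell_def)

lemma cell_L2_iff: "u \<in> bmeas ==> u \<in> L2 Ycell \<longleftrightarrow> cell u \<in> LL"
proof -
 assume [measurable]: "u \<in> bmeas"
 have "indicator Ycell x *R (norm (u x))^2 = (norm (cell u x))^2" for x by (simp add: cell_def indicator_def)
 then show ?thesis
  unfolding L2_def mem_Collect_eq set_borel_measurable_def set_integrable_def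
  by (simp add: cell_def[abs_def])
qed

lemma L2_perD:
 assumes "u \<in> L2_per" shows "u \<in> bmeas" "periodic u" "cell u \<in> LL"
  and "ae x. \<forall>k. u (x + rv k) = u x"
 using assms cell_L2_iff periodic_lattice unfolding L2_per_def by blast+

lemma bdd_supp_cell: "cell u \<in> LL ==> bdd_supp (cell u)"
 unfolding bdd_supp_def using Ycell_bounded cell_outside by blast

lemma partial_d_shift:
 assumes "test_function \<phi>" shows "partial_d j (\<lambda>x. \<phi> (x - z)) x = partial_d j \<phi> (x - z)"
proof -
 have "\<phi> differentiable (at (x - z))"
  using assms iter_partial.simps(1)[of \<phi>] unfolding test_function_def by metis
 then have D: "(\<phi> has_derivative frechet_derivative \<phi> (at (x - z))) (at (x - z))"
  by (simp add: frechet_derivative_works)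
 have "((\<lambda>x. x - z) has_derivative (\<lambda>h. h)) (at x)" by (auto intro!: derivative_eq_intros)
 from has_derivative_compose[OF this D]
 have "((\<lambda>x. \<phi> (x - z)) has_derivative frechet_derivative \<phi> (at (x - z))) (at x)" .
 then show ?thesis unfolding partial_d_def using frechet_derivative_at by metis
qed

text \<open>Averaging a test function against a periodic function over all translations in the cell
 factorises into the Fourier coefficient of the one and the Fourier transform of the other. This
 passes from test functions on the whole space to Fourier coefficients on the cell.\<close>

lemma periodic_average:
 fixes v :: "real^'n => complex"
 assumes v: "v \<in> L2_per" and \<phi>: "test_function \<phi>"
 shows "(LI z. cnj (plane_wave z (rv k)) * indicator Ycell z * (LI x. \<phi> (x - z) *R v x))
  = cf (cell v) (rv k) * cf (cplx \<phi>) (- rv k)"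
proof -
 note [measurable] = L2_perD(1)[OF v] test_function_facts(2)[OF \<phi>]
 note per = L2_perD(4)[OF v]
 have vi: "integrable lborel (\<lambda>x. indicator Ycell x * v x)"
  using bdd_supp_integrable[OF bdd_supp_cell[OF L2_perD(3)[OF v]]] by (simp add: cell_def[abs_def])
 define F where "F s z = complex_of_real (\<phi> s) * (cnj (plane_wave z (rv k)) * indicator Ycell z * v (z + s))" for s z
 have "integrable (lborel \<Otimes>\<^sub>M lborel) (\<lambda>(s, z). F s z)"
 proof (rule lborel_pair.Fubini_integrable)
  show "(\<lambda>(s, z). F s z) \<in> borel_measurable (lborel \<Otimes>\<^sub>M lborel)" unfolding F_def by measurable
  have n: "integrable lborel (\<lambda>z. indicator Ycell z * complex_of_real (norm (v z)))"
  proof -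
   have "(\<lambda>z. indicator Ycell z * complex_of_real (norm (v z))) = (\<lambda>z. complex_of_real (norm (indicator Ycell z * v z)))"
    by (auto simp: indicator_def)
   then show ?thesis using integrable_of_real[OF integrable_norm[OF vi]] by simp
  qed
  have nper: "ae x. \<forall>k. complex_of_real (norm (v (x + rv k))) = complex_of_real (norm (v x))"
   using per by eventually_elim simp
  have "(LI z. norm (case (s, z) of (s, z) => F s z)) = \<bar>\<phi> s\<bar> * Re (LI z. indicator Ycell z * complex_of_real (norm (v (z + s))))" for s
  proof -
   have "norm (F s z) = \<bar>\<phi> s\<bar> * Re (indicator Ycell z * complex_of_real (norm (v (z + s))))" for z
    by (simp add: F_def norm_mult indicator_def)
   then show ?thesis using integral_Re[OF integral_Ycell_translate(1)[OF _ nper n, of s]] by simp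
  qed
  also have "\<bar>\<phi> s\<bar> * Re (LI z. indicator Ycell z * complex_of_real (norm (v (z + s)))) = \<bar>\<phi> s\<bar> * Re (LI z. indicator Ycell z * complex_of_real (norm (v z)))" for s
   by (subst integral_Ycell_translate(2)[OF _ nper n]) auto
  finally show "integrable lborel (\<lambda>s. LI z. norm (case (s, z) of (s, z) => F s z))"
   using integrable_test_function[OF \<phi>] by simp
  show "ae s. integrable lborel (\<lambda>z. case (s, z) of (s, z) => F s z)"
  proof (rule AE_I2)
   fix s
   have "integrable lborel (\<lambda>z. indicator Ycell z * v (z + s))"
    by (rule integral_Ycell_translate(1)[OF _ per vi]) simp
   then have "integrable lborel (\<lambda>z. complex_of_real (\<phi> s) * (indicator Ycell z * v (z + s)))"
    by (rule integrable_mult_right)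
   then show "integrable lborel (\<lambda>z. case (s, z) of (s, z) => F s z)"
    by (rule B_integrable_bound) (auto simp: F_def norm_mult)
  qed
 qed
 then have Fub: "(LI z. LI s. F s z) = (LI s. LI z. F s z)"
  by (rule lborel_pair.Fubini_integral)
 have "cnj (plane_wave z (rv k)) * indicator Ycell z * (LI x. \<phi> (x - z) *R v x) = (LI s. F s z)" for z
 proof -
  have "(LI x. \<phi> (x - z) *R v x) = (LI s. complex_of_real (\<phi> s) * v (z + s))"
   using integral_translate[of "\<lambda>x. \<phi> (x - z) *R v x" z] by (simp add: scaleR_conv_of_real add.commute)
  then show ?thesis unfolding F_def by (simp only: integral_mult_right_zero[symmetric] ac_simps)
 qed
 then have "(LI z. cnj (plane_wave z (rv k)) * indicator Ycell z * (LI x. \<phi> (x - z) *R v x))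
  = (LI s. LI z. F s z)" using Fub by simp
 also have "... = (LI s. cf (cell v) (rv k) * (complex_of_real (\<phi> s) * plane_wave s (rv k)))"
 proof (rule B_integral_cong[OF refl])
  fix s
  define g where "g z = v z * cnj (plane_wave z (rv k))" for z
  have gper: "ae x. \<forall>l. g (x + rv l) = g x"
   using per by eventually_elim (simp add: g_def plane_wave_add_left)
  have gi: "integrable lborel (\<lambda>x. indicator Ycell x * g x)"
   by (rule B_integrable_bound[OF vi]) (auto simp: g_def norm_mult)
  have "(LI z. F s z) = (LI z. complex_of_real (\<phi> s) * plane_wave s (rv k) * (indicator Ycell z * g (z + s)))"
  proof (rule B_integral_cong[OF refl])
   fix z
   have "cnj (plane_wave z (rv k)) = plane_wave s (rv k) * cnj (plane_wave (z + s) (rv k))"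
    by (simp add: plane_wave_add_left mult.left_commute[of "plane_wave s _"])
   then show "F s z = complex_of_real (\<phi> s) * plane_wave s (rv k) * (indicator Ycell z * g (z + s))"
    by (simp add: F_def g_def ac_simps)
  qed
  also have "... = complex_of_real (\<phi> s) * plane_wave s (rv k) * (LI z. indicator Ycell z * g (z + s))"
   by simp
  also have "(LI z. indicator Ycell z * g (z + s)) = (LI z. indicator Ycell z * g z)"
   by (rule integral_Ycell_translate(2)[OF _ gper gi]) (simp add: g_def[abs_def])
  also have "... = cf (cell v) (rv k)" by (simp add: cf_def cell_def g_def mult.assoc)
  finally show "(LI z. F s z) = cf (cell v) (rv k) * (complex_of_real (\<phi> s) * plane_wave s (rv k))"
   by (simp add: ac_simps)
 qed
 also have "... = cf (cell v) (rv k) * cf (cplx \<phi>) (- rv k)"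
  by (simp add: cf_def cnj_plane_wave)
 finally show ?thesis .
qed

text \<open>Averaged over translates in the cell, the definition of the weak derivative becomes an identity of Fourier
 coefficients times the transform of a bump, which is chosen nonzero at the frequency.\<close>

lemma coefficients_weak_deriv:
 fixes u v :: "real^'n => complex"
 assumes u: "u \<in> L2_per" and v: "v \<in> L2_per" and w: "has_weak_deriv [j] u v"
 shows "cf (cell v) (rv k) = 2 * of_real pi * \<i> * of_int (k $ j) * cf (cell u) (rv k)"
proof -
 obtain n where n: "cf (cplx (bump 1 (\<chi> i. - (1 / real (Suc n))) (\<chi> i. 1 / real (Suc n)))) (- rv k) \<noteq> 0"
  using bump_cf_nonzero by blast
 define a b where "a = (\<chi> i. - (1 / real (Suc n)) :: real^'n)" and "b = (\<chi> i. 1 / real (Suc n) :: real^'n)"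
 define \<phi> where "\<phi> = bump 1 a b"
 have \<phi>: "test_function \<phi>" "cf (cplx \<phi>) (- rv k) \<noteq> 0"
  using n by (auto simp: \<phi>_def a_def b_def intro: test_function_bump)
 have d: "test_function (partial_d j \<phi>)" using test_function_iter[OF \<phi>(1), of "[j]"] by simp
 have "(LI x. partial_d j \<phi> (x - z) *R u x) = - (LI x. \<phi> (x - z) *R v x)" for z
 proof -
  have "(\<lambda>x. \<phi> (x - z)) = bump 1 (a + z) (b + z)" by (simp add: \<phi>_def bump_translate)
  then have "test_function (\<lambda>x. \<phi> (x - z))" using test_function_bump[of 1] by simp
  then have "(LI x. iter_partial [j] (\<lambda>x. \<phi> (x - z)) x *R u x) = (-1::real) ^ length [j] *R (LI x. \<phi> (x - z) *R v x)"
   using w unfolding has_weak_deriv_def by blast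
  then show ?thesis by (simp add: partial_d_shift[OF \<phi>(1)])
 qed
 then have "cf (cell u) (rv k) * cf (cplx (partial_d j \<phi>)) (- rv k) = - (cf (cell v) (rv k) * cf (cplx \<phi>) (- rv k))"
  unfolding periodic_average[OF u d, symmetric] periodic_average[OF v \<phi>(1), symmetric] by simp
 then show ?thesis using \<phi>(2) by (simp add: cf_partial_d[OF \<phi>(1)] mult.commute)
qed

lemma finite_int_vec_ball: "finite {k :: int^'n. norm (rv k) \<le> r}"
proof -
 have "{k :: int^'n. norm (rv k) \<le> r} \<subseteq> vec_lambda ` (UNIV \<rightarrow>\<^sub>E {- \<lceil>r\<rceil>..\<lceil>r\<rceil>})"
 proof
  fix k :: "int^'n" assume "k \<in> {k. norm (rv k) \<le> r}"
  then have "\<bar>of_int (k $ i)\<bar> \<le> r" for i using component_le_norm_cart[of "rv k" i] by simp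
  then have "\<bar>k $ i\<bar> \<le> \<lceil>r\<rceil>" for i by (metis le_of_int_ceiling of_int_abs of_int_le_iff order_trans)
  then have "(\<lambda>i. k $ i) \<in> UNIV \<rightarrow>\<^sub>E {- \<lceil>r\<rceil>..\<lceil>r\<rceil>}" by (auto simp: abs_le_iff minus_le_iff)
  then show "k \<in> vec_lambda ` (UNIV \<rightarrow>\<^sub>E {- \<lceil>r\<rceil>..\<lceil>r\<rceil>})" by (intro image_eqI[of _ _ "\<lambda>i. k $ i"]) auto
 qed
 then show ?thesis by (rule finite_subset) (intro finite_imageI finite_PiE, auto)
qed

lemma plane_wave_L2_per: "(\<lambda>x. c * plane_wave x (rv k)) \<in> L2_per"
 unfolding L2_per_def mem_Collect_eq
proof (intro conjI)
 show m: "(\<lambda>x. c * plane_wave x (rv k)) \<in> bmeas" by measurable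
 have "rv (axis i 1) = axis i (1::real)" for i :: 'a by (simp add: vec_eq_iff axis_def)
 then have "plane_wave (axis i 1) (rv k) = 1" for i using plane_wave_int[of "axis i 1" k] by simp
 then show "periodic (\<lambda>x. c * plane_wave x (rv k))" by (simp add: periodic_def plane_wave_add_left)
 show "(\<lambda>x. c * plane_wave x (rv k)) \<in> L2 Ycell"
  unfolding cell_L2_iff[OF m] cell_def[abs_def] by (rule L2_Ycell_bounded[where B="norm c"]) (auto simp: norm_mult)
qed

lemma plane_wave_locally_integrable: "locally_integrable (\<lambda>x. c * plane_wave x (xi :: real^'n))"
proof -
 have "integrable lborel (\<lambda>x::real^'n. norm c * indicator (cball 0 R) x)" for R
  using emeasure_bounded_finite[of "cball (0::real^'n) R"] by (intro integrable_mult_right) (simp add: integrable_indicator_iff)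
 then have "integrable lborel (\<lambda>x. indicator (cball 0 R) x *R (c * plane_wave x xi))" for R
 proof (rule B_integrable_bound)
  have [measurable]: "cball (0::real^'n) R \<in> sets borel" by simp
  show "(\<lambda>x. indicator (cball 0 R) x *R (c * plane_wave x xi)) \<in> borel_measurable lborel" by measurable
  show "ae x. norm (indicator (cball 0 R) x *R (c * plane_wave x xi)) \<le> norm (norm c * indicator (cball 0 R) x)"
   by (simp add: norm_mult)
 qed
 then show ?thesis by (simp add: locally_integrable_def set_integrable_def)
qed

lemma plane_wave_weak_deriv:
 "has_weak_deriv [j] (\<lambda>x. plane_wave x xi) (\<lambda>x. 2 * of_real pi * \<i> * of_real (xi $ j) * plane_wave x xi)"
 unfolding has_weak_deriv_def
proof (intro conjI allI impI)
 fix \<phi> :: "real^'a => real" assume \<phi>: "test_function \<phi>"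
 have e: "(LI x. \<psi> x *R (c * plane_wave x xi)) = c * cf (cplx \<psi>) (- xi)" for \<psi> :: "real^'a => real" and c
  by (simp add: cf_def cnj_plane_wave scaleR_conv_of_real mult.left_commute[of _ c])
 show "(LI x. iter_partial [j] \<phi> x *R plane_wave x xi)
   = (-1::real) ^ length [j] *R (LI x. \<phi> x *R (2 * of_real pi * \<i> * of_real (xi $ j) * plane_wave x xi))"
  using e[of "partial_d j \<phi>" 1] by (simp add: e cf_partial_d[OF \<phi>])
qed (use plane_wave_locally_integrable[of 1] plane_wave_locally_integrable in simp_all)

lemma plane_wave_H1_per: "(\<lambda>x. plane_wave x (rv k)) \<in> H1_per"
 unfolding H1_per_def mem_Collect_eq
 using plane_wave_L2_per[of 1 k] plane_wave_L2_per plane_wave_weak_deriv by fastforce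

lemma nn_integral_periodic_ball:
 fixes h :: "real^'n => ennreal"
 assumes [measurable]: "h \<in> bmeas" and per: "ae x. \<forall>k. h (x + rv k) = h x"
 shows "(NI x. indicator (cball 0 R) x * h x)
  \<le> of_nat (card {k :: int^'n. norm (rv k) \<le> R + CARD('n)}) * (NI x. indicator Ycell x * h x)"
proof -
 let ?F = "{k :: int^'n. norm (rv k) \<le> R + CARD('n)}"
 have [measurable]: "cball (0::real^'n) R \<in> sets borel" by simp
 have "(NI x. indicator (cball 0 R) x * h x)
  = (NI x. (\<integral>\<^sup>+k. indicator Ycell x * (indicator (cball 0 R) (x + 1 *R rv k) * h (x + 1 *R rv k)) \<partial>cspace))"
  by (rule nn_integral_tiling[OF tiles_Ycell]) measurable
 also have "... \<le> (NI x. of_nat (card ?F) * (indicator Ycell x * h x))"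
 proof (rule nn_integral_mono_AE, use per in eventually_elim)
  case (elim x)
  have "(\<integral>\<^sup>+k. indicator Ycell x * (indicator (cball 0 R) (x + 1 *R rv k) * h (x + 1 *R rv k)) \<partial>cspace)
   \<le> (\<integral>\<^sup>+k. (indicator Ycell x * h x) * indicator ?F k \<partial>cspace)"
  proof (rule nn_integral_mono)
   fix k :: "int^'n"
   show "indicator Ycell x * (indicator (cball 0 R) (x + 1 *R rv k) * h (x + 1 *R rv k)) \<le> (indicator Ycell x * h x) * indicator ?F k"
   proof (cases "x \<in> Ycell \<and> norm (x + rv k) \<le> R")
    case True
    then have "norm (rv k) \<le> R + CARD('n)"
     using norm_triangle_ineq4[of "x + rv k" x] Ycell_bounded[of x] by simp
    then show ?thesis using elim by (simp add: indicator_def)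
   qed (auto simp: indicator_def)
  qed
  also have "... = (indicator Ycell x * h x) * of_nat (card ?F)"
   by (subst nn_integral_cmult_indicator) (auto simp: finite_int_vec_ball)
  finally show ?case by (simp add: mult.commute)
 qed
 also have "... = of_nat (card ?F) * (NI x. indicator Ycell x * h x)"
  by (rule nn_integral_cmult) measurable
 finally show ?thesis .
qed

lemma periodic_ball_L2:
 fixes u :: "real^'n => complex"
 assumes "u \<in> bmeas" and per: "ae x. \<forall>k. u (x + rv k) = u x" and c: "cell u \<in> LL" and e: "eps > 0"
 shows "(\<lambda>x. indicator (cball 0 R) x * u ((1/eps) *R x)) \<in> LL"
  and "(nrm (\<lambda>x. indicator (cball 0 R) x * u ((1/eps) *R x)))^2
   \<le> eps ^ CARD('n) * card {k :: int^'n. norm (rv k) \<le> R/eps + CARD('n)} * (nrm (cell u))^2"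
proof -
 note [measurable] = assms(1)
 let ?N = "card {k :: int^'n. norm (rv k) \<le> R/eps + CARD('n)}"
 let ?v = "\<lambda>x. indicator (cball 0 R) x * u ((1/eps) *R x)"
 have [measurable]: "cball (0::real^'n) R \<in> sets borel" by simp
 have "(NI x. ennreal ((norm (?v x))^2))
  = ennreal (eps ^ CARD('n)) * (NI x. indicator (cball 0 (R/eps)) x * ennreal ((norm (u x))^2))"
  using e by (subst nn_integral_affine[of _ eps 0]) (auto simp: indicator_def field_simps intro!: arg_cong2[where f="(*)"] nn_integral_cong)
 also have "... \<le> ennreal (eps ^ CARD('n)) * (of_nat ?N * (NI x. indicator Ycell x * ennreal ((norm (u x))^2)))"
  by (intro mult_left_mono nn_integral_periodic_ball) (use per in auto)
 also have "(NI x. indicator Ycell x * ennreal ((norm (u x))^2)) = ennreal ((nrm (cell u))^2)"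
  unfolding nn_integral_L2[OF c, symmetric] by (intro nn_integral_cong) (simp add: cell_def indicator_def)
 also have "ennreal (eps ^ CARD('n)) * (of_nat ?N * ennreal ((nrm (cell u))^2)) = ennreal (eps ^ CARD('n) * ?N * (nrm (cell u))^2)"
  using e by (simp add: ennreal_mult mult.assoc ennreal_of_nat_eq_real_of_nat)
 finally have *: "(NI x. ennreal ((norm (?v x))^2)) \<le> ennreal (eps ^ CARD('n) * ?N * (nrm (cell u))^2)" .
 show "?v \<in> LL" by (rule L2_nn_integralI(1)[OF _ *]) (use e in auto)
 show "(nrm ?v)^2 \<le> eps ^ CARD('n) * ?N * (nrm (cell u))^2"
  by (rule L2_nn_integralI(2)[OF _ *]) (use e in auto)
qed

lemma summable_complex_integrable:
 fixes f :: "'a => complex"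
 assumes "(f has_sum s) UNIV" shows "integrable (cspace) f" "(LINT k|cspace. f k) = s"
proof -
 have "f summable_on UNIV" using assms by (auto simp: summable_on_def)
 then have "(\<lambda>k. norm (f k)) summable_on UNIV" by (simp add: summable_on_iff_abs_summable_on_complex)
 then have i: "Infinite_Set_Sum.abs_summable_on f UNIV" by (simp only: abs_summable_equivalent)
 then show "integrable (cspace) f" by (simp add: Infinite_Set_Sum.abs_summable_on_def)
 show "(LINT k|cspace. f k) = s"
  using infsetsum_infsum[OF i] assms by (simp add: infsetsum_def infsumI)
qed

text \<open>On the ball that supports \<open>u\<close>, which meets finitely many cells, the Fourier sums of \<open>v\<close> converge in the mean.
 Each term of a Fourier sum contributes a value of the transform of \<open>u\<close> on the fibre of \<open>eta\<close>.\<close>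

lemma parseval_periodic:
 fixes u v :: "real^'n => complex" and eps :: real
 assumes u: "bdd_supp u" and v: "v \<in> L2_per" and e: "eps > 0"
 shows "integrable (cspace) (\<lambda>k. cf u (eta + (1/eps) *R rv k) * cnj (cf (cell v) (rv k)))"
  and "(LINT k|cspace. cf u (eta + (1/eps) *R rv k) * cnj (cf (cell v) (rv k)))
   = (LI x. u x * cnj (v ((1/eps) *R x) * plane_wave x eta))"
proof -
 obtain R where R: "\<And>x. u x \<noteq> 0 ==> norm x \<le> R" using bdd_supp_obtain[OF u] by blast
 note uL = bdd_suppD[OF u] note L2_measurable[OF uL, measurable] and vp = L2_perD[OF v]
 note [measurable] = vp(1)
 let ?a = "\<lambda>k. cf (cell v) (rv k)"
 let ?g = "\<lambda>F x. (\<Sum>k\<in>F. ?a k * plane_wave x (rv k))"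
 let ?w = "\<lambda>x. u x * cnj (plane_wave x eta)"
 let ?C = "sqrt (eps ^ CARD('n) * card {k :: int^'n. norm (rv k) \<le> R/eps + CARD('n)})"
 have w: "?w \<in> LL" by (rule L2_bound(1)[OF uL]) (auto simp: norm_mult)
 let ?d = "\<lambda>F x. indicator (cball 0 R) x * (v ((1/eps) *R x) - ?g F ((1/eps) *R x))"
 have d: "?d F \<in> LL" "nrm (?d F) \<le> ?C * nrm (\<lambda>x. cell v x - tp F ?a x)" for F
 proof -
  let ?h = "\<lambda>x. v x - ?g F x"
  have ch: "cell ?h = (\<lambda>x. cell v x - tp F ?a x)" by (auto simp: cell_def tp_def right_diff_distrib)
  have hL: "cell ?h \<in> LL" unfolding ch by (intro L2_diff vp tp_L2)
  have hp: "ae x. \<forall>k. ?h (x + rv k) = ?h x"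
   using vp(4) by eventually_elim (simp add: plane_wave_add_left)
  note p = periodic_ball_L2[of ?h, OF _ hp hL e, of R]
  show "?d F \<in> LL" by (rule p(1)) measurable
  have "(nrm (?d F))^2 \<le> (?C * nrm (\<lambda>x. cell v x - tp F ?a x))^2"
   using p(2) e unfolding ch by (simp add: power_mult_distrib)
  then show "nrm (?d F) \<le> ?C * nrm (\<lambda>x. cell v x - tp F ?a x)" by (rule power2_le_imp_le) (use e in simp)
 qed
 let ?I = "LI x. u x * cnj (v ((1/eps) *R x) * plane_wave x eta)"
 have sumF: "(\<Sum>k\<in>F. cf u (eta + (1/eps) *R rv k) * cnj (?a k)) = ?I - ip ?w (?d F)" for F
 proof -
  have ig: "integrable lborel (\<lambda>x. u x * cnj (plane_wave x xi))" for xi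
   by (rule B_integrable_bound[OF bdd_supp_integrable[OF u]]) (auto simp: norm_mult)
  have "(\<Sum>k\<in>F. cf u (eta + (1/eps) *R rv k) * cnj (?a k))
   = (LI x. (\<Sum>k\<in>F. cnj (?a k) * (u x * cnj (plane_wave x (eta + (1/eps) *R rv k)))))"
   unfolding cf_def[of u] by (subst B_integral_sum) (auto intro!: integrable_mult_right ig simp: mult.commute)
  also have "... = (LI x. ?w x * cnj (?g F ((1/eps) *R x)))"
   by (intro B_integral_cong)
     (auto simp: sum_distrib_left plane_wave_add_right plane_wave_scale ac_simps)
  finally have 1: "(\<Sum>k\<in>F. cf u (eta + (1/eps) *R rv k) * cnj (?a k)) = (LI x. ?w x * cnj (?g F ((1/eps) *R x)))" .
  have iv: "integrable lborel (\<lambda>x. ?w x * cnj (v ((1/eps) *R x)))"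
  proof -
   have "integrable lborel (\<lambda>x. ?w x * cnj (indicator (cball 0 R) x * v ((1/eps) *R x)))"
    by (intro integrable_ip w periodic_ball_L2(1) vp e)
   also have "(\<lambda>x. ?w x * cnj (indicator (cball 0 R) x * v ((1/eps) *R x))) = (\<lambda>x. ?w x * cnj (v ((1/eps) *R x)))"
    using R by (fastforce simp: indicator_def)
   finally show ?thesis .
  qed
  have id: "integrable lborel (\<lambda>x. ?w x * cnj (?d F x))" by (intro integrable_ip w d)
  have "(LI x. ?w x * cnj (v ((1/eps) *R x))) - ip ?w (?d F) = (LI x. ?w x * cnj (?g F ((1/eps) *R x)))"
   unfolding ip_def B_integral_diff[OF iv id, symmetric]
  proof (rule B_integral_cong[OF refl])
   fix x
   show "?w x * cnj (v ((1/eps) *R x)) - ?w x * cnj (?d F x) = ?w x * cnj (?g F ((1/eps) *R x))"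
   proof (cases "u x = 0")
    case False
    then have "x \<in> cball 0 R" using R by simp
    then have "?d F x = v ((1/eps) *R x) - ?g F ((1/eps) *R x)" by simp
    then show ?thesis by (simp only: complex_cnj_diff right_diff_distrib) simp
   qed simp
  qed
  with 1 show ?thesis by (simp add: mult.assoc mult.commute[of "cnj (plane_wave _ _)"])
 qed
 have "((\<lambda>F. \<Sum>k\<in>F. cf u (eta + (1/eps) *R rv k) * cnj (?a k)) \<longlongrightarrow> ?I - 0) (finite_subsets_at_top UNIV)"
  unfolding sumF
 proof (rule tendsto_diff[OF tendsto_const], rule Lim_null_comparison)
  show "\<forall>\<^sub>F F in finite_subsets_at_top UNIV. norm (ip ?w (?d F)) \<le> nrm ?w * (?C * nrm (\<lambda>x. cell v x - tp F ?a x))"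
   by (intro always_eventually allI order_trans[OF norm_ip_le[OF w d(1)]] mult_left_mono d(2)) simp
  have "((\<lambda>F. nrm ?w * (?C * nrm (\<lambda>x. cell v x - tp F ?a x))) \<longlongrightarrow> nrm ?w * (?C * 0)) (finite_subsets_at_top UNIV)"
   by (intro tendsto_mult_left fourier_series_converges vp cell_outside)
  then show "((\<lambda>F. nrm ?w * (?C * nrm (\<lambda>x. cell v x - tp F ?a x))) \<longlongrightarrow> 0) (finite_subsets_at_top UNIV)" by simp
 qed
 then have "((\<lambda>k. cf u (eta + (1/eps) *R rv k) * cnj (?a k)) has_sum ?I) UNIV" by (simp add: has_sum_def)
 from summable_complex_integrable[OF this]
 show "integrable (cspace) (\<lambda>k. cf u (eta + (1/eps) *R rv k) * cnj (?a k))"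
  "(LINT k|cspace. cf u (eta + (1/eps) *R rv k) * cnj (?a k)) = ?I" .
qed

section \<open>Bloch eigenfunctions in Fourier coefficients\<close>

lemma cf_add:
 assumes "integrable lborel f" "integrable lborel g" shows "cf (\<lambda>x. f x + g x) xi = cf f xi + cf g xi"
proof -
 have "integrable lborel (\<lambda>x. h x * cnj (plane_wave x xi))" if h: "integrable lborel h" for h :: "real^'a => complex"
  by (rule B_integrable_bound[OF h]) (use h in \<open>auto simp: norm_mult\<close>)
 with assms show ?thesis unfolding cf_def distrib_right
  by (intro B_integral_add) auto
qed

lemma cf_cmult: "cf (\<lambda>x. a * f x) xi = a * cf f xi"
 unfolding cf_def by (simp add: mult.assoc)

lemma cf_sum:
 "finite I ==> (\<And>i. i \<in> I ==> integrable lborel (f i)) ==> cf (\<lambda>x. \<Sum>i\<in>I. f i x) xi = (\<Sum>i\<in>I. cf (f i) xi)"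
proof (induction I rule: finite_induct)
 case empty then show ?case by (simp add: cf_def)
next
 case (insert i I) then show ?case by (simp add: cf_add)
qed

lemma cf_AE_cong:
 assumes "f \<in> bmeas" "g \<in> bmeas" "ae x. f x = g x"
 shows "cf f xi = cf g xi"
 unfolding cf_def using assms by (intro integral_cong_AE) auto

lemma cf_plane_wave_mult: "cf (\<lambda>x. plane_wave x zeta * f x) xi = cf f (xi - zeta)"
 using cf_translate_arg[of f xi "- zeta"] by (simp add: cnj_plane_wave mult.commute)

lemma trig_periodic: "trig p ==> p (x + rv k) = p x"
 by (induction rule: trig.induct) (auto simp: plane_wave_add_left)

lemma trig_bounded: assumes "trig p" obtains B where "\<And>x. norm (p x) \<le> B"
proof -
 have "\<exists>B. \<forall>x. norm (p x) \<le> B" using assms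
 proof induction
  case (mono c k) show ?case by (intro exI[of _ "norm c"]) (simp add: norm_mult)
 next
  case (add p q)
  then obtain B C where "\<And>x. norm (p x) \<le> B" "\<And>x. norm (q x) \<le> C" by blast
  then show ?case by (intro exI[of _ "B + C"]) (meson add_mono norm_triangle_ineq order_trans)
 qed
 with that show ?thesis by blast
qed

text \<open>Multiplication by a bounded periodic function acts on the sequence of Fourier coefficients over each
 fibre \<open>eta + (1/eps) k\<close> in the same way as on the Fourier coefficients of a function on the cell:
 this is clear for exponentials, and bounded limits preserve it.\<close>

lemma periodic_mult_trig:
 fixes F Fh :: "real^'n => complex" and f :: "real^'n => real^'n => complex" and eps :: real
 assumes p: "trig p" and F: "FT F Fh"
  and f: "ae eta. eta \<in> Z --> integrable lborel (f eta) \<and> (\<forall>k. Fh (eta + (1/eps) *R rv k) = cf (f eta) (rv k))"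
 shows "\<exists>H. FT (\<lambda>x. p ((1/eps) *R x) * F x) H \<and>
  (ae eta. eta \<in> Z --> (\<forall>k. H (eta + (1/eps) *R rv k) = cf (\<lambda>x. p x * f eta x) (rv k)))"
 using p
proof induction
 case (mono c l)
 have "FT (\<lambda>x. c * (plane_wave x ((1/eps) *R rv l) * F x)) (\<lambda>xi. c * Fh (xi - (1/eps) *R rv l))"
  by (intro FT_cmult FT_modulate F)
 then have "FT (\<lambda>x. c * plane_wave ((1/eps) *R x) (rv l) * F x) (\<lambda>xi. c * Fh (xi - (1/eps) *R rv l))"
  by (simp add: plane_wave_scale mult.assoc)
 moreover have "ae eta. eta \<in> Z --> (\<forall>k. c * Fh (eta + (1/eps) *R rv k - (1/eps) *R rv l) = cf (\<lambda>x. c * plane_wave x (rv l) * f eta x) (rv k))"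
  using f
 proof eventually_elim
  case (elim eta)
  show ?case
  proof (intro impI allI)
   fix k assume "eta \<in> Z"
   then have "Fh (eta + (1/eps) *R rv (k - l)) = cf (f eta) (rv k - rv l)"
    using elim unfolding rv_diff[of k l, symmetric] by blast
   moreover have eq: "eta + (1/eps) *R rv k - (1/eps) *R rv l = eta + (1/eps) *R rv (k - l)"
    by (simp add: rv_diff scaleR_diff_right)
   ultimately show "c * Fh (eta + (1/eps) *R rv k - (1/eps) *R rv l) = cf (\<lambda>x. c * plane_wave x (rv l) * f eta x) (rv k)"
    by (simp only: eq cf_cmult cf_plane_wave_mult mult.assoc)
  qed
 qed
 ultimately show ?case by blast
next
 case (add p q)
 then obtain H1 H2 where H: "FT (\<lambda>x. p ((1/eps) *R x) * F x) H1" "FT (\<lambda>x. q ((1/eps) *R x) * F x) H2"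
  "ae eta. eta \<in> Z --> (\<forall>k. H1 (eta + (1/eps) *R rv k) = cf (\<lambda>x. p x * f eta x) (rv k))"
  "ae eta. eta \<in> Z --> (\<forall>k. H2 (eta + (1/eps) *R rv k) = cf (\<lambda>x. q x * f eta x) (rv k))" by blast
 have tm: "integrable lborel (\<lambda>x. g x * h x)" if g: "trig g" and h: "integrable lborel h" for g h :: "real^'n => complex"
 proof -
  obtain B where B: "\<And>x. norm (g x) \<le> B" using trig_bounded[OF g] by blast
  have "B \<ge> 0" using B[of 0] norm_ge_zero order_trans by blast
  with B have le: "norm (g x * h x) \<le> norm (complex_of_real B * h x)" for x
   by (simp add: norm_mult mult_right_mono)
  show ?thesis
   by (rule B_integrable_bound[OF integrable_mult_right[OF h, of "complex_of_real B"]])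
     (use le trig_measurable[OF g] h in auto)
 qed
 have "ae eta. eta \<in> Z --> (\<forall>k. H1 (eta + (1/eps) *R rv k) + H2 (eta + (1/eps) *R rv k) = cf (\<lambda>x. (p x + q x) * f eta x) (rv k))"
  using H(3,4) f
 proof eventually_elim
  case (elim eta)
  then show ?case using tm[OF add.hyps(1), of "f eta"] tm[OF add.hyps(2), of "f eta"]
   by (auto simp: cf_add distrib_right)
 qed
 then show ?case using FT_add[OF H(1,2)]
  by (intro exI[of _ "\<lambda>xi. H1 xi + H2 xi"]) (simp add: distrib_right)
qed

lemma cf_mult_limit:
 fixes g :: "real^'n => complex"
 assumes p: "\<And>n. trig (p n)" "\<And>n x. norm (p n x) \<le> B" "ae x. x \<in> Ycell --> (\<lambda>n. p n x) ----> b x"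
  and b: "b \<in> bmeas" and g: "integrable lborel g" "\<And>x. x \<notin> Ycell ==> g x = 0"
 shows "(\<lambda>n. cf (\<lambda>x. p n x * g x) xi) ----> cf (\<lambda>x. b x * g x) xi"
 unfolding cf_def
proof (rule integral_dominated_convergence[where w="\<lambda>x. B * norm (g x)"])
 show "ae x. (\<lambda>n. p n x * g x * cnj (plane_wave x xi)) ----> b x * g x * cnj (plane_wave x xi)"
  using p(3)
 proof eventually_elim
  case (elim x)
  show ?case
  proof (cases "x \<in> Ycell")
   case True then show ?thesis using elim by (intro tendsto_intros) auto
  qed (simp add: g(2))
 qed
 show "ae x. norm (p n x * g x * cnj (plane_wave x xi)) \<le> B * norm (g x)" for n
  using p(2) by (auto simp: norm_mult intro!: AE_I2 mult_right_mono)
qed (use g(1) b trig_measurable[OF p(1)] in auto)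

lemma periodic_mult:
 fixes F Fh H b :: "real^'n => complex" and f :: "real^'n => real^'n => complex" and eps :: real
 assumes e: "eps > 0" and b [measurable]: "b \<in> bmeas" and B: "\<And>x. norm (b x) \<le> B"
  and per: "ae x. \<forall>k. b (x + rv k) = b x" and F: "FT F Fh"
  and f: "ae eta. eta \<in> Z --> integrable lborel (f eta) \<and> (\<forall>x. x \<notin> Ycell --> f eta x = 0) \<and> (\<forall>k. Fh (eta + (1/eps) *R rv k) = cf (f eta) (rv k))"
  and H: "FT (\<lambda>x. b ((1/eps) *R x) * F x) H"
 shows "ae eta. eta \<in> Z --> (\<forall>k. H (eta + (1/eps) *R rv k) = cf (\<lambda>x. b x * f eta x) (rv k))"
proof -
 obtain p where p: "\<And>n. trig (p n)" "\<And>n x. norm (p n x) \<le> 2 * B + 2"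
  "ae x. x \<in> Ycell --> (\<lambda>n. p n x) ----> b x"
  using trig_approx[OF b B] by blast
 note [measurable] = trig_measurable[OF p(1)] L2_measurable[OF FT_L2(1)[OF F]]
 have B0: "B \<ge> 0" using B[of 0] norm_ge_zero order_trans by blast
 have ex: "\<exists>Hn. FT (\<lambda>x. p n ((1/eps) *R x) * F x) Hn \<and>
  (ae eta. eta \<in> Z --> (\<forall>k. Hn (eta + (1/eps) *R rv k) = cf (\<lambda>x. p n x * f eta x) (rv k)))" for n
 proof (rule periodic_mult_trig[OF p(1) F])
  show "ae eta. eta \<in> Z --> integrable lborel (f eta) \<and> (\<forall>k. Fh (eta + (1/eps) *R rv k) = cf (f eta) (rv k))"
   using f by (rule AE_mp) simp
 qed
 from choice[OF allI, of "\<lambda>n Hn. FT (\<lambda>x. p n ((1/eps) *R x) * F x) Hn \<and>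
  (ae eta. eta \<in> Z --> (\<forall>k. Hn (eta + (1/eps) *R rv k) = cf (\<lambda>x. p n x * f eta x) (rv k)))", OF ex]
 obtain Hn where Hn: "\<And>n. FT (\<lambda>x. p n ((1/eps) *R x) * F x) (Hn n)"
  "\<And>n. ae eta. eta \<in> Z --> (\<forall>k. Hn n (eta + (1/eps) *R rv k) = cf (\<lambda>x. p n x * f eta x) (rv k))"
  by blast
 have conv: "ae x. (\<lambda>n. p n x) ----> b x"
 proof -
  have "ae x. \<exists>!k. x + 1 *R rv k \<in> (Ycell :: (real^'n) set)" using tiles_Ycell by (simp add: tiles_def)
  then show ?thesis using AE_tiling[OF p(3), of 1] per
  proof eventually_elim
   case (elim x)
   then obtain k where "x + rv k \<in> Ycell" by auto
   then have "(\<lambda>n. p n (x + rv k)) ----> b (x + rv k)" using elim(2) by simp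
   then show ?case using elim(3) by (simp add: trig_periodic[OF p(1)])
  qed
 qed
 have conv': "ae x. (\<lambda>n. p n ((1/eps) *R x)) ----> b ((1/eps) *R x)"
  using AE_affine[OF conv, of "1/eps" 0] e by simp
 have lim: "(\<lambda>n. nrm (\<lambda>x. p n ((1/eps) *R x) * F x - b ((1/eps) *R x) * F x)) ----> 0"
 proof (rule L2_dominated_convergence(3))
  show "(\<lambda>x. complex_of_real (2 * B + 2) * F x) \<in> LL" by (intro L2_cmult FT_L2(1)[OF F])
  show "ae x. (\<lambda>n. p n ((1/eps) *R x) * F x) ----> b ((1/eps) *R x) * F x"
   using conv' by eventually_elim (intro tendsto_intros)
  have "norm (complex_of_real (2 * B + 2)) = 2 * B + 2" unfolding norm_of_real using B0 by simp
  then show "ae x. norm (p n ((1/eps) *R x) * F x) \<le> norm (complex_of_real (2 * B + 2) * F x)" for n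
   unfolding norm_mult by (auto intro!: mult_right_mono p(2))
 qed measurable
 have "(\<lambda>n. nrm (\<lambda>xi. Hn n xi - H xi)) ----> 0"
  using lim FT_nrm[OF FT_diff[OF Hn(1) H]] by simp
 then obtain r where r: "strict_mono (r::nat=>nat)" "ae xi. (\<lambda>n. Hn (r n) xi) ----> H xi"
  using L2_tendsto_AE_subseq[of Hn H, OF FT_L2(2)[OF Hn(1)] FT_L2(2)[OF H]] by blast
 have "ae eta. \<forall>n. eta \<in> Z --> (\<forall>k. Hn n (eta + (1/eps) *R rv k) = cf (\<lambda>x. p n x * f eta x) (rv k))"
  unfolding AE_all_countable using Hn(2) by blast
 then show ?thesis using f AE_tiling[OF r(2), of "1/eps"]
 proof eventually_elim
  case (elim eta)
  show ?case
  proof (intro impI allI)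
   fix k assume Z: "eta \<in> Z"
   have "(\<lambda>n. cf (\<lambda>x. p n x * f eta x) (rv k)) ----> cf (\<lambda>x. b x * f eta x) (rv k)"
    by (rule cf_mult_limit[OF p b]) (use elim(2) Z in auto)
   then have "(\<lambda>n. cf (\<lambda>x. p (r n) x * f eta x) (rv k)) ----> cf (\<lambda>x. b x * f eta x) (rv k)"
    using r(1) by (rule LIMSEQ_subseq_LIMSEQ[unfolded o_def])
   moreover have "(\<lambda>n. cf (\<lambda>x. p (r n) x * f eta x) (rv k)) ----> H (eta + (1/eps) *R rv k)"
    using elim(1,3) Z by simp
   ultimately show "H (eta + (1/eps) *R rv k) = cf (\<lambda>x. b x * f eta x) (rv k)"
    by (rule LIMSEQ_unique[rotated])
  qed
 qed
qed

lemma cf_mult_measurable: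
 fixes b :: "real^'n => complex" and f :: "real^'n => real^'n => complex"
 assumes b: "b \<in> bmeas" "\<And>x. norm (b x) \<le> B"
  and f: "\<And>zeta. integrable lborel (f zeta)" "\<And>zeta x. x \<notin> Ycell ==> f zeta x = 0"
  and m: "\<And>k. (\<lambda>zeta. cf (f zeta) (rv k)) \<in> bmeas"
 shows "(\<lambda>zeta. cf (\<lambda>x. b x * f zeta x) (rv k)) \<in> bmeas"
proof -
 obtain p where p: "\<And>n. trig (p n)" "\<And>n x. norm (p n x) \<le> 2 * B + 2"
  "ae x. x \<in> Ycell --> (\<lambda>n. p n x) ----> b x"
  using trig_approx[OF b] by blast
 have "(\<lambda>zeta. cf (\<lambda>x. q x * f zeta x) (rv k)) \<in> bmeas \<and> (\<forall>zeta. integrable lborel (\<lambda>x. q x * f zeta x))" if "trig q" for q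
  using that
 proof induction
  case (mono c l)
  have "integrable lborel (\<lambda>x. c * (plane_wave x (rv l) * f zeta x))" for zeta
   by (rule integrable_mult_right, rule B_integrable_bound[OF f(1)[of zeta]])
     (use borel_measurable_integrable[OF f(1)] in \<open>auto simp: norm_mult\<close>)
  then show ?case using m[of "k - l"] by (simp add: cf_cmult cf_plane_wave_mult mult.assoc rv_diff)
 next
  case (add p q) then show ?case by (simp add: distrib_right cf_add borel_measurable_add)
 qed
 then have pm: "(\<lambda>zeta. cf (\<lambda>x. p n x * f zeta x) (rv k)) \<in> bmeas" for n using p(1) by blast
 show ?thesis
  by (rule borel_measurable_LIMSEQ_metric[OF pm]) (rule cf_mult_limit[OF p b(1) f])
qed

locale bloch =
 fixes A :: "real^'n => real^'n^'n" and lam :: "nat => real^'n => real"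
  and Phi :: "nat => real^'n => real^'n => complex" and eps :: real
 assumes coeff: "coefficient_field A" and sys: "bloch_system A lam Phi" and eps: "eps > 0"
begin

text \<open>Extending by zero off the cell makes the eigenfunctions jointly measurable on the whole space.\<close>

definition P0 :: "real^'n => real^'n => complex" where
 "P0 zeta x = (if zeta \<in> Zcell then Phi 0 zeta x else 0)"

lemma P0_measurable: "(\<lambda>(x, zeta). P0 zeta x) \<in> borel_measurable (borel \<Otimes>\<^sub>M borel)"
proof -
 have M: "(\<lambda>(x, zeta). Phi 0 zeta x) \<in> borel_measurable (borel \<Otimes>\<^sub>M restrict_space borel Zcell)"
  using sys by (simp add: bloch_system_def)
 let ?S = "UNIV \<times> Zcell :: ((real^'n) \<times> (real^'n)) set"
 have "(\<lambda>z. (fst z, snd z)) \<in> measurable (restrict_space (borel \<Otimes>\<^sub>M borel) ?S) (borel \<Otimes>\<^sub>M restrict_space borel Zcell)"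
  by (intro measurable_Pair measurable_restrict_space2 measurable_restrict_space1 measurable_fst measurable_snd)
    (auto simp: space_restrict_space)
 from measurable_compose[OF this M]
 have "(\<lambda>z. Phi 0 (snd z) (fst z)) \<in> borel_measurable (restrict_space (borel \<Otimes>\<^sub>M borel) ?S)"
  by (simp add: case_prod_beta)
 moreover have "?S \<inter> space (borel \<Otimes>\<^sub>M borel) \<in> sets (borel \<Otimes>\<^sub>M borel)"
  by (simp add: space_pair_measure pair_measureI)
 ultimately have "(\<lambda>z. if z \<in> ?S then Phi 0 (snd z) (fst z) else 0) \<in> borel_measurable (borel \<Otimes>\<^sub>M borel)"
  by (subst (asm) measurable_restrict_space_iff[where c=0]) auto
 then show ?thesis by (rule measurable_cong[THEN iffD1, rotated]) (auto simp: P0_def split: if_splits)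
qed

lemma P0_measurable' [measurable (raw)]:
 assumes "f \<in> borel_measurable M" "g \<in> borel_measurable M" shows "(\<lambda>z. P0 (f z) (g z)) \<in> borel_measurable M"
 using measurable_compose[OF measurable_Pair[OF assms(2,1)] P0_measurable] by simp

definition phi :: "int^'n => real^'n => complex" where
 "phi k zeta = cf (cell (P0 zeta)) (rv k)"

lemma phi_measurable [measurable]: "phi k \<in> bmeas"
 unfolding phi_def[abs_def] cf_def cell_def by measurable

lemma phi_outside: "zeta \<notin> Zcell ==> phi k zeta = 0"
 by (simp add: phi_def P0_def cell_def cf_def)

lemma eigen:
 assumes "zeta \<in> Zcell"
 shows "shifted_eigen A zeta (lam 0 zeta) (P0 zeta)" "P0 zeta \<in> H1_per" "P0 zeta \<in> L2_per" "lam 0 zeta \<ge> 0"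
  and "nrm (cell (P0 zeta)) = 1"
proof -
 have P: "P0 zeta = Phi 0 zeta" using assms by (auto simp: P0_def)
 show e: "shifted_eigen A zeta (lam 0 zeta) (P0 zeta)" "lam 0 zeta \<ge> 0"
  using sys assms unfolding bloch_system_def P by blast+
 then show h: "P0 zeta \<in> H1_per" by (simp add: shifted_eigen_def)
 then show "P0 zeta \<in> L2_per" by (simp add: H1_per_def)
 have "(LINT x:Ycell|lborel. P0 zeta x * cnj (P0 zeta x)) = 1"
  using sys assms unfolding bloch_system_def orthonormal_basis_per_def P by auto
 also have "(LINT x:Ycell|lborel. P0 zeta x * cnj (P0 zeta x)) = ip (cell (P0 zeta)) (cell (P0 zeta))"
  unfolding set_lebesgue_integral_def ip_def
  by (intro B_integral_cong) (auto simp: cell_def indicator_def)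
 finally have "(nrm (cell (P0 zeta)))^2 = 1" unfolding ip_self by (metis of_real_1 of_real_eq_iff)
 then show "nrm (cell (P0 zeta)) = 1" by (simp add: power2_eq_1_iff) (use nrm_nonneg[of "cell (P0 zeta)"] in linarith)
qed

lemma phi_norm:
 assumes "zeta \<in> Zcell"
 shows "(\<integral>\<^sup>+k. ennreal ((norm (phi k zeta))^2) \<partial>cspace) = 1"
  and "integrable (cspace) (\<lambda>k. (norm (phi k zeta))^2)"
  and "(LINT k|cspace. (norm (phi k zeta))^2) = 1"
 using parseval_torus[OF L2_perD(3)[OF eigen(3)[OF assms]] cell_outside] eigen(5)[OF assms] by (simp_all add: phi_def)

text \<open>The symbol of the shifted derivative \<open>\<partial>\<^sub>j + 2 \<pi> i zeta\<^sub>j\<close> at the frequency \<open>k\<close>.\<close>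

definition sy :: "'n => int^'n => real^'n => complex" where
 "sy j k zeta = 2 * of_real pi * \<i> * of_real (rv k $ j + zeta $ j)"

definition grad :: "'n => real^'n => real^'n => complex" where
 "grad j zeta x = (if zeta \<in> Zcell then cell (\<lambda>x. shifted_grad zeta (P0 zeta) x $ j) x else 0)"

lemma grad_outside: "x \<notin> Ycell ==> grad j zeta x = 0"
 by (simp add: grad_def cell_def)

lemma shifted_grad_AE:
 assumes "u \<in> H1_per"
 obtains v where "v \<in> L2_per" "has_weak_deriv [j] u v" "(\<lambda>x. shifted_grad zeta u x $ j) \<in> bmeas"
  "ae x. shifted_grad zeta u x $ j = v x + 2 * of_real pi * \<i> * of_real (zeta $ j) * u x"
proof -
 obtain v where v: "v \<in> L2_per" "has_weak_deriv [j] u v" using assms by (auto simp: H1_per_def)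
 note w = weak_deriv_AE[OF v(2)]
 have u: "u \<in> bmeas" using assms by (auto simp: H1_per_def L2_per_def)
 show ?thesis
 proof (rule that[OF v])
  show "(\<lambda>x. shifted_grad zeta u x $ j) \<in> bmeas"
   unfolding shifted_grad_def using w(1) u by simp
  show "ae x. shifted_grad zeta u x $ j = v x + 2 * of_real pi * \<i> * of_real (zeta $ j) * u x"
   using w(2) by eventually_elim (simp add: shifted_grad_def)
 qed
qed

lemma grad_L2: "grad j zeta \<in> LL"
 and grad_coeff: "cf (grad j zeta) (rv k) = sy j k zeta * phi k zeta"
proof -
 have "grad j zeta \<in> LL \<and> cf (grad j zeta) (rv k) = sy j k zeta * phi k zeta"
 proof (cases "zeta \<in> Zcell")
  case False
  then have "grad j zeta = (\<lambda>x. 0)" by (auto simp: grad_def)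
  then show ?thesis by (simp add: phi_outside[OF False] cf_def)
 next
  case True
  note u = eigen(3)[OF True]
  let ?u = "P0 zeta" and ?c = "2 * of_real pi * \<i> * of_real (zeta $ j)"
  obtain v where v: "v \<in> L2_per" "has_weak_deriv [j] ?u v" "(\<lambda>x. shifted_grad zeta ?u x $ j) \<in> bmeas"
   "ae x. shifted_grad zeta ?u x $ j = v x + ?c * ?u x"
   using shifted_grad_AE[OF eigen(2)[OF True]] by blast
  have L: "(\<lambda>x. cell v x + ?c * cell ?u x) \<in> LL"
   by (intro L2_add L2_cmult L2_perD(3) v(1) u)
  have eq: "ae x. grad j zeta x = cell v x + ?c * cell ?u x"
   using v(4) by eventually_elim (use True in \<open>simp add: grad_def cell_def indicator_def\<close>)
  have m: "grad j zeta \<in> bmeas"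
   unfolding grad_def[abs_def] cell_def using True v(3) by simp
  have "cf (grad j zeta) (rv k) = cf (\<lambda>x. cell v x + ?c * cell ?u x) (rv k)"
   by (rule cf_AE_cong[OF m L2_measurable[OF L] eq])
  also have "... = cf (cell v) (rv k) + ?c * cf (cell ?u) (rv k)"
   using bdd_supp_integrable[OF bdd_supp_cell[OF L2_perD(3)[OF v(1)]]] bdd_supp_integrable[OF bdd_supp_cell[OF L2_perD(3)[OF u]]]
   by (simp add: cf_add cf_cmult)
  also have "... = sy j k zeta * phi k zeta"
   unfolding coefficients_weak_deriv[OF u v(1,2)] by (simp add: sy_def phi_def algebra_simps)
  finally show ?thesis using L2_AE_cong(1)[OF L m eq] by blast
 qed
 then show "grad j zeta \<in> LL" "cf (grad j zeta) (rv k) = sy j k zeta * phi k zeta" by auto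
qed

lemma grad_integrable: "integrable lborel (grad j zeta)"
 by (rule bdd_supp_integrable) (use grad_L2 grad_outside Ycell_bounded in \<open>auto simp: bdd_supp_def\<close>, blast)

lemma coeff_bound: obtains \<beta> where "\<beta> \<ge> 0" "ae x. \<forall>i j. \<bar>A x $ i $ j\<bar> \<le> \<beta>"
proof -
 obtain \<beta> where b: "ae x. norm (A x) \<le> \<beta>" using coeff by (auto simp: coefficient_field_def)
 have "ae x. \<forall>i j. \<bar>A x $ i $ j\<bar> \<le> max \<beta> 0" using b
 proof eventually_elim
  case (elim x)
  have "\<bar>A x $ i $ j\<bar> \<le> norm (A x)" for i j
   using component_le_norm_cart[of "A x $ i" j] Finite_Cartesian_Product.norm_nth_le[of "A x" i] by simp
  then show ?case using elim by (meson max.coboundedI1 order_trans)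
 qed
 then show ?thesis using that[of "max \<beta> 0"] by simp
qed

text \<open>The entries of \<open>A\<close> are cut off at an almost everywhere bound, so that products with them are square
 integrable without exceptional sets.\<close>

definition bnd :: real where "bnd = (SOME \<beta>. \<beta> \<ge> 0 \<and> (ae x. \<forall>i j. \<bar>A x $ i $ j\<bar> \<le> \<beta>))"

definition a :: "'n => 'n => real^'n => complex" where
 "a i j x = (if \<bar>A x $ i $ j\<bar> \<le> bnd then of_real (A x $ i $ j) else 0)"

lemma bnd: "bnd \<ge> 0" "ae x. \<forall>i j. \<bar>A x $ i $ j\<bar> \<le> bnd"
proof -
 obtain \<beta> where "\<beta> \<ge> 0 \<and> (ae x. \<forall>i j. \<bar>A x $ i $ j\<bar> \<le> \<beta>)" using coeff_bound by blast
 then have "bnd \<ge> 0 \<and> (ae x. \<forall>i j. \<bar>A x $ i $ j\<bar> \<le> bnd)" unfolding bnd_def by (rule someI)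
 then show "bnd \<ge> 0" "ae x. \<forall>i j. \<bar>A x $ i $ j\<bar> \<le> bnd" by auto
qed

lemma a_AE: "ae x. \<forall>i j. a i j x = of_real (A x $ i $ j)"
 using bnd(2) by eventually_elim (simp add: a_def)

lemma a_norm: "norm (a i j x) \<le> bnd"
 using bnd(1) by (simp add: a_def)

lemma A_measurable [measurable]: "(\<lambda>x. A x $ i $ j) \<in> bmeas"
proof -
 have [measurable]: "A \<in> bmeas" using coeff by (simp add: coefficient_field_def)
 have "(\<lambda>M :: real^'n^'n. M $ i $ j) \<in> bmeas"
  by (intro borel_measurable_continuous_onI continuous_intros)
 from measurable_compose[OF \<open>A \<in> _\<close> this] show ?thesis .
qed

lemma a_measurable [measurable]: "a i j \<in> bmeas"
 unfolding a_def[abs_def] by measurable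

lemma a_periodic: "ae x. \<forall>k. a i j (x + rv k) = a i j x"
proof -
 have "ae x. \<forall>k. A (x + rv k) = A x"
  using coeff by (intro periodic_lattice) (simp add: coefficient_field_def)
 then show ?thesis by eventually_elim (simp add: a_def)
qed

definition flux :: "'n => real^'n => real^'n => complex" where
 "flux i zeta x = (\<Sum>j\<in>UNIV. a i j x * grad j zeta x)"

lemma a_grad_integrable: "integrable lborel (\<lambda>x. a i j x * grad j zeta x)"
 by (rule B_integrable_bound[OF integrable_mult_right[OF grad_integrable[of j zeta], of "complex_of_real bnd"]])
   (use a_norm bnd(1) L2_measurable[OF grad_L2] in \<open>auto simp: norm_mult intro!: AE_I2 mult_right_mono\<close>)

lemma flux_coeff: "cf (flux i zeta) (rv k) = (\<Sum>j\<in>UNIV. cf (\<lambda>x. a i j x * grad j zeta x) (rv k))"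
 unfolding flux_def[abs_def] by (rule cf_sum) (auto intro: a_grad_integrable)

lemma flux_coeff_measurable: "(\<lambda>zeta. cf (flux i zeta) (rv k)) \<in> bmeas"
 unfolding flux_coeff
 by (intro borel_measurable_sum cf_mult_measurable[OF a_measurable a_norm] grad_integrable grad_outside)
   (auto simp: grad_coeff sy_def)

text \<open>Testing the eigenvalue equation with exponentials gives the equation in Fourier coefficients,
 testing it with the eigenfunction itself bounds the gradient by the eigenvalue.\<close>

lemma eigen_coeff:
 assumes zeta: "zeta \<in> Zcell"
 shows "(\<Sum>i\<in>UNIV. cf (flux i zeta) (rv k) * cnj (sy i k zeta)) = of_real (lam 0 zeta) * phi k zeta"
proof -
 let ?e = "\<lambda>x. plane_wave x (rv k)" and ?g = "shifted_grad zeta (P0 zeta)"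
 have sg: "ae x. shifted_grad zeta ?e x $ i = sy i k zeta * ?e x" and sgm: "(\<lambda>x. shifted_grad zeta ?e x $ i) \<in> bmeas" for i
 proof -
  note w = weak_deriv_AE[OF plane_wave_weak_deriv[of i "rv k"]]
  show "ae x. shifted_grad zeta ?e x $ i = sy i k zeta * ?e x"
   using w(2) by eventually_elim (simp add: shifted_grad_def sy_def algebra_simps)
  show "(\<lambda>x. shifted_grad zeta ?e x $ i) \<in> bmeas"
   unfolding shifted_grad_def using w(1) by simp
 qed
 have gm: "(\<lambda>x. ?g x $ j) \<in> bmeas" for j
  using shifted_grad_AE[OF eigen(2)[OF zeta]] by blast
 note [measurable] = sgm gm L2_measurable[OF grad_L2]
 have i1: "integrable lborel (\<lambda>x. flux i zeta x * cnj (plane_wave x (rv k)) * cnj (sy i k zeta))" for i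
 proof -
  have fi: "integrable lborel (flux i zeta)"
   unfolding flux_def[abs_def] by (intro B_integrable_sum a_grad_integrable)
  show ?thesis
   by (intro integrable_mult_left, rule B_integrable_bound[OF fi])
     (use fi in \<open>auto simp: norm_mult\<close>)
 qed
 have "(LINT x:Ycell|lborel. \<Sum>i\<in>UNIV. \<Sum>j\<in>UNIV. of_real (A x $ i $ j) * ?g x $ j * cnj (shifted_grad zeta ?e x $ i))
   = of_real (lam 0 zeta) * (LINT x:Ycell|lborel. P0 zeta x * cnj (?e x))"
  using eigen(1)[OF zeta] plane_wave_H1_per[of k] unfolding shifted_eigen_def by blast
 moreover have "(LINT x:Ycell|lborel. P0 zeta x * cnj (?e x)) = phi k zeta"
  unfolding set_lebesgue_integral_def phi_def cf_def
  by (intro B_integral_cong) (auto simp: cell_def indicator_def)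
 moreover have "(LINT x:Ycell|lborel. \<Sum>i\<in>UNIV. \<Sum>j\<in>UNIV. of_real (A x $ i $ j) * ?g x $ j * cnj (shifted_grad zeta ?e x $ i))
   = (LI x. (\<Sum>i\<in>UNIV. flux i zeta x * cnj (plane_wave x (rv k)) * cnj (sy i k zeta)))"
  unfolding set_lebesgue_integral_def
 proof (rule integral_cong_AE)
  have "ae x. \<forall>i. shifted_grad zeta ?e x $ i = sy i k zeta * ?e x"
   using sg by (simp add: AE_finite_all[of UNIV, simplified] AE_all_countable)
  then show "ae x. indicator Ycell x *R (\<Sum>i\<in>UNIV. \<Sum>j\<in>UNIV. of_real (A x $ i $ j) * ?g x $ j * cnj (shifted_grad zeta ?e x $ i))
   = (\<Sum>i\<in>UNIV. flux i zeta x * cnj (plane_wave x (rv k)) * cnj (sy i k zeta))"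
   using a_AE
  proof eventually_elim
   case (elim x)
   then show ?case using zeta
    by (cases "x \<in> Ycell")
      (auto simp: flux_def grad_def cell_def sum_distrib_right sum_distrib_left ac_simps intro!: sum.cong)
  qed
 qed (auto simp: flux_def)
 moreover have "... = (\<Sum>i\<in>UNIV. cf (flux i zeta) (rv k) * cnj (sy i k zeta))"
  using i1 by (subst B_integral_sum) (auto simp: cf_def)
 ultimately show ?thesis by simp
qed

definition ell :: real where
 "ell = (SOME \<alpha>. \<alpha> > 0 \<and> (ae x. \<forall>xi. \<alpha> * (norm xi)^2 \<le> xi \<bullet> (A x *v xi)))"

lemma ell: "ell > 0" "ae x. \<forall>xi. ell * (norm xi)^2 \<le> xi \<bullet> (A x *v xi)"
proof -
 obtain \<alpha> where "\<alpha> > 0 \<and> (ae x. \<forall>xi. \<alpha> * (norm xi)^2 \<le> xi \<bullet> (A x *v xi))"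
  using coeff by (auto simp: coefficient_field_def)
 then have "ell > 0 \<and> (ae x. \<forall>xi. ell * (norm xi)^2 \<le> xi \<bullet> (A x *v xi))" unfolding ell_def by (rule someI)
 then show "ell > 0" "ae x. \<forall>xi. ell * (norm xi)^2 \<le> xi \<bullet> (A x *v xi)" by auto
qed

lemma elliptic_complex:
 fixes g :: "complex^'n"
 assumes "\<forall>xi. ell * (norm xi)^2 \<le> xi \<bullet> (M *v xi)"
 shows "ell * (\<Sum>j\<in>UNIV. (norm (g $ j))^2) \<le> Re (\<Sum>i\<in>UNIV. \<Sum>j\<in>UNIV. of_real (M $ i $ j) * g $ j * cnj (g $ i))"
proof -
 have nn: "(norm xi)^2 = (\<Sum>j\<in>UNIV. (xi $ j)^2)" for xi :: "real^'n"
  unfolding power2_norm_eq_inner by (simp add: inner_vec_def power2_eq_square)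
 have q: "xi \<bullet> (M *v xi) = (\<Sum>i\<in>UNIV. \<Sum>j\<in>UNIV. M $ i $ j * (xi $ j * xi $ i))" for xi :: "real^'n"
  by (simp add: inner_vec_def matrix_vector_mult_def sum_distrib_left ac_simps)
 let ?R = "\<chi> j. Re (g $ j)" and ?I = "\<chi> j. Im (g $ j)"
 have "ell * (\<Sum>j\<in>UNIV. (norm (g $ j))^2) = ell * (norm ?R)^2 + ell * (norm ?I)^2"
  unfolding nn by (simp add: cmod_power2 sum.distrib distrib_left)
 also have "... \<le> ?R \<bullet> (M *v ?R) + ?I \<bullet> (M *v ?I)" using assms by (intro add_mono) auto
 also have "... = Re (\<Sum>i\<in>UNIV. \<Sum>j\<in>UNIV. of_real (M $ i $ j) * g $ j * cnj (g $ i))"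
  unfolding q by (simp add: sum.distrib[symmetric] algebra_simps)
 finally show ?thesis .
qed

lemma grad_bound:
 assumes zeta: "zeta \<in> Zcell" shows "ell * (\<Sum>j\<in>UNIV. (nrm (grad j zeta))^2) \<le> lam 0 zeta"
proof -
 let ?g = "shifted_grad zeta (P0 zeta)"
 note [measurable] = L2_measurable[OF grad_L2]
 have gm [measurable]: "(\<lambda>x. ?g x $ j) \<in> bmeas" for j
  using shifted_grad_AE[OF eigen(2)[OF zeta]] by blast
 define Q where "Q x = (\<Sum>i\<in>UNIV. \<Sum>j\<in>UNIV. a i j x * (grad j zeta x * cnj (grad i zeta x)))" for x
 have Qi: "integrable lborel Q"
  unfolding Q_def
 proof (intro B_integrable_sum)
  fix i j
  have "integrable lborel (\<lambda>x. (a i j x * grad j zeta x) * cnj (grad i zeta x))"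
   by (intro integrable_ip grad_L2 L2_mult_bounded(1)[OF grad_L2 a_measurable a_norm])
  then show "integrable lborel (\<lambda>x. a i j x * (grad j zeta x * cnj (grad i zeta x)))" by (simp add: mult.assoc)
 qed
 have "(LINT x:Ycell|lborel. \<Sum>i\<in>UNIV. \<Sum>j\<in>UNIV. of_real (A x $ i $ j) * ?g x $ j * cnj (?g x $ i))
   = of_real (lam 0 zeta) * (LINT x:Ycell|lborel. P0 zeta x * cnj (P0 zeta x))"
  using eigen(1,2)[OF zeta] unfolding shifted_eigen_def by blast
 also have "(LINT x:Ycell|lborel. P0 zeta x * cnj (P0 zeta x)) = ip (cell (P0 zeta)) (cell (P0 zeta))"
  unfolding set_lebesgue_integral_def ip_def
  by (intro B_integral_cong) (auto simp: cell_def indicator_def)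
 also have "... = 1" by (simp add: ip_self eigen(5)[OF zeta])
 also have "(LINT x:Ycell|lborel. \<Sum>i\<in>UNIV. \<Sum>j\<in>UNIV. of_real (A x $ i $ j) * ?g x $ j * cnj (?g x $ i)) = (LI x. Q x)"
  unfolding set_lebesgue_integral_def
 proof (rule integral_cong_AE)
  show "ae x. indicator Ycell x *R (\<Sum>i\<in>UNIV. \<Sum>j\<in>UNIV. of_real (A x $ i $ j) * ?g x $ j * cnj (?g x $ i)) = Q x"
   using a_AE
   by eventually_elim (use zeta in \<open>auto simp: Q_def grad_def cell_def indicator_def mult.assoc intro!: sum.cong\<close>)
 qed (auto simp: Q_def)
 finally have "lam 0 zeta = (LI x. Re (Q x))" using integral_Re[OF Qi] by simp
 moreover have "(LI x. ell * (\<Sum>j\<in>UNIV. (norm (grad j zeta x))^2)) \<le> (LI x. Re (Q x))"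
 proof (rule integral_mono_AE)
  show "integrable lborel (\<lambda>x. ell * (\<Sum>j\<in>UNIV. (norm (grad j zeta x))^2))"
   by (intro integrable_mult_right B_integrable_sum L2_integrable grad_L2)
  show "integrable lborel (\<lambda>x. Re (Q x))" using Qi by (rule integrable_Re)
  show "ae x. ell * (\<Sum>j\<in>UNIV. (norm (grad j zeta x))^2) \<le> Re (Q x)"
   using ell(2) a_AE
  proof eventually_elim
   case (elim x)
   then show ?case using elliptic_complex[OF elim(1), of "\<chi> j. grad j zeta x"] by (simp add: Q_def mult.assoc)
  qed
 qed
 ultimately show ?thesis
  by (simp add: nrm_sq B_integral_sum[OF L2_integrable[OF grad_L2]])
qed

text \<open>Paired with the coefficients of the normalised eigenfunction, the eigenvalue equation expresses the eigenvalue by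
 coefficients, which depend measurably on \<open>zeta\<close>.\<close>

lemma lam_measurable: "(\<lambda>zeta. if zeta \<in> Zcell then lam 0 zeta else 0) \<in> bmeas"
proof -
 define g where "g k zeta = (\<Sum>i\<in>UNIV. cf (flux i zeta) (rv k) * cnj (sy i k zeta)) * cnj (phi k zeta)" for k zeta
 have gm: "g k \<in> bmeas" for k
  unfolding g_def[abs_def] sy_def using flux_coeff_measurable by measurable
 have "(\<lambda>(k, zeta). g k zeta) \<in> borel_measurable (cspace \<Otimes>\<^sub>M borel)"
  by (rule measurable_pair_measure_countable1) (use gm in auto)
 then have "(\<lambda>(zeta, k). g k zeta) \<in> borel_measurable (borel \<Otimes>\<^sub>M cspace)"
  by (subst (asm) measurable_pair_swap_iff) (simp add: case_prod_beta)
 then have m: "(\<lambda>zeta. LINT k|cspace. g k zeta) \<in> bmeas"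
  by (rule sigma_finite_measure.borel_measurable_lebesgue_integral[OF sigma_finite_measure_count_space_countable[OF countable_int_vec]])
 have "(if zeta \<in> Zcell then lam 0 zeta else 0) = (if zeta \<in> Zcell then Re (LINT k|cspace. g k zeta) else 0)" for zeta
 proof (cases "zeta \<in> Zcell")
  case True
  have "g k zeta = of_real (lam 0 zeta) * of_real ((norm (phi k zeta))^2)" for k
   unfolding g_def eigen_coeff[OF True] complex_norm_square by (simp add: mult.assoc)
  then have "(LINT k|cspace. g k zeta) = of_real (lam 0 zeta) * of_real (LINT k|cspace. (norm (phi k zeta))^2)"
   unfolding integral_complex_of_real[symmetric] by simp
  then show ?thesis using phi_norm(3)[OF True] True by simp
 qed simp
 moreover have "(\<lambda>zeta. if zeta \<in> Zcell then Re (LINT k|cspace. g k zeta) else 0) \<in> bmeas"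
  using m by measurable
 ultimately show ?thesis by simp
qed

end

section \<open>Bloch synthesis, Bloch coefficients and the resolvent\<close>

lemma borel_measurable_testing:
 fixes h :: "real^'n => complex"
 assumes [measurable]: "h \<in> bmeas"
  and i: "\<And>g. bdd_supp g ==> integrable lborel (\<lambda>x. h x * cnj (g x))"
  and z: "\<And>g. bdd_supp g ==> (LI x. h x * cnj (g x)) = 0"
 shows "ae x. h x = 0"
proof -
 have "ae x. x \<in> cball 0 (real n) --> h x = 0" for n
 proof -
  let ?g = "\<lambda>x. indicator (cball 0 (real n)) x * (h x / of_real (norm (h x)))"
  have "(\<lambda>x. (h x / of_real (norm (h x))) * indicator (cball 0 (real n)) x) \<in> LL"
  proof (rule L2_mult_bounded(1)[of _ _ 1])
   have "integrable lborel (\<lambda>x::real^'n. indicator (cball 0 (real n)) x :: real)"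
    using emeasure_bounded_finite[of "cball (0::real^'n) (real n)"] by (simp add: integrable_indicator_iff)
   moreover have "(norm (indicator (cball (0::real^'n) (real n)) x :: complex))^2 = indicator (cball 0 (real n)) x" for x
    by (simp add: indicator_def)
   ultimately show "(indicator (cball (0::real^'n) (real n)) :: _ => complex) \<in> LL"
    by (simp add: L2_UNIV_iff borel_measurable_indicator)
  qed (auto simp: norm_divide)
  then have g: "bdd_supp ?g"
   unfolding bdd_supp_def by (auto simp: mult.commute indicator_def split: if_splits)
  have *: "h x * cnj (?g x) = complex_of_real (indicator (cball 0 (real n)) x * norm (h x))" for x
   by (cases "h x = 0") (auto simp: indicator_def complex_norm_square[symmetric] power2_eq_square nonzero_divide_eq_eq
    simp flip: of_real_mult)
  have "integrable lborel (\<lambda>x. indicator (cball 0 (real n)) x * norm (h x))"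
   using integrable_Re[OF i[OF g]] unfolding * by simp
  moreover have "(LI x. indicator (cball 0 (real n)) x * norm (h x)) = 0"
   using z[OF g] unfolding * integral_complex_of_real by simp
  ultimately have "ae x. indicator (cball 0 (real n)) x * norm (h x) = 0"
   by (subst (asm) integral_nonneg_eq_0_iff_AE) auto
  then show ?thesis by eventually_elim (auto simp: indicator_def)
 qed
 then have "ae x. \<forall>n. x \<in> cball 0 (real n) --> h x = 0" by (subst AE_all_countable) blast
 then show ?thesis
 proof eventually_elim
  case (elim x)
  have "norm x \<le> real (nat \<lceil>norm x\<rceil>)" by (rule real_nat_ceiling_ge)
  with elim show ?case by (metis mem_cball_0)
 qed
qed

lemma count_space_Cauchy_Schwarz:
 fixes f p :: "'a => complex"
 assumes p: "integrable (cspace) (\<lambda>k. (norm (p k))^2)" "(LINT k|cspace. (norm (p k))^2) \<le> 1"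
 shows "ennreal ((norm (LINT k|cspace. f k * cnj (p k)))^2) \<le> (\<integral>\<^sup>+k. ennreal ((norm (f k))^2) \<partial>cspace)"
  and "(\<integral>\<^sup>+k. ennreal ((norm (f k))^2) \<partial>cspace) < \<infinity> ==> integrable (cspace) (\<lambda>k. f k * cnj (p k))"
proof -
 have main: "integrable (cspace) (\<lambda>k. f k * cnj (p k)) \<and>
  (norm (LINT k|cspace. f k * cnj (p k)))^2 \<le> (LINT k|cspace. (norm (f k))^2)"
  if f: "integrable (cspace) (\<lambda>k. (norm (f k))^2)"
 proof -
  define S where "S = (LINT k|cspace. (norm (f k))^2)"
  have S: "S \<ge> 0" unfolding S_def by (intro B_integral_nonneg) auto
  have pt: "norm (f k * cnj (p k)) \<le> (t * (norm (f k))^2 + (1/t) * (norm (p k))^2) / 2" if "t > 0" for t k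
  proof -
   have "0 \<le> (sqrt t * norm (f k) - (1 / sqrt t) * norm (p k))^2" by simp
   also have "... = t * (norm (f k))^2 + (1/t) * (norm (p k))^2 - 2 * (norm (f k) * norm (p k))"
    using that by (simp add: power2_diff power_mult_distrib power_divide)
   finally show ?thesis by (simp add: norm_mult)
  qed
  have int: "integrable (cspace) (\<lambda>k. (t * (norm (f k))^2 + (1/t) * (norm (p k))^2) / 2)" for t
   using f p(1) by simp
  have i: "integrable (cspace) (\<lambda>k. f k * cnj (p k))"
   by (rule B_integrable_bound[OF int[of 1]]) (use pt[of 1] in auto)
  have "norm (LINT k|cspace. f k * cnj (p k)) \<le> (t * S + 1/t) / 2" if t: "t > 0" for t
  proof -
   have "norm (LINT k|cspace. f k * cnj (p k)) \<le> (LINT k|cspace. norm (f k * cnj (p k)))"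
    by (rule integral_norm_bound)
   also have "... \<le> (LINT k|cspace. (t * (norm (f k))^2 + (1/t) * (norm (p k))^2) / 2)"
    by (intro integral_mono integrable_norm i int pt t)
   also have "... = (t * S + (1/t) * (LINT k|cspace. (norm (p k))^2)) / 2"
    using f p(1) by (simp add: S_def)
   also have "... \<le> (t * S + (1/t) * 1) / 2"
    using p(2) t by (intro divide_right_mono add_left_mono mult_left_mono) auto
   finally show ?thesis by simp
  qed
  note b = this
  let ?N = "norm (LINT k|cspace. f k * cnj (p k))"
  have "?N^2 \<le> S"
  proof (cases "S = 0")
   case True
   have "?N \<le> 0"
   proof (rule field_le_epsilon)
    fix e :: real assume "e > 0"
    then show "?N \<le> 0 + e" using b[of "1/e"] True by simp
   qed
   then show ?thesis using True by simp
  next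
   case False
   then have "?N \<le> ((1 / sqrt S) * S + 1 / (1 / sqrt S)) / 2" using S by (intro b) simp
   also have "... = sqrt S" using S False by (simp add: real_div_sqrt)
   finally have "?N^2 \<le> (sqrt S)^2" by (intro power_mono) auto
   then show ?thesis using S by simp
  qed
  with i show ?thesis by (simp add: S_def)
 qed
 have fin: "integrable (cspace) (\<lambda>k. (norm (f k))^2)" if "(\<integral>\<^sup>+k. ennreal ((norm (f k))^2) \<partial>cspace) < \<infinity>"
  using that by (intro integrableI_bounded) auto
 show "ennreal ((norm (LINT k|cspace. f k * cnj (p k)))^2) \<le> (\<integral>\<^sup>+k. ennreal ((norm (f k))^2) \<partial>cspace)"
 proof (cases "(\<integral>\<^sup>+k. ennreal ((norm (f k))^2) \<partial>cspace) < \<infinity>")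
  case True
  have "(\<integral>\<^sup>+k. ennreal ((norm (f k))^2) \<partial>cspace) = ennreal (LINT k|cspace. (norm (f k))^2)"
   by (rule nn_integral_eq_integral[OF fin[OF True]]) auto
  then show ?thesis using main[OF fin[OF True]] by (simp add: ennreal_leI)
 qed (simp add: not_less top_unique)
 show "integrable (cspace) (\<lambda>k. f k * cnj (p k))" if "(\<integral>\<^sup>+k. ennreal ((norm (f k))^2) \<partial>cspace) < \<infinity>"
  using main[OF fin[OF that]] by blast
qed

context bloch
begin

abbreviation Zs :: "(real^'n) set" where "Zs \<equiv> scaled_Zcell eps"

lemma Zs_sets [measurable, simp]: "Zs \<in> sets borel"
 using eps by simp

lemma Zs_iff: "eta \<in> Zs \<longleftrightarrow> eps *R eta \<in> Zcell"
 by (rule scaled_Zcell_iff[OF eps])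

text \<open>The function on \<open>\<real>\<^sup>n\<close> whose value at the point \<open>eta + k/eps\<close>, with \<open>eta\<close> in the scaled cell, is \<open>b k eta\<close>.\<close>

definition glue :: "(int^'n => real^'n => complex) => real^'n => complex" where
 "glue b xi = b (lat (eps *R xi)) (xi - (1/eps) *R rv (lat (eps *R xi)))"

lemma fibre_point: "xi - (1/eps) *R rv (lat (eps *R xi)) \<in> Zs"
 using scaled_Zcell_lat[OF eps, of xi] by simp

lemma glue_at: "eta \<in> Zs ==> glue b (eta + (1/eps) *R rv k) = b k eta"
proof -
 assume "eta \<in> Zs"
 then have "k = lat (eps *R (eta + (1/eps) *R rv k))"
  using scaled_Zcell_lat[OF eps, of "eta + (1/eps) *R rv k" k] by simp
 then show ?thesis unfolding glue_def by (metis add_diff_cancel_right')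
qed

lemma glue_measurable:
 assumes "\<And>k. b k \<in> bmeas" shows "glue b \<in> bmeas"
proof -
 have "(\<lambda>xi::real^'n. lat (eps *R xi)) \<in> measurable borel (cspace)"
 proof -
  have "(\<lambda>xi::real^'n. lat (eps *R xi)) -` {k} \<inter> space borel \<in> sets borel" for k :: "int^'n"
  proof -
   have "(\<lambda>xi. xi - (1/eps) *R rv k) -` Zs \<inter> space borel \<in> sets borel"
    by (rule measurable_sets[of _ borel borel]) auto
   moreover have "(\<lambda>xi. xi - (1/eps) *R rv k) -` Zs \<inter> space borel = (\<lambda>xi. lat (eps *R xi)) -` {k} \<inter> space borel"
    using scaled_Zcell_lat[OF eps, of _ k] by auto
   ultimately show ?thesis by simp
  qed
  then show ?thesis unfolding measurable_count_space_eq_countable[OF countable_int_vec] by auto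
 qed
 then show ?thesis unfolding glue_def[abs_def]
  by (rule measurable_compose_countable[rotated]) (use assms in measurable)
qed

lemma AE_fibres:
 assumes "ae eta. eta \<in> Zs --> (\<forall>k. P (eta + (1/eps) *R rv k))"
 shows "ae xi. P xi"
 using AE_tiling[OF assms, of "1/eps"]
proof eventually_elim
 case (elim xi)
 have "xi + (1/eps) *R rv (- lat (eps *R xi)) \<in> Zs" using fibre_point[of xi] by (simp add: rv_minus)
 with elim have "P (xi + (1/eps) *R rv (- lat (eps *R xi)) + (1/eps) *R rv (lat (eps *R xi)))" by blast
 then show ?case by (simp add: rv_minus)
qed

lemma fibre_nn_integral:
 fixes h :: "real^'n => complex"
 assumes [measurable]: "h \<in> bmeas"
 shows "(NI xi. ennreal ((norm (h xi))^2))
  = (NI eta. indicator Zs eta * (\<integral>\<^sup>+k. ennreal ((norm (h (eta + (1/eps) *R rv k)))^2) \<partial>cspace))"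
 by (subst nn_integral_tiling[OF tiles_scaled_Zcell[OF eps]]) (auto simp: nn_integral_cmult)

lemma fibre_finite:
 assumes "h \<in> LL"
 shows "ae eta. eta \<in> Zs --> (\<integral>\<^sup>+k. ennreal ((norm (h (eta + (1/eps) *R rv k)))^2) \<partial>cspace) < \<infinity>"
proof -
 note [measurable] = L2_measurable[OF assms]
 have "integrable lborel (\<lambda>x. complex_of_real ((norm (h x))^2))"
  using L2_integrable[OF assms] by (rule integrable_of_real)
 from integrable_tiling(2)[OF tiles_scaled_Zcell[OF eps] this] show ?thesis
 proof eventually_elim
  case (elim eta)
  show ?case
  proof
   assume "eta \<in> Zs"
   then have "integrable (cspace) (\<lambda>k. (norm (h (eta + (1/eps) *R rv k)))^2)"
    using elim integrable_Re by fastforce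
   then show "(\<integral>\<^sup>+k. ennreal ((norm (h (eta + (1/eps) *R rv k)))^2) \<partial>cspace) < \<infinity>"
    by (simp add: integrable_iff_bounded)
  qed
 qed
qed

definition onZ :: "(real^'n => complex) => bool" where
 "onZ e \<longleftrightarrow> e \<in> LL \<and> (\<forall>eta. eta \<notin> Zs --> e eta = 0)"

lemma onZ_L2: "onZ e ==> e \<in> LL" by (simp add: onZ_def)

lemma Zs_bounded: "eta \<in> Zs ==> norm eta \<le> CARD('n) / eps"
proof -
 assume "eta \<in> Zs"
 then have "- (1/2) \<le> (eps *R eta) $ i \<and> (eps *R eta) $ i < 1/2" for i unfolding Zs_iff Zcell_def by blast
 then have "\<bar>(eps *R eta) $ i\<bar> \<le> 1" for i
 proof -
  assume *: "\<And>i. - (1/2) \<le> (eps *R eta) $ i \<and> (eps *R eta) $ i < 1/2"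
  from *[of i] show ?thesis unfolding abs_le_iff by linarith
 qed
 then have "(\<Sum>i\<in>UNIV. \<bar>(eps *R eta) $ i\<bar>) \<le> (\<Sum>i\<in>(UNIV::'n set). 1)" by (intro sum_mono)
 then have "norm (eps *R eta) \<le> CARD('n)" using norm_le_l1_cart[of "eps *R eta"] by simp
 then show ?thesis using eps by (simp add: field_simps)
qed

lemma onZ_bdd_supp: "onZ e ==> bdd_supp e"
 unfolding onZ_def bdd_supp_def using Zs_bounded by blast

text \<open>The Fourier transform of the synthesis \<open>S e\<close> below: over each fibre it is \<open>e eta\<close> times the sequence of Fourier
 coefficients of the eigenfunction.\<close>

definition W :: "(real^'n => complex) => real^'n => complex" where
 "W e = glue (\<lambda>k eta. e eta * phi k (eps *R eta))"

definition S :: "(real^'n => complex) => real^'n => complex" where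
 "S e x = (LI eta. e eta * (P0 (eps *R eta) ((1/eps) *R x) * plane_wave x eta))"

lemma W_at: "eta \<in> Zs ==> W e (eta + (1/eps) *R rv k) = e eta * phi k (eps *R eta)"
 by (simp add: W_def glue_at)

lemma W_L2: assumes e: "onZ e" shows "W e \<in> LL" "nrm (W e) = nrm e"
proof -
 note [measurable] = L2_measurable[OF onZ_L2[OF e]]
 have m [measurable]: "W e \<in> bmeas"
  unfolding W_def by (rule glue_measurable) measurable
 have "(NI xi. ennreal ((norm (W e xi))^2)) = (NI eta. ennreal ((norm (e eta))^2))"
  unfolding fibre_nn_integral[OF m]
 proof (rule nn_integral_cong)
  fix eta
  show "indicator Zs eta * (\<integral>\<^sup>+k. ennreal ((norm (W e (eta + (1/eps) *R rv k)))^2) \<partial>cspace) = ennreal ((norm (e eta))^2)"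
  proof (cases "eta \<in> Zs")
   case True
   then show ?thesis using phi_norm(1)[of "eps *R eta"]
    by (simp add: W_at norm_mult power_mult_distrib ennreal_mult nn_integral_cmult Zs_iff)
  next
   case False then show ?thesis using e by (simp add: onZ_def)
  qed
 qed
 then have P: "(NI xi. ennreal ((norm (W e xi))^2)) = ennreal ((nrm e)^2)"
  by (simp add: nn_integral_L2[OF onZ_L2[OF e]])
 show L: "W e \<in> LL" by (rule L2_nn_integralI(1)[of _ "(nrm e)^2"]) (use P in auto)
 have "(nrm (W e))^2 = (nrm e)^2" using P unfolding nn_integral_L2[OF L] by simp
 then show "nrm (W e) = nrm e" by simp
qed

lemma bloch_integral:
 assumes u: "bdd_supp u" and eta: "eta \<in> Zs"
 shows "(LINT k|cspace. cf u (eta + (1/eps) *R rv k) * cnj (phi k (eps *R eta)))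
  = (LI x. u x * cnj (P0 (eps *R eta) ((1/eps) *R x) * plane_wave x eta))"
 using parseval_periodic(2)[OF u eigen(3) eps] eta by (simp add: Zs_iff phi_def)

text \<open>By Fubini and \<open>parseval_periodic\<close> for each \<open>eta\<close>, the pairing is an integral over fibres. Absolute integrability holds
 since the eigenfunctions are uniformly bounded in the mean on the ball that supports \<open>g\<close>.\<close>

lemma S_test:
 assumes e: "onZ e" and g: "bdd_supp g"
 shows "integrable lborel (\<lambda>x. S e x * cnj (g x))"
  and "(LI x. S e x * cnj (g x)) = ip (W e) (cf g)"
proof -
 have eL: "e \<in> LL" and gL: "g \<in> LL" using e g by (auto simp: onZ_def bdd_supp_def)
 note [measurable] = L2_measurable[OF eL] L2_measurable[OF gL]
 obtain R where R: "\<And>x. g x \<noteq> 0 ==> norm x \<le> R" using bdd_supp_obtain[OF g] by blast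
 let ?C = "sqrt (eps ^ CARD('n) * card {k :: int^'n. norm (rv k) \<le> R/eps + CARD('n)})"
 let ?P = "\<lambda>eta x. indicator (cball 0 R) x * P0 (eps *R eta) ((1/eps) *R x)"
 have P: "?P eta \<in> LL" "nrm (?P eta) \<le> ?C" if "eta \<in> Zs" for eta
 proof -
  have z: "eps *R eta \<in> Zcell" using that by (simp add: Zs_iff)
  note p = periodic_ball_L2[OF L2_perD(1,4,3)[OF eigen(3)[OF z]] eps, of R]
  show "?P eta \<in> LL" by (rule p(1))
  have "(nrm (?P eta))^2 \<le> ?C^2" using p(2) eigen(5)[OF z] eps by simp
  then show "nrm (?P eta) \<le> ?C" by (rule power2_le_imp_le) (use eps in simp)
 qed
 define G where "G eta x = e eta * (P0 (eps *R eta) ((1/eps) *R x) * plane_wave x eta) * cnj (g x)" for eta x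
 have nG: "norm (G eta x) = norm (e eta) * norm (?P eta x * g x)" for eta x
  using R[of x] by (cases "g x = 0") (auto simp: G_def norm_mult)
 have int: "integrable (lborel \<Otimes>\<^sub>M lborel) (\<lambda>(eta, x). G eta x)"
 proof (rule lborel_pair.Fubini_integrable)
  show "(\<lambda>(eta, x). G eta x) \<in> borel_measurable (lborel \<Otimes>\<^sub>M lborel)" unfolding G_def by measurable
  have inner: "integrable lborel (\<lambda>x. ?P eta x * g x)" "(LI x. norm (?P eta x * g x)) \<le> ?C * nrm g" if "eta \<in> Zs" for eta
  proof -
   show i: "integrable lborel (\<lambda>x. ?P eta x * g x)" by (intro integrable_L2_mult P that gL)
   let ?p = "cplx (\<lambda>x. norm (?P eta x))" and ?q = "cplx (\<lambda>x. norm (g x))"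
   have pq: "?p \<in> LL" "?q \<in> LL" "nrm ?p = nrm (?P eta)" "nrm ?q = nrm g"
   proof -
    have "(\<lambda>x. norm (?P eta x)) \<in> LL"
    proof (rule L2_bound(1)[OF P(1)[OF that]])
     show "(\<lambda>x. norm (?P eta x)) \<in> bmeas"
      by (rule measurable_compose[OF L2_measurable[OF P(1)[OF that]] borel_measurable_norm])
    qed (intro AE_I2, simp)
    then show "?p \<in> LL" unfolding L2_cplx .
    have "(\<lambda>x. norm (g x)) \<in> LL" by (rule L2_bound(1)[OF gL]) auto
    then show "?q \<in> LL" unfolding L2_cplx .
    show "nrm ?p = nrm (?P eta)" "nrm ?q = nrm g" unfolding nrm_eq by simp_all
   qed
   have pq_eq: "complex_of_real (LI x. norm (?P eta x * g x)) = ip ?p ?q"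
    unfolding ip_def integral_complex_of_real[symmetric]
    by (intro B_integral_cong) (auto simp: norm_mult)
   have "(LI x. norm (?P eta x * g x)) = Re (ip ?p ?q)" unfolding pq_eq[symmetric] by simp
   also have "... \<le> nrm (?P eta) * nrm g"
    using Re_ip_le[OF pq(1,2)] unfolding pq(3,4) .
   also have "... \<le> ?C * nrm g" by (intro mult_right_mono P that) simp
   finally show "(LI x. norm (?P eta x * g x)) \<le> ?C * nrm g" .
  qed
  have "integrable lborel (\<lambda>eta. (?C * nrm g) * norm (e eta))"
   using bdd_supp_integrable[OF onZ_bdd_supp[OF e]] by simp
  then show "integrable lborel (\<lambda>eta. LI x. norm (case (eta, x) of (eta, x) => G eta x))"
  proof (rule B_integrable_bound)
   show "(\<lambda>eta. LI x. norm (case (eta, x) of (eta, x) => G eta x)) \<in> borel_measurable lborel"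
    unfolding G_def by measurable
   show "ae eta. norm (LI x. norm (case (eta, x) of (eta, x) => G eta x)) \<le> norm ((?C * nrm g) * norm (e eta))"
   proof (rule AE_I2)
    fix eta
    show "norm (LI x. norm (case (eta, x) of (eta, x) => G eta x)) \<le> norm ((?C * nrm g) * norm (e eta))"
    proof (cases "eta \<in> Zs")
     case True
     have C: "?C \<ge> 0" using eps by simp
     have "0 \<le> (LI x. norm (?P eta x * g x))" by simp
     then show ?thesis using inner(2)[OF True] C
      unfolding nG split integral_mult_right_zero
      by (simp add: abs_mult mult.commute[of "norm (e eta)"] mult_right_mono)
    next
     case False then show ?thesis using e by (simp add: onZ_def G_def)
    qed
   qed
  qed
  show "ae eta. integrable lborel (\<lambda>x. case (eta, x) of (eta, x) => G eta x)"
  proof (rule AE_I2)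
   fix eta
   show "integrable lborel (\<lambda>x. case (eta, x) of (eta, x) => G eta x)"
   proof (cases "eta \<in> Zs")
    case True
    show ?thesis
    proof (rule B_integrable_bound[OF integrable_mult_right[OF inner(1)[OF True], of "e eta"]])
     show "(\<lambda>x. case (eta, x) of (eta, x) => G eta x) \<in> borel_measurable lborel"
      unfolding G_def split by measurable
     show "ae x. norm (case (eta, x) of (eta, x) => G eta x) \<le> norm (e eta * (?P eta x * g x))"
      unfolding split nG norm_mult[of "e eta"] by simp
    qed
   next
    case False then show ?thesis using e by (simp add: onZ_def G_def)
   qed
  qed
 qed
 have eqS: "S e x * cnj (g x) = (LI eta. G eta x)" for x
  unfolding S_def G_def by simp
 show "integrable lborel (\<lambda>x. S e x * cnj (g x))"
  unfolding eqS using lborel_pair.integrable_snd[OF int] by simp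
 have "(LI x. S e x * cnj (g x)) = (LI eta. LI x. G eta x)"
  unfolding eqS by (rule lborel_pair.Fubini_integral[OF int])
 also have "... = (LI eta. indicator Zs eta * (LINT k|cspace. W e (eta + (1/eps) *R rv k) * cnj (cf g (eta + (1/eps) *R rv k))))"
 proof (rule B_integral_cong[OF refl])
  fix eta
  show "(LI x. G eta x) = indicator Zs eta * (LINT k|cspace. W e (eta + (1/eps) *R rv k) * cnj (cf g (eta + (1/eps) *R rv k)))"
  proof (cases "eta \<in> Zs")
   case True
   have "(LI x. G eta x) = e eta * cnj (LI x. g x * cnj (P0 (eps *R eta) ((1/eps) *R x) * plane_wave x eta))"
    unfolding G_def B_integral_cnj[symmetric] integral_mult_right_zero[symmetric]
    by (intro B_integral_cong) auto
   also have "... = (LINT k|cspace. W e (eta + (1/eps) *R rv k) * cnj (cf g (eta + (1/eps) *R rv k)))"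
    unfolding bloch_integral[OF g True, symmetric] B_integral_cnj[symmetric] integral_mult_right_zero[symmetric]
    by (intro B_integral_cong) (auto simp: W_at[OF True])
   finally show ?thesis using True by simp
  next
   case False then show ?thesis using e by (simp add: onZ_def G_def)
  qed
 qed
 also have "... = ip (W e) (cf g)"
  unfolding ip_def
  by (rule integrable_tiling(4)[OF tiles_scaled_Zcell[OF eps], symmetric])
    (intro integrable_ip W_L2 e plancherel_bdd_supp g)
 finally show "(LI x. S e x * cnj (g x)) = ip (W e) (cf g)" .
qed

lemma S_FT: assumes e: "onZ e" shows "FT (S e) (W e)"
proof -
 note [measurable] = L2_measurable[OF onZ_L2[OF e]]
 have Sm [measurable]: "S e \<in> bmeas" unfolding S_def[abs_def] by measurable
 obtain w where w: "FT w (W e)" using FT_surj[OF W_L2(1)[OF e]] by blast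
 note wL = FT_L2(1)[OF w] note [measurable] = L2_measurable[OF wL]
 have "ae x. S e x - w x = 0"
 proof (rule borel_measurable_testing)
  fix g :: "real^'n => complex" assume g: "bdd_supp g"
  note i = S_test[OF e g] integrable_ip[OF wL bdd_suppD[OF g]]
  show "integrable lborel (\<lambda>x. (S e x - w x) * cnj (g x))" using i by (simp add: left_diff_distrib)
  have "ip w g = ip (W e) (cf g)" by (rule FT_ip[OF w FT_cf[OF g]])
  then show "(LI x. (S e x - w x) * cnj (g x)) = 0"
   using i by (simp add: left_diff_distrib ip_def)
 qed measurable
 then have "ae x. S e x = w x" by simp
 then show ?thesis using FT_cong[OF w Sm _ L2_measurable[OF FT_L2(2)[OF w]]] by simp
qed

lemma S_L2: "onZ e ==> S e \<in> LL"
 using S_FT FT_L2(1) by blast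

lemma synthesis_S:
 assumes "K \<subseteq> Zs" shows "synthesis K (bloch_wave Phi eps 0) c = S (\<lambda>eta. indicator K eta * c eta)"
 unfolding synthesis_def S_def set_lebesgue_integral_def bloch_wave_def fun_eq_iff
 using assms by (auto intro!: B_integral_cong simp: indicator_def P0_def subset_iff Zs_iff)

lemma S_cong: "ae eta. e eta = e' eta ==> e \<in> bmeas ==> e' \<in> bmeas ==> S e = S e'"
 unfolding S_def fun_eq_iff by (intro allI integral_cong_AE) auto

subsection \<open>Bloch coefficients\<close>

text \<open>The Bloch coefficients of order zero in terms of the Fourier transform \<open>h\<close>: on each fibre, the inner product with
 the coefficients of the eigenfunction.\<close>

definition Bc :: "(real^'n => complex) => real^'n => complex" where
 "Bc h eta = indicator Zs eta * (LINT k|cspace. h (eta + (1/eps) *R rv k) * cnj (phi k (eps *R eta)))"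

lemma Bc_L2:
 assumes h: "h \<in> LL" shows "onZ (Bc h)" "nrm (Bc h) \<le> nrm h"
proof -
 note [measurable] = L2_measurable[OF h]
 have "(\<lambda>(k, eta). h (eta + (1/eps) *R rv k) * cnj (phi k (eps *R eta))) \<in> borel_measurable (cspace \<Otimes>\<^sub>M borel)"
  by (rule measurable_pair_measure_countable1) auto
 then have "(\<lambda>(eta, k). h (eta + (1/eps) *R rv k) * cnj (phi k (eps *R eta))) \<in> borel_measurable (borel \<Otimes>\<^sub>M cspace)"
  by (subst (asm) measurable_pair_swap_iff) (simp add: case_prod_beta)
 then have [measurable]: "(\<lambda>eta. LINT k|cspace. h (eta + (1/eps) *R rv k) * cnj (phi k (eps *R eta))) \<in> bmeas"
  by (rule sigma_finite_measure.borel_measurable_lebesgue_integral[OF sigma_finite_measure_count_space_countable[OF countable_int_vec]])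
 have m: "Bc h \<in> bmeas" unfolding Bc_def[abs_def] by measurable
 have "(NI eta. ennreal ((norm (Bc h eta))^2))
  \<le> (NI eta. indicator Zs eta * (\<integral>\<^sup>+k. ennreal ((norm (h (eta + (1/eps) *R rv k)))^2) \<partial>cspace))"
 proof (rule nn_integral_mono)
  fix eta
  show "ennreal ((norm (Bc h eta))^2) \<le> indicator Zs eta * (\<integral>\<^sup>+k. ennreal ((norm (h (eta + (1/eps) *R rv k)))^2) \<partial>cspace)"
  proof (cases "eta \<in> Zs")
   case True
   then have z: "eps *R eta \<in> Zcell" by (simp add: Zs_iff)
   show ?thesis
    using count_space_Cauchy_Schwarz(1)[of "\<lambda>k. phi k (eps *R eta)" "\<lambda>k. h (eta + (1/eps) *R rv k)"] phi_norm(2,3)[OF z] True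
    by (simp add: Bc_def)
  qed (simp add: Bc_def)
 qed
 also have "... = ennreal ((nrm h)^2)"
  by (rule trans[OF fibre_nn_integral[OF L2_measurable[OF h], symmetric] nn_integral_L2[OF h]])
 finally have le: "(NI eta. ennreal ((norm (Bc h eta))^2)) \<le> ennreal ((nrm h)^2)" .
 have "Bc h \<in> LL" using L2_nn_integralI(1)[OF m le] by simp
 moreover have "Bc h eta = 0" if "eta \<notin> Zs" for eta using that by (simp add: Bc_def)
 ultimately show "onZ (Bc h)" unfolding onZ_def by blast
 have "(nrm (Bc h))^2 \<le> (nrm h)^2" using L2_nn_integralI(2)[OF m le] by simp
 then show "nrm (Bc h) \<le> nrm h" by (rule power2_le_imp_le) simp
qed

lemma Bc_diff:
 assumes "h \<in> LL" "h' \<in> LL"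
 shows "ae eta. Bc (\<lambda>xi. h xi - h' xi) eta = Bc h eta - Bc h' eta"
 using fibre_finite[OF assms(1)] fibre_finite[OF assms(2)]
proof eventually_elim
 case (elim eta)
 show ?case
 proof (cases "eta \<in> Zs")
  case True
  then have z: "eps *R eta \<in> Zcell" by (simp add: Zs_iff)
  note cs = count_space_Cauchy_Schwarz(2)[of "\<lambda>k. phi k (eps *R eta)"]
  show ?thesis using cs[of "\<lambda>k. h (eta + (1/eps) *R rv k)"] cs[of "\<lambda>k. h' (eta + (1/eps) *R rv k)"] phi_norm(2,3)[OF z] elim True
   by (simp add: Bc_def left_diff_distrib)
 qed (simp add: Bc_def)
qed

text \<open>For truncated functions both sides agree by \<open>parseval_periodic\<close>, and \<open>Bc\<close> is a contraction, so the truncated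
 integrals converge to \<open>Bc uh\<close>; the choice in the definition of the transform is therefore unique up to null sets.\<close>

lemma bloch_coeff_Bc:
 assumes uh: "FT u uh"
 shows "ae eta. eta \<in> Zs --> bloch_coeff Phi eps 0 u eta = Bc uh eta"
  and "(\<lambda>eta. indicator Zs eta * bloch_coeff Phi eps 0 u eta) \<in> bmeas"
proof -
 have u: "u \<in> LL" and uhL: "uh \<in> LL" using uh FT_L2 by auto
 let ?cR = "\<lambda>R eta. LINT x:cball 0 R|lborel. u x * cnj (bloch_wave Phi eps 0 x eta)"
 let ?L = "\<lambda>c. ((\<lambda>R. \<integral>\<^sup>+eta\<in>Zs. ennreal ((norm (c eta - ?cR R eta))^2) \<partial>lborel) \<longlongrightarrow> 0) at_top"
 have cR: "?cR R eta = Bc (cf (trunc R u)) eta" if "eta \<in> Zs" for R eta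
 proof -
  have "?cR R eta = (LI x. trunc R u x * cnj (P0 (eps *R eta) ((1/eps) *R x) * plane_wave x eta))"
   unfolding set_lebesgue_integral_def using that
   by (intro B_integral_cong) (auto simp: trunc_def indicator_def bloch_wave_def P0_def Zs_iff)
  then show ?thesis using bloch_integral[OF bdd_supp_trunc[OF u] that] that by (simp add: Bc_def)
 qed
 have cL: "cf (trunc R u) \<in> LL" for R by (rule plancherel_bdd_supp(1)[OF bdd_supp_trunc[OF u]])
 have BL: "Bc uh \<in> LL" "Bc (cf (trunc R u)) \<in> LL" for R
  using Bc_L2(1)[OF uhL] Bc_L2(1)[OF cL] onZ_L2 by auto
 note [measurable] = L2_measurable[OF BL(1)] L2_measurable[OF BL(2)]
 have le: "(\<integral>\<^sup>+eta\<in>Zs. ennreal ((norm (Bc uh eta - ?cR R eta))^2) \<partial>lborel) \<le> ennreal ((nrm (\<lambda>x. u x - trunc R u x))^2)" for R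
 proof -
  have dL: "(\<lambda>xi. uh xi - cf (trunc R u) xi) \<in> LL" by (intro L2_diff uhL cL)
  have "(\<integral>\<^sup>+eta\<in>Zs. ennreal ((norm (Bc uh eta - ?cR R eta))^2) \<partial>lborel)
   \<le> (NI eta. ennreal ((norm (Bc (\<lambda>xi. uh xi - cf (trunc R u) xi) eta))^2))"
   by (rule nn_integral_mono_AE, use Bc_diff[OF uhL cL, of R] in eventually_elim)
     (auto simp: indicator_def cR)
  also have "... = ennreal ((nrm (Bc (\<lambda>xi. uh xi - cf (trunc R u) xi)))^2)"
   by (rule nn_integral_L2[OF onZ_L2[OF Bc_L2(1)[OF dL]]])
  also have "... \<le> ennreal ((nrm (\<lambda>xi. uh xi - cf (trunc R u) xi))^2)"
   by (intro ennreal_leI power_mono Bc_L2 dL) simp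
  also have "nrm (\<lambda>xi. uh xi - cf (trunc R u) xi) = nrm (\<lambda>x. u x - trunc R u x)"
   by (rule FT_nrm[OF FT_diff[OF uh FT_cf[OF bdd_supp_trunc[OF u]]]])
  finally show ?thesis .
 qed
 have LB: "?L (Bc uh)"
 proof (rule tendsto_sandwich[OF _ _ tendsto_const])
  show "((\<lambda>R. ennreal ((nrm (\<lambda>x. u x - trunc R u x))^2)) \<longlongrightarrow> 0) at_top"
   using tendsto_ennreal_sq_iff[of "\<lambda>R. nrm (\<lambda>x. u x - trunc R u x)" at_top] trunc_tendsto[OF u] by simp
 qed (use le in auto)
 have B2: "Bc uh \<in> L2 Zs"
 proof -
  have "(\<lambda>eta. indicator Zs eta *R (norm (Bc uh eta))^2) = (\<lambda>eta. (norm (Bc uh eta))^2)" by (auto simp: Bc_def indicator_def)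
  then show ?thesis using L2_integrable[OF BL(1)]
   by (simp add: L2_def set_borel_measurable_def set_integrable_def)
 qed
 define c where "c = bloch_coeff Phi eps 0 u"
 have "c \<in> L2 Zs \<and> ?L c"
  unfolding c_def bloch_coeff_def L2_transform_def
  by (rule someI[of "\<lambda>c. c \<in> L2 Zs \<and> ?L c" "Bc uh"]) (use LB B2 in blast)
 then have c: "set_borel_measurable lborel Zs c" "?L c" by (auto simp: L2_def)
 have "(\<lambda>eta. indicator Zs eta * c eta) = (\<lambda>eta. indicator Zs eta *R c eta)" by (auto simp: indicator_def)
 then show m [measurable]: "(\<lambda>eta. indicator Zs eta * c eta) \<in> bmeas"
  using c(1) by (simp add: set_borel_measurable_def)
 have "(NI eta. ennreal ((norm (indicator Zs eta * c eta - Bc uh eta))^2)) = 0"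
 proof -
  let ?D = "\<integral>\<^sup>+eta. ennreal ((norm (indicator Zs eta * c eta - Bc uh eta))^2) \<partial>lborel"
  have b: "?D \<le> 2 * (\<integral>\<^sup>+eta\<in>Zs. ennreal ((norm (c eta - ?cR R eta))^2) \<partial>lborel)
     + 2 * (\<integral>\<^sup>+eta\<in>Zs. ennreal ((norm (Bc uh eta - ?cR R eta))^2) \<partial>lborel)" for R
  proof -
   have e: "ennreal ((norm (f eta - ?cR R eta))^2) * indicator Zs eta
    = ennreal ((norm (indicator Zs eta * f eta - Bc (cf (trunc R u)) eta))^2)" for f eta
    by (auto simp: indicator_def cR Bc_def)
   have "Bc uh eta = indicator Zs eta * Bc uh eta" for eta by (simp add: Bc_def indicator_def)
   then have "?D \<le> (NI eta. 2 * ennreal ((norm (indicator Zs eta * c eta - Bc (cf (trunc R u)) eta))^2)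
     + 2 * ennreal ((norm (indicator Zs eta * Bc uh eta - Bc (cf (trunc R u)) eta))^2))"
   proof (intro nn_integral_mono)
    fix eta
    have "(norm (indicator Zs eta * c eta - Bc uh eta))^2 \<le> 2 * (norm (indicator Zs eta * c eta - Bc (cf (trunc R u)) eta))^2
     + 2 * (norm (Bc (cf (trunc R u)) eta - Bc uh eta))^2"
     using norm_add_sq_le[of "indicator Zs eta * c eta - Bc (cf (trunc R u)) eta" "Bc (cf (trunc R u)) eta - Bc uh eta"] by simp
    then have "ennreal ((norm (indicator Zs eta * c eta - Bc uh eta))^2) \<le> ennreal (2 * (norm (indicator Zs eta * c eta - Bc (cf (trunc R u)) eta))^2
     + 2 * (norm (Bc uh eta - Bc (cf (trunc R u)) eta))^2)"
     unfolding norm_minus_commute[of "Bc (cf (trunc R u)) eta" "Bc uh eta"] by (rule ennreal_leI)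
    moreover have "indicator Zs eta * Bc uh eta = Bc uh eta" by (simp add: Bc_def indicator_def)
    moreover have "ennreal (2 * x^2 + 2 * y^2) = 2 * ennreal (x^2) + 2 * ennreal (y^2)" for x y :: real
     by (simp add: ennreal_plus ennreal_mult)
    ultimately show "ennreal ((norm (indicator Zs eta * c eta - Bc uh eta))^2) \<le> 2 * ennreal ((norm (indicator Zs eta * c eta - Bc (cf (trunc R u)) eta))^2)
     + 2 * ennreal ((norm (indicator Zs eta * Bc uh eta - Bc (cf (trunc R u)) eta))^2)"
     by (simp only:)
   qed
   also have "... = 2 * (NI eta. ennreal ((norm (indicator Zs eta * c eta - Bc (cf (trunc R u)) eta))^2))
     + 2 * (NI eta. ennreal ((norm (indicator Zs eta * Bc uh eta - Bc (cf (trunc R u)) eta))^2))"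
    by (subst nn_integral_add) (auto simp: nn_integral_cmult)
   finally show ?thesis unfolding e .
  qed
  have "((\<lambda>R. 2 * (\<integral>\<^sup>+eta\<in>Zs. ennreal ((norm (c eta - ?cR R eta))^2) \<partial>lborel)
     + 2 * (\<integral>\<^sup>+eta\<in>Zs. ennreal ((norm (Bc uh eta - ?cR R eta))^2) \<partial>lborel)) \<longlongrightarrow> 2 * 0 + 2 * 0) at_top"
   using c(2) LB by (intro tendsto_add ennreal_tendsto_cmult) auto
  from tendsto_lowerbound[OF this always_eventually, of ?D] b have "?D \<le> 0" by simp
  then show ?thesis by simp
 qed
 then have "ae eta. ennreal ((norm (indicator Zs eta * c eta - Bc uh eta))^2) = 0"
  by (subst (asm) nn_integral_0_iff_AE) auto
 then show "ae eta. eta \<in> Zs --> c eta = Bc uh eta"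
  by eventually_elim (auto simp: indicator_def)
qed

lemma ip_S:
 assumes uh: "FT u uh" and e: "onZ e" shows "ip u (S e) = ip (Bc uh) e"
proof -
 have "ip u (S e) = ip uh (W e)" by (rule FT_ip[OF uh S_FT[OF e]])
 also have "... = (LI eta. indicator Zs eta * (LINT k|cspace. uh (eta + (1/eps) *R rv k) * cnj (W e (eta + (1/eps) *R rv k))))"
  unfolding ip_def by (rule integrable_tiling(4)[OF tiles_scaled_Zcell[OF eps]]) (intro integrable_ip FT_L2(2)[OF uh] W_L2 e)
 also have "... = ip (Bc uh) e"
  unfolding ip_def
 proof (rule B_integral_cong[OF refl])
  fix eta
  have "(LINT k|cspace. uh (eta + (1/eps) *R rv k) * cnj (e eta * phi k (eps *R eta)))
   = (LINT k|cspace. uh (eta + (1/eps) *R rv k) * cnj (phi k (eps *R eta))) * cnj (e eta)"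
   unfolding integral_mult_left_zero[symmetric] by (simp add: ac_simps)
  then show "indicator Zs eta * (LINT k|cspace. uh (eta + (1/eps) *R rv k) * cnj (W e (eta + (1/eps) *R rv k))) = Bc uh eta * cnj (e eta)"
   by (cases "eta \<in> Zs") (simp_all add: Bc_def W_at)
 qed
 finally show ?thesis .
qed

lemma Bc_W: assumes e: "onZ e" shows "Bc (W e) eta = e eta"
proof (cases "eta \<in> Zs")
 case True
 then have z: "eps *R eta \<in> Zcell" by (simp add: Zs_iff)
 have "(LINT k|cspace. e eta * phi k (eps *R eta) * cnj (phi k (eps *R eta))) = e eta * of_real (LINT k|cspace. (norm (phi k (eps *R eta)))^2)"
  unfolding integral_complex_of_real[symmetric] integral_mult_right_zero[symmetric] complex_norm_square
  by (simp add: mult.assoc)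
 then show ?thesis using True phi_norm(3)[OF z] by (simp add: Bc_def W_at)
next
 case False then show ?thesis using e by (simp add: Bc_def onZ_def)
qed

lemma ip_S_S: assumes "onZ e" "onZ e'" shows "ip (S e) (S e') = ip e e'"
 using ip_S[OF S_FT[OF assms(1)] assms(2)] Bc_W[OF assms(1), abs_def] by simp

end

lemma FT_weak_deriv_real:
 fixes u v :: "real^'n => real"
 assumes w: "has_weak_deriv js u v" and v: "v \<in> LL" and u: "FT (cplx u) c"
 shows "FT (cplx v) (\<lambda>xi. symb js xi * c xi)"
proof -
 have v': "cplx v \<in> LL" using v by simp
 note F = fourier_FT(1)[OF v']
 have "ae xi. fourier (cplx v) xi = symb js xi * c xi"
  by (rule weak_deriv_FT[OF _ u F]) (simp add: has_weak_deriv_of_real w)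
 then have "ae xi. symb js xi * c xi = fourier (cplx v) xi" by eventually_elim simp
 then show ?thesis
  by (intro FT_cong[OF F L2_measurable[OF v']] borel_measurable_times symb_measurable L2_measurable[OF FT_L2(2)[OF u]]) auto
qed

lemma has_weak_deriv_Re:
 fixes u v :: "real^'n => complex"
 assumes "has_weak_deriv js u v" shows "has_weak_deriv js (\<lambda>x. Re (u x)) (\<lambda>x. Re (v x))"
proof -
 have l: "locally_integrable u" "locally_integrable v" using assms by (auto simp: has_weak_deriv_def)
 have lR: "locally_integrable (\<lambda>x. Re (w x))" if "locally_integrable w" for w :: "real^'n => complex"
  using integrable_Re[OF locally_integrableD(2)[OF that]] by (simp add: locally_integrable_def set_integrable_def)
 show ?thesis unfolding has_weak_deriv_def
 proof (intro conjI allI impI lR l)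
  fix \<phi> :: "real^'n => real" assume \<phi>: "test_function \<phi>"
  have "(LI x. iter_partial js \<phi> x *R u x) = (-1::real) ^ length js *R (LI x. \<phi> x *R v x)"
   using assms \<phi> unfolding has_weak_deriv_def by blast
  from arg_cong[OF this, of Re]
  show "(LI x. iter_partial js \<phi> x *R Re (u x)) = (-1::real) ^ length js *R (LI x. \<phi> x *R Re (v x))"
   using integral_Re[OF integrable_test_mult[OF l(1) test_function_iter[OF \<phi>, of js]]] integral_Re[OF integrable_test_mult[OF l(2) \<phi>]]
   by simp
 qed
qed

lemma has_weak_deriv_Nil: "(u :: real^'n => real) \<in> LL ==> has_weak_deriv [] u u"
proof -
 assume "u \<in> LL"
 then have "locally_integrable (cplx u)" by (intro L2_locally_integrable) simp
 then have "has_weak_deriv [] (cplx u) (cplx u)" by (simp add: has_weak_deriv_def)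
 then show ?thesis by (simp add: has_weak_deriv_of_real)
qed

lemma Sobolev_1I:
 assumes "u \<in> LL" "\<And>j. \<exists>v \<in> LL. has_weak_deriv [j] u v" shows "u \<in> Sobolev 1"
 unfolding Sobolev_def
proof (intro CollectI conjI allI impI assms(1))
 fix js :: "'a list" assume "length js \<le> 1"
 then consider "js = []" | j where "js = [j]" by (cases js) auto
 then show "\<exists>v \<in> LL. has_weak_deriv js u v"
  using assms has_weak_deriv_Nil by cases blast+
qed

lemma Sobolev_1D:
 assumes "u \<in> Sobolev 1"
 shows "u \<in> LL" "\<exists>v \<in> LL. has_weak_deriv [j] u v"
  and "weak_deriv [j] u \<in> LL" "has_weak_deriv [j] u (weak_deriv [j] u)"
proof -
 have *: "\<And>js. length js \<le> 1 --> (\<exists>v \<in> LL. has_weak_deriv js u v)"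
  using assms unfolding Sobolev_def by blast
 show "u \<in> LL" using assms by (simp add: Sobolev_def)
 show ex: "\<exists>v \<in> LL. has_weak_deriv [j] u v" using *[of "[j]"] by simp
 then obtain v where v: "v \<in> LL" "has_weak_deriv [j] u v" by blast
 show "has_weak_deriv [j] u (weak_deriv [j] u)" unfolding weak_deriv_def by (rule someI[of "has_weak_deriv [j] u" v, OF v(2)])
 show "weak_deriv [j] u \<in> LL"
  by (rule L2_AE_cong(1)[OF v(1) weak_deriv_AE_real[OF v(2)]])
qed

lemma has_weak_deriv_linear:
 fixes u v u' v' :: "real^'n => real"
 assumes "has_weak_deriv js u v" "has_weak_deriv js u' v'"
 shows "has_weak_deriv js (\<lambda>x. u x - u' x) (\<lambda>x. v x - v' x)"
proof -
 have l: "locally_integrable u" "locally_integrable v" "locally_integrable u'" "locally_integrable v'"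
  using assms by (auto simp: has_weak_deriv_def)
 show ?thesis unfolding has_weak_deriv_def
 proof (intro conjI allI impI)
  fix \<phi> :: "real^'n => real" assume \<phi>: "test_function \<phi>"
  have "(LI x. iter_partial js \<phi> x *R u x) = (-1::real) ^ length js *R (LI x. \<phi> x *R v x)"
   "(LI x. iter_partial js \<phi> x *R u' x) = (-1::real) ^ length js *R (LI x. \<phi> x *R v' x)"
   using assms \<phi> unfolding has_weak_deriv_def by blast+
  then show "(LI x. iter_partial js \<phi> x *R (u x - u' x)) = (-1::real) ^ length js *R (LI x. \<phi> x *R (v x - v' x))"
   using integrable_test_mult[OF l(1) test_function_iter[OF \<phi>, of js]] integrable_test_mult[OF l(3) test_function_iter[OF \<phi>, of js]]
    integrable_test_mult[OF l(2) \<phi>] integrable_test_mult[OF l(4) \<phi>]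
   by (simp add: right_diff_distrib)
 qed (use l in \<open>auto simp: locally_integrable_diff\<close>)
qed

lemma Sobolev_1_diff:
 assumes "u \<in> Sobolev 1" "v \<in> Sobolev 1"
 shows "(\<lambda>x. u x - v x) \<in> Sobolev 1"
  and "ae x. weak_grad (\<lambda>x. u x - v x) x = weak_grad u x - weak_grad v x"
proof -
 note d = has_weak_deriv_linear[OF Sobolev_1D(4)[OF assms(1)] Sobolev_1D(4)[OF assms(2)]]
 show "(\<lambda>x. u x - v x) \<in> Sobolev 1"
  by (rule Sobolev_1I) (use d assms Sobolev_1D in blast)+
 have "ae x. \<forall>j. weak_deriv [j] (\<lambda>x. u x - v x) x = weak_deriv [j] u x - weak_deriv [j] v x"
  unfolding AE_all_countable using weak_deriv_AE_real(2)[OF d] by blast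
 then show "ae x. weak_grad (\<lambda>x. u x - v x) x = weak_grad u x - weak_grad v x"
  by eventually_elim (simp add: weak_grad_def vec_eq_iff)
qed

context bloch
begin

subsection \<open>The resolvent on Bloch waves\<close>

text \<open>The multiplier of the solution operator on Bloch coefficients.\<close>

definition res :: "real^'n => real" where
 "res eta = (if eta \<in> Zs then 1 / (1 + lam 0 (eps *R eta) / eps^2) else 0)"

lemma lam_nonneg: "eta \<in> Zs ==> lam 0 (eps *R eta) / eps^2 \<ge> 0"
 using eigen(4)[of "eps *R eta"] by (simp add: Zs_iff)

lemma res_bounds: "0 \<le> res eta" "res eta \<le> 1"
 using lam_nonneg[of eta] by (auto simp: res_def)

lemma res_measurable [measurable]: "res \<in> bmeas"
proof -
 have "(\<lambda>eta. if eps *R eta \<in> Zcell then lam 0 (eps *R eta) else 0) \<in> bmeas"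
  by (rule measurable_compose[OF _ lam_measurable]) measurable
 then have [measurable]: "(\<lambda>eta. if eta \<in> Zs then lam 0 (eps *R eta) else 0) \<in> bmeas" by (simp add: Zs_iff)
 have "res = (\<lambda>eta. if eta \<in> Zs then 1 / (1 + (if eta \<in> Zs then lam 0 (eps *R eta) else 0) / eps^2) else 0)"
  by (auto simp: res_def)
 also have "... \<in> bmeas" by measurable
 finally show ?thesis .
qed

definition rs :: "(real^'n => complex) => real^'n => complex" where
 "rs e eta = of_real (res eta) * e eta"

lemma onZ_mult:
 assumes "onZ e" "b \<in> bmeas" "\<And>eta. norm (b eta) \<le> B"
 shows "onZ (\<lambda>eta. b eta * e eta)"
 using L2_mult_bounded(1)[OF onZ_L2[OF assms(1)] assms(2,3)] assms(1) by (auto simp: onZ_def)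

lemma onZ_rs: "onZ e ==> onZ (rs e)"
 unfolding rs_def[abs_def] by (rule onZ_mult[where B=1]) (use res_bounds in auto)

lemma symb_fibre: "symb [j] (eta + (1/eps) *R rv k) = sy j k (eps *R eta) / of_real eps"
proof -
 have "eta $ j + of_int (k $ j) / eps = (of_int (k $ j) + eps * eta $ j) / eps" using eps by (simp add: field_simps)
 then have "complex_of_real (eta $ j + of_int (k $ j) / eps) = (of_int (k $ j) + of_real eps * of_real (eta $ j)) / of_real eps"
  by (simp only:) simp
 then show ?thesis by (simp add: sy_def)
qed

lemma gradient_fibre:
 assumes "eta \<in> Zs"
 shows "symb [j] (eta + (1/eps) *R rv k) * W (rs e) (eta + (1/eps) *R rv k)
  = cf (\<lambda>x. (rs e eta / of_real eps) * grad j (eps *R eta) x) (rv k)"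
 unfolding symb_fibre W_at[OF assms] cf_cmult grad_coeff by simp

text \<open>On each fibre the gradient of the eigenfunction is bounded by the eigenvalue (\<open>grad_bound\<close>), and the square of the
 resolvent multiplier compensates the eigenvalue.\<close>

lemma gradient_L2:
 assumes e: "onZ e" shows "(\<lambda>xi. symb [j] xi * W (rs e) xi) \<in> LL"
proof -
 note [measurable] = L2_measurable[OF W_L2(1)[OF onZ_rs[OF e]]]
 have m: "(\<lambda>xi. symb [j] xi * W (rs e) xi) \<in> bmeas" by measurable
 have "(NI xi. ennreal ((norm (symb [j] xi * W (rs e) xi))^2))
  \<le> (NI eta. ennreal ((norm (of_real (1 / sqrt ell) * e eta))^2))"
  unfolding fibre_nn_integral[OF m]
 proof (rule nn_integral_mono)
  fix eta
  show "indicator Zs eta * (\<integral>\<^sup>+k. ennreal ((norm (symb [j] (eta + (1/eps) *R rv k) * W (rs e) (eta + (1/eps) *R rv k)))^2) \<partial>cspace)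
   \<le> ennreal ((norm (of_real (1 / sqrt ell) * e eta))^2)"
  proof (cases "eta \<in> Zs")
   case True
   then have z: "eps *R eta \<in> Zcell" by (simp add: Zs_iff)
   let ?b = "rs e eta / of_real eps" and ?g = "grad j (eps *R eta)"
   have "(\<integral>\<^sup>+k. ennreal ((norm (symb [j] (eta + (1/eps) *R rv k) * W (rs e) (eta + (1/eps) *R rv k)))^2) \<partial>cspace)
    = ennreal ((nrm (\<lambda>x. ?b * ?g x))^2)"
    unfolding gradient_fibre[OF True]
    by (rule parseval_torus(1)[OF L2_cmult[OF grad_L2]]) (simp add: grad_outside)
   also have "(nrm (\<lambda>x. ?b * ?g x))^2 = (res eta)^2 * (norm (e eta))^2 / eps^2 * (nrm ?g)^2"
    unfolding nrm_cmult by (simp add: rs_def norm_mult norm_divide power_mult_distrib power_divide)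
   also have "... \<le> (norm (of_real (1 / sqrt ell) * e eta))^2"
   proof -
    have "ell * (nrm ?g)^2 \<le> ell * (\<Sum>j\<in>UNIV. (nrm (grad j (eps *R eta)))^2)"
     using ell(1) member_le_sum[of j UNIV "\<lambda>j. (nrm (grad j (eps *R eta)))^2"] by simp
    also have "... \<le> lam 0 (eps *R eta)" by (rule grad_bound[OF z])
    finally have "(nrm ?g)^2 \<le> lam 0 (eps *R eta) / ell" using ell(1) by (simp add: field_simps)
    then have "(res eta)^2 * (norm (e eta))^2 / eps^2 * (nrm ?g)^2 \<le> (res eta)^2 * (norm (e eta))^2 / eps^2 * (lam 0 (eps *R eta) / ell)"
     by (intro mult_left_mono) auto
    also have "... = (res eta * (res eta * (lam 0 (eps *R eta) / eps^2))) * ((norm (e eta))^2 / ell)"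
     by (simp add: power2_eq_square)
    also have "... \<le> (1 * 1) * ((norm (e eta))^2 / ell)"
    proof (intro mult_right_mono mult_mono res_bounds)
     show "res eta * (lam 0 (eps *R eta) / eps^2) \<le> 1"
     proof -
      have "1 / (1 + t) * t \<le> 1" if "t \<ge> 0" for t :: real using that by (simp add: field_simps)
      from this[OF lam_nonneg[OF True]] show ?thesis using True by (simp add: res_def)
     qed
     show "0 \<le> res eta * (lam 0 (eps *R eta) / eps^2)"
      using lam_nonneg[OF True] res_bounds(1)[of eta] by (rule mult_nonneg_nonneg[rotated])
    qed (use ell(1) in auto)
    also have "... = (norm (of_real (1 / sqrt ell) * e eta))^2"
     using ell(1) by (simp add: norm_mult power_mult_distrib norm_divide power_divide)
    finally show ?thesis .
   qed
   finally show ?thesis using True by (simp add: ennreal_leI)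
  qed simp
 qed
 also have "... = ennreal ((nrm (\<lambda>eta. of_real (1 / sqrt ell) * e eta))^2)"
  by (rule nn_integral_L2[OF L2_cmult[OF onZ_L2[OF e]]])
 finally show ?thesis using L2_nn_integralI(1)[OF m] by simp
qed

text \<open>The equation is checked on the fibres: by \<open>periodic_mult\<close> the coefficient matrix acts there as on the cell, and
 \<open>eigen_coeff\<close> turns the operator into multiplication by \<open>1 + lam 0 (eps *R eta) / eps^2 = 1 / res eta\<close>.\<close>

lemma resolvent_equation:
 assumes e: "onZ e" and V: "\<And>j. FT (V j) (\<lambda>xi. symb [j] xi * W (rs e) xi)"
  and \<phi>: "FT \<phi> \<phi>h" and D: "\<And>i. FT (D i) (\<lambda>xi. symb [i] xi * \<phi>h xi)"
 shows "(\<Sum>i\<in>UNIV. \<Sum>j\<in>UNIV. ip (\<lambda>x. a i j ((1/eps) *R x) * V j x) (D i)) + ip (S (rs e)) \<phi> = ip (S e) \<phi>"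
proof -
 have "(\<lambda>x. a i j ((1/eps) *R x) * V j x) \<in> LL" for i j
  by (rule L2_mult_bounded(1)[OF FT_L2(1)[OF V]]) (auto intro: a_norm)
 then have "\<exists>H. FT (\<lambda>x. a i j ((1/eps) *R x) * V j x) H" for i j using fourier_FT(1) by blast
 then obtain H where H: "\<And>i j. FT (\<lambda>x. a i j ((1/eps) *R x) * V j x) (H i j)" by metis
 have "ae eta. eta \<in> Zs --> (\<forall>k. H i j (eta + (1/eps) *R rv k) = cf (\<lambda>x. a i j x * ((rs e eta / of_real eps) * grad j (eps *R eta) x)) (rv k))" for i j
 proof (rule periodic_mult[OF eps a_measurable a_norm a_periodic V _ H])
  show "ae eta. eta \<in> Zs --> integrable lborel (\<lambda>x. (rs e eta / of_real eps) * grad j (eps *R eta) x)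
   \<and> (\<forall>x. x \<notin> Ycell --> (rs e eta / of_real eps) * grad j (eps *R eta) x = 0)
   \<and> (\<forall>k. symb [j] (eta + (1/eps) *R rv k) * W (rs e) (eta + (1/eps) *R rv k) = cf (\<lambda>x. (rs e eta / of_real eps) * grad j (eps *R eta) x) (rv k))"
  proof (rule AE_I2, intro impI conjI allI)
   fix eta k assume eta: "eta \<in> Zs"
   show "integrable lborel (\<lambda>x. (rs e eta / of_real eps) * grad j (eps *R eta) x)"
    by (rule integrable_mult_right[OF grad_integrable])
   show "symb [j] (eta + (1/eps) *R rv k) * W (rs e) (eta + (1/eps) *R rv k) = cf (\<lambda>x. (rs e eta / of_real eps) * grad j (eps *R eta) x) (rv k)"
    by (rule gradient_fibre[OF eta])
  qed (simp add: grad_outside)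
 qed
 then have Hf: "ae eta. \<forall>i j. eta \<in> Zs --> (\<forall>k. H i j (eta + (1/eps) *R rv k) = cf (\<lambda>x. a i j x * ((rs e eta / of_real eps) * grad j (eps *R eta) x)) (rv k))"
  unfolding AE_all_countable by blast
 have eq: "ae xi. (\<Sum>i\<in>UNIV. \<Sum>j\<in>UNIV. H i j xi * cnj (symb [i] xi)) + W (rs e) xi = W e xi"
 proof (rule AE_fibres, use Hf in eventually_elim)
  case (elim eta)
  show ?case
  proof (intro impI allI)
   fix k assume eta: "eta \<in> Zs"
   then have z: "eps *R eta \<in> Zcell" by (simp add: Zs_iff)
   let ?xi = "eta + (1/eps) *R rv k" and ?b = "rs e eta / of_real eps"
   have "H i j ?xi = ?b * cf (\<lambda>x. a i j x * grad j (eps *R eta) x) (rv k)" for i j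
    using elim eta unfolding cf_cmult[symmetric] by (simp only: mult.left_commute) 
   then have "(\<Sum>i\<in>UNIV. \<Sum>j\<in>UNIV. H i j ?xi * cnj (symb [i] ?xi))
    = (\<Sum>i\<in>UNIV. ?b / of_real eps * (cf (flux i (eps *R eta)) (rv k) * cnj (sy i k (eps *R eta))))"
    unfolding symb_fibre flux_coeff
    by (simp add: sum_distrib_left sum_distrib_right mult.assoc)
   also have "... = ?b / of_real eps * (of_real (lam 0 (eps *R eta)) * phi k (eps *R eta))"
    by (simp only: sum_distrib_left[symmetric] eigen_coeff[OF z])
   also have "... + W (rs e) ?xi = of_real (res eta * (1 + lam 0 (eps *R eta) / eps^2)) * (e eta * phi k (eps *R eta))"
    unfolding W_at[OF eta] by (simp add: rs_def power2_eq_square algebra_simps)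
   also have "res eta * (1 + lam 0 (eps *R eta) / eps^2) = 1"
    using lam_nonneg[OF eta] eta by (simp add: res_def)
   finally show "(\<Sum>i\<in>UNIV. \<Sum>j\<in>UNIV. H i j ?xi * cnj (symb [i] ?xi)) + W (rs e) ?xi = W e ?xi"
    by (simp add: W_at[OF eta])
  qed
 qed
 note WL = W_L2(1)[OF e] W_L2(1)[OF onZ_rs[OF e]] and \<phi>L = FT_L2(2)[OF \<phi>]
 note [measurable] = L2_measurable[OF WL(1)] L2_measurable[OF WL(2)] L2_measurable[OF \<phi>L] L2_measurable[OF FT_L2(2)[OF H]]
 have int: "integrable lborel (\<lambda>xi. H i j xi * cnj (symb [i] xi * \<phi>h xi))" for i j
  by (rule integrable_ip[OF FT_L2(2)[OF H] FT_L2(2)[OF D]])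
 have "(\<Sum>i\<in>UNIV. \<Sum>j\<in>UNIV. ip (\<lambda>x. a i j ((1/eps) *R x) * V j x) (D i))
  = (\<Sum>i\<in>UNIV. \<Sum>j\<in>UNIV. LI xi. H i j xi * cnj (symb [i] xi * \<phi>h xi))"
  unfolding FT_ip[OF H D] unfolding ip_def ..
 also have "... = (LI xi. (\<Sum>i\<in>UNIV. \<Sum>j\<in>UNIV. H i j xi * cnj (symb [i] xi * \<phi>h xi)))"
 proof -
  have "(\<Sum>j\<in>UNIV. LI xi. H i j xi * cnj (symb [i] xi * \<phi>h xi)) = (LI xi. (\<Sum>j\<in>UNIV. H i j xi * cnj (symb [i] xi * \<phi>h xi)))" for i
   by (rule B_integral_sum[symmetric]) (rule int)
  moreover have "(\<Sum>i\<in>UNIV. LI xi. (\<Sum>j\<in>UNIV. H i j xi * cnj (symb [i] xi * \<phi>h xi)))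
    = (LI xi. (\<Sum>i\<in>UNIV. \<Sum>j\<in>UNIV. H i j xi * cnj (symb [i] xi * \<phi>h xi)))"
   by (rule B_integral_sum[symmetric]) (intro B_integrable_sum int)
  ultimately show ?thesis by (simp only:)
 qed
 finally have "(\<Sum>i\<in>UNIV. \<Sum>j\<in>UNIV. ip (\<lambda>x. a i j ((1/eps) *R x) * V j x) (D i)) + ip (S (rs e)) \<phi>
  = (LI xi. (\<Sum>i\<in>UNIV. \<Sum>j\<in>UNIV. H i j xi * cnj (symb [i] xi * \<phi>h xi)) + W (rs e) xi * cnj (\<phi>h xi))"
 proof -
  assume *: "(\<Sum>i\<in>UNIV. \<Sum>j\<in>UNIV. ip (\<lambda>x. a i j ((1/eps) *R x) * V j x) (D i))
   = (LI xi. (\<Sum>i\<in>UNIV. \<Sum>j\<in>UNIV. H i j xi * cnj (symb [i] xi * \<phi>h xi)))"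
  have "(LI xi. (\<Sum>i\<in>UNIV. \<Sum>j\<in>UNIV. H i j xi * cnj (symb [i] xi * \<phi>h xi)) + W (rs e) xi * cnj (\<phi>h xi))
   = (LI xi. (\<Sum>i\<in>UNIV. \<Sum>j\<in>UNIV. H i j xi * cnj (symb [i] xi * \<phi>h xi))) + (LI xi. W (rs e) xi * cnj (\<phi>h xi))"
   by (rule B_integral_add) (intro B_integrable_sum int integrable_ip WL \<phi>L)+
  then show ?thesis by (simp only: * FT_ip[OF S_FT[OF onZ_rs[OF e]] \<phi>] ip_def[of "W (rs e)" \<phi>h])
 qed
 also have "... = (LI xi. W e xi * cnj (\<phi>h xi))"
 proof (rule integral_cong_AE)
  show "ae xi. (\<Sum>i\<in>UNIV. \<Sum>j\<in>UNIV. H i j xi * cnj (symb [i] xi * \<phi>h xi)) + W (rs e) xi * cnj (\<phi>h xi) = W e xi * cnj (\<phi>h xi)"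
   using eq
  proof eventually_elim
   case (elim xi)
   show ?case unfolding elim[symmetric] by (simp add: sum_distrib_right distrib_right mult.assoc)
  qed
 qed measurable
 also have "... = ip (S e) \<phi>" by (simp only: FT_ip[OF S_FT[OF e] \<phi>] ip_def[of "W e" \<phi>h])
 finally show ?thesis .
qed

definition form :: "(real^'n => real) => (real^'n => real) => real" where
 "form y \<phi> = (LI x. weak_grad \<phi> x \<bullet> (A ((1/eps) *R x) *v weak_grad y x) + y x * \<phi> x)"

lemma a_AE_scaled: "ae x. \<forall>i j. a i j ((1/eps) *R x) = of_real (A ((1/eps) *R x) $ i $ j)"
 using AE_affine[OF a_AE, of "1/eps" 0] eps by simp

lemma form_integrand:
 "weak_grad \<phi> x \<bullet> (M *v weak_grad y x) = (\<Sum>i\<in>UNIV. \<Sum>j\<in>UNIV. M $ i $ j * (weak_deriv [j] y x * weak_deriv [i] \<phi> x))"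
 by (simp add: inner_vec_def matrix_vector_mult_def weak_grad_def sum_distrib_left ac_simps)

lemma form_integrable:
 assumes "y \<in> Sobolev 1" "\<phi> \<in> Sobolev 1"
 shows "integrable lborel (\<lambda>x. weak_grad \<phi> x \<bullet> (A ((1/eps) *R x) *v weak_grad y x) + y x * \<phi> x)"
proof -
 note L = Sobolev_1D(3)[OF assms(1)] Sobolev_1D(3)[OF assms(2)]
 note [measurable] = L2_measurable[OF L(1)] L2_measurable[OF L(2)]
 have "integrable lborel (\<lambda>x. A ((1/eps) *R x) $ i $ j * (weak_deriv [j] y x * weak_deriv [i] \<phi> x))" for i j
 proof (rule B_integrable_bound)
  show "integrable lborel (\<lambda>x. bnd * (weak_deriv [j] y x * weak_deriv [i] \<phi> x))"
   by (intro integrable_mult_right integrable_L2_mult L)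
  have "ae x. \<forall>i j. \<bar>A ((1/eps) *R x) $ i $ j\<bar> \<le> bnd"
   using AE_affine[OF bnd(2), of "1/eps" 0] eps by simp
  then show "ae x. norm (A ((1/eps) *R x) $ i $ j * (weak_deriv [j] y x * weak_deriv [i] \<phi> x)) \<le> norm (bnd * (weak_deriv [j] y x * weak_deriv [i] \<phi> x))"
   by eventually_elim (simp add: bnd(1) abs_mult mult_right_mono)
 qed measurable
 then show ?thesis unfolding form_integrand
 proof (intro B_integrable_add B_integrable_sum)
  show "integrable lborel (\<lambda>x. y x * \<phi> x)"
   by (rule integrable_L2_mult[OF Sobolev_1D(1)[OF assms(1)] Sobolev_1D(1)[OF assms(2)]])
 qed
qed

lemma form_measurable_integrand:
 assumes "y \<in> Sobolev 1" "\<phi> \<in> Sobolev 1"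
 shows "(\<lambda>x. weak_grad \<phi> x \<bullet> (A ((1/eps) *R x) *v weak_grad y x) + y x * \<phi> x) \<in> borel_measurable lborel"
 by (rule borel_measurable_integrable[OF form_integrable[OF assms]])

lemma form_commute:
 assumes "y \<in> Sobolev 1" "\<phi> \<in> Sobolev 1" shows "form y \<phi> = form \<phi> y"
 unfolding form_def
proof (rule integral_cong_AE)
 have "ae x. transpose (A x) = A x" using coeff by (simp add: coefficient_field_def)
 from AE_affine[OF this, of "1/eps" 0] have "ae x. transpose (A ((1/eps) *R x)) = A ((1/eps) *R x)" using eps by simp
 then show "ae x. weak_grad \<phi> x \<bullet> (A ((1/eps) *R x) *v weak_grad y x) + y x * \<phi> x
   = weak_grad y x \<bullet> (A ((1/eps) *R x) *v weak_grad \<phi> x) + \<phi> x * y x"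
 proof eventually_elim
  case (elim x)
  have "weak_grad \<phi> x \<bullet> (A ((1/eps) *R x) *v weak_grad y x) = (transpose (A ((1/eps) *R x)) *v weak_grad \<phi> x) \<bullet> weak_grad y x"
   by (simp add: dot_lmul_matrix)
  then show ?case unfolding elim by (simp add: inner_commute)
 qed
qed (intro form_measurable_integrand assms)+

lemma form_diff_left:
 assumes "y \<in> Sobolev 1" "z \<in> Sobolev 1" "\<phi> \<in> Sobolev 1"
 shows "form (\<lambda>x. y x - z x) \<phi> = form y \<phi> - form z \<phi>"
proof -
 have "form y \<phi> - form z \<phi> = (LI x. (weak_grad \<phi> x \<bullet> (A ((1/eps) *R x) *v weak_grad y x) + y x * \<phi> x)
   - (weak_grad \<phi> x \<bullet> (A ((1/eps) *R x) *v weak_grad z x) + z x * \<phi> x))"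
  unfolding form_def by (rule B_integral_diff[symmetric]) (intro form_integrable assms)+
 also have "... = form (\<lambda>x. y x - z x) \<phi>"
  unfolding form_def
 proof (rule integral_cong_AE)
  show "ae x. (weak_grad \<phi> x \<bullet> (A ((1/eps) *R x) *v weak_grad y x) + y x * \<phi> x)
   - (weak_grad \<phi> x \<bullet> (A ((1/eps) *R x) *v weak_grad z x) + z x * \<phi> x)
   = weak_grad \<phi> x \<bullet> (A ((1/eps) *R x) *v weak_grad (\<lambda>x. y x - z x) x) + (y x - z x) * \<phi> x"
   using Sobolev_1_diff(2)[OF assms(1,2)]
   by eventually_elim (simp add: matrix_vector_mult_diff_distrib inner_diff_right left_diff_distrib)
 qed (intro borel_measurable_diff form_measurable_integrand Sobolev_1_diff(1) assms)+
 finally show ?thesis by simp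
qed

lemma energy_form: "energy_eps A eps y = form y y"
 unfolding energy_eps_def form_def by (simp add: power2_eq_square)

lemma energy_diff:
 assumes "y \<in> Sobolev 1" "z \<in> Sobolev 1"
 shows "energy_eps A eps (\<lambda>x. y x - z x) = form y y - 2 * form y z + form z z"
proof -
 note d = Sobolev_1_diff(1)[OF assms]
 have "form (\<lambda>x. y x - z x) (\<lambda>x. y x - z x) = form y (\<lambda>x. y x - z x) - form z (\<lambda>x. y x - z x)"
  by (rule form_diff_left[OF assms d])
 also have "form y (\<lambda>x. y x - z x) = form y y - form z y"
  by (simp add: form_commute[OF assms(1) d] form_diff_left[OF assms assms(1)])
 also have "form z (\<lambda>x. y x - z x) = form y z - form z z"
  by (simp add: form_commute[OF assms(2) d] form_diff_left[OF assms assms(2)])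
 finally show ?thesis by (simp add: energy_form form_commute[OF assms(2,1)])
qed

lemma form_nonneg:
 assumes "y \<in> Sobolev 1"
 shows "form y y \<ge> 0" "form y y = 0 ==> ae x. y x = 0"
proof -
 have "ae x. \<forall>xi. ell * (norm xi)^2 \<le> xi \<bullet> (A ((1/eps) *R x) *v xi)"
  using AE_affine[OF ell(2), of "1/eps" 0] eps by simp
 then have q: "ae x. 0 \<le> weak_grad y x \<bullet> (A ((1/eps) *R x) *v weak_grad y x)"
 proof eventually_elim
  case (elim x)
  have "0 \<le> ell * (norm (weak_grad y x))^2" using ell(1) by simp
  with elim show ?case by (meson order_trans)
 qed
 then have n: "ae x. 0 \<le> weak_grad y x \<bullet> (A ((1/eps) *R x) *v weak_grad y x) + y x * y x"
  by eventually_elim simp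
 then show "form y y \<ge> 0" unfolding form_def by (rule integral_nonneg_AE)
 assume "form y y = 0"
 then have "ae x. weak_grad y x \<bullet> (A ((1/eps) *R x) *v weak_grad y x) + y x * y x = 0"
  using integral_nonneg_eq_0_iff_AE[OF form_integrable[OF assms assms] n] by (simp add: form_def)
 with q show "ae x. y x = 0"
 proof eventually_elim
  case (elim x)
  have "0 \<le> y x * y x" by simp
  with elim have "y x * y x = 0" by linarith
  then show ?case by simp
 qed
qed

text \<open>The weak formulation has real coefficients and real test functions, so the real part of \<open>resolvent_equation\<close>
 concerns real parts only.\<close>

lemma weak_solution:
 assumes e: "onZ e"
 shows "(\<lambda>x. Re (S (rs e) x)) \<in> Sobolev 1"
  and "\<And>\<phi>. \<phi> \<in> Sobolev 1 ==> form (\<lambda>x. Re (S (rs e) x)) \<phi> = (LI x. Re (S e x) * \<phi> x)"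
proof -
 let ?y = "\<lambda>x. Re (S (rs e) x)"
 have SL: "S (rs e) \<in> LL" by (rule S_L2[OF onZ_rs[OF e]])
 have "\<exists>v. FT v (\<lambda>xi. symb [j] xi * W (rs e) xi)" for j using FT_surj[OF gradient_L2[OF e]] by metis
 then obtain V where V: "\<And>j. FT (V j) (\<lambda>xi. symb [j] xi * W (rs e) xi)" by metis
 have dy: "has_weak_deriv [j] ?y (\<lambda>x. Re (V j x))" for j
  by (rule has_weak_deriv_Re[OF FT_has_weak_deriv[OF S_FT[OF onZ_rs[OF e]] V]])
 show y: "?y \<in> Sobolev 1"
  by (rule Sobolev_1I[OF L2_Re[OF SL]]) (use dy L2_Re[OF FT_L2(1)[OF V]] in blast)
 fix \<phi> :: "real^'n => real" assume \<phi>: "\<phi> \<in> Sobolev 1"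
 have \<phi>L: "cplx \<phi> \<in> LL" using Sobolev_1D(1)[OF \<phi>] by simp
 let ?D = "\<lambda>i. cplx (weak_deriv [i] \<phi>)"
 have DL: "?D i \<in> LL" for i using Sobolev_1D(3)[OF \<phi>] by simp
 have D: "FT (?D i) (\<lambda>xi. symb [i] xi * fourier (cplx \<phi>) xi)" for i
  by (rule FT_weak_deriv_real[OF Sobolev_1D(4)[OF \<phi>] Sobolev_1D(3)[OF \<phi>] fourier_FT(1)[OF \<phi>L]])
 have eq: "(\<Sum>i\<in>UNIV. \<Sum>j\<in>UNIV. ip (\<lambda>x. a i j ((1/eps) *R x) * V j x) (?D i)) + ip (S (rs e)) (cplx \<phi>) = ip (S e) (cplx \<phi>)"
  by (rule resolvent_equation[OF e V fourier_FT(1)[OF \<phi>L]]) (rule D)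
 have aV: "(\<lambda>x. a i j ((1/eps) *R x) * V j x) \<in> LL" for i j
  by (rule L2_mult_bounded(1)[OF FT_L2(1)[OF V]]) (auto intro: a_norm)
 have int: "integrable lborel (\<lambda>x. a i j ((1/eps) *R x) * V j x * cnj (?D i x))" for i j
  by (rule integrable_ip[OF aV DL])
 let ?T = "\<lambda>x. (\<Sum>i\<in>UNIV. \<Sum>j\<in>UNIV. a i j ((1/eps) *R x) * V j x * cnj (?D i x)) + S (rs e) x * cnj (cplx \<phi> x)"
 have Tint: "integrable lborel ?T"
  by (intro B_integrable_add B_integrable_sum int integrable_ip SL \<phi>L)
 have "(LI x. ?T x) = (\<Sum>i\<in>UNIV. \<Sum>j\<in>UNIV. ip (\<lambda>x. a i j ((1/eps) *R x) * V j x) (?D i)) + ip (S (rs e)) (cplx \<phi>)"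
 proof -
  have "(LI x. ?T x) = (LI x. (\<Sum>i\<in>UNIV. \<Sum>j\<in>UNIV. a i j ((1/eps) *R x) * V j x * cnj (?D i x))) + ip (S (rs e)) (cplx \<phi>)"
   unfolding ip_def by (rule B_integral_add) (intro B_integrable_sum int integrable_ip SL \<phi>L)+
  also have "(LI x. (\<Sum>i\<in>UNIV. \<Sum>j\<in>UNIV. a i j ((1/eps) *R x) * V j x * cnj (?D i x)))
    = (\<Sum>i\<in>UNIV. LI x. (\<Sum>j\<in>UNIV. a i j ((1/eps) *R x) * V j x * cnj (?D i x)))"
   by (rule B_integral_sum) (intro B_integrable_sum int)
  also have "... = (\<Sum>i\<in>UNIV. \<Sum>j\<in>UNIV. ip (\<lambda>x. a i j ((1/eps) *R x) * V j x) (?D i))"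
  proof (rule sum.cong[OF refl])
   fix i show "(LI x. (\<Sum>j\<in>UNIV. a i j ((1/eps) *R x) * V j x * cnj (?D i x))) = (\<Sum>j\<in>UNIV. ip (\<lambda>x. a i j ((1/eps) *R x) * V j x) (?D i))"
    unfolding ip_def by (rule B_integral_sum) (rule int)
  qed
  finally show ?thesis .
 qed
 then have T: "(LI x. ?T x) = ip (S e) (cplx \<phi>)" using eq by simp
 have "form ?y \<phi> = (LI x. Re (?T x))"
  unfolding form_def
 proof (rule integral_cong_AE)
  have "ae x. \<forall>j. weak_deriv [j] ?y x = Re (V j x)"
   unfolding AE_all_countable using weak_deriv_AE_real(2)[OF dy] by blast
  then show "ae x. weak_grad \<phi> x \<bullet> (A ((1/eps) *R x) *v weak_grad ?y x) + ?y x * \<phi> x = Re (?T x)"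
   using a_AE_scaled
   by eventually_elim (simp add: form_integrand mult.assoc)
  show "(\<lambda>x. Re (?T x)) \<in> borel_measurable lborel" using borel_measurable_integrable[OF integrable_Re[OF Tint]] .
 qed (rule form_measurable_integrand[OF y \<phi>])
 also have "... = Re (ip (S e) (cplx \<phi>))" using integral_Re[OF Tint] T by simp
 also have "... = (LI x. Re (S e x * cnj (cplx \<phi> x)))"
  unfolding ip_def by (rule integral_Re[OF integrable_ip[OF S_L2[OF e] \<phi>L], symmetric])
 finally show "form ?y \<phi> = (LI x. Re (S e x) * \<phi> x)" by simp
qed

end

section \<open>Quadratic functionals with a multiplication operator\<close>

text \<open>The control enters through its coefficients \<open>c\<close>, and \<open>F + c\<close> represents the right-hand side of the state equation.
 Multiplication by \<open>r\<close> solves that equation, and \<open>j\<close> is the cost of \<open>c\<close> up to an additive constant.\<close>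

locale quad =
 fixes \<mu>1 \<mu>2 \<kappa> :: real and r :: "real^'n => real" and F D1 D2 :: "real^'n => complex"
 assumes weights: "\<mu>1 \<ge> 0" "\<mu>2 \<ge> 0" "\<kappa> > 0"
  and r [measurable]: "r \<in> bmeas" and r_bounds: "\<And>eta. 0 \<le> r eta" "\<And>eta. r eta \<le> 1"
  and data: "F \<in> LL" "D1 \<in> LL" "D2 \<in> LL"
begin

definition mult :: "(real^'n => complex) => real^'n => complex" where
 "mult u eta = of_real (r eta) * u eta"

definition j :: "(real^'n => complex) => real" where
 "j c = \<mu>1 / 2 * Re (ip (mult (\<lambda>eta. F eta + c eta)) (\<lambda>eta. F eta + c eta)) - \<mu>1 * Re (ip (\<lambda>eta. F eta + c eta) D1)
  + \<mu>2 / 2 * (nrm (\<lambda>eta. mult (\<lambda>eta. F eta + c eta) eta - D2 eta))^2 + \<kappa> / 2 * (nrm c)^2"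

definition grad_j :: "(real^'n => complex) => real^'n => complex" where
 "grad_j c eta = of_real \<mu>1 * (mult (\<lambda>eta. F eta + c eta) eta - D1 eta)
  + of_real \<mu>2 * mult (\<lambda>eta. mult (\<lambda>eta. F eta + c eta) eta - D2 eta) eta + of_real \<kappa> * c eta"

definition rem :: "(real^'n => complex) => real" where
 "rem h = \<mu>1 / 2 * Re (ip (mult h) h) + \<mu>2 / 2 * (nrm (mult h))^2 + \<kappa> / 2 * (nrm h)^2"

lemma mult_L2: assumes "u \<in> LL" shows "mult u \<in> LL" "nrm (mult u) \<le> nrm u"
proof -
 have e: "mult u = (\<lambda>eta. of_real (r eta) * u eta)" by (rule ext) (simp add: mult_def)
 have m: "(\<lambda>eta. complex_of_real (r eta)) \<in> bmeas" by measurable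
 have b: "norm (complex_of_real (r eta)) \<le> 1" for eta using r_bounds[of eta] by simp
 show "mult u \<in> LL" unfolding e by (rule L2_mult_bounded(1)[OF assms m b])
 show "nrm (mult u) \<le> nrm u" unfolding e using L2_mult_bounded(2)[OF assms m b] by simp
qed

lemma mult_add: "mult (\<lambda>eta. u eta + v eta) = (\<lambda>eta. mult u eta + mult v eta)"
 by (rule ext) (simp add: mult_def distrib_left)

lemma ip_mult: "ip (mult u) v = ip u (mult v)"
 by (simp add: ip_def mult_def mult_ac)

lemma Re_ip_commute: "Re (ip u v) = Re (ip v u)"
 by (subst ip_commute) simp

lemma ip_mult_nonneg: "Re (ip (mult h) h) \<ge> 0"
proof -
 have "ip (mult h) h = (LI eta. complex_of_real (r eta * (norm (h eta))^2))"
  unfolding ip_def by (rule B_integral_cong) (simp_all add: mult_def complex_norm_square[symmetric] mult.assoc)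
 also have "... = complex_of_real (LI eta. r eta * (norm (h eta))^2)" by (rule integral_complex_of_real)
 finally have "Re (ip (mult h) h) = (LI eta. r eta * (norm (h eta))^2)" by simp
 also have "... \<ge> 0" using r_bounds by (intro integral_nonneg_AE AE_I2) simp
 finally show ?thesis .
qed

lemma rem_ge: "\<kappa> / 2 * (nrm h)^2 \<le> rem h"
proof -
 have "0 \<le> \<mu>1 / 2 * Re (ip (mult h) h)" "0 \<le> \<mu>2 / 2 * (nrm (mult h))^2"
  using weights ip_mult_nonneg[of h] by auto
 then show ?thesis by (simp add: rem_def)
qed

lemma rem_cmult: "rem (\<lambda>eta. of_real t * h eta) = t^2 * rem h"
proof -
 have m: "mult (\<lambda>eta. of_real t * h eta) = (\<lambda>eta. of_real t * mult h eta)" by (rule ext) (simp add: mult_def)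
 show ?thesis unfolding rem_def m nrm_cmult ip_cmult_left ip_cmult_right
  by (simp add: power2_eq_square algebra_simps)
qed

lemma grad_j_L2: assumes "c \<in> LL" shows "grad_j c \<in> LL"
 unfolding grad_j_def[abs_def]
 by (rule L2_add[OF L2_add[OF L2_cmult[OF L2_diff[OF mult_L2(1)[OF L2_add[OF data(1) assms]] data(2)]]
   L2_cmult[OF mult_L2(1)[OF L2_diff[OF mult_L2(1)[OF L2_add[OF data(1) assms]] data(3)]]]] L2_cmult[OF assms]])

lemma j_expand:
 assumes c: "c \<in> LL" and h: "h \<in> LL"
 shows "j (\<lambda>eta. c eta + h eta) = j c + Re (ip (grad_j c) h) + rem h"
proof -
 define w where "w = (\<lambda>eta. F eta + c eta)"
 have w: "w \<in> LL" unfolding w_def by (rule L2_add[OF data(1) c])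
 note wL = mult_L2(1)[OF w] and hL = mult_L2(1)[OF h]
 define z where "z = (\<lambda>eta. mult w eta - D2 eta)"
 have z: "z \<in> LL" unfolding z_def by (rule L2_diff[OF wL data(3)])
 have wh: "(\<lambda>eta. F eta + (c eta + h eta)) = (\<lambda>eta. w eta + h eta)" by (simp add: w_def add.assoc)
 have zh: "(\<lambda>eta. mult w eta + mult h eta - D2 eta) = (\<lambda>eta. z eta + mult h eta)" by (rule ext) (simp add: z_def)
 have 1: "Re (ip (\<lambda>eta. mult w eta + mult h eta) (\<lambda>eta. w eta + h eta))
  = Re (ip (mult w) w) + 2 * Re (ip (mult w) h) + Re (ip (mult h) h)"
 proof -
  have "ip (\<lambda>eta. mult w eta + mult h eta) (\<lambda>eta. w eta + h eta) = (ip (mult w) w + ip (mult w) h) + (ip (mult h) w + ip (mult h) h)"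
   by (simp only: ip_add_left[OF wL hL L2_add[OF w h]] ip_add_right[OF w h wL] ip_add_right[OF w h hL])
  moreover have "Re (ip (mult h) w) = Re (ip (mult w) h)"
   unfolding ip_mult[of h w] by (rule Re_ip_commute)
  ultimately show ?thesis by simp
 qed
 have 2: "Re (ip (\<lambda>eta. w eta + h eta) D1) = Re (ip w D1) + Re (ip D1 h)"
  by (simp add: ip_add_left[OF w h data(2)] Re_ip_commute[of h D1])
 have 3: "(nrm (\<lambda>eta. z eta + mult h eta))^2 = (nrm z)^2 + 2 * Re (ip (mult z) h) + (nrm (mult h))^2"
  by (simp add: nrm_add_sq[OF z hL] ip_mult)
 have G: "Re (ip (grad_j c) h) = \<mu>1 * (Re (ip (mult w) h) - Re (ip D1 h)) + \<mu>2 * Re (ip (mult z) h) + \<kappa> * Re (ip c h)"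
 proof -
  have "ip (grad_j c) h = ip (\<lambda>eta. of_real \<mu>1 * (mult w eta - D1 eta) + of_real \<mu>2 * mult z eta + of_real \<kappa> * c eta) h"
   by (simp add: grad_j_def[abs_def] w_def z_def)
  also have "... = of_real \<mu>1 * (ip (mult w) h - ip D1 h) + of_real \<mu>2 * ip (mult z) h + of_real \<kappa> * ip c h"
   by (simp only: ip_add_left[OF L2_add[OF L2_cmult[OF L2_diff[OF wL data(2)]] L2_cmult[OF mult_L2(1)[OF z]]] L2_cmult[OF c] h]
     ip_add_left[OF L2_cmult[OF L2_diff[OF wL data(2)]] L2_cmult[OF mult_L2(1)[OF z]] h] ip_cmult_left ip_diff_left[OF wL data(2) h])
  finally show ?thesis by simp
 qed
 have jc: "j c = \<mu>1 / 2 * Re (ip (mult w) w) - \<mu>1 * Re (ip w D1) + \<mu>2 / 2 * (nrm z)^2 + \<kappa> / 2 * (nrm c)^2"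
  by (simp add: j_def w_def z_def)
 have "j (\<lambda>eta. c eta + h eta) = \<mu>1 / 2 * Re (ip (\<lambda>eta. mult w eta + mult h eta) (\<lambda>eta. w eta + h eta)) - \<mu>1 * Re (ip (\<lambda>eta. w eta + h eta) D1)
  + \<mu>2 / 2 * (nrm (\<lambda>eta. z eta + mult h eta))^2 + \<kappa> / 2 * (nrm (\<lambda>eta. c eta + h eta))^2"
  unfolding j_def wh mult_add zh ..
 then show ?thesis unfolding 1 2 3 nrm_add_sq[OF c h] jc G rem_def by (simp add: field_simps)
qed

lemma j_ge:
 assumes c: "c \<in> LL" and d: "d \<in> LL"
 shows "j d \<ge> j c + Re (ip (grad_j c) (\<lambda>eta. d eta - c eta)) + \<kappa> / 2 * (nrm (\<lambda>eta. d eta - c eta))^2"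
 using j_expand[OF c L2_diff[OF d c]] rem_ge[of "\<lambda>eta. d eta - c eta"] by simp

definition minimises :: "(real^'n => complex) set => (real^'n => complex) => bool" where
 "minimises C c \<longleftrightarrow> c \<in> C \<and> (\<forall>d\<in>C. j c \<le> j d)"

end

definition convexL :: "(real^'n => complex) set => bool" where
 "convexL C \<longleftrightarrow> C \<subseteq> LL \<and>
   (\<forall>c\<in>C. \<forall>d\<in>C. \<forall>t. 0 \<le> t \<and> t \<le> 1 --> (\<lambda>eta. c eta + complex_of_real t * (d eta - c eta)) \<in> C)"

text \<open>Limits are determined up to null sets only, whereas membership is a pointwise condition; hence the representative \<open>l'\<close>.\<close>

definition closedL :: "(real^'n => complex) set => bool" where
 "closedL C \<longleftrightarrow> (\<forall>c l. (\<forall>k. c k \<in> C) \<and> l \<in> LL \<and> (\<lambda>k::nat. nrm (\<lambda>eta. c k eta - l eta)) ----> 0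
   --> (\<exists>l'\<in>C. (\<lambda>k. nrm (\<lambda>eta. c k eta - l' eta)) ----> 0))"

context quad
begin

lemma variational_inequality:
 assumes C: "convexL C" and m: "minimises C c" and d: "d \<in> C"
 shows "Re (ip (grad_j c) (\<lambda>eta. d eta - c eta)) \<ge> 0"
proof (rule ccontr)
 let ?h = "\<lambda>eta. d eta - c eta"
 assume "\<not> Re (ip (grad_j c) ?h) \<ge> 0"
 then have neg: "Re (ip (grad_j c) ?h) < 0" by simp
 have cL: "c \<in> LL" and dL: "d \<in> LL" using C m d by (auto simp: convexL_def minimises_def)
 have hL: "?h \<in> LL" by (rule L2_diff[OF dL cL])
 have key: "0 \<le> Re (ip (grad_j c) ?h) + t * rem ?h" if t: "0 < t" "t \<le> 1" for t
 proof -
  have "(\<lambda>eta. c eta + complex_of_real t * ?h eta) \<in> C" using C m d t by (auto simp: convexL_def minimises_def)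
  then have "j c \<le> j (\<lambda>eta. c eta + complex_of_real t * ?h eta)" using m by (simp add: minimises_def)
  also have "... = j c + t * Re (ip (grad_j c) ?h) + t^2 * rem ?h"
   unfolding j_expand[OF cL L2_cmult[OF hL]] rem_cmult by (simp add: ip_cmult_right)
  finally have "0 \<le> t * (Re (ip (grad_j c) ?h) + t * rem ?h)" by (simp add: power2_eq_square algebra_simps)
  with t(1) show ?thesis by (simp add: zero_le_mult_iff)
 qed
 have "(\<lambda>n. Re (ip (grad_j c) ?h) + 1 / real (Suc n) * rem ?h) ----> Re (ip (grad_j c) ?h) + 0 * rem ?h"
  by (intro tendsto_intros LIMSEQ_Suc lim_1_over_n)
 then have "0 \<le> Re (ip (grad_j c) ?h) + 0 * rem ?h"
  by (rule LIMSEQ_le_const) (intro exI allI impI key, auto)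
 with neg show False by simp
qed

text \<open>The quadratic remainder occurs twice, in the expansions at \<open>c\<close> and at \<open>d\<close>; hence the full factor \<open>\<kappa>\<close>.\<close>

lemma minimiser_gap:
 assumes C: "convexL C" and m: "minimises C c" and d: "d \<in> C"
 shows "\<kappa> * nrm (\<lambda>eta. c eta - d eta) ^ 2 \<le> - Re (ip (grad_j d) (\<lambda>eta. c eta - d eta))"
proof -
 have cL: "c \<in> LL" and dL: "d \<in> LL" using C m d by (auto simp: convexL_def minimises_def)
 have "j d \<ge> j c + \<kappa> / 2 * (nrm (\<lambda>eta. d eta - c eta))^2"
  using j_ge[OF cL dL] variational_inequality[OF assms] by linarith
 moreover have "j c \<ge> j d + Re (ip (grad_j d) (\<lambda>eta. c eta - d eta)) + \<kappa> / 2 * (nrm (\<lambda>eta. c eta - d eta))^2"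
  by (rule j_ge[OF dL cL])
 ultimately show ?thesis unfolding nrm_minus_commute[of d c] by simp
qed

lemma minimiser_unique:
 assumes C: "convexL C" and m: "minimises C c" "minimises C d"
 shows "ae eta. c eta = d eta"
proof -
 have cC: "c \<in> C" "d \<in> C" using m by (auto simp: minimises_def)
 then have L: "c \<in> LL" "d \<in> LL" using C by (auto simp: convexL_def)
 have "\<kappa> * nrm (\<lambda>eta. c eta - d eta) ^ 2 \<le> 0"
  using minimiser_gap[OF C m(1) cC(2)] variational_inequality[OF C m(2) cC(1)] by simp
 then have "nrm (\<lambda>eta. c eta - d eta) = 0" using weights(3) by (simp add: mult_le_0_iff)
 then have "ae eta. c eta - d eta = 0" using nrm_zero_iff[OF L2_diff[OF L]] by simp
 then show ?thesis by eventually_elim simp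
qed

text \<open>The direct method: by the expansion at the midpoint, minimising sequences are Cauchy.\<close>

lemma minimiser_exists:
 assumes C: "convexL C" and cl: "closedL C" and ne: "C \<noteq> {}"
 obtains c where "minimises C c"
proof -
 obtain c0 where c0: "c0 \<in> C" using ne by blast
 have L: "c \<in> LL" if "c \<in> C" for c using C that by (auto simp: convexL_def)
 have low: "j c0 - (nrm (grad_j c0))^2 / (2 * \<kappa>) \<le> j c" if c: "c \<in> C" for c
 proof -
  let ?x = "nrm (grad_j c0)" and ?y = "nrm (\<lambda>eta. c0 eta - c eta)"
  have d: "(\<lambda>eta. c0 eta - c eta) \<in> LL" by (rule L2_diff[OF L[OF c0] L[OF c]])
  have n: "(\<lambda>eta. c eta - c0 eta) = (\<lambda>eta. (- 1) * (c0 eta - c eta))" by auto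
  have "Re (ip (grad_j c0) (\<lambda>eta. c eta - c0 eta)) = - Re (ip (grad_j c0) (\<lambda>eta. c0 eta - c eta))"
   unfolding n ip_cmult_right by simp
  also have "... \<ge> - (?x * ?y)" using Re_ip_le[OF grad_j_L2[OF L[OF c0]] d] by simp
  finally have "j c \<ge> j c0 - ?x * ?y + \<kappa> / 2 * ?y^2" using j_ge[OF L[OF c0] L[OF c]] nrm_minus_commute[of c c0] by simp
  moreover have "\<kappa> / 2 * ?y^2 - ?x * ?y + ?x^2 / (2 * \<kappa>) = (\<kappa> * ?y - ?x)^2 / (2 * \<kappa>)"
   using weights(3) by (simp add: power2_eq_square field_simps)
  moreover have "(\<kappa> * ?y - ?x)^2 / (2 * \<kappa>) \<ge> 0" using weights(3) by simp
  ultimately show ?thesis by linarith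
 qed
 define I where "I = Inf (j ` C)"
 have bdd: "bdd_below (j ` C)" using low by (auto intro!: bdd_belowI)
 have I: "I \<le> j c" if "c \<in> C" for c unfolding I_def by (rule cInf_lower[OF imageI[OF that] bdd])
 have "\<exists>c\<in>C. j c < I + 1 / real (Suc n)" for n
 proof -
  have "Inf (j ` C) < I + 1 / real (Suc n)" by (simp add: I_def)
  then show ?thesis using cInf_lessD[of "j ` C"] ne by auto
 qed
 then obtain c where c: "\<And>n. c n \<in> C" "\<And>n. j (c n) < I + 1 / real (Suc n)" by metis
 have gap: "\<kappa> / 4 * (nrm (\<lambda>eta. c n eta - c m eta))^2 \<le> 1 / real (Suc n) + 1 / real (Suc m)" for n m
 proof -
  let ?p = "\<lambda>eta. c n eta + complex_of_real (1/2) * (c m eta - c n eta)"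
  let ?h = "\<lambda>eta. complex_of_real (1/2) * (c n eta - c m eta)"
  have p: "?p \<in> C"
  proof -
   have "\<And>t. 0 \<le> t \<and> t \<le> 1 ==> (\<lambda>eta. c n eta + complex_of_real t * (c m eta - c n eta)) \<in> C"
    using C c(1) unfolding convexL_def by blast
   from this[of "1/2"] show ?thesis by simp
  qed
  have h: "?h \<in> LL" by (rule L2_cmult[OF L2_diff[OF L[OF c(1)] L[OF c(1)]]])
  have e1: "c n = (\<lambda>eta. ?p eta + ?h eta)" and e2: "c m = (\<lambda>eta. ?p eta + complex_of_real (- 1) * ?h eta)"
   by (auto simp: algebra_simps simp flip: distrib_right)
  have "j (c n) = j ?p + Re (ip (grad_j ?p) ?h) + rem ?h" by (subst e1) (rule j_expand[OF L[OF p] h])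
  moreover have "j (c m) = j ?p - Re (ip (grad_j ?p) ?h) + rem ?h"
   by (subst e2) (simp only: j_expand[OF L[OF p] L2_cmult[OF h]] rem_cmult ip_cmult_right, simp)
  moreover have "rem ?h \<ge> \<kappa> / 8 * (nrm (\<lambda>eta. c n eta - c m eta))^2"
   using rem_ge[of ?h] unfolding nrm_cmult by (simp add: power2_eq_square)
  ultimately show ?thesis using I[OF p] c(2)[of n] c(2)[of m] by linarith
 qed
 have "\<exists>N. \<forall>m\<ge>N. \<forall>n\<ge>N. nrm (\<lambda>x. c m x - c n x) < e" if e: "e > 0" for e
 proof -
  have "\<kappa> / 4 * e^2 > 0" using e weights(3) by simp
  then obtain N where N: "1 / real (Suc N) < \<kappa> / 4 * e^2 / 2" using nat_approx_posE[of "\<kappa> / 4 * e^2 / 2"] by auto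
  have "nrm (\<lambda>x. c m x - c n x) < e" if "m \<ge> N" "n \<ge> N" for m n
  proof -
   have le: "1 / real (Suc m) \<le> 1 / real (Suc N)" "1 / real (Suc n) \<le> 1 / real (Suc N)"
    using that by (auto intro!: divide_left_mono)
   have "\<kappa> / 4 * (nrm (\<lambda>eta. c m eta - c n eta))^2 < \<kappa> / 4 * e^2"
    using gap[of m n] le N by linarith
   then have "(nrm (\<lambda>eta. c m eta - c n eta))^2 < e^2" using weights(3) by simp
   then show ?thesis using e by (simp add: power2_less_imp_less)
  qed
  then show ?thesis by blast
 qed
 then obtain l' where "l' \<in> LL" "(\<lambda>n. nrm (\<lambda>x. c n x - l' x)) ----> 0"
  using L2_complete[of c] L[OF c(1)] by blast
 then obtain l where lC: "l \<in> C" and l2: "(\<lambda>n. nrm (\<lambda>x. c n x - l x)) ----> 0"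
  using cl c(1) unfolding closedL_def by blast
 note l = L[OF lC] l2
 have "j l \<le> I"
 proof (rule LIMSEQ_le_const)
  have "(\<lambda>n. I + 1 / real (Suc n) + nrm (grad_j l) * nrm (\<lambda>x. c n x - l x)) ----> I + 0 + nrm (grad_j l) * 0"
   by (intro tendsto_intros LIMSEQ_Suc lim_1_over_n l(2))
  then show "(\<lambda>n. I + 1 / real (Suc n) + nrm (grad_j l) * nrm (\<lambda>x. c n x - l x)) ----> I" by simp
  have "j l \<le> I + 1 / real (Suc n) + nrm (grad_j l) * nrm (\<lambda>x. c n x - l x)" for n
  proof -
   let ?h = "\<lambda>x. l x - c n x"
   have n: "(\<lambda>eta. c n eta - l eta) = (\<lambda>eta. (- 1) * ?h eta)" by auto
   have "- (nrm (grad_j l) * nrm ?h) \<le> - Re (ip (grad_j l) ?h)"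
    using Re_ip_le[OF grad_j_L2[OF l(1)] L2_diff[OF l(1) L[OF c(1)[of n]]]] by simp
   also have "- Re (ip (grad_j l) ?h) = Re (ip (grad_j l) (\<lambda>x. c n x - l x))"
    unfolding n ip_cmult_right by simp
   finally have "- (nrm (grad_j l) * nrm (\<lambda>x. c n x - l x)) \<le> Re (ip (grad_j l) (\<lambda>x. c n x - l x))"
    by (simp add: nrm_minus_commute[of l "c n"])
   moreover have "0 \<le> \<kappa> / 2 * (nrm (\<lambda>x. c n x - l x))^2" using weights(3) by simp
   ultimately show ?thesis using j_ge[OF l(1) L[OF c(1)[of n]]] c(2)[of n] by linarith
  qed
  then show "\<exists>N. \<forall>n\<ge>N. j l \<le> I + 1 / real (Suc n) + nrm (grad_j l) * nrm (\<lambda>x. c n x - l x)" by blast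
 qed
 then have "minimises C l" unfolding minimises_def using lC I by (auto intro: order_trans)
 then show ?thesis by (rule that)
qed

lemma nrm_grad_j:
 assumes c: "c \<in> LL"
 shows "nrm (grad_j c) \<le> \<mu>1 * (nrm F + nrm c + nrm D1) + \<mu>2 * (nrm F + nrm c + nrm D2) + \<kappa> * nrm c"
proof -
 define w where "w = (\<lambda>eta. F eta + c eta)"
 have w: "w \<in> LL" "nrm w \<le> nrm F + nrm c" unfolding w_def by (rule L2_add[OF data(1) c], rule nrm_triangle[OF data(1) c])
 note wL = mult_L2[OF w(1)]
 have tri: "nrm (\<lambda>eta. u eta - v eta) \<le> nrm u + nrm v" if "u \<in> LL" "v \<in> LL" for u v :: "real^'n => complex"
  using nrm_diff_triangle[OF that(1) L2_zero that(2)] nrm_minus_commute[of "\<lambda>x. 0" v] by simp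
 note d1 = L2_diff[OF wL(1) data(2)] and d2 = L2_diff[OF wL(1) data(3)]
 have "nrm (grad_j c) \<le> nrm (\<lambda>eta. of_real \<mu>1 * (mult w eta - D1 eta) + of_real \<mu>2 * mult (\<lambda>eta. mult w eta - D2 eta) eta) + nrm (\<lambda>eta. of_real \<kappa> * c eta)"
  unfolding grad_j_def[abs_def] w_def[symmetric]
  by (rule nrm_triangle[OF L2_add[OF L2_cmult[OF d1] L2_cmult[OF mult_L2(1)[OF d2]]] L2_cmult[OF c]])
 also have "... \<le> (nrm (\<lambda>eta. of_real \<mu>1 * (mult w eta - D1 eta)) + nrm (\<lambda>eta. of_real \<mu>2 * mult (\<lambda>eta. mult w eta - D2 eta) eta)) + nrm (\<lambda>eta. of_real \<kappa> * c eta)"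
  by (rule add_right_mono) (rule nrm_triangle[OF L2_cmult[OF d1] L2_cmult[OF mult_L2(1)[OF d2]]])
 also have "... = \<mu>1 * nrm (\<lambda>eta. mult w eta - D1 eta) + \<mu>2 * nrm (mult (\<lambda>eta. mult w eta - D2 eta)) + \<kappa> * nrm c"
  unfolding nrm_cmult using weights by simp
 also have "... \<le> \<mu>1 * (nrm F + nrm c + nrm D1) + \<mu>2 * (nrm F + nrm c + nrm D2) + \<kappa> * nrm c"
 proof (intro add_mono mult_left_mono weights order_refl)
  show "nrm (\<lambda>eta. mult w eta - D1 eta) \<le> nrm F + nrm c + nrm D1"
   using tri[OF wL(1) data(2)] wL(2) w(2) by linarith
  show "nrm (mult (\<lambda>eta. mult w eta - D2 eta)) \<le> nrm F + nrm c + nrm D2"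
   using tri[OF wL(1) data(3)] mult_L2(2)[OF d2] wL(2) w(2) by linarith
 qed (use weights in simp)
 finally show ?thesis .
qed

lemma minimiser_bound:
 assumes C: "convexL C" and m: "minimises C c" and d: "d \<in> C"
 shows "\<kappa> * nrm (\<lambda>eta. c eta - d eta) \<le> \<mu>1 * (nrm F + nrm d + nrm D1) + \<mu>2 * (nrm F + nrm d + nrm D2) + \<kappa> * nrm d"
proof -
 have cL: "c \<in> LL" and dL: "d \<in> LL" using C m d by (auto simp: convexL_def minimises_def)
 let ?h = "\<lambda>eta. c eta - d eta"
 have "\<kappa> * (nrm ?h)^2 \<le> norm (ip (grad_j d) ?h)"
  using minimiser_gap[OF assms] abs_Re_le_cmod[of "ip (grad_j d) ?h"] by linarith
 also have "... \<le> nrm (grad_j d) * nrm ?h" by (rule norm_ip_le[OF grad_j_L2[OF dL] L2_diff[OF cL dL]])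
 finally have "\<kappa> * nrm ?h * nrm ?h \<le> nrm (grad_j d) * nrm ?h" by (simp add: power2_eq_square mult.assoc)
 then have "\<kappa> * nrm ?h \<le> nrm (grad_j d)"
  using nrm_nonneg[of ?h] nrm_nonneg[of "grad_j d"] by (cases "nrm ?h = 0") (auto simp: mult_le_cancel_right)
 then show ?thesis using nrm_grad_j[OF dL] by linarith
qed

end

text \<open>The variational inequality for \<open>s\<close> at \<open>c2\<close> and \<open>minimiser_gap\<close> for \<open>r\<close> leave the difference of the two gradients
 at \<open>c2\<close>, which is controlled by the difference of the multipliers.\<close>

lemma minimiser_stability:
 assumes q1: "quad \<mu>1 \<mu>2 \<kappa> r F D1 D2" and q2: "quad \<mu>1 \<mu>2 \<kappa> s F D1 D2"
  and C: "convexL C" and m1: "quad.minimises \<mu>1 \<mu>2 \<kappa> r F D1 D2 C c1" and m2: "quad.minimises \<mu>1 \<mu>2 \<kappa> s F D1 D2 C c2"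
  and close: "ae eta. F eta + c2 eta \<noteq> 0 \<or> D2 eta \<noteq> 0 --> \<bar>r eta - s eta\<bar> \<le> \<delta>" and \<delta>: "\<delta> \<ge> 0"
 shows "\<kappa> * nrm (\<lambda>eta. c1 eta - c2 eta) \<le> \<delta> * ((\<mu>1 + 2 * \<mu>2) * (nrm F + nrm c2) + \<mu>2 * nrm D2)"
proof -
 interpret R: quad \<mu>1 \<mu>2 \<kappa> r F D1 D2 by (rule q1)
 interpret T: quad \<mu>1 \<mu>2 \<kappa> s F D1 D2 by (rule q2)
 have cC: "c1 \<in> C" "c2 \<in> C" using m1 m2 by (auto simp: R.minimises_def T.minimises_def)
 then have L: "c1 \<in> LL" "c2 \<in> LL" using C by (auto simp: convexL_def)
 let ?h = "\<lambda>eta. c1 eta - c2 eta" and ?D = "\<lambda>eta. T.grad_j c2 eta - R.grad_j c2 eta"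
 have h: "?h \<in> LL" by (rule L2_diff[OF L])
 have D: "?D \<in> LL" by (rule L2_diff[OF T.grad_j_L2[OF L(2)] R.grad_j_L2[OF L(2)]])
 have "\<kappa> * (nrm ?h)^2 \<le> Re (ip (T.grad_j c2) ?h) - Re (ip (R.grad_j c2) ?h)"
  using R.minimiser_gap[OF C m1 cC(2)] T.variational_inequality[OF C m2 cC(1)] by linarith
 also have "... = Re (ip ?D ?h)" by (simp add: ip_diff_left[OF T.grad_j_L2[OF L(2)] R.grad_j_L2[OF L(2)] h])
 also have "... \<le> nrm ?D * nrm ?h" by (rule Re_ip_le[OF D h])
 finally have "\<kappa> * nrm ?h * nrm ?h \<le> nrm ?D * nrm ?h" by (simp add: power2_eq_square mult.assoc)
 then have 1: "\<kappa> * nrm ?h \<le> nrm ?D"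
  using nrm_nonneg[of ?h] nrm_nonneg[of ?D] by (cases "nrm ?h = 0") (auto simp: mult_le_cancel_right)
 define w where "w = (\<lambda>eta. F eta + c2 eta)"
 have w: "w \<in> LL" "nrm w \<le> nrm F + nrm c2" unfolding w_def by (rule L2_add[OF R.data(1) L(2)], rule nrm_triangle[OF R.data(1) L(2)])
 have aL: "(\<lambda>eta. complex_of_real (norm (u eta))) \<in> LL" "nrm (\<lambda>eta. complex_of_real (norm (u eta))) = nrm u"
  if "u \<in> LL" for u :: "real^'n => complex"
  using that by (auto simp: L2_UNIV_iff nrm_eq)
 let ?B = "\<lambda>eta. complex_of_real (\<delta> * (\<mu>1 + 2 * \<mu>2)) * complex_of_real (norm (w eta)) + complex_of_real (\<delta> * \<mu>2) * complex_of_real (norm (D2 eta))"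
 have "nrm ?D \<le> nrm ?B"
 proof (rule L2_bound(2)[OF L2_add[OF L2_cmult[OF aL(1)[OF w(1)]] L2_cmult[OF aL(1)[OF R.data(3)]]] L2_measurable[OF D]])
  show "ae eta. norm (?D eta) \<le> norm (?B eta)"
   using close
  proof eventually_elim
   case (elim eta)
   have e: "?D eta = of_real (\<mu>1 * (s eta - r eta) + \<mu>2 * ((s eta - r eta) * (s eta + r eta))) * w eta - of_real (\<mu>2 * (s eta - r eta)) * D2 eta"
    by (simp add: T.grad_j_def R.grad_j_def T.mult_def R.mult_def w_def algebra_simps)
   have wB: "norm (?B eta) = \<delta> * (\<mu>1 + 2 * \<mu>2) * norm (w eta) + \<delta> * \<mu>2 * norm (D2 eta)"
   proof -
    have "?B eta = complex_of_real (\<delta> * (\<mu>1 + 2 * \<mu>2) * norm (w eta) + \<delta> * \<mu>2 * norm (D2 eta))" by simp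
    then show ?thesis using R.weights \<delta> by (simp only: norm_of_real) simp
   qed
   show ?case
   proof (cases "w eta = 0 \<and> D2 eta = 0")
    case True then show ?thesis unfolding e by simp
   next
    case False
    then have le: "\<bar>s eta - r eta\<bar> \<le> \<delta>" using elim by (auto simp: w_def abs_minus_commute)
    have "\<bar>(s eta - r eta) * (s eta + r eta)\<bar> \<le> \<delta> * 2"
     unfolding abs_mult using R.r_bounds[of eta] T.r_bounds[of eta] le \<delta> by (intro mult_mono) auto
    then have "\<bar>\<mu>1 * (s eta - r eta) + \<mu>2 * ((s eta - r eta) * (s eta + r eta))\<bar> \<le> \<mu>1 * \<delta> + \<mu>2 * (\<delta> * 2)"
     using R.weights le by (intro order_trans[OF abs_triangle_ineq] add_mono) (auto simp: abs_mult intro!: mult_left_mono)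
    then have "\<bar>\<mu>1 * (s eta - r eta) + \<mu>2 * ((s eta - r eta) * (s eta + r eta))\<bar> * norm (w eta) \<le> (\<mu>1 * \<delta> + \<mu>2 * (\<delta> * 2)) * norm (w eta)"
     by (rule mult_right_mono) simp
    moreover have "\<bar>\<mu>2 * (s eta - r eta)\<bar> * norm (D2 eta) \<le> (\<mu>2 * \<delta>) * norm (D2 eta)"
     using R.weights le by (intro mult_right_mono) (auto simp: abs_mult intro!: mult_left_mono)
    moreover have "norm (of_real a * w eta - of_real b * D2 eta) \<le> \<bar>a\<bar> * norm (w eta) + \<bar>b\<bar> * norm (D2 eta)" for a b
     using norm_triangle_ineq4[of "of_real a * w eta" "of_real b * D2 eta"] by (simp add: norm_mult)
    ultimately have "norm (?D eta) \<le> (\<mu>1 * \<delta> + \<mu>2 * (\<delta> * 2)) * norm (w eta) + (\<mu>2 * \<delta>) * norm (D2 eta)"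
     unfolding e by (meson add_mono order_trans)
    then show ?thesis unfolding wB by (simp add: algebra_simps)
   qed
  qed
 qed
 also have "... \<le> nrm (\<lambda>eta. complex_of_real (\<delta> * (\<mu>1 + 2 * \<mu>2)) * complex_of_real (norm (w eta))) + nrm (\<lambda>eta. complex_of_real (\<delta> * \<mu>2) * complex_of_real (norm (D2 eta)))"
  by (rule nrm_triangle[OF L2_cmult[OF aL(1)[OF w(1)]] L2_cmult[OF aL(1)[OF R.data(3)]]])
 also have "... = \<delta> * (\<mu>1 + 2 * \<mu>2) * nrm w + \<delta> * \<mu>2 * nrm D2"
  unfolding nrm_cmult aL(2)[OF w(1)] aL(2)[OF R.data(3)] norm_of_real using R.weights \<delta> by (simp add: abs_mult)
 also have "... \<le> \<delta> * (\<mu>1 + 2 * \<mu>2) * (nrm F + nrm c2) + \<delta> * \<mu>2 * nrm D2"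
  using R.weights \<delta> w(2) by (intro add_right_mono mult_left_mono) auto
 finally show ?thesis using 1 by (simp add: algebra_simps)
qed

section \<open>The oscillating problem in Bloch coefficients\<close>

lemma ip_cplx: "ip (cplx u) (cplx v) = complex_of_real (LI x. u x * v x)"
 unfolding ip_def by (simp flip: of_real_mult)

lemma nrm_sq_real: "(nrm u)^2 = (LI x. (u x)^2)" for u :: "real^'n => real"
 by (simp add: nrm_sq)

context bloch
begin

lemma onZ_add: "onZ e ==> onZ e' ==> onZ (\<lambda>eta. e eta + e' eta)"
 by (auto simp: onZ_def)

lemma onZ_cmult: "onZ e ==> onZ (\<lambda>eta. b * e eta)"
 by (auto simp: onZ_def)

lemma S_cmult: "S (\<lambda>eta. b * e eta) x = b * S e x"
 by (simp add: S_def mult.assoc)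

lemma S_add:
 assumes "onZ e" "onZ e'"
 shows "ae x. S (\<lambda>eta. e eta + e' eta) x = S e x + S e' x"
proof (rule FT_inj[OF S_FT[OF onZ_add[OF assms]]])
 have "W (\<lambda>eta. e eta + e' eta) = (\<lambda>xi. W e xi + W e' xi)" by (simp add: W_def glue_def[abs_def] distrib_right)
 then show "FT (\<lambda>x. S e x + S e' x) (W (\<lambda>eta. e eta + e' eta))"
  using FT_add[OF S_FT[OF assms(1)] S_FT[OF assms(2)]] by simp
qed

lemma S_diff:
 assumes "onZ e" "onZ e'"
 shows "ae x. S (\<lambda>eta. e eta - e' eta) x = S e x - S e' x"
proof -
 have "(\<lambda>eta. e eta - e' eta) = (\<lambda>eta. e eta + (- 1) * e' eta)" by auto
 then show ?thesis using S_add[OF assms(1) onZ_cmult[OF assms(2), of "- 1"]] S_cmult[of "- 1" e'] by simp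
qed

lemma nrm_S: assumes "onZ e" shows "nrm (S e) = nrm e"
 using FT_nrm[OF S_FT[OF assms]] W_L2(2)[OF assms] by simp

text \<open>The imaginary part of \<open>S (rs d)\<close> solves the homogeneous equation, hence vanishes by ellipticity.\<close>

lemma state_solution:
 assumes d: "onZ d" and gmeas: "g \<in> bmeas" and g: "ae x. S d x = cplx g x"
 obtains y where "y \<in> Sobolev 1" "ae x. S (rs d) x = cplx y x"
  "\<And>\<phi>. \<phi> \<in> Sobolev 1 ==> form y \<phi> = (LI x. g x * \<phi> x)"
proof -
 let ?y = "\<lambda>x. Re (S (rs d) x)" and ?z = "\<lambda>x. Re (S (rs (\<lambda>eta. - \<i> * d eta)) x)"
 note d' = onZ_cmult[OF d, of "- \<i>"]
 have cong: "(LI x. a x * \<phi> x) = (LI x. b x * \<phi> x)"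
  if "ae x. a x = b x" "a \<in> bmeas" "b \<in> bmeas" "\<phi> \<in> Sobolev 1" for a b \<phi> :: "real^'n => real"
 proof (rule integral_cong_AE)
  note [measurable] = that(2,3) L2_measurable[OF Sobolev_1D(1)[OF that(4)]]
  show "(\<lambda>x. a x * \<phi> x) \<in> borel_measurable lborel" "(\<lambda>x. b x * \<phi> x) \<in> borel_measurable lborel" by measurable
  show "ae x. a x * \<phi> x = b x * \<phi> x" using that(1) by eventually_elim simp
 qed
 note [measurable] = L2_measurable[OF S_L2[OF d]]
 have zform: "form ?z \<phi> = 0" if \<phi>: "\<phi> \<in> Sobolev 1" for \<phi>
 proof -
  have "form ?z \<phi> = (LI x. Im (S d x) * \<phi> x)"
   unfolding weak_solution(2)[OF d' \<phi>] unfolding S_cmult by simp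
  also have "... = (LI x. 0 * \<phi> x)"
   by (rule cong[OF _ _ _ \<phi>]) (use g in \<open>auto elim: eventually_mono\<close>)
  finally show ?thesis by simp
 qed
 have "ae x. ?z x = 0"
  by (rule form_nonneg(2)[OF weak_solution(1)[OF d'] zform[OF weak_solution(1)[OF d']]])
 moreover have "?z x = Im (S (rs d) x)" for x
 proof -
  have "rs (\<lambda>eta. - \<i> * d eta) = (\<lambda>eta. - \<i> * rs d eta)" by (rule ext) (simp add: rs_def)
  then show ?thesis by (simp only: S_cmult) simp
 qed
 ultimately have yr: "ae x. S (rs d) x = cplx ?y x"
  by (auto elim!: eventually_mono simp: complex_eq_iff)
 have gr: "ae x. g x = Re (S d x)" using g by eventually_elim simp
 have gm: "form ?y \<phi> = (LI x. Re (S d x) * \<phi> x)" if "\<phi> \<in> Sobolev 1" for \<phi>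
  by (rule weak_solution(2)[OF d that])
 have "form ?y \<phi> = (LI x. g x * \<phi> x)" if \<phi>: "\<phi> \<in> Sobolev 1" for \<phi>
  unfolding gm[OF \<phi>] using gr by (intro cong[OF _ _ gmeas \<phi>]) (auto elim: eventually_mono)
 then show ?thesis by (rule that[OF weak_solution(1)[OF d] yr])
qed

end

locale eps_problem = bloch A lam Phi eps
 for A :: "real^'n => real^'n^'n" and lam Phi eps +
 fixes K :: "(real^'n) set" and fh h1 h2 :: "real^'n => complex" and f yd1 yd2 :: "real^'n => real"
  and U :: "(real^'n => real) set" and \<mu>1 \<mu>2 \<kappa> :: real
 assumes K [measurable]: "K \<in> sets borel" and KZ: "K \<subseteq> scaled_Zcell eps"
  and data_hat: "fh \<in> LL" "h1 \<in> LL" "h2 \<in> LL"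
   "\<And>eta. eta \<notin> K ==> fh eta = 0" "\<And>eta. eta \<notin> K ==> h1 eta = 0" "\<And>eta. eta \<notin> K ==> h2 eta = 0"
  and f: "f \<in> LL" "ae x. S fh x = cplx f x"
  and yd1: "yd1 \<in> Sobolev 1" "ae x. S h1 x = cplx yd1 x"
  and yd2: "yd2 \<in> LL" "ae x. S h2 x = cplx yd2 x"
  and U: "U \<subseteq> LL" "L2_convex U" "L2_closed U"
  and projection: "\<And>u. u \<in> U ==> ae_mem (S (\<lambda>eta. indicator K eta * bloch_coeff Phi eps 0 (cplx u) eta)) U"
  and weights: "\<mu>1 \<ge> 0" "\<mu>2 \<ge> 0" "\<kappa> > 0"
begin

definition onK :: "(real^'n => complex) => bool" where
 "onK e \<longleftrightarrow> e \<in> LL \<and> (\<forall>eta. eta \<notin> K --> e eta = 0)"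

lemma onK_onZ: "onK e ==> onZ e" using KZ by (auto simp: onK_def onZ_def)
lemma onK_L2: "onK e ==> e \<in> LL" by (simp add: onK_def)
lemma onK_add: "onK e ==> onK e' ==> onK (\<lambda>eta. e eta + e' eta)" by (auto simp: onK_def)
lemma onK_diff: "onK e ==> onK e' ==> onK (\<lambda>eta. e eta - e' eta)" by (auto simp: onK_def)
lemma onK_cmult: "onK e ==> onK (\<lambda>eta. b * e eta)" by (auto simp: onK_def)
lemma onK_rs: "onK e ==> onK (rs e)"
 using onZ_L2[OF onZ_rs[OF onK_onZ]] by (auto simp: onK_def rs_def)
lemma onK_data: "onK fh" "onK h1" "onK h2" using data_hat by (auto simp: onK_def)
lemma onK_indicator: "u \<in> LL ==> onK (\<lambda>eta. indicator K eta * u eta)"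
 using L2_indicator[OF _ K] by (auto simp: onK_def)

definition rep :: "(real^'n => complex) => (real^'n => real) => bool" where
 "rep e u \<longleftrightarrow> onK e \<and> u \<in> LL \<and> (ae x. S e x = cplx u x)"

lemma rep_add: assumes "rep e u" "rep e' u'" shows "rep (\<lambda>eta. e eta + e' eta) (\<lambda>x. u x + u' x)"
proof -
 have "ae x. S e x = cplx u x" "ae x. S e' x = cplx u' x" "onK e" "onK e'" using assms by (auto simp: rep_def)
 moreover from S_add[OF onK_onZ onK_onZ, OF this(3,4)] this(1,2)
 have "ae x. S (\<lambda>eta. e eta + e' eta) x = cplx (\<lambda>x. u x + u' x) x" by eventually_elim simp
 ultimately show ?thesis using assms by (auto simp: rep_def intro: onK_add)
qed

lemma rep_diff: assumes "rep e u" "rep e' u'" shows "rep (\<lambda>eta. e eta - e' eta) (\<lambda>x. u x - u' x)"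
proof -
 have "ae x. S e x = cplx u x" "ae x. S e' x = cplx u' x" "onK e" "onK e'" using assms by (auto simp: rep_def)
 moreover from S_diff[OF onK_onZ onK_onZ, OF this(3,4)] this(1,2)
 have "ae x. S (\<lambda>eta. e eta - e' eta) x = cplx (\<lambda>x. u x - u' x) x" by eventually_elim simp
 ultimately show ?thesis using assms by (auto simp: rep_def intro: onK_diff)
qed

lemma rep_ip:
 assumes "rep e u" "w \<in> LL" shows "complex_of_real (LI x. w x * u x) = ip (cplx w) (S e)"
 unfolding ip_cplx[symmetric]
 by (rule ip_AE_cong) (use assms L2_measurable[OF S_L2[OF onK_onZ]] in \<open>auto simp: rep_def intro: L2_measurable elim: eventually_mono\<close>)

lemma rep_ip_rep:
 assumes "rep e u" "rep e' u'" shows "(LI x. u x * u' x) = Re (ip e e')"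
proof -
 have o: "onK e" "onK e'" "u \<in> LL" "ae x. S e x = cplx u x" using assms by (auto simp: rep_def)
 have "complex_of_real (LI x. u x * u' x) = ip (cplx u) (S e')" by (rule rep_ip[OF assms(2) o(3)])
 also have "... = ip (S e) (S e')"
  by (rule ip_AE_cong) (use o L2_measurable[OF S_L2[OF onK_onZ]] in \<open>auto intro: L2_measurable elim: eventually_mono\<close>)
 also have "... = ip e e'" by (rule ip_S_S[OF onK_onZ[OF o(1)] onK_onZ[OF o(2)]])
 finally show ?thesis by (metis Re_complex_of_real)
qed

lemma rep_nrm: assumes "rep e u" shows "(nrm u)^2 = (nrm e)^2"
proof -
 have "(LI x. u x * u x) = (nrm e)^2" using rep_ip_rep[OF assms assms] by (simp add: ip_self)
 then show ?thesis unfolding nrm_sq_real by (simp add: power2_eq_square)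
qed

definition coef :: "(real^'n => real) => real^'n => complex" where
 "coef u eta = indicator K eta * Bc (fourier (cplx u)) eta"

lemma coef_onK: assumes "u \<in> LL" shows "onK (coef u)"
proof -
 have "cplx u \<in> LL" using assms by simp
 from onK_indicator[OF onZ_L2[OF Bc_L2(1)[OF FT_L2(2)[OF fourier_FT(1)[OF this]]]]]
 show ?thesis by (simp add: coef_def[abs_def])
qed

lemma coef_bloch: assumes "u \<in> LL"
 shows "ae eta. indicator K eta * bloch_coeff Phi eps 0 (cplx u) eta = coef u eta"
  and "(\<lambda>eta. indicator K eta * bloch_coeff Phi eps 0 (cplx u) eta) \<in> bmeas"
proof -
 have "cplx u \<in> LL" using assms by simp
 note b = bloch_coeff_Bc[OF fourier_FT(1)[OF this]]
 show "ae eta. indicator K eta * bloch_coeff Phi eps 0 (cplx u) eta = coef u eta"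
  using b(1) by eventually_elim (use KZ in \<open>auto simp: coef_def indicator_def\<close>)
 note [measurable] = b(2)
 have "(\<lambda>eta. indicator K eta * bloch_coeff Phi eps 0 (cplx u) eta)
  = (\<lambda>eta. indicator K eta * (indicator (scaled_Zcell eps) eta * bloch_coeff Phi eps 0 (cplx u) eta))"
  using KZ by (auto simp: indicator_def fun_eq_iff)
 also have "... \<in> bmeas" by measurable
 finally show "(\<lambda>eta. indicator K eta * bloch_coeff Phi eps 0 (cplx u) eta) \<in> bmeas" .
qed

text \<open>Pairings with functions synthesised from \<open>K\<close> see only the coefficients on \<open>K\<close>.\<close>

lemma coef_orthogonal:
 assumes w: "w \<in> LL" and r: "rep e u"
 shows "(LI x. w x * u x) = Re (ip (coef w) e)"
proof -
 have e: "onK e" using r by (simp add: rep_def)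
 have wL: "cplx w \<in> LL" using w by simp
 have "complex_of_real (LI x. w x * u x) = ip (Bc (fourier (cplx w))) e"
  using rep_ip[OF r w] ip_S[OF fourier_FT(1)[OF wL] onK_onZ[OF e]] by simp
 also have "... = ip (coef w) e"
  unfolding ip_def coef_def by (rule B_integral_cong) (use e in \<open>auto simp: onK_def indicator_def\<close>)
 finally show ?thesis by (metis Re_complex_of_real)
qed

lemma projection_rep:
 assumes u: "u \<in> U" obtains v where "v \<in> U" "rep (coef u) v"
proof -
 have uL: "u \<in> LL" using u U by blast
 obtain v where v: "v \<in> U" "ae x. S (\<lambda>eta. indicator K eta * bloch_coeff Phi eps 0 (cplx u) eta) x = cplx v x"
  using projection[OF u] unfolding ae_mem_def ae_real_def by blast
 have "S (\<lambda>eta. indicator K eta * bloch_coeff Phi eps 0 (cplx u) eta) = S (coef u)"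
  by (rule S_cong[OF coef_bloch[OF uL] L2_measurable[OF onK_L2[OF coef_onK[OF uL]]]])
 then have "rep (coef u) v" unfolding rep_def using v coef_onK[OF uL] U(1) by auto
 with v(1) show ?thesis by (rule that)
qed

lemma rep_state:
 assumes "rep e g"
 obtains y where "y \<in> Sobolev 1" "rep (rs e) y" "\<And>\<phi>. \<phi> \<in> Sobolev 1 ==> form y \<phi> = (LI x. g x * \<phi> x)"
proof -
 have e: "onK e" "g \<in> LL" "ae x. S e x = cplx g x" using assms by (auto simp: rep_def)
 obtain y where y: "y \<in> Sobolev 1" "ae x. S (rs e) x = cplx y x"
  "\<And>\<phi>. \<phi> \<in> Sobolev 1 ==> form y \<phi> = (LI x. g x * \<phi> x)"
  using state_solution[OF onK_onZ[OF e(1)] L2_measurable[OF e(2)] e(3)] by blast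
 show ?thesis by (rule that[OF y(1) _ y(3)]) (use y onK_rs[OF e(1)] Sobolev_1D(1)[OF y(1)] in \<open>auto simp: rep_def\<close>)
qed

lemma rep_data: "rep fh f" "rep h1 yd1" "rep h2 yd2"
 using f yd1 yd2 onK_data Sobolev_1D(1)[OF yd1(1)] by (auto simp: rep_def)

abbreviation cost :: "(real^'n => real) \<times> (real^'n => real) => real" where
 "cost \<equiv> tracking_cost (energy_eps A eps) \<mu>1 \<mu>2 \<kappa> yd1 yd2"

abbreviation feasible :: "(real^'n => real) \<times> (real^'n => real) => bool" where
 "feasible \<equiv> feasible_eps A eps f U"

lemma feasible_iff: "feasible (u, y) \<longleftrightarrow> u \<in> U \<and> y \<in> Sobolev 1 \<and>
  (\<forall>\<phi> \<in> Sobolev 1. form y \<phi> = (LI x. (f x + u x) * \<phi> x))"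
 by (simp add: feasible_eps_def form_def)

sublocale Q: quad \<mu>1 \<mu>2 \<kappa> res fh h1 h2
 by unfold_locales (use weights res_bounds data_hat in auto)

lemma cost_rep:
 assumes v: "rep c v" and y: "y \<in> Sobolev 1" "rep (rs (\<lambda>eta. fh eta + c eta)) y"
  and eq: "\<And>\<phi>. \<phi> \<in> Sobolev 1 ==> form y \<phi> = (LI x. (f x + v x) * \<phi> x)"
 shows "cost (v, y) = Q.j c + \<mu>1 / 2 * form yd1 yd1"
proof -
 let ?g = "\<lambda>eta. fh eta + c eta"
 note g = rep_add[OF rep_data(1) v]
 have rm: "Q.mult ?g = rs ?g" by (rule ext) (simp add: Q.mult_def rs_def)
 have 1: "energy_eps A eps (\<lambda>x. y x - yd1 x) = Re (ip (rs ?g) ?g) - 2 * Re (ip ?g h1) + form yd1 yd1"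
  unfolding energy_diff[OF y(1) yd1(1)] eq[OF y(1)] eq[OF yd1(1)] rep_ip_rep[OF g y(2)] rep_ip_rep[OF g rep_data(2)]
  by (subst Q.Re_ip_commute) simp
 have 2: "(LI x. (y x - yd2 x)^2) = (nrm (\<lambda>eta. rs ?g eta - h2 eta))^2"
  using rep_nrm[OF rep_diff[OF y(2) rep_data(3)]] by (simp add: nrm_sq_real)
 have 3: "(LI x. (v x)^2) = (nrm c)^2" using rep_nrm[OF v] by (simp add: nrm_sq_real)
 show ?thesis unfolding tracking_cost_def prod.case 1 2 3 Q.j_def rm by (simp add: algebra_simps)
qed

text \<open>The differences of controls and of states are orthogonal to everything synthesised from \<open>K\<close>, in particular to the
 targets and to the solution \<open>z\<close>. So the cost splits, and the part off \<open>K\<close> is nonnegative.\<close>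

lemma cost_projection:
 assumes feas: "feasible (u, y)" and v: "v \<in> U" "rep (coef u) v"
  and z: "z \<in> Sobolev 1" "rep (rs (\<lambda>eta. fh eta + coef u eta)) z"
  and eq: "\<And>\<phi>. \<phi> \<in> Sobolev 1 ==> form z \<phi> = (LI x. (f x + v x) * \<phi> x)"
 shows "cost (u, y) \<ge> cost (v, z) + \<kappa> / 2 * (nrm (\<lambda>x. u x - v x))^2"
proof -
 have u: "u \<in> U" "u \<in> LL" and y: "y \<in> Sobolev 1" "y \<in> LL" and zL: "z \<in> LL" and vL: "v \<in> LL"
  and yeq: "\<And>\<phi>. \<phi> \<in> Sobolev 1 ==> form y \<phi> = (LI x. (f x + u x) * \<phi> x)"
  using feas U(1) v Sobolev_1D(1) z(1) by (auto simp: feasible_iff)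
 let ?c = "coef u"
 let ?w = "\<lambda>x. y x - z x"
 note wS = Sobolev_1_diff(1)[OF y(1) z(1)]
 have orth: "(LI x. (u x - v x) * g x) = 0" if g: "rep e g" for e g
 proof -
  have gL: "g \<in> LL" using g by (simp add: rep_def)
  have "(LI x. (u x - v x) * g x) = (LI x. u x * g x) - (LI x. v x * g x)"
   unfolding left_diff_distrib by (rule B_integral_diff) (intro integrable_L2_mult u vL gL)+
  then show ?thesis by (simp add: coef_orthogonal[OF u(2) g] rep_ip_rep[OF v(2) g])
 qed
 have wform: "form ?w \<phi> = (LI x. (u x - v x) * \<phi> x)" if \<phi>: "\<phi> \<in> Sobolev 1" for \<phi>
 proof -
  note \<phi>L = Sobolev_1D(1)[OF \<phi>]
  have "form ?w \<phi> = (LI x. (f x + u x) * \<phi> x - (f x + v x) * \<phi> x)"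
   unfolding form_diff_left[OF y(1) z(1) \<phi>] yeq[OF \<phi>] eq[OF \<phi>]
   by (rule B_integral_diff[symmetric]) (rule integrable_L2_mult[OF L2_add[OF f(1) u(2)] \<phi>L], rule integrable_L2_mult[OF L2_add[OF f(1) vL] \<phi>L])
  then show ?thesis by (simp add: algebra_simps)
 qed
 have worth: "(LI x. ?w x * g x) = 0" if g: "rep e g" for e g
 proof -
  obtain p where p: "p \<in> Sobolev 1" "rep (rs e) p" "\<And>\<phi>. \<phi> \<in> Sobolev 1 ==> form p \<phi> = (LI x. g x * \<phi> x)"
   using rep_state[OF g] by blast
  have "(LI x. ?w x * g x) = form p ?w" by (simp add: p(3)[OF wS] mult.commute)
  also have "... = (LI x. (u x - v x) * p x)" unfolding form_commute[OF p(1) wS] by (rule wform[OF p(1)])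
  finally show ?thesis using orth[OF p(2)] by simp
 qed
 have sq: "(nrm (\<lambda>x. a x + b x))^2 = (nrm a)^2 + 2 * (LI x. a x * b x) + (nrm b)^2"
  if "a \<in> LL" "b \<in> LL" for a b :: "real^'n => real"
  using nrm_add_sq[of "cplx a" "cplx b"] that nrm_cplx[of "\<lambda>x. a x + b x"] by (simp add: ip_cplx)
 have 1: "energy_eps A eps (\<lambda>x. y x - yd1 x) \<ge> energy_eps A eps (\<lambda>x. z x - yd1 x)"
 proof -
  let ?q = "\<lambda>x. yd1 x - z x"
  note qS = Sobolev_1_diff(1)[OF yd1(1) z(1)]
  have e: "(\<lambda>x. y x - yd1 x) = (\<lambda>x. ?w x - ?q x)" by auto
  have "energy_eps A eps (\<lambda>x. ?w x - ?q x) = form ?w ?w - 2 * form ?w ?q + form ?q ?q"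
   by (rule energy_diff[OF wS qS])
  moreover have "form ?w ?q = 0" unfolding wform[OF qS] by (rule orth[OF rep_diff[OF rep_data(2) z(2)]])
  moreover have "form ?q ?q = energy_eps A eps (\<lambda>x. z x - yd1 x)"
   unfolding energy_form[symmetric] energy_diff[OF yd1(1) z(1)] energy_diff[OF z(1) yd1(1)] form_commute[OF yd1(1) z(1)] by simp
  ultimately show ?thesis unfolding e using form_nonneg(1)[OF wS] by simp
 qed
 have 2: "(LI x. (y x - yd2 x)^2) \<ge> (LI x. (z x - yd2 x)^2)"
 proof -
  have "(nrm (\<lambda>x. ?w x + (z x - yd2 x)))^2 = (nrm ?w)^2 + 2 * (LI x. ?w x * (z x - yd2 x)) + (nrm (\<lambda>x. z x - yd2 x))^2"
   by (rule sq[OF L2_diff[OF y(2) zL] L2_diff[OF zL yd2(1)]])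
  then have "(nrm (\<lambda>x. y x - yd2 x))^2 = (nrm ?w)^2 + (nrm (\<lambda>x. z x - yd2 x))^2"
   by (simp add: worth[OF rep_diff[OF z(2) rep_data(3)]])
  then show ?thesis unfolding nrm_sq_real[symmetric] by simp
 qed
 have 3: "(LI x. (u x)^2) = (LI x. (v x)^2) + (nrm (\<lambda>x. u x - v x))^2"
  using sq[OF L2_diff[OF u(2) vL] vL] by (simp add: orth[OF v(2)] nrm_sq_real)
 show ?thesis unfolding tracking_cost_def prod.case 3
  using mult_left_mono[OF 1, of "\<mu>1 / 2"] mult_left_mono[OF 2, of "\<mu>2 / 2"] weights
  by (simp add: distrib_left)
qed

definition Cset :: "(real^'n => complex) set" where
 "Cset = {c. onK c \<and> ae_mem (S c) U}"

lemma Cset_iff: "c \<in> Cset \<longleftrightarrow> (\<exists>v\<in>U. rep c v)"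
 using U(1) by (auto simp: Cset_def rep_def ae_mem_def ae_real_def)

text \<open>Replacing a control by its projection never raises the cost; so an optimal control equals its projection, and
 among synthesised controls the cost is \<open>Q.j\<close> up to a constant.\<close>

lemma optimal_eps:
 assumes opt: "optimal_control cost feasible u"
 shows "u \<in> LL" "rep (coef u) u" "Q.minimises Cset (coef u)"
proof -
 obtain y where feas: "feasible (u, y)" and min: "\<And>p. feasible p ==> cost (u, y) \<le> cost p"
  using opt unfolding optimal_control_def is_arg_min_def by (meson not_le)
 have u: "u \<in> U" using feas by (simp add: feasible_iff)
 then show uL: "u \<in> LL" using U(1) by blast
 have solve: "\<exists>z. z \<in> Sobolev 1 \<and> rep (rs (\<lambda>eta. fh eta + c eta)) z \<and> (\<forall>\<phi>\<in>Sobolev 1. form z \<phi> = (LI x. (f x + v x) * \<phi> x))"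
  if "rep c v" for c v
  by (rule rep_state[OF rep_add[OF rep_data(1) that]]) blast
 obtain v where v: "v \<in> U" "rep (coef u) v" using projection_rep[OF u] by blast
 from solve[OF v(2)] obtain z where z: "z \<in> Sobolev 1" "rep (rs (\<lambda>eta. fh eta + coef u eta)) z"
  "\<And>\<phi>. \<phi> \<in> Sobolev 1 ==> form z \<phi> = (LI x. (f x + v x) * \<phi> x)" by blast
 have "feasible (v, z)" using v z by (simp add: feasible_iff)
 note le = min[OF this] cost_projection[OF feas v z]
 have "\<kappa> / 2 * (nrm (\<lambda>x. u x - v x))^2 \<le> 0" using le by linarith
 then have "nrm (\<lambda>x. u x - v x) = 0" using weights(3) by (simp add: mult_le_0_iff)
 moreover have vL: "v \<in> LL" using v(2) by (simp add: rep_def)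
 ultimately have ae: "ae x. u x - v x = 0" using nrm_zero_iff[OF L2_diff[OF uL vL]] by simp
 have "ae x. S (coef u) x = cplx v x" using v(2) by (simp add: rep_def)
 with ae have "ae x. S (coef u) x = cplx u x" by eventually_elim simp
 then show "rep (coef u) u" using uL coef_onK[OF uL] by (simp add: rep_def)
 show "Q.minimises Cset (coef u)" unfolding Q.minimises_def
 proof (intro conjI ballI)
  show "coef u \<in> Cset" unfolding Cset_iff using v by blast
  fix d assume "d \<in> Cset"
  then obtain v' where v': "v' \<in> U" "rep d v'" unfolding Cset_iff by blast
  from solve[OF v'(2)] obtain z' where z': "z' \<in> Sobolev 1" "rep (rs (\<lambda>eta. fh eta + d eta)) z'"
   "\<And>\<phi>. \<phi> \<in> Sobolev 1 ==> form z' \<phi> = (LI x. (f x + v' x) * \<phi> x)" by blast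
  have "feasible (v', z')" using v' z' by (simp add: feasible_iff)
  from min[OF this] have le1: "cost (u, y) \<le> cost (v', z')" .
  have le2: "cost (v, z) \<le> cost (u, y)"
  proof -
   have "0 \<le> \<kappa> / 2 * (nrm (\<lambda>x. u x - v x))^2" using weights(3) by simp
   then show ?thesis using le(2) by linarith
  qed
  have "cost (v, z) = Q.j (coef u) + \<mu>1 / 2 * form yd1 yd1" by (rule cost_rep[OF v(2) z])
  moreover have "cost (v', z') = Q.j d + \<mu>1 / 2 * form yd1 yd1" by (rule cost_rep[OF v'(2) z'])
  ultimately show "Q.j (coef u) \<le> Q.j d" using order_trans[OF le2 le1] by simp
 qed
qed

lemma Cset_convex: "convexL Cset"
 unfolding convexL_def
proof (intro conjI ballI allI impI)
 show "Cset \<subseteq> LL" by (auto simp: Cset_def onK_def)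
 fix c d and t :: real assume c: "c \<in> Cset" "d \<in> Cset" and t: "0 \<le> t \<and> t \<le> 1"
 obtain u v where uv: "u \<in> U" "rep c u" "v \<in> U" "rep d v" using c unfolding Cset_iff by blast
 have "(\<lambda>x. (1 - t) * u x + t * v x) \<in> U" using U(2) uv t unfolding L2_convex_def by blast
 moreover have "rep (\<lambda>eta. c eta + complex_of_real t * (d eta - c eta)) (\<lambda>x. (1 - t) * u x + t * v x)"
 proof -
  note r = rep_diff[OF uv(4,2)]
  have "onK (\<lambda>eta. complex_of_real t * (d eta - c eta))" "ae x. S (\<lambda>eta. d eta - c eta) x = cplx (\<lambda>x. v x - u x) x"
   using r onK_cmult by (auto simp: rep_def)
  then have "rep (\<lambda>eta. complex_of_real t * (d eta - c eta)) (\<lambda>x. t * (v x - u x))"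
   using r L2_cplx[of "\<lambda>x. t * (v x - u x)"] L2_cmult[of "cplx (\<lambda>x. v x - u x)" "complex_of_real t"] L2_cplx[of "\<lambda>x. v x - u x"]
   unfolding rep_def S_cmult by (simp del: L2_cplx add: of_real_mult del: of_real_diff)
  from rep_add[OF uv(2) this] show ?thesis by (simp add: algebra_simps)
 qed
 ultimately show "(\<lambda>eta. c eta + complex_of_real t * (d eta - c eta)) \<in> Cset" unfolding Cset_iff by blast
qed

text \<open>As \<open>S\<close> is an isometry, the synthesised functions converge, and the imaginary part of their limit vanishes.\<close>

lemma Cset_closed: "closedL Cset"
 unfolding closedL_def
proof (intro allI impI)
 fix c :: "nat => real^'n => complex" and l
 assume as: "(\<forall>k. c k \<in> Cset) \<and> l \<in> LL \<and> (\<lambda>k. nrm (\<lambda>eta. c k eta - l eta)) ----> 0"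
 then have "\<forall>k. \<exists>v\<in>U. rep (c k) v" unfolding Cset_iff by blast
 then obtain v where v: "\<And>k. v k \<in> U" "\<And>k. rep (c k) (v k)" by metis
 have cK: "onK (c k)" for k using v(2) by (simp add: rep_def)
 let ?l = "\<lambda>eta. indicator K eta * l eta"
 have l: "onK ?l" using onK_indicator as by blast
 have lim: "(\<lambda>k. nrm (\<lambda>eta. c k eta - ?l eta)) ----> 0"
 proof (rule tendsto_sandwich[OF _ _ tendsto_const])
  show "(\<lambda>k. nrm (\<lambda>eta. c k eta - l eta)) ----> 0" using as by blast
  show "\<forall>\<^sub>F k in sequentially. nrm (\<lambda>eta. c k eta - ?l eta) \<le> nrm (\<lambda>eta. c k eta - l eta)"
  proof (rule always_eventually, rule allI)
   fix k
   have *: "(\<lambda>eta. c k eta - l eta) \<in> LL" "(\<lambda>eta. c k eta - ?l eta) \<in> LL"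
    using as L2_diff[OF onK_L2[OF cK]] onK_L2[OF l] by auto
   show "nrm (\<lambda>eta. c k eta - ?l eta) \<le> nrm (\<lambda>eta. c k eta - l eta)"
    by (rule L2_bound(2)[OF *(1) L2_measurable[OF *(2)]]) (use cK[of k] in \<open>auto simp: onK_def indicator_def\<close>)
  qed
 qed auto
 have dS: "ae x. cplx (v k) x - S ?l x = S (\<lambda>eta. c k eta - ?l eta) x" for k
 proof -
  have "ae x. S (c k) x = cplx (v k) x" using v(2) by (simp add: rep_def)
  with S_diff[OF onK_onZ[OF cK] onK_onZ[OF l], of k] show ?thesis by eventually_elim simp
 qed
 define g where "g = (\<lambda>x. Re (S ?l x))"
 have SlL: "S ?l \<in> LL" by (rule S_L2[OF onK_onZ[OF l]])
 have gL: "g \<in> LL" unfolding g_def by (rule L2_Re[OF SlL])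
 have n: "nrm (S (\<lambda>eta. c k eta - ?l eta)) = nrm (\<lambda>eta. c k eta - ?l eta)" for k by (rule nrm_S[OF onK_onZ[OF onK_diff[OF cK l]]])
 note dL = S_L2[OF onK_onZ[OF onK_diff[OF cK l]]]
 have vL: "v k \<in> LL" for k using v(2) by (simp add: rep_def)
 have "nrm (\<lambda>x. v k x - g x) \<le> nrm (\<lambda>eta. c k eta - ?l eta)" for k
  unfolding n[symmetric]
 proof (rule L2_bound(2)[OF dL L2_measurable[OF L2_diff[OF vL gL]]])
  show "ae x. norm (v k x - g x) \<le> norm (S (\<lambda>eta. c k eta - ?l eta) x)"
   using dS[of k]
  proof eventually_elim
   case (elim x)
   have "v k x - g x = Re (cplx (v k) x - S ?l x)" by (simp add: g_def)
   then show ?case unfolding elim using abs_Re_le_cmod by simp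
  qed
 qed
 then have "(\<lambda>k. nrm (\<lambda>x. v k x - g x)) ----> 0"
  by (intro tendsto_sandwich[OF _ _ tendsto_const lim]) auto
 then have gU: "g \<in> U" using U(3) v(1) gL unfolding L2_closed_def by blast
 have "nrm (\<lambda>x. Im (S ?l x)) \<le> nrm (\<lambda>eta. c k eta - ?l eta)" for k
  unfolding n[symmetric]
 proof (rule L2_bound(2)[OF dL L2_measurable[OF L2_Im[OF SlL]]])
  show "ae x. norm (Im (S ?l x)) \<le> norm (S (\<lambda>eta. c k eta - ?l eta) x)"
   using dS[of k]
  proof eventually_elim
   case (elim x)
   have "\<bar>Im (S ?l x)\<bar> = \<bar>Im (cplx (v k) x - S ?l x)\<bar>" by simp
   then show ?case unfolding elim using abs_Im_le_cmod by simp
  qed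
 qed
 then have "nrm (\<lambda>x. Im (S ?l x)) \<le> 0" by (intro LIMSEQ_le_const[OF lim]) auto
 then have "ae x. Im (S ?l x) = 0"
  using nrm_zero_iff[OF L2_Im[OF SlL]] nrm_nonneg[of "\<lambda>x. Im (S ?l x)"] by linarith
 then have "ae x. S ?l x = cplx g x" by eventually_elim (simp add: g_def complex_eq_iff)
 then have "rep ?l g" using l gL by (simp add: rep_def)
 then have "?l \<in> Cset" using gU unfolding Cset_iff by blast
 with lim show "\<exists>l'\<in>Cset. (\<lambda>k. nrm (\<lambda>eta. c k eta - l' eta)) ----> 0" by (intro bexI[of _ ?l])
qed

end

section \<open>The effective operator on the Fourier side\<close>

lemma prod_list_scale: "(\<Prod>i\<leftarrow>js. (t *R eta :: real^'n) $ i) = t ^ length js * (\<Prod>i\<leftarrow>js. eta $ i)"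
 by (induction js) auto

lemma tensor_power_scale: "tensor_power T j (t *R eta) = t ^ j * tensor_power T j eta"
 unfolding tensor_power_def sum_distrib_left
 by (rule sum.cong) (auto simp: indices_def prod_list_scale simp del: vector_scaleR_component)

lemma continuous_prod_list: "continuous_on UNIV (\<lambda>eta :: real^'n. \<Prod>i\<leftarrow>js. eta $ i)"
 by (induction js) (auto intro!: continuous_intros)

lemma tensor_power_continuous: "continuous_on UNIV (tensor_power T j :: real^'n => real)"
 unfolding tensor_power_def[abs_def] by (intro continuous_intros continuous_prod_list)

lemma effective_symbol_continuous: "continuous_on UNIV (effective_symbol AA eps M :: real^'n => real)"
 unfolding effective_symbol_def[abs_def] by (intro continuous_intros tensor_power_continuous)

lemma effective_symbol_measurable [measurable]: "(effective_symbol AA eps M :: real^'n => real) \<in> bmeas"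
 by (rule borel_measurable_continuous_onI[OF effective_symbol_continuous])

lemma effective_symbol_minus: "effective_symbol AA eps M (- eta) = effective_symbol AA eps M eta"
proof -
 have "tensor_power T (2 * k) (- eta) = tensor_power T (2 * k) eta" for T :: "'a list => real" and k
  using tensor_power_scale[of T "2 * k" "-1" eta] by simp
 then show ?thesis by (simp add: effective_symbol_def)
qed

text \<open>Along a ray the symbol is a polynomial with value \<open>1\<close> at the origin, so it vanishes at finitely many points
 of the ray; Fubini for the dilations shows that the zero set is null.\<close>

lemma effective_symbol_zeros:
 "ae eta. 1 + effective_symbol AA eps M (eta :: real^'n) \<noteq> 0"
proof -
 let ?N = "{eta :: real^'n. 1 + effective_symbol AA eps M eta = 0}"
 have N [measurable]: "?N \<in> sets borel" by measurable
 have fin: "finite {t. t *R eta \<in> ?N}" for eta :: "real^'n"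
 proof -
  define p where "p = 1 + (\<Sum>k=1..M. monom (eps ^ (2*k - 2) * (2 * pi) ^ (2*k) * tensor_power (AA (2*k)) (2*k) eta) (2*k))"
  have p: "poly p t = 1 + effective_symbol AA eps M (t *R eta)" for t
   unfolding p_def effective_symbol_def tensor_power_scale by (simp add: poly_sum poly_monom mult_ac)
  have "effective_symbol AA eps M (0 *R eta) = 0"
   unfolding effective_symbol_def tensor_power_scale by (rule sum.neutral) auto
  then have "poly p 0 = 1" using p[of 0] by simp
  then have "p \<noteq> 0" by auto
  from poly_roots_finite[OF this] show ?thesis by (simp add: p)
 qed
 let ?g = "\<lambda>(t::real) (eta::real^'n). indicator {1..2} t * indicator ?N (t *R eta) :: ennreal"
 have m: "case_prod ?g \<in> borel_measurable (lborel \<Otimes>\<^sub>M lborel)" by measurable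
 have Fub: "(NI t. (NI eta. ?g t eta)) = (NI eta. (NI t. ?g t eta))"
  using lborel_pair.Fubini'[OF m] by simp
 have line: "(NI t. ?g t eta) = 0" for eta
 proof -
  have "ae t. t \<notin> {t. t *R eta \<in> ?N}" by (rule AE_not_in[OF finite_imp_null_set_lborel[OF fin]])
  then have "ae t. ?g t eta = 0" by eventually_elim auto
  then have "(NI t. ?g t eta) = (\<integral>\<^sup>+t. 0 \<partial>(lborel :: real measure))" by (rule nn_integral_cong_AE)
  then show ?thesis by simp
 qed
 have z: "(NI t. (NI eta. ?g t eta)) = 0" unfolding Fub line by simp
 have "(\<lambda>t. \<integral>\<^sup>+eta. ?g t eta \<partial>lborel) \<in> borel_measurable (lborel :: real measure)"
  by (rule lborel.borel_measurable_nn_integral[OF m])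
 from nn_integral_0_iff_AE[OF this] z have ae: "ae t. (NI eta. ?g t eta) = 0" by simp
 have "\<exists>t\<in>{1..2::real}. (NI eta. ?g t eta) = 0"
 proof (rule ccontr)
  assume "\<not> ?thesis"
  with ae have "ae t. t \<notin> {1..2::real}" by (auto elim!: eventually_mono)
  then have "{1..2::real} \<in> null_sets lborel" by (subst AE_iff_null_sets) auto
  then show False by (simp add: null_sets_def)
 qed
 then obtain t :: real where t: "1 \<le> t" "(NI eta. indicator ?N (t *R eta)) = 0" by auto
 have "(NI eta. indicator ?N eta) = ennreal (\<bar>t\<bar> ^ CARD('n)) * (NI eta. indicator ?N (0 + t *R eta))"
  by (rule nn_integral_affine) (use t(1) in auto)
 then have "(NI eta. indicator ?N eta) = 0" using t(2) by simp
 then have "ae eta. indicator ?N eta = (0::ennreal)" by (subst (asm) nn_integral_0_iff_AE) auto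
 then show ?thesis by eventually_elim (auto simp: indicator_def split: if_splits)
qed

lemma symb_eq: "symb js xi = (2 * of_real pi * \<i>) ^ length js * of_real (\<Prod>i\<leftarrow>js. xi $ i)"
 by (induction js) (auto simp: mult_ac)

lemma symb_append: "symb (xs @ ys) xi = symb xs xi * symb ys xi"
 by (simp add: symb_def)

lemma symb_even:
 assumes "length js = 2 * k"
 shows "(- 1) ^ k * symb js xi = complex_of_real ((2 * pi) ^ (2 * k) * (\<Prod>i\<leftarrow>js. xi $ i))"
proof -
 have "(2 * complex_of_real pi * \<i>) ^ (2 * k) = ((2 * complex_of_real pi * \<i>)^2) ^ k" by (simp add: power_mult)
 also have "(2 * complex_of_real pi * \<i>)^2 = - 1 * complex_of_real ((2 * pi)^2)" by (simp add: power_mult_distrib)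
 also have "... ^ k = (- 1) ^ k * complex_of_real ((2 * pi) ^ (2 * k))" unfolding power_mult_distrib by (simp add: power_mult)
 finally have "(- 1) ^ k * (2 * complex_of_real pi * \<i>) ^ (2 * k) = ((- 1) ^ k * (- 1) ^ k) * complex_of_real ((2 * pi) ^ (2 * k))"
  by (simp only: mult.assoc)
 also have "(- 1 :: complex) ^ k * (- 1) ^ k = 1" by (simp flip: power_mult_distrib)
 finally show ?thesis unfolding symb_eq assms mult.assoc[symmetric] by simp
qed

lemma symb_split:
 assumes "length js = 2 * k"
 shows "symb (take k js) xi * cnj (symb (drop k js) xi) = complex_of_real ((2 * pi) ^ (2 * k) * (\<Prod>i\<leftarrow>js. xi $ i))"
proof -
 have l: "length (drop k js) = k" using assms by simp
 have "symb (take k js) xi * cnj (symb (drop k js) xi) = (- 1) ^ k * (symb (take k js) xi * symb (drop k js) xi)"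
  unfolding cnj_symb l by simp
 also have "symb (take k js) xi * symb (drop k js) xi = symb js xi" by (simp flip: symb_append)
 finally show ?thesis by (simp only: symb_even[OF assms])
qed

lemma norm_symb_le: assumes "norm xi \<le> R" shows "norm (symb js xi) \<le> (2 * pi * R) ^ length js"
proof (induction js)
 case (Cons i js)
 have "0 \<le> R" using assms norm_ge_zero[of xi] by linarith
 have "\<bar>xi $ i\<bar> \<le> R" using component_le_norm_cart[of xi i] assms by linarith
 then have "(2 * pi * \<bar>xi $ i\<bar>) * norm (symb js xi) \<le> (2 * pi * R) * (2 * pi * R) ^ length js"
  using Cons \<open>0 \<le> R\<close> by (intro mult_mono) auto
 then show ?case by (simp add: norm_mult)
qed simp

lemma symb_mult_L2:
 assumes c: "c \<in> LL" "\<And>xi. c xi \<noteq> 0 ==> norm xi \<le> R"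
 shows "(\<lambda>xi. symb js xi * c xi) \<in> LL"
proof (rule L2_bound(1)[OF L2_cmult[OF c(1), of "of_real ((2 * pi * R) ^ length js)"]])
 note [measurable] = L2_measurable[OF c(1)]
 show "(\<lambda>xi. symb js xi * c xi) \<in> bmeas" by measurable
 show "ae xi. norm (symb js xi * c xi) \<le> norm (complex_of_real ((2 * pi * R) ^ length js) * c xi)"
 proof (rule AE_I2)
  fix xi
  show "norm (symb js xi * c xi) \<le> norm (complex_of_real ((2 * pi * R) ^ length js) * c xi)"
  proof (cases "c xi = 0")
   case False
   have "norm (symb js xi) \<le> \<bar>(2 * pi * R) ^ length js\<bar>" using norm_symb_le[OF c(2)[OF False], of js] by linarith
   then show ?thesis unfolding norm_mult norm_of_real by (rule mult_right_mono) simp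
  qed simp
 qed
qed

lemma SobolevI_FT:
 fixes y :: "real^'n => real"
 assumes y: "FT (cplx y) yh" and yh: "\<And>js :: 'n list. length js \<le> k ==> (\<lambda>xi. symb js xi * yh xi) \<in> LL"
 shows "y \<in> Sobolev k"
 unfolding Sobolev_def
proof (intro CollectI conjI allI impI)
 show "y \<in> LL" using FT_L2(1)[OF y] by simp
 fix js :: "'n list" assume "length js \<le> k"
 from FT_surj[OF yh[OF this]] obtain v where v: "FT v (\<lambda>xi. symb js xi * yh xi)" by blast
 have "has_weak_deriv js y (\<lambda>x. Re (v x))" using has_weak_deriv_Re[OF FT_has_weak_deriv[OF y v]] by simp
 then show "\<exists>v\<in>LL. has_weak_deriv js y v" using L2_Re[OF FT_L2(1)[OF v]] by blast
qed

lemma Sobolev_weak_deriv: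
 fixes y :: "real^'n => real"
 assumes y: "y \<in> Sobolev k" and js: "length js \<le> k" and yh: "FT (cplx y) yh"
 shows "weak_deriv js y \<in> LL" "FT (cplx (weak_deriv js y)) (\<lambda>xi. symb js xi * yh xi)"
proof -
 obtain v where v: "v \<in> LL" "has_weak_deriv js y v" using y js unfolding Sobolev_def by blast
 show L: "weak_deriv js y \<in> LL" by (rule L2_AE_cong(1)[OF v(1) weak_deriv_AE_real[OF v(2)]])
 have "has_weak_deriv js y (weak_deriv js y)" unfolding weak_deriv_def by (rule someI[of "has_weak_deriv js y" v, OF v(2)])
 then show "FT (cplx (weak_deriv js y)) (\<lambda>xi. symb js xi * yh xi)" by (rule FT_weak_deriv_real[OF _ L yh])
qed

text \<open>Both sides are compared through their transforms; the signs \<open>(-1) ^ k\<close> cancel against those of \<open>(2 \<pi> i) ^ (2 * k)\<close>.\<close>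

lemma effective_equation:
 fixes y g :: "real^'n => real"
 assumes y: "y \<in> Sobolev (2 * M)" "FT (cplx y) yh" and g: "FT (cplx g) gh"
 shows "(ae x. (\<Sum>k=1..M. eps ^ (2*k - 2) * (-1) ^ k * tensor_deriv (AA (2*k)) (2*k) y x) + y x = g x)
  \<longleftrightarrow> (ae xi. complex_of_real (1 + effective_symbol AA eps M xi) * yh xi = gh xi)"
proof -
 let ?L = "\<lambda>x. (\<Sum>k=1..M. eps ^ (2*k - 2) * (-1) ^ k * tensor_deriv (AA (2*k)) (2*k) y x) + y x"
 let ?Lh = "\<lambda>xi. complex_of_real (1 + effective_symbol AA eps M xi) * yh xi"
 have D: "FT (\<lambda>x. complex_of_real (AA (2*k) js) * cplx (weak_deriv js y) x) (\<lambda>xi. complex_of_real (AA (2*k) js) * (symb js xi * yh xi))"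
  if "k \<in> {1..M}" "js \<in> indices (2*k)" for k js
  by (rule FT_cmult, rule Sobolev_weak_deriv(2)[OF y(1) _ y(2)]) (use that in \<open>auto simp: indices_def\<close>)
 have "FT (\<lambda>x. (\<Sum>k=1..M. complex_of_real (eps ^ (2*k - 2) * (-1) ^ k) * (\<Sum>js\<in>indices (2*k). complex_of_real (AA (2*k) js) * cplx (weak_deriv js y) x)) + cplx y x)
  (\<lambda>xi. (\<Sum>k=1..M. complex_of_real (eps ^ (2*k - 2) * (-1) ^ k) * (\<Sum>js\<in>indices (2*k). complex_of_real (AA (2*k) js) * (symb js xi * yh xi))) + yh xi)"
  by (intro FT_add[OF _ y(2)] FT_sum FT_cmult D)
 moreover have "(\<lambda>x. (\<Sum>k=1..M. complex_of_real (eps ^ (2*k - 2) * (-1) ^ k) * (\<Sum>js\<in>indices (2*k). complex_of_real (AA (2*k) js) * cplx (weak_deriv js y) x)) + cplx y x) = cplx ?L"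
  by (simp add: tensor_deriv_def)
 moreover have "(\<Sum>k=1..M. complex_of_real (eps ^ (2*k - 2) * (-1) ^ k) * (\<Sum>js\<in>indices (2*k). complex_of_real (AA (2*k) js) * (symb js xi * yh xi))) + yh xi = ?Lh xi" for xi
 proof -
  have "complex_of_real (eps ^ (2*k - 2) * (-1) ^ k) * (\<Sum>js\<in>indices (2*k). complex_of_real (AA (2*k) js) * (symb js xi * yh xi))
   = complex_of_real (eps ^ (2*k - 2) * (2 * pi) ^ (2*k) * tensor_power (AA (2*k)) (2*k) xi) * yh xi" for k
  proof -
   have "complex_of_real (eps ^ (2*k - 2) * (-1) ^ k) * (\<Sum>js\<in>indices (2*k). complex_of_real (AA (2*k) js) * (symb js xi * yh xi))
    = (\<Sum>js\<in>indices (2*k). complex_of_real (eps ^ (2*k - 2)) * (complex_of_real (AA (2*k) js) * ((- 1) ^ k * symb js xi)) * yh xi)"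
    unfolding sum_distrib_left by (rule sum.cong) (simp_all add: mult_ac)
   also have "... = (\<Sum>js\<in>indices (2*k). complex_of_real (eps ^ (2*k - 2) * (AA (2*k) js * ((2 * pi) ^ (2 * k) * (\<Prod>i\<leftarrow>js. xi $ i)))) * yh xi)"
   proof (rule sum.cong[OF refl])
    fix js :: "'n list" assume "js \<in> indices (2*k)"
    then have l: "length js = 2 * k" by (simp add: indices_def)
    show "complex_of_real (eps ^ (2*k - 2)) * (complex_of_real (AA (2*k) js) * ((- 1) ^ k * symb js xi)) * yh xi
     = complex_of_real (eps ^ (2*k - 2) * (AA (2*k) js * ((2 * pi) ^ (2 * k) * (\<Prod>i\<leftarrow>js. xi $ i)))) * yh xi"
     unfolding symb_even[OF l] by (simp only: of_real_mult)
   qed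
   also have "... = complex_of_real (\<Sum>js\<in>indices (2*k). eps ^ (2*k - 2) * (AA (2*k) js * ((2 * pi) ^ (2 * k) * (\<Prod>i\<leftarrow>js. xi $ i)))) * yh xi"
    by (simp only: of_real_sum sum_distrib_right)
   also have "(\<Sum>js\<in>indices (2*k). eps ^ (2*k - 2) * (AA (2*k) js * ((2 * pi) ^ (2 * k) * (\<Prod>i\<leftarrow>js. xi $ i))))
    = eps ^ (2*k - 2) * (2 * pi) ^ (2*k) * tensor_power (AA (2*k)) (2*k) xi"
    unfolding tensor_power_def sum_distrib_left by (rule sum.cong) (simp_all add: mult_ac)
   finally show ?thesis .
  qed
  then show ?thesis unfolding effective_symbol_def by (simp only: of_real_add of_real_sum of_real_1 sum_distrib_right distrib_right) simp
 qed
 ultimately have L: "FT (cplx ?L) ?Lh" by (simp only:)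
 note Lm = L2_measurable[OF FT_L2(1)[OF L]] L2_measurable[OF FT_L2(2)[OF L]] L2_measurable[OF FT_L2(1)[OF g]] L2_measurable[OF FT_L2(2)[OF g]]
 show ?thesis
 proof
  assume "ae x. ?L x = g x"
  then have "ae x. cplx g x = cplx ?L x" by eventually_elim simp
  from FT_cong[OF L Lm(3) this Lm(2)] have "FT (cplx g) ?Lh" by simp
  from FT_unique[OF this g] show "ae xi. ?Lh xi = gh xi" .
 next
  assume "ae xi. ?Lh xi = gh xi"
  then have "ae xi. gh xi = ?Lh xi" by eventually_elim simp
  from FT_cong[OF L Lm(1) _ Lm(4) this] have "FT (cplx ?L) gh" by simp
  from FT_inj[OF this g] show "ae x. ?L x = g x" by (simp del: of_real_add of_real_sum of_real_mult)
 qed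
qed

text \<open>Parseval's identity for each pair of derivatives of order \<open>k\<close>; conjugating the second symbol produces the sign that
 makes the product the term of the effective symbol.\<close>

lemma effective_energy:
 fixes w :: "real^'n => real"
 assumes w: "w \<in> Sobolev (2 * M)" "FT (cplx w) wh"
 shows "energy_eff AA eps M w = (LI xi. (1 + effective_symbol AA eps M xi) * (norm (wh xi))^2)"
proof -
 have wL: "w \<in> LL" using FT_L2(1)[OF w(2)] by simp
 let ?q = "\<lambda>k js xi. (2 * pi) ^ (2 * k) * (\<Prod>i\<leftarrow>js. xi $ i) * (norm (wh xi))^2"
 let ?d = "\<lambda>k js x. weak_deriv (take k js) w x * weak_deriv (drop k js) w x"
 have *: "integrable lborel (?d k js)" "integrable lborel (?q k js)" "(LI x. ?d k js x) = (LI xi. ?q k js xi)"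
  if k: "k \<in> {1..M}" and "js \<in> indices (2*k)" for k js
 proof -
  have l: "length js = 2 * k" using that by (simp add: indices_def)
  have l12: "length (take k js) \<le> 2 * M" "length (drop k js) \<le> 2 * M" using l k by auto
  note d1 = Sobolev_weak_deriv[OF w(1) l12(1) w(2)] and d2 = Sobolev_weak_deriv[OF w(1) l12(2) w(2)]
  show "integrable lborel (?d k js)" by (rule integrable_L2_mult[OF d1(1) d2(1)])
  have e: "(symb (take k js) xi * wh xi) * cnj (symb (drop k js) xi * wh xi) = complex_of_real (?q k js xi)" for xi
  proof -
   have "(symb (take k js) xi * wh xi) * cnj (symb (drop k js) xi * wh xi)
    = (symb (take k js) xi * cnj (symb (drop k js) xi)) * (wh xi * cnj (wh xi))" by (simp add: mult_ac)
   then show ?thesis unfolding symb_split[OF l] complex_norm_square[symmetric] by (simp only: of_real_mult)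
  qed
  have i: "integrable lborel (\<lambda>xi. complex_of_real (?q k js xi))"
   using integrable_ip[OF FT_L2(2)[OF d1(2)] FT_L2(2)[OF d2(2)]] unfolding e .
  from integrable_Re[OF i] show "integrable lborel (?q k js)" by (simp only: Re_complex_of_real)
  have "complex_of_real (LI x. ?d k js x) = (LI xi. complex_of_real (?q k js xi))"
   using FT_ip[OF d1(2) d2(2)] unfolding ip_cplx unfolding ip_def e .
  then show "(LI x. ?d k js x) = (LI xi. ?q k js xi)"
   unfolding integral_complex_of_real by (simp only: of_real_eq_iff)
 qed
 have ww: "integrable lborel (\<lambda>x. (w x)^2)" "integrable lborel (\<lambda>xi. (norm (wh xi))^2)" "(LI x. (w x)^2) = (LI xi. (norm (wh xi))^2)"
  using L2_integrable[OF wL] L2_integrable[OF FT_L2(2)[OF w(2)]] FT_nrm[OF w(2)] by (simp_all add: nrm_sq_real flip: nrm_sq)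
 have "energy_eff AA eps M w = (LI x. (\<Sum>k=1..M. \<Sum>js\<in>indices (2*k). eps ^ (2*k - 2) * AA (2*k) js * ?d k js x) + (w x)^2)"
  unfolding energy_eff_def deriv_form_def sum_distrib_left by (simp only: mult.assoc)
 also have "... = (LI x. (\<Sum>k=1..M. \<Sum>js\<in>indices (2*k). eps ^ (2*k - 2) * AA (2*k) js * ?d k js x)) + (LI x. (w x)^2)"
  by (intro B_integral_add B_integrable_sum integrable_mult_right * ww)
 also have "(LI x. (\<Sum>k=1..M. \<Sum>js\<in>indices (2*k). eps ^ (2*k - 2) * AA (2*k) js * ?d k js x))
  = (\<Sum>k=1..M. LI x. (\<Sum>js\<in>indices (2*k). eps ^ (2*k - 2) * AA (2*k) js * ?d k js x))"
  by (intro B_integral_sum B_integrable_sum integrable_mult_right *)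
 also have "... = (\<Sum>k=1..M. \<Sum>js\<in>indices (2*k). LI x. eps ^ (2*k - 2) * AA (2*k) js * ?d k js x)"
  by (intro sum.cong[OF refl] B_integral_sum integrable_mult_right *)
 also have "... = (\<Sum>k=1..M. \<Sum>js\<in>indices (2*k). LI xi. eps ^ (2*k - 2) * AA (2*k) js * ?q k js xi)"
  by (intro sum.cong[OF refl]) (simp only: B_integral_mult_right_zero *(3))
 also have "... = (\<Sum>k=1..M. LI xi. (\<Sum>js\<in>indices (2*k). eps ^ (2*k - 2) * AA (2*k) js * ?q k js xi))"
  by (intro sum.cong[OF refl] B_integral_sum[symmetric] integrable_mult_right *)
 also have "... = (LI xi. (\<Sum>k=1..M. \<Sum>js\<in>indices (2*k). eps ^ (2*k - 2) * AA (2*k) js * ?q k js xi))"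
  by (intro B_integral_sum[symmetric] B_integrable_sum integrable_mult_right *)
 also have "... + (LI x. (w x)^2) = (LI xi. (\<Sum>k=1..M. \<Sum>js\<in>indices (2*k). eps ^ (2*k - 2) * AA (2*k) js * ?q k js xi) + (norm (wh xi))^2)"
  unfolding ww(3) by (intro B_integral_add[symmetric] B_integrable_sum integrable_mult_right * ww)
 also have "... = (LI xi. (1 + effective_symbol AA eps M xi) * (norm (wh xi))^2)"
 proof (rule B_integral_cong[OF refl])
  fix xi
  have "(\<Sum>k=1..M. \<Sum>js\<in>indices (2*k). eps ^ (2*k - 2) * AA (2*k) js * ?q k js xi) = effective_symbol AA eps M xi * (norm (wh xi))^2"
   unfolding effective_symbol_def tensor_power_def sum_distrib_left sum_distrib_right by (simp only: mult_ac)
  then show "(\<Sum>k=1..M. \<Sum>js\<in>indices (2*k). eps ^ (2*k - 2) * AA (2*k) js * ?q k js xi) + (norm (wh xi))^2 = (1 + effective_symbol AA eps M xi) * (norm (wh xi))^2"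
   by (simp only: distrib_right mult_1 add.commute)
 qed
 finally show ?thesis .
qed

text \<open>The Taylor expansion controls the symbol on a ball of radius \<open>\<delta>\<close>; where \<open>eps * norm eta \<ge> \<delta>\<close> the factor
 \<open>(R/\<delta>) ^ (2*M) * eps ^ (2*M)\<close> is at least \<open>1\<close>, and the difference of two numbers in \<open>[0,1]\<close> is at most \<open>1\<close>.\<close>

lemma resolvent_difference:
 fixes lam0 :: "real^'n => real"
 assumes T: "effective_tensors lam0 AA" and M: "M \<ge> 1" and R: "R > 0"
 obtains C where "C > 0" "\<And>eps eta. eps > 0 ==> eta \<noteq> 0 ==> norm eta \<le> R ==> 0 \<le> lam0 (eps *R eta) ==> 0 \<le> effective_symbol AA eps M eta ==>
  \<bar>1 / (1 + lam0 (eps *R eta) / eps^2) - 1 / (1 + effective_symbol AA eps M eta)\<bar> \<le> C * eps ^ (2*M)"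
proof -
 let ?T = "\<lambda>eta. \<Sum>k=1..M. (2 * pi) ^ (2*k) * tensor_power (AA (2*k)) (2*k) eta"
 have "(\<lambda>eta. lam0 eta - ?T eta) \<in> O[at 0](\<lambda>eta. norm eta ^ (2*M + 2))"
  using T M unfolding effective_tensors_def by blast
 then obtain c where c: "c > 0" "eventually (\<lambda>eta. norm (lam0 eta - ?T eta) \<le> c * norm (norm eta ^ (2*M + 2))) (at 0)"
  by (rule landau_o.bigE)
 from c(2) obtain \<delta> where \<delta>: "\<delta> > 0" "\<And>eta. eta \<noteq> 0 ==> norm eta < \<delta> ==> \<bar>lam0 eta - ?T eta\<bar> \<le> c * norm eta ^ (2*M + 2)"
  unfolding eventually_at by (auto simp: dist_norm)
 define C where "C = c * R ^ (2*M + 2) + (R / \<delta>) ^ (2*M)"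
 have pos: "c * R ^ (2*M + 2) > 0" "(R / \<delta>) ^ (2*M) > 0" using c(1) R \<delta>(1) by auto
 show ?thesis
 proof (rule that[of C])
  show "C > 0" unfolding C_def using pos by linarith
  fix eps :: real and eta :: "real^'n"
  assume e: "eps > 0" and eta: "eta \<noteq> 0" "norm eta \<le> R" and l0: "0 \<le> lam0 (eps *R eta)" and p0: "0 \<le> effective_symbol AA eps M eta"
  let ?a = "lam0 (eps *R eta) / eps^2" and ?b = "effective_symbol AA eps M eta"
  have a0: "0 \<le> ?a" using l0 by simp
  show "\<bar>1 / (1 + ?a) - 1 / (1 + ?b)\<bar> \<le> C * eps ^ (2*M)"
  proof (cases "eps * norm eta < \<delta>")
   case True
   have "?T (eps *R eta) = eps^2 * ?b"
    unfolding effective_symbol_def sum_distrib_left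
   proof (rule sum.cong[OF refl])
    fix k assume "k \<in> {1..M}"
    then have "2 * k = 2 + (2 * k - 2)" by auto
    then have "eps ^ (2*k) = eps^2 * eps ^ (2*k - 2)" by (metis power_add)
    then show "(2 * pi) ^ (2*k) * tensor_power (AA (2*k)) (2*k) (eps *R eta) = eps^2 * (eps ^ (2*k - 2) * (2 * pi) ^ (2*k) * tensor_power (AA (2*k)) (2*k) eta)"
     unfolding tensor_power_scale by (simp only: mult_ac)
   qed
   then have "\<bar>lam0 (eps *R eta) - eps^2 * ?b\<bar> \<le> c * (eps * norm eta) ^ (2*M + 2)"
    using \<delta>(2)[of "eps *R eta"] e eta True by simp
   also have "(eps * norm eta) ^ (2*M + 2) \<le> eps ^ (2*M + 2) * R ^ (2*M + 2)"
    unfolding power_mult_distrib using e eta by (intro mult_left_mono power_mono) auto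
   finally have "\<bar>lam0 (eps *R eta) - eps^2 * ?b\<bar> \<le> eps^2 * (c * R ^ (2*M + 2) * eps ^ (2*M))"
    using c(1) by (simp add: power_add power2_eq_square mult_ac)
   moreover have "lam0 (eps *R eta) - eps^2 * ?b = eps^2 * (?a - ?b)" using e by (simp add: field_simps)
   ultimately have ab: "\<bar>?a - ?b\<bar> \<le> c * R ^ (2*M + 2) * eps ^ (2*M)"
    using e by (simp add: abs_mult)
   have "\<bar>1 / (1 + x) - 1 / (1 + y)\<bar> \<le> \<bar>x - y\<bar>" if "0 \<le> x" "0 \<le> y" for x y :: real
   proof -
    have "1 / (1 + x) - 1 / (1 + y) = (y - x) / ((1 + x) * (1 + y))" using that by (simp add: field_simps)
    moreover have "1 * 1 \<le> (1 + x) * (1 + y)" using that by (intro mult_mono) auto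
    ultimately show ?thesis using that by (simp add: abs_mult divide_le_eq abs_minus_commute mult_le_cancel_left1)
   qed
   from this[OF a0 p0] ab have "\<bar>1 / (1 + ?a) - 1 / (1 + ?b)\<bar> \<le> c * R ^ (2*M + 2) * eps ^ (2*M)" by linarith
   also have "... \<le> C * eps ^ (2*M)" unfolding C_def using pos e by (intro mult_right_mono) auto
   finally show ?thesis .
  next
   case False
   have "eps * norm eta \<le> eps * R" using e eta(2) by (rule mult_left_mono[OF _ less_imp_le, rotated])
   then have "\<delta> \<le> R * eps" using False by (simp add: mult.commute)
   then have "1 \<le> R / \<delta> * eps" using \<delta>(1) by (simp add: field_simps)
   then have "1 \<le> (R / \<delta> * eps) ^ (2*M)" by (rule one_le_power)
   then have "1 \<le> (R / \<delta>) ^ (2*M) * eps ^ (2*M)" by (simp only: power_mult_distrib)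
   also have "... \<le> C * eps ^ (2*M)" unfolding C_def using pos e by (intro mult_right_mono) auto
   finally have "1 \<le> C * eps ^ (2*M)" .
   moreover have "0 \<le> 1 / (1 + ?a)" "1 / (1 + ?a) \<le> 1" "0 \<le> 1 / (1 + ?b)" "1 / (1 + ?b) \<le> 1" using a0 p0 by auto
   ultimately show ?thesis by linarith
  qed
 qed
qed

section \<open>The effective problem\<close>

lemma icf_AE_cong:
 assumes "ae eta. g eta = g' eta" "g \<in> bmeas" "g' \<in> bmeas"
 shows "icf g = icf g'"
proof
 fix x :: "real^'a"
 note [measurable] = assms(2,3)
 have "(LI xi. g xi * plane_wave x xi) = (LI xi. g' xi * plane_wave x xi)"
  by (rule integral_cong_AE) (use assms(1) in \<open>auto elim: eventually_mono\<close>)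
 then show "icf g x = icf g' x" by (simp add: icf_eq)
qed

lemma FT_of_symmetric:
 assumes "c \<in> LL" "ae xi. cnj (c (- xi)) = c xi"
 obtains u :: "real^'n => real" where "FT (cplx u) c"
proof -
 obtain v where v: "FT v c" using FT_surj[OF assms(1)] by blast
 have "ae x. cnj (v x) = v x" using FT_real_iff[OF v] assms(2) by blast
 then have "ae x. complex_of_real (Re (v x)) = v x" by eventually_elim (simp add: complex_eq_iff)
 then have "FT (cplx (\<lambda>x. Re (v x))) c"
  using L2_measurable[OF FT_L2(1)[OF v]] L2_measurable[OF FT_L2(2)[OF v]] by (intro FT_cong[OF v]) auto
 then show ?thesis by (rule that)
qed

lemma FT_real_symmetric: assumes "FT (cplx u) c" shows "ae xi. cnj (c (- xi)) = c xi"
 using FT_real_iff[OF assms] by simp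

context bloch
begin

lemma adaption_S:
 assumes "FT (cplx u) c" "\<And>eta. eta \<notin> Zs ==> c eta = 0" shows "adaption Phi eps (cplx u) = S c"
proof -
 have F: "FT (cplx u) (fourier (cplx u))" by (rule fourier_FT(1)[OF FT_L2(1)[OF assms(1)]])
 note [measurable] = L2_measurable[OF FT_L2(2)[OF F]]
 have "ae eta. indicator Zs eta * fourier (cplx u) eta = c eta"
  using FT_unique[OF F assms(1)] by eventually_elim (use assms(2) in \<open>auto simp: indicator_def\<close>)
 then show ?thesis unfolding adaption_def synthesis_S[OF subset_refl]
  by (rule S_cong) (use L2_measurable[OF FT_L2(2)[OF assms(1)]] in auto)
qed

lemma phi_minus: "ae zeta. zeta \<in> Zcell \<and> - zeta \<in> Zcell --> (\<forall>k. phi (- k) (- zeta) = cnj (phi k zeta))"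
proof -
 have "ae zeta. zeta \<in> Zcell \<and> - zeta \<in> Zcell --> (ae x. Phi 0 (- zeta) x = cnj (Phi 0 zeta x))"
  using sys unfolding bloch_system_def by blast
 then show ?thesis
 proof eventually_elim
  case (elim zeta)
  show ?case
  proof (intro impI allI)
   fix k assume z: "zeta \<in> Zcell \<and> - zeta \<in> Zcell"
   then have ae: "ae x. Phi 0 (- zeta) x = cnj (Phi 0 zeta x)" using elim by blast
   have "cf (cell (P0 (- zeta))) (rv (- k)) = (LI x. cnj (cell (P0 zeta) x * cnj (plane_wave x (rv k))))"
    unfolding cf_def
   proof (rule integral_cong_AE)
    show "ae x. cell (P0 (- zeta)) x * cnj (plane_wave x (rv (- k))) = cnj (cell (P0 zeta) x * cnj (plane_wave x (rv k)))"
     using ae by eventually_elim (use z in \<open>simp add: cell_def P0_def rv_minus plane_wave_def exp_cnj indicator_def\<close>)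
   qed (unfold cell_def, measurable)
   also have "... = cnj (cf (cell (P0 zeta)) (rv k))" unfolding cf_def by (rule B_integral_cnj)
   finally show "phi (- k) (- zeta) = cnj (phi k zeta)" by (simp add: phi_def)
  qed
 qed
qed

text \<open>The symmetry of the Fourier transform \<open>W c\<close> of a real function is compared on the fibres over \<open>eta\<close> and
 \<open>- eta\<close>, at a \<open>k\<close> for which the Fourier coefficient \<open>phi k (eps *R eta)\<close> of the normalised eigenfunction is nonzero.\<close>

lemma real_coefficients_symmetric:
 assumes c: "onZ c" and r: "ae x. S c x = cplx v x"
 shows "ae eta. eta \<in> Zs \<and> - eta \<in> Zs --> cnj (c (- eta)) = c eta"
proof -
 have "ae x. cnj (S c x) = S c x" using r by eventually_elim simp
 then have "ae xi. cnj (W c (- xi)) = W c xi" using FT_real_iff[OF S_FT[OF c]] by blast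
 from AE_translate[OF this] have "ae eta. \<forall>k. cnj (W c (- (eta + (1/eps) *R rv k))) = W c (eta + (1/eps) *R rv k)"
  unfolding AE_all_countable by blast
 moreover have "ae eta. eps *R eta \<in> Zcell \<and> - (eps *R eta) \<in> Zcell --> (\<forall>k. phi (- k) (- (eps *R eta)) = cnj (phi k (eps *R eta)))"
  using AE_affine[OF phi_minus, of eps 0] eps by simp
 ultimately show ?thesis
 proof eventually_elim
  case (elim eta)
  show ?case
  proof
   assume z: "eta \<in> Zs \<and> - eta \<in> Zs"
   then have z': "eps *R eta \<in> Zcell" "- (eps *R eta) \<in> Zcell" by (simp_all add: Zs_iff)
   have "\<exists>k. phi k (eps *R eta) \<noteq> 0"
   proof (rule ccontr)
    assume "\<nexists>k. phi k (eps *R eta) \<noteq> 0"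
    then show False using phi_norm(1)[OF z'(1)] by simp
   qed
   then obtain k where k: "phi k (eps *R eta) \<noteq> 0" by blast
   have "- (eta + (1/eps) *R rv k) = - eta + (1/eps) *R rv (- k)" by (simp add: rv_minus)
   then have "W c (- (eta + (1/eps) *R rv k)) = c (- eta) * cnj (phi k (eps *R eta))"
    using W_at[of "- eta" c "- k"] z elim(2) z' by simp
   moreover have "W c (eta + (1/eps) *R rv k) = c eta * phi k (eps *R eta)" using W_at z by blast
   moreover have "cnj (W c (- (eta + (1/eps) *R rv k))) = W c (eta + (1/eps) *R rv k)" using elim(1) by blast
   ultimately have "cnj (c (- eta)) * phi k (eps *R eta) = c eta * phi k (eps *R eta)" by simp
   then show "cnj (c (- eta)) = c eta" using k by simp
  qed
 qed
qed

end

locale eff_problem = eps_problem A lam Phi eps K fh h1 h2 fe d1e d2e U \<mu>1 \<mu>2 \<kappa>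
 for A :: "real^'n => real^'n^'n" and lam Phi eps K fh h1 h2 fe d1e d2e U \<mu>1 \<mu>2 \<kappa> +
 fixes AA :: "nat => 'n list => real" and M :: nat and f0 y1 y2 :: "real^'n => real"
 assumes compact_K: "compact K" and K_minus: "uminus ` K = K"
  and FT_data: "FT (cplx f0) fh" "FT (cplx y1) h1" "FT (cplx y2) h2"
  and symbol_nonneg: "\<And>eta. eta \<in> K ==> 0 \<le> effective_symbol AA eps M eta"
begin

abbreviation P :: "real^'n => real" where "P \<equiv> effective_symbol AA eps M"

definition es :: "real^'n => real" where "es eta = (if eta \<in> K then 1 / (1 + P eta) else 0)"

lemma es_bounds: "0 \<le> es eta" "es eta \<le> 1"
 using symbol_nonneg[of eta] by (auto simp: es_def)

lemma es_measurable [measurable]: "es \<in> bmeas"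
 unfolding es_def[abs_def] by measurable

sublocale T: quad \<mu>1 \<mu>2 \<kappa> es fh h1 h2
 by unfold_locales (use weights es_bounds data_hat in auto)

lemma K_minus_iff: "- eta \<in> K \<longleftrightarrow> eta \<in> K"
 using K_minus by (metis image_eqI minus_minus)

lemma es_minus: "es (- eta) = es eta"
 by (simp add: es_def K_minus_iff effective_symbol_minus)

lemma onK_bdd_supp: "onK c ==> bdd_supp c"
 by (rule onZ_bdd_supp[OF onK_onZ])

lemma onK_mult: "onK c ==> onK (T.mult c)"
 using T.mult_L2(1) by (auto simp: onK_def T.mult_def)

lemma Sobolev_onK: assumes "onK c" "FT (cplx y) c" shows "y \<in> Sobolev k"
proof -
 obtain R where R: "\<And>eta. eta \<in> K ==> norm eta \<le> R" using compact_imp_bounded[OF compact_K] unfolding bounded_iff by blast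
 show ?thesis
  by (rule SobolevI_FT[OF assms(2)], rule symb_mult_L2[where R=R]) (use assms(1) R in \<open>auto simp: onK_def\<close>)
qed

text \<open>Off \<open>K\<close> the symbol \<open>1 + P\<close> may be negative, but it vanishes on a null set only, so the transform of the state is zero there.\<close>

lemma state_coefficients:
 assumes u: "FT (cplx u) c" "onK c" and y: "y \<in> Sobolev (2 * M)"
  and eq: "ae x. (\<Sum>k=1..M. eps ^ (2*k - 2) * (-1) ^ k * tensor_deriv (AA (2*k)) (2*k) y x) + y x = f0 x + u x"
 shows "FT (cplx y) (T.mult (\<lambda>eta. fh eta + c eta))"
proof -
 let ?g = "\<lambda>eta. fh eta + c eta"
 have yL: "cplx y \<in> LL" using y by (simp add: Sobolev_def)
 note Y = fourier_FT(1)[OF yL]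
 have g: "FT (cplx (\<lambda>x. f0 x + u x)) ?g" using FT_add[OF FT_data(1) u(1)] by simp
 note gK = onK_add[OF onK_data(1) u(2)]
 have "ae xi. complex_of_real (1 + P xi) * fourier (cplx y) xi = ?g xi"
  using effective_equation[OF y Y g] eq by blast
 moreover note effective_symbol_zeros[of AA eps M]
 ultimately have "ae xi. T.mult ?g xi = fourier (cplx y) xi"
 proof eventually_elim
  case (elim xi)
  have nz: "complex_of_real (1 + P xi) \<noteq> 0" using elim(2) by (simp only: of_real_eq_0_iff) simp
  show ?case
  proof (cases "xi \<in> K")
   case True
   then have "T.mult ?g xi = ?g xi / complex_of_real (1 + P xi)" by (simp add: T.mult_def es_def of_real_divide)
   then show ?thesis unfolding elim(1)[symmetric] using nz by simp
  next
   case False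
   then have "?g xi = 0" "T.mult ?g xi = 0" using gK by (auto simp: onK_def T.mult_def)
   then show ?thesis using elim(1) nz by simp
  qed
 qed
 then show ?thesis
  using L2_measurable[OF yL] L2_measurable[OF onK_L2[OF onK_mult[OF gK]]] by (intro FT_cong[OF Y]) auto
qed

lemma state_exists:
 assumes u: "FT (cplx u) c" "onK c"
 obtains y where "y \<in> Sobolev (2 * M)"
  "ae x. (\<Sum>k=1..M. eps ^ (2*k - 2) * (-1) ^ k * tensor_deriv (AA (2*k)) (2*k) y x) + y x = f0 x + u x"
proof -
 let ?g = "\<lambda>eta. fh eta + c eta"
 have g: "FT (cplx (\<lambda>x. f0 x + u x)) ?g" using FT_add[OF FT_data(1) u(1)] by simp
 note gK = onK_add[OF onK_data(1) u(2)]
 have "ae xi. cnj (T.mult ?g (- xi)) = T.mult ?g xi"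
  using FT_real_symmetric[OF g] by eventually_elim (simp add: T.mult_def es_minus)
 from FT_of_symmetric[OF onK_L2[OF onK_mult[OF gK]] this] obtain y :: "real^'n => real" where y: "FT (cplx y) (T.mult ?g)" by blast
 have yS: "y \<in> Sobolev (2 * M)" by (rule Sobolev_onK[OF onK_mult[OF gK] y])
 have "complex_of_real (1 + P xi) * T.mult ?g xi = ?g xi" for xi
 proof (cases "xi \<in> K")
  case True
  have "1 + P xi \<noteq> 0" using symbol_nonneg[OF True] by linarith
  then have "(1 + P xi) * es xi = 1" using True by (simp add: es_def)
  from arg_cong[OF this, of complex_of_real] have "complex_of_real (1 + P xi) * complex_of_real (es xi) = 1" by (simp only: of_real_mult of_real_1)
  then show ?thesis by (simp only: T.mult_def mult.assoc[symmetric] mult_1)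
 next
  case False then show ?thesis using gK by (auto simp: onK_def T.mult_def)
 qed
 then have "ae x. (\<Sum>k=1..M. eps ^ (2*k - 2) * (-1) ^ k * tensor_deriv (AA (2*k)) (2*k) y x) + y x = f0 x + u x"
  using effective_equation[OF yS y g] by simp
 with yS show ?thesis by (rule that)
qed

abbreviation cost_eff :: "(real^'n => real) \<times> (real^'n => real) => real" where
 "cost_eff \<equiv> tracking_cost (energy_eff AA eps M) \<mu>1 \<mu>2 \<kappa> y1 y2"

abbreviation feasible_effective :: "(real^'n => real) \<times> (real^'n => real) => bool" where
 "feasible_effective \<equiv> feasible_eff AA eps M f0 (admissible_eff Phi eps K U)"

definition target_energy :: real where
 "target_energy = (LI xi. (1 + P xi) * (norm (h1 xi))^2)"

text \<open>On \<open>K\<close> the factor \<open>1 + P\<close> in the energy cancels against \<open>es\<close>, which leaves the form of \<open>T.j\<close>.\<close>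

lemma cost_eff_coefficients:
 assumes u: "FT (cplx u) c" "onK c" and y: "FT (cplx y) (T.mult (\<lambda>eta. fh eta + c eta))"
 shows "cost_eff (u, y) = T.j c + \<mu>1 / 2 * target_energy"
proof -
 let ?g = "\<lambda>eta. fh eta + c eta"
 note gK = onK_add[OF onK_data(1) u(2)]
 note gL = onK_L2[OF gK] and hL = onK_L2[OF onK_data(2)] and sK = onK_mult[OF gK]
 have w1: "FT (cplx (\<lambda>x. y x - y1 x)) (\<lambda>xi. T.mult ?g xi - h1 xi)" using FT_diff[OF y FT_data(2)] by simp
 have w2: "FT (cplx (\<lambda>x. y x - y2 x)) (\<lambda>xi. T.mult ?g xi - h2 xi)" using FT_diff[OF y FT_data(3)] by simp
 have "continuous_on K (\<lambda>xi. 1 + P xi)"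
  by (intro continuous_intros continuous_on_subset[OF effective_symbol_continuous]) auto
 then have "bounded ((\<lambda>xi. 1 + P xi) ` K)" by (intro compact_imp_bounded compact_continuous_image compact_K)
 then obtain B where B: "\<And>xi. xi \<in> K ==> \<bar>1 + P xi\<bar> \<le> B" unfolding bounded_iff by auto
 have int3: "integrable lborel (\<lambda>xi. (1 + P xi) * (norm (h1 xi))^2)"
 proof -
  let ?p = "\<lambda>xi. complex_of_real (indicator K xi * (1 + P xi))"
  have b: "norm (?p xi) \<le> \<bar>B\<bar>" for xi
   using B[of xi] unfolding norm_of_real by (cases "xi \<in> K") auto
  have pm: "?p \<in> bmeas" by measurable
  have "integrable lborel (\<lambda>xi. Re (?p xi * h1 xi * cnj (h1 xi)))"
   by (rule integrable_Re[OF integrable_ip[OF L2_mult_bounded(1)[OF hL pm b] hL]])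
  moreover have "Re (?p xi * h1 xi * cnj (h1 xi)) = (1 + P xi) * (norm (h1 xi))^2" for xi
  proof (cases "xi \<in> K")
   case True then show ?thesis unfolding mult.assoc complex_norm_square[symmetric] by (simp flip: of_real_mult of_real_add of_real_power)
  next
   case False then show ?thesis using onK_data(2) by (simp add: onK_def)
  qed
  ultimately show ?thesis by simp
 qed
 have int1: "integrable lborel (\<lambda>xi. T.mult ?g xi * cnj (?g xi))" by (rule integrable_ip[OF onK_L2[OF sK] gL])
 have int2: "integrable lborel (\<lambda>xi. ?g xi * cnj (h1 xi))" by (rule integrable_ip[OF gL hL])
 have pt: "(1 + P xi) * (norm (T.mult ?g xi - h1 xi))^2
  = Re (T.mult ?g xi * cnj (?g xi)) - 2 * Re (?g xi * cnj (h1 xi)) + (1 + P xi) * (norm (h1 xi))^2" for xi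
 proof (cases "xi \<in> K")
  case True
  have "t * (norm (complex_of_real s * a - b))^2 = Re (complex_of_real s * a * cnj a) - 2 * Re (a * cnj b) + t * (norm b)^2"
   if "t * s = 1" for t s :: real and a b :: complex
  proof -
   have "t * ((s * p - q)^2) = s * p^2 - 2 * (p * q) + t * q^2" for p q :: real using that by algebra
   from this[of "Re a" "Re b"] this[of "Im a" "Im b"]
   show ?thesis by (simp add: cmod_power2 distrib_left) (simp add: power2_eq_square distrib_left mult.assoc)
  qed
  from this[of "1 + P xi" "es xi" "?g xi" "h1 xi"] symbol_nonneg[OF True] True show ?thesis
   unfolding T.mult_def es_def by simp
 next
  case False then show ?thesis using gK onK_data(2) by (simp add: onK_def T.mult_def)
 qed
 have "energy_eff AA eps M (\<lambda>x. y x - y1 x) = (LI xi. Re (T.mult ?g xi * cnj (?g xi)) - 2 * Re (?g xi * cnj (h1 xi)) + (1 + P xi) * (norm (h1 xi))^2)"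
  unfolding effective_energy[OF Sobolev_onK[OF onK_diff[OF sK onK_data(2)] w1] w1] pt ..
 also have "... = (LI xi. Re (T.mult ?g xi * cnj (?g xi)) - 2 * Re (?g xi * cnj (h1 xi))) + target_energy"
  unfolding target_energy_def
  by (rule B_integral_add[OF B_integrable_diff[OF integrable_Re[OF int1] integrable_mult_right[OF integrable_Re[OF int2]]] int3])
 also have "(LI xi. Re (T.mult ?g xi * cnj (?g xi)) - 2 * Re (?g xi * cnj (h1 xi)))
  = (LI xi. Re (T.mult ?g xi * cnj (?g xi))) - (LI xi. 2 * Re (?g xi * cnj (h1 xi)))"
  by (rule B_integral_diff[OF integrable_Re[OF int1] integrable_mult_right[OF integrable_Re[OF int2]]])
 also have "... = Re (ip (T.mult ?g) ?g) - 2 * Re (ip ?g h1)"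
  unfolding B_integral_mult_right_zero integral_Re[OF int1] integral_Re[OF int2] ip_def ..
 finally have 1: "energy_eff AA eps M (\<lambda>x. y x - y1 x) = Re (ip (T.mult ?g) ?g) - 2 * Re (ip ?g h1) + target_energy" .
 have 2: "(LI x. (y x - y2 x)^2) = (nrm (\<lambda>eta. T.mult ?g eta - h2 eta))^2"
  unfolding FT_nrm[OF w2] nrm_cplx nrm_sq_real ..
 have 3: "(LI x. (u x)^2) = (nrm c)^2" unfolding FT_nrm[OF u(1)] nrm_cplx nrm_sq_real ..
 show ?thesis unfolding tracking_cost_def prod.case 1 2 3 T.j_def by (simp add: algebra_simps)
qed

lemma synthesis_icf:
 assumes "ae eta. indicator K eta * h eta = c eta" "(\<lambda>eta. indicator K eta * h eta) \<in> bmeas" "onK c"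
 shows "synthesis K plane_wave h = icf c"
 unfolding synthesis_plane_wave by (rule icf_AE_cong[OF assms(1,2) L2_measurable[OF onK_L2[OF assms(3)]]])

lemma admissible_coefficients:
 assumes u: "u \<in> admissible_eff Phi eps K U"
 obtains c where "c \<in> Cset" "FT (cplx u) c"
proof -
 have uL: "u \<in> LL" "cplx u \<in> LL" and syn: "ae x. synthesis K plane_wave (fourier (cplx u)) x = cplx u x"
  and mem: "ae_mem (adaption Phi eps (cplx u)) U" using u by (auto simp: admissible_eff_def ae_real_def)
 let ?c = "\<lambda>eta. indicator K eta * fourier (cplx u) eta"
 have c: "onK ?c" by (rule onK_indicator[OF FT_L2(2)[OF fourier_FT(1)[OF uL(2)]]])
 have F: "FT (icf ?c) ?c" by (rule FT_icf[OF onK_bdd_supp[OF c]])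
 have "ae x. cplx u x = icf ?c x" using syn unfolding synthesis_plane_wave by eventually_elim simp
 then have Fu: "FT (cplx u) ?c"
  using L2_measurable[OF uL(2)] L2_measurable[OF onK_L2[OF c]] by (intro FT_cong[OF F]) auto
 have "?c \<in> Cset"
 proof -
  have "adaption Phi eps (cplx u) = S ?c" by (rule adaption_S[OF Fu]) (use KZ in \<open>auto simp: indicator_def\<close>)
  then show ?thesis using mem c by (simp add: Cset_def)
 qed
 then show ?thesis using Fu by (rule that)
qed

text \<open>A real synthesis with Bloch waves has symmetric coefficients, hence a real synthesis with plane waves.\<close>

lemma admissible_exists:
 assumes c: "c \<in> Cset"
 obtains u where "u \<in> admissible_eff Phi eps K U" "FT (cplx u) c"
proof -
 have cK: "onK c" using c by (simp add: Cset_def)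
 obtain v where v: "rep c v" using c unfolding Cset_iff by blast
 then have "ae x. S c x = cplx v x" by (simp add: rep_def)
 from real_coefficients_symmetric[OF onK_onZ[OF cK] this]
 have "ae eta. cnj (c (- eta)) = c eta"
 proof eventually_elim
  case (elim eta)
  show ?case
  proof (cases "eta \<in> K")
   case True
   then have "- eta \<in> K" by (simp add: K_minus_iff)
   with True elim KZ show ?thesis by blast
  next
   case False
   then have "- eta \<notin> K" by (simp add: K_minus_iff)
   with False cK show ?thesis by (simp add: onK_def)
  qed
 qed
 from FT_of_symmetric[OF onK_L2[OF cK] this] obtain u :: "real^'n => real" where u: "FT (cplx u) c" by blast
 have uL: "u \<in> LL" using FT_L2(1)[OF u] by simp
 note F = fourier_FT(1)[OF FT_L2(1)[OF u]]
 have ae: "ae eta. indicator K eta * fourier (cplx u) eta = c eta"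
  using FT_unique[OF F u] by eventually_elim (use cK in \<open>auto simp: onK_def indicator_def\<close>)
 have "synthesis K plane_wave (fourier (cplx u)) = icf c"
  by (rule synthesis_icf[OF ae L2_measurable[OF onK_L2[OF onK_indicator[OF FT_L2(2)[OF F]]]] cK])
 moreover have "ae x. icf c x = cplx u x" by (rule FT_inj[OF FT_icf[OF onK_bdd_supp[OF cK]] u])
 moreover have "adaption Phi eps (cplx u) = S c" by (rule adaption_S[OF u]) (use cK KZ in \<open>auto simp: onK_def\<close>)
 ultimately have "u \<in> admissible_eff Phi eps K U"
  using uL c by (simp add: admissible_eff_def ae_real_def Cset_def)
 then show ?thesis using u by (rule that)
qed

lemma feasible_coefficients:
 assumes "feasible_effective (u, y)" and u: "FT (cplx u) c" "onK c"
 shows "cost_eff (u, y) = T.j c + \<mu>1 / 2 * target_energy"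
 by (rule cost_eff_coefficients[OF u state_coefficients[OF u]]) (use assms(1) in \<open>auto simp: feasible_eff_def\<close>)

lemma feasible_exists:
 assumes "u \<in> admissible_eff Phi eps K U" "FT (cplx u) c" "onK c"
 obtains y where "feasible_effective (u, y)"
proof -
 obtain y where "y \<in> Sobolev (2 * M)"
  "ae x. (\<Sum>k=1..M. eps ^ (2*k - 2) * (-1) ^ k * tensor_deriv (AA (2*k)) (2*k) y x) + y x = f0 x + u x"
  using state_exists[OF assms(2,3)] by blast
 then show ?thesis using that assms(1) by (simp add: feasible_eff_def)
qed

lemma Cset_onK: "c \<in> Cset ==> onK c" by (simp add: Cset_def)

lemma optimal_eff_minimises:
 assumes "optimal_control cost_eff feasible_effective u"
 obtains c where "FT (cplx u) c" "T.minimises Cset c"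
proof -
 obtain y where feas: "feasible_effective (u, y)" and min: "\<And>p. feasible_effective p ==> cost_eff (u, y) \<le> cost_eff p"
  using assms unfolding optimal_control_def is_arg_min_def by (meson not_le)
 have "u \<in> admissible_eff Phi eps K U" using feas by (simp add: feasible_eff_def)
 then obtain c where c: "c \<in> Cset" "FT (cplx u) c" using admissible_coefficients by blast
 have "T.j c \<le> T.j d" if d: "d \<in> Cset" for d
 proof -
  obtain v where v: "v \<in> admissible_eff Phi eps K U" "FT (cplx v) d" using admissible_exists[OF d] by blast
  obtain z where z: "feasible_effective (v, z)" using feasible_exists[OF v Cset_onK[OF d]] by blast
  show ?thesis
   using min[OF z] feasible_coefficients[OF feas c(2) Cset_onK[OF c(1)]] feasible_coefficients[OF z v(2) Cset_onK[OF d]] by simp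
 qed
 then show ?thesis using that[OF c(2)] c(1) by (simp add: T.minimises_def)
qed

lemma optimal_eff_exists:
 assumes "Cset \<noteq> {}" shows "\<exists>u. optimal_control cost_eff feasible_effective u"
proof -
 obtain c where c: "T.minimises Cset c" using T.minimiser_exists[OF Cset_convex Cset_closed assms] by blast
 then have cC: "c \<in> Cset" by (simp add: T.minimises_def)
 obtain u where u: "u \<in> admissible_eff Phi eps K U" "FT (cplx u) c" using admissible_exists[OF cC] by blast
 obtain y where y: "feasible_effective (u, y)" using feasible_exists[OF u Cset_onK[OF cC]] by blast
 have "cost_eff (u, y) \<le> cost_eff p" if p: "feasible_effective p" for p
 proof -
  obtain v z where vz: "p = (v, z)" by (cases p)
  then have "v \<in> admissible_eff Phi eps K U" using p by (simp add: feasible_eff_def)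
  then obtain d where d: "d \<in> Cset" "FT (cplx v) d" using admissible_coefficients by blast
  have "T.j c \<le> T.j d" using c d(1) by (simp add: T.minimises_def)
  then show ?thesis
   using feasible_coefficients[OF y u(2) Cset_onK[OF cC]] feasible_coefficients[OF p[unfolded vz] d(2) Cset_onK[OF d(1)]]
   unfolding vz by simp
 qed
 then show ?thesis using y unfolding optimal_control_def is_arg_min_def by (meson not_le)
qed

lemma optimal_eff_unique:
 assumes "optimal_control cost_eff feasible_effective u" "optimal_control cost_eff feasible_effective v"
 shows "ae x. u x = v x"
proof -
 obtain c where c: "FT (cplx u) c" "T.minimises Cset c" using optimal_eff_minimises[OF assms(1)] by blast
 obtain d where d: "FT (cplx v) d" "T.minimises Cset d" using optimal_eff_minimises[OF assms(2)] by blast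
 have "ae eta. d eta = c eta" by (rule T.minimiser_unique[OF Cset_convex d(2) c(2)])
 then have "FT (cplx u) d"
  using L2_measurable[OF FT_L2(1)[OF c(1)]] L2_measurable[OF FT_L2(2)[OF d(1)]] by (intro FT_cong[OF c(1)]) auto
 from FT_inj[OF this d(1)] show ?thesis by eventually_elim simp
qed

text \<open>The constants in \<open>minimiser_stability\<close> are made independent of the period by comparing the minimiser with \<open>c0\<close>.\<close>

lemma control_estimate:
 assumes ue: "optimal_control cost feasible ue" and u: "optimal_control cost_eff feasible_effective u"
  and close: "ae eta. eta \<in> K --> \<bar>res eta - es eta\<bar> \<le> \<delta>" and \<delta>: "\<delta> \<ge> 0" and c0: "c0 \<in> Cset" "nrm c0 \<le> e0"
 defines "d \<equiv> \<lambda>x. synthesis K plane_wave (bloch_coeff Phi eps 0 (cplx ue)) x - cplx u x"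
  and "B \<equiv> 2 * e0 + (\<mu>1 * (nrm f0 + e0 + nrm y1) + \<mu>2 * (nrm f0 + e0 + nrm y2)) / \<kappa>"
 shows "d \<in> LL" "nrm d \<le> \<delta> * (((\<mu>1 + 2 * \<mu>2) * (nrm f0 + B) + \<mu>2 * nrm y2) / \<kappa>)"
proof -
 let ?c1 = "coef ue"
 note o = optimal_eps[OF ue]
 have c1K: "onK ?c1" by (rule coef_onK[OF o(1)])
 obtain c2 where c2: "FT (cplx u) c2" "T.minimises Cset c2" using optimal_eff_minimises[OF u] by blast
 have c2C: "c2 \<in> Cset" using c2(2) by (simp add: T.minimises_def)
 then have c2K: "onK c2" by (rule Cset_onK)
 have nd: "nrm fh = nrm f0" "nrm h1 = nrm y1" "nrm h2 = nrm y2" using FT_data[THEN FT_nrm] by simp_all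
 have d: "FT d (\<lambda>eta. ?c1 eta - c2 eta)"
  unfolding d_def synthesis_icf[OF coef_bloch[OF o(1)] c1K] by (rule FT_diff[OF FT_icf[OF onK_bdd_supp[OF c1K]] c2(1)])
 show "d \<in> LL" by (rule FT_L2(1)[OF d])
 have k: "\<kappa> > 0" by (rule weights)
 have stab: "\<kappa> * nrm d \<le> \<delta> * ((\<mu>1 + 2 * \<mu>2) * (nrm fh + nrm c2) + \<mu>2 * nrm h2)"
  unfolding FT_nrm[OF d, symmetric]
 proof (rule minimiser_stability[OF Q.quad_axioms T.quad_axioms Cset_convex o(3) c2(2) _ \<delta>])
  show "ae eta. fh eta + c2 eta \<noteq> 0 \<or> h2 eta \<noteq> 0 --> \<bar>res eta - es eta\<bar> \<le> \<delta>"
   using close by eventually_elim (use c2K onK_data in \<open>auto simp: onK_def\<close>)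
 qed
 have c0L: "c0 \<in> LL" by (rule onK_L2[OF Cset_onK[OF c0(1)]])
 have e0: "0 \<le> e0" using c0(2) nrm_nonneg[of c0] by linarith
 have "\<kappa> * nrm (\<lambda>eta. c2 eta - c0 eta) \<le> \<mu>1 * (nrm fh + nrm c0 + nrm h1) + \<mu>2 * (nrm fh + nrm c0 + nrm h2) + \<kappa> * nrm c0"
  by (rule T.minimiser_bound[OF Cset_convex c2(2) c0(1)])
 also have "... \<le> \<mu>1 * (nrm fh + e0 + nrm h1) + \<mu>2 * (nrm fh + e0 + nrm h2) + \<kappa> * e0"
  using weights c0(2) by (intro add_mono mult_left_mono) auto
 finally have "nrm (\<lambda>eta. c2 eta - c0 eta) \<le> (\<mu>1 * (nrm f0 + e0 + nrm y1) + \<mu>2 * (nrm f0 + e0 + nrm y2)) / \<kappa> + e0"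
  using k by (simp add: nd field_simps)
 moreover have "nrm c2 \<le> nrm (\<lambda>eta. c2 eta - c0 eta) + nrm c0"
  using nrm_diff_le[OF onK_L2[OF c2K] c0L] by linarith
 ultimately have "nrm c2 \<le> B" unfolding B_def using c0(2) by linarith
 then have "(\<mu>1 + 2 * \<mu>2) * (nrm fh + nrm c2) + \<mu>2 * nrm h2 \<le> (\<mu>1 + 2 * \<mu>2) * (nrm f0 + B) + \<mu>2 * nrm y2"
  unfolding nd using weights by (intro add_right_mono mult_left_mono) auto
 then have "\<kappa> * nrm d \<le> \<delta> * ((\<mu>1 + 2 * \<mu>2) * (nrm f0 + B) + \<mu>2 * nrm y2)"
  using stab \<delta> by (meson mult_left_mono order_trans)
 then show "nrm d \<le> \<delta> * (((\<mu>1 + 2 * \<mu>2) * (nrm f0 + B) + \<mu>2 * nrm y2) / \<kappa>)"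
  using k by (simp add: field_simps)
qed

text \<open>The projection of the adaption of \<open>u0\<close>; neither operation increases the norm.\<close>

lemma Cset_element:
 assumes u0: "u0 \<in> LL" and mem: "ae_mem (adaption Phi eps (cplx u0)) U"
 obtains c0 where "c0 \<in> Cset" "nrm c0 \<le> nrm u0"
proof -
 obtain v0 where v0: "v0 \<in> U" "ae x. adaption Phi eps (cplx u0) x = cplx v0 x"
  using mem by (auto simp: ae_mem_def ae_real_def)
 have vL: "v0 \<in> LL" "cplx v0 \<in> LL" using v0(1) U(1) by auto
 have uL: "cplx u0 \<in> LL" using u0 by simp
 let ?e = "\<lambda>eta. indicator Zs eta * fourier (cplx u0) eta"
 note F = fourier_FT[OF uL]
 have ind: "nrm (\<lambda>eta. indicator X eta * h eta) \<le> nrm h" if "h \<in> LL" "X \<in> sets borel" for h :: "real^'n => complex" and X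
  by (rule L2_bound(2)[OF that(1) L2_measurable[OF L2_indicator[OF that]]]) (auto simp: indicator_def)
 have e: "onZ ?e" using L2_indicator[OF FT_L2(2)[OF F(1)] Zs_sets] by (auto simp: onZ_def)
 have "nrm v0 = nrm (cplx v0)" by simp
 also have "... = nrm (S ?e)"
  by (rule L2_AE_cong(2)[OF S_L2[OF e] L2_measurable[OF vL(2)]])
    (use v0(2) in \<open>auto simp: adaption_def synthesis_S[OF subset_refl] elim: eventually_mono\<close>)
 also have "... \<le> nrm (fourier (cplx u0))" unfolding nrm_S[OF e] by (rule ind[OF FT_L2(2)[OF F(1)] Zs_sets])
 finally have le: "nrm v0 \<le> nrm u0" using F(2) by simp
 obtain v where v: "v \<in> U" "rep (coef v0) v" using projection_rep[OF v0(1)] by blast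
 have G: "FT (cplx v0) (fourier (cplx v0))" "nrm (fourier (cplx v0)) = nrm v0" using fourier_FT[OF vL(2)] by simp_all
 have "nrm (coef v0) \<le> nrm (Bc (fourier (cplx v0)))"
  unfolding coef_def[abs_def] by (rule ind[OF onZ_L2[OF Bc_L2(1)[OF FT_L2(2)[OF G(1)]]] K])
 also have "... \<le> nrm (fourier (cplx v0))" by (rule Bc_L2(2)[OF FT_L2(2)[OF G(1)]])
 finally have "nrm (coef v0) \<le> nrm u0" using G(2) le by linarith
 moreover have "coef v0 \<in> Cset" unfolding Cset_iff using v by blast
 ultimately show ?thesis using that by blast
qed

end

lemma fourier_supported_FT:
 assumes u: "u \<in> LL" and s: "fourier_supported K u" and K: "K \<in> sets borel"
 shows "FT (cplx u) (\<lambda>eta. indicator K eta * fourier (cplx u) eta)"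
proof -
 have uL: "cplx u \<in> LL" using u by simp
 note F = fourier_FT(1)[OF uL]
 have "ae eta. indicator K eta * fourier (cplx u) eta = fourier (cplx u) eta"
  using s unfolding fourier_supported_def by eventually_elim (auto simp: indicator_def)
 then show ?thesis
  using L2_measurable[OF uL] L2_measurable[OF L2_indicator[OF FT_L2(2)[OF F] K]] by (intro FT_cong[OF F]) auto
qed

theorem corollary3p2:
  fixes A :: "real^'n \<Rightarrow> real^'n^'n"
    and lam :: "nat \<Rightarrow> real^'n \<Rightarrow> real"
    and Phi :: "nat \<Rightarrow> real^'n \<Rightarrow> real^'n \<Rightarrow> complex"
    and AA :: "nat \<Rightarrow> 'n list \<Rightarrow> real"
    and K :: "(real^'n) set"
    and f yd1 yd2 u0 :: "real^'n \<Rightarrow> real"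
    and f_eps yd1_eps yd2_eps :: "real \<Rightarrow> real^'n \<Rightarrow> real"
    and U :: "real \<Rightarrow> (real^'n \<Rightarrow> real) set"
    and \<mu>1 \<mu>2 \<kappa> \<Lambda> \<epsilon>\<^sub>M :: real
    and M :: nat
  assumes "coefficient_field A"
    and "bloch_system A lam Phi"
    and "\<mu>1 \<ge> 0" and "\<mu>2 \<ge> 0" and "\<kappa> > 0"
    and "compact K" and "uminus ` K = K"
    and "f \<in> L2 UNIV" and "yd1 \<in> L2 UNIV" and "yd2 \<in> L2 UNIV"
    and "fourier_supported K f" and "fourier_supported K yd1" and "fourier_supported K yd2"
    and "\<And>\<epsilon>. \<epsilon> > 0 \<Longrightarrow> f_eps \<epsilon> \<in> L2 UNIV \<and> ae_real (adaption Phi \<epsilon> (cplx f)) (f_eps \<epsilon>)"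
    and "\<And>\<epsilon>. \<epsilon> > 0 \<Longrightarrow> yd1_eps \<epsilon> \<in> Sobolev 1 \<and> ae_real (adaption Phi \<epsilon> (cplx yd1)) (yd1_eps \<epsilon>)"
    and "\<And>\<epsilon>. \<epsilon> > 0 \<Longrightarrow> yd2_eps \<epsilon> \<in> L2 UNIV \<and> ae_real (adaption Phi \<epsilon> (cplx yd2)) (yd2_eps \<epsilon>)"
    and "\<And>\<epsilon>. \<epsilon> > 0 \<Longrightarrow> U \<epsilon> \<noteq> {} \<and> U \<epsilon> \<subseteq> L2 UNIV \<and> L2_convex (U \<epsilon>) \<and> L2_closed (U \<epsilon>)"
    and "u0 \<in> L2 UNIV" and "\<And>\<epsilon>. \<epsilon> > 0 \<Longrightarrow> ae_mem (adaption Phi \<epsilon> (cplx u0)) (U \<epsilon>)"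
    and "\<And>\<epsilon> u. \<epsilon> > 0 \<Longrightarrow> K \<subseteq> scaled_Zcell \<epsilon> \<Longrightarrow> u \<in> U \<epsilon> \<Longrightarrow>
           ae_mem (synthesis K (bloch_wave Phi \<epsilon> 0) (bloch_coeff Phi \<epsilon> 0 (cplx u))) (U \<epsilon>)"
    and "effective_tensors (lam 0) AA"
    and "\<Lambda> > 0" and "\<And>\<eta>. tensor_power (AA 2) 2 \<eta> \<ge> \<Lambda> * (norm \<eta>)\<^sup>2"
    and "M \<ge> 1" and "\<epsilon>\<^sub>M > 0"
    and "\<And>\<eta> \<epsilon> N. \<eta> \<in> K \<Longrightarrow> 0 < \<epsilon> \<Longrightarrow> \<epsilon> < \<epsilon>\<^sub>M \<Longrightarrow> 1 \<le> N \<Longrightarrow> N \<le> M \<Longrightarrow>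
           effective_symbol AA \<epsilon> N \<eta> \<ge> \<Lambda> / 2 * (norm \<eta>)\<^sup>2"
  shows "\<exists>C>0. \<forall>\<epsilon>. 0 < \<epsilon> \<and> \<epsilon> < \<epsilon>\<^sub>M \<and> K \<subseteq> scaled_Zcell \<epsilon> \<longrightarrow>
    (let optimal_eps = optimal_control
           (tracking_cost (energy_eps A \<epsilon>) \<mu>1 \<mu>2 \<kappa> (yd1_eps \<epsilon>) (yd2_eps \<epsilon>))
           (feasible_eps A \<epsilon> (f_eps \<epsilon>) (U \<epsilon>));
         optimal_eff = optimal_control
           (tracking_cost (energy_eff AA \<epsilon> M) \<mu>1 \<mu>2 \<kappa> yd1 yd2)
           (feasible_eff AA \<epsilon> M f (admissible_eff Phi \<epsilon> K (U \<epsilon>)))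
     in (\<exists>u. optimal_eff u) \<and>
        (\<forall>u v. optimal_eff u \<and> optimal_eff v \<longrightarrow> (AE x in lborel. u x = v x)) \<and>
        (\<forall>u_eps u. optimal_eps u_eps \<and> optimal_eff u \<longrightarrow>
           (let d = (\<lambda>x. synthesis K plane_wave (bloch_coeff Phi \<epsilon> 0 (cplx u_eps)) x - cplx u x)
            in d \<in> L2 UNIV \<and> L2_norm UNIV d \<le> C * \<epsilon> ^ (2*M))))"
proof -
 note coeff = assms(1) and sys = assms(2) and w = assms(3,4,5) and Kc = assms(6) and Km = assms(7)
  and L = assms(8,9,10) and supp = assms(11,12,13) and fe = assms(14) and d1e = assms(15) and d2e = assms(16)
  and U = assms(17) and u0 = assms(18,19) and proj = assms(20) and T = assms(21) and \<Lambda> = assms(22)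
  and M = assms(24) and nonneg = assms(26)
 have K [measurable]: "K \<in> sets borel" by (rule borel_compact[OF Kc])
 obtain R where R: "R > 0" "\<And>eta. eta \<in> K ==> norm eta \<le> R"
  using compact_imp_bounded[OF Kc] unfolding bounded_pos by blast
 obtain C0 where C0: "C0 > 0" and diff: "\<And>\<epsilon> eta. \<epsilon> > 0 ==> eta \<noteq> 0 ==> norm eta \<le> R ==> 0 \<le> lam 0 (\<epsilon> *R eta) ==>
  0 \<le> effective_symbol AA \<epsilon> M eta ==> \<bar>1 / (1 + lam 0 (\<epsilon> *R eta) / \<epsilon>^2) - 1 / (1 + effective_symbol AA \<epsilon> M eta)\<bar> \<le> C0 * \<epsilon> ^ (2*M)"
  using resolvent_difference[OF T M R(1)] by metis
 \<comment> \<open>a bound for the norm of the minimisers, uniform in the period\<close>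
 define B where "B = 2 * nrm u0 + (\<mu>1 * (nrm f + nrm u0 + nrm yd1) + \<mu>2 * (nrm f + nrm u0 + nrm yd2)) / \<kappa>"
 define D where "D = ((\<mu>1 + 2 * \<mu>2) * (nrm f + B) + \<mu>2 * nrm yd2) / \<kappa>"
 have "D \<ge> 0" unfolding D_def B_def using w by (intro divide_nonneg_pos add_nonneg_nonneg mult_nonneg_nonneg) auto
 \<comment> \<open>the summand 1 keeps the constant positive when all data vanish\<close>
 then have C: "C0 * D + 1 > 0" using C0 by (simp add: add_nonneg_pos)
 let ?eps = "\<lambda>\<epsilon>. optimal_control (tracking_cost (energy_eps A \<epsilon>) \<mu>1 \<mu>2 \<kappa> (yd1_eps \<epsilon>) (yd2_eps \<epsilon>))
   (feasible_eps A \<epsilon> (f_eps \<epsilon>) (U \<epsilon>))"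
 let ?eff = "\<lambda>\<epsilon>. optimal_control (tracking_cost (energy_eff AA \<epsilon> M) \<mu>1 \<mu>2 \<kappa> yd1 yd2)
   (feasible_eff AA \<epsilon> M f (admissible_eff Phi \<epsilon> K (U \<epsilon>)))"
 have main: "(\<exists>u. ?eff \<epsilon> u) \<and> (\<forall>u v. ?eff \<epsilon> u \<and> ?eff \<epsilon> v --> (ae x. u x = v x)) \<and>
   (\<forall>u_eps u. ?eps \<epsilon> u_eps \<and> ?eff \<epsilon> u -->
     (\<lambda>x. synthesis K plane_wave (bloch_coeff Phi \<epsilon> 0 (cplx u_eps)) x - cplx u x) \<in> LL \<and>
     nrm (\<lambda>x. synthesis K plane_wave (bloch_coeff Phi \<epsilon> 0 (cplx u_eps)) x - cplx u x) \<le> (C0 * D + 1) * \<epsilon> ^ (2*M))"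
  if e: "0 < \<epsilon>" "\<epsilon> < \<epsilon>\<^sub>M" "K \<subseteq> scaled_Zcell \<epsilon>" for \<epsilon>
 proof -
  interpret bloch A lam Phi \<epsilon> by unfold_locales (rule coeff sys e)+
  let ?h = "\<lambda>u eta. indicator K eta * fourier (cplx u) eta"
  note F = fourier_supported_FT[OF L(1) supp(1) K] fourier_supported_FT[OF L(2) supp(2) K] fourier_supported_FT[OF L(3) supp(3) K]
  have off: "?h u eta = 0" if "eta \<notin> K" for u eta using that by simp
  have rep: "ae x. S (?h u) x = cplx g x" if "FT (cplx u) (?h u)" "ae_real (adaption Phi \<epsilon> (cplx u)) g" for u g
  proof -
   have "adaption Phi \<epsilon> (cplx u) = S (?h u)" by (rule adaption_S[OF that(1)]) (use e(3) in \<open>auto simp: indicator_def\<close>)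
   with that(2) show ?thesis by (simp add: ae_real_def)
  qed
  have sym: "0 \<le> effective_symbol AA \<epsilon> M eta" if "eta \<in> K" for eta
  proof -
   have "0 \<le> \<Lambda> / 2 * (norm eta)^2" using \<Lambda> by simp
   also have "... \<le> effective_symbol AA \<epsilon> M eta" by (rule nonneg[OF that e(1,2) M order_refl])
   finally show ?thesis .
  qed
  have pr: "ae_mem (S (\<lambda>eta. indicator K eta * bloch_coeff Phi \<epsilon> 0 (cplx u) eta)) (U \<epsilon>)" if "u \<in> U \<epsilon>" for u
   using proj[OF e(1,3) that] unfolding synthesis_S[OF e(3)] .
  interpret E: eff_problem A lam Phi \<epsilon> K "?h f" "?h yd1" "?h yd2" "f_eps \<epsilon>" "yd1_eps \<epsilon>" "yd2_eps \<epsilon>" "U \<epsilon>" \<mu>1 \<mu>2 \<kappa> AA M f yd1 yd2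
  proof unfold_locales
   show "ae x. S (?h f) x = cplx (f_eps \<epsilon>) x" by (rule rep[OF F(1)]) (use fe[OF e(1)] in blast)
   show "ae x. S (?h yd1) x = cplx (yd1_eps \<epsilon>) x" by (rule rep[OF F(2)]) (use d1e[OF e(1)] in blast)
   show "ae x. S (?h yd2) x = cplx (yd2_eps \<epsilon>) x" by (rule rep[OF F(3)]) (use d2e[OF e(1)] in blast)
  qed (use K e Kc Km off F[THEN FT_L2(2)] F fe[OF e(1)] d1e[OF e(1)] d2e[OF e(1)] U[OF e(1)] pr w sym in auto)
  obtain c0 where c0: "c0 \<in> E.Cset" "nrm c0 \<le> nrm u0" using E.Cset_element[OF u0(1) u0(2)[OF e(1)]] by blast
  \<comment> \<open>the asymptotic expansion says nothing about the value at the origin itself\<close>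
  have "ae eta. eta \<noteq> (0 :: real^'n)" using AE_lborel_singleton[of "0 :: real^'n"] .
  then have close: "ae eta. eta \<in> K --> \<bar>res eta - E.es eta\<bar> \<le> C0 * \<epsilon> ^ (2*M)"
  proof eventually_elim
   case (elim eta)
   show ?case
   proof
    assume eta: "eta \<in> K"
    then have z: "eta \<in> scaled_Zcell \<epsilon>" using e(3) by blast
    then have "0 \<le> lam 0 (\<epsilon> *R eta)" using lam_nonneg[OF z] e(1) by (simp add: zero_le_divide_iff)
    from diff[OF e(1) elim R(2)[OF eta] this sym[OF eta]] show "\<bar>res eta - E.es eta\<bar> \<le> C0 * \<epsilon> ^ (2*M)"
     using z eta by (simp add: res_def E.es_def)
   qed
  qed
  have pos: "0 \<le> C0 * \<epsilon> ^ (2*M)" using C0 e(1) by simp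
  have "C0 * \<epsilon> ^ (2*M) * D \<le> (C0 * D + 1) * \<epsilon> ^ (2*M)" using e(1) by (simp add: algebra_simps)
  then show ?thesis
   using E.optimal_eff_exists E.optimal_eff_unique c0(1) E.control_estimate[OF _ _ close pos c0, folded B_def, folded D_def]
   by (blast intro: order_trans)
 qed
 show ?thesis unfolding Let_def by (intro exI[of _ "C0 * D + 1"] conjI C allI impI main) auto
qed

end
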